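(* Let $\varepsilon:[0,\infty)\to(0,\infty)$ be a (Borel measurable) function such that $\varepsilon(r)\to 0$ as $r\to\infty$. Then: (i) there exists a measurable function $\varphi:\mathbb R\to[0,\infty)$ such that $T\big(\varphi(x)\,dx\big)=0$ while $T\big((\varphi(x)+e^{-\varepsilon(|x|)|x|})\,dx\big)=\infty$; (ii) there exist two sequences of real points $\{x_n\}_{n\in\mathbb Z}$, $\{y_n\}_{n\in\mathbb Z}$ with $|y_n-x_n|\le e^{-\varepsilon(|x_n|)|x_n|}$ for all $n\in\mathbb Z$, such that $T\big(\sum_{n\in\mathbb Z}\delta_{x_n}\big)=\pi$ while $T\big(\sum_{n\in\mathbb Z}(\delta_{x_n}+\delta_{y_n})\big)=2\pi$. (In both parts it is understood that the measures involved have at most polynomial growth, so that their types are defined.)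
   Context: A non-negative Borel measure $\mu$ on $\mathbb R$ has at most polynomial growth if $\int_{\mathbb R}\frac{d\mu(\lambda)}{1+|\lambda|^{2s}}<\infty$ for some $s<\infty$. For $a>0$, $\mathcal E(a)$ is the linear space of Fourier transforms $\widehat f(\lambda)=\int_{\mathbb R} f(x)e^{-i\lambda x}\,dx$ of complex-valued $C^\infty$ functions $f$ compactly supported in $(-a,a)$, regarded as elements of $L^2(\mu)$ by restriction to $\mathbb R$. The type of a measure $\mu$ of at most polynomial growth is $T(\mu)=\inf\{a>0:\mathcal E(a)\text{ is dense in }L^2(\mu)\}\in[0,\infty]$, with $\inf\emptyset=\infty$. $\delta_\lambda$ denotes the unit point mass at $\lambda\in\mathbb R$. *)

theory Defs
  imports "HOL-Analysis.Analysis" "HOL-Probability.Probability"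
begin

text \<open>The exponent is taken positive: larger exponents only weaken the condition, and exponents
  \<open>s < 0\<close> are not meant, since they would admit measures of infinite mass near the origin.\<close>

definition poly_growth :: "real measure \<Rightarrow> bool" where
  "poly_growth M \<longleftrightarrow> sets M = sets borel \<and>
     (\<exists>s::real. s > 0 \<and> (\<integral>\<^sup>+ t. ennreal (1 / (1 + \<bar>t\<bar> powr (2 * s))) \<partial>M) < \<infinity>)"

definition smooth :: "(real \<Rightarrow> complex) \<Rightarrow> bool" where
  "smooth f \<longleftrightarrow>
     (\<forall>n x. ((\<lambda>g t. vector_derivative g (at t)) ^^ n) f differentiable (at x))"

definition test_functions :: "real \<Rightarrow> (real \<Rightarrow> complex) set" where
  "test_functions a = {f. smooth f \<and> closure {x. f x \<noteq> 0} \<subseteq> {-a<..<a}}"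

definition fourier :: "(real \<Rightarrow> complex) \<Rightarrow> real \<Rightarrow> complex" where
  "fourier f l = (\<integral>x. f x * exp (- (\<i> * of_real l * of_real x)) \<partial>lborel)"

definition fourier_space :: "real \<Rightarrow> (real \<Rightarrow> complex) set" where
  "fourier_space a = fourier ` test_functions a"

text \<open>Elements of \<open>L\<^sup>2(M)\<close> are represented by functions rather than by classes modulo null sets;
  density only involves the seminorm, so it is unaffected.\<close>

definition L2 :: "'a measure \<Rightarrow> ('a \<Rightarrow> complex) set" where
  "L2 M = {g \<in> borel_measurable M. integrable M (\<lambda>x. (cmod (g x))\<^sup>2)}"

definition L2_norm :: "'a measure \<Rightarrow> ('a \<Rightarrow> complex) \<Rightarrow> real" where
  "L2_norm M g = sqrt (\<integral>x. (cmod (g x))\<^sup>2 \<partial>M)"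

definition dense_in_L2 :: "'a measure \<Rightarrow> ('a \<Rightarrow> complex) set \<Rightarrow> bool" where
  "dense_in_L2 M S \<longleftrightarrow> S \<subseteq> L2 M \<and>
     (\<forall>g\<in>L2 M. \<forall>e>0. \<exists>h\<in>S. L2_norm M (\<lambda>x. g x - h x) < e)"

text \<open>In \<^typ>\<open>ereal\<close> the infimum of the empty set is \<open>\<infinity>\<close>. The type is only meaningful together
  with \<^const>\<open>poly_growth\<close>.\<close>

definition measure_type :: "real measure \<Rightarrow> ereal" where
  "measure_type M = Inf {ereal a | a. a > 0 \<and> dense_in_L2 M (fourier_space a)}"

abbreviation dirac :: "real \<Rightarrow> real measure" where
  "dirac x \<equiv> return borel x"

definition add_measure :: "real measure \<Rightarrow> real measure \<Rightarrow> real measure" where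
  "add_measure M N = measure_of UNIV (sets borel) (\<lambda>A. emeasure M A + emeasure N A)"

definition sum_measure :: "('i \<Rightarrow> real measure) \<Rightarrow> real measure" where
  "sum_measure M = measure_of UNIV (sets borel) (\<lambda>A. \<integral>\<^sup>+ i. emeasure (M i) A \<partial>count_space UNIV)"

text \<open>\<^const>\<open>measure_of\<close> yields the zero measure when its argument is not countably additive;
  the next lemmas show that this does not happen here.\<close>

lemma sets_add_measure [simp, measurable_cong]: "sets (add_measure M N) = sets borel"
  unfolding add_measure_def by (metis sets.sets_measure_of_eq space_borel)

lemma sets_sum_measure [simp, measurable_cong]: "sets (sum_measure M) = sets borel"
  unfolding sum_measure_def by (metis sets.sets_measure_of_eq space_borel)

lemma emeasure_add_measure:
  assumes "sets M = sets borel" "sets N = sets borel" "A \<in> sets borel"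
  shows "emeasure (add_measure M N) A = emeasure M A + emeasure N A"
proof (rule emeasure_measure_of[OF add_measure_def])
  show "countably_additive (sets (add_measure M N)) (\<lambda>A. emeasure M A + emeasure N A)"
  proof (rule countably_additiveI)
    fix F :: "nat \<Rightarrow> real set"
    assume F: "range F \<subseteq> sets (add_measure M N)" "disjoint_family F"
    have "(\<Sum>i. emeasure M (F i) + emeasure N (F i)) = (\<Sum>i. emeasure M (F i)) + (\<Sum>i. emeasure N (F i))"
      by (simp add: suminf_add)
    also have "\<dots> = emeasure M (\<Union>i. F i) + emeasure N (\<Union>i. F i)"
      using F assms by (simp add: suminf_emeasure)
    finally show "(\<Sum>i. emeasure M (F i) + emeasure N (F i)) = emeasure M (\<Union> (range F)) + emeasure N (\<Union> (range F))" .
  qed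
qed (use assms in \<open>auto simp: positive_def\<close>)

lemma emeasure_sum_measure:
  assumes "\<And>i. sets (M i) = sets borel" "A \<in> sets borel"
  shows "emeasure (sum_measure M) A = (\<integral>\<^sup>+ i. emeasure (M i) A \<partial>count_space UNIV)"
proof (rule emeasure_measure_of[OF sum_measure_def])
  show "countably_additive (sets (sum_measure M)) (\<lambda>A. \<integral>\<^sup>+ i. emeasure (M i) A \<partial>count_space UNIV)"
  proof (rule countably_additiveI)
    fix F :: "nat \<Rightarrow> real set"
    assume F: "range F \<subseteq> sets (sum_measure M)" "disjoint_family F"
    have "(\<Sum>k. \<integral>\<^sup>+ i. emeasure (M i) (F k) \<partial>count_space UNIV)
        = (\<integral>\<^sup>+ i. (\<Sum>k. emeasure (M i) (F k)) \<partial>count_space UNIV)"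
      by (rule nn_integral_suminf[symmetric]) simp
    also have "\<dots> = (\<integral>\<^sup>+ i. emeasure (M i) (\<Union>k. F k) \<partial>count_space UNIV)"
      using F assms by (intro nn_integral_cong) (simp add: suminf_emeasure)
    finally show "(\<Sum>k. \<integral>\<^sup>+ i. emeasure (M i) (F k) \<partial>count_space UNIV)
        = (\<integral>\<^sup>+ i. emeasure (M i) (\<Union> (range F)) \<partial>count_space UNIV)" .
  qed
qed (use assms in \<open>auto simp: positive_def\<close>)

end

theory Submission
  imports Defs "HOL-Complex_Analysis.Complex_Analysis" "HOL-Real_Asymp.Real_Asymp"
begin

text \<open>
  The idea is that the type of a measure does not see what happens on long gaps which are followed by
  far longer ones, whereas an exponentially small mass on such gaps is enough to restore the type.

  Fix rapidly growing scales \<open>B j = 2 ^ j * m j\<close>. The \<open>j\<close>-th gap is \<open>B j \<le> \<bar>x\<bar> \<le> (j + 2) * B j\<close>, and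
  the scales are so large that \<open>exp (- eps \<bar>x\<bar> * \<bar>x\<bar>) \<ge> exp (- m j)\<close> there (\<open>decay_on_gap\<close>). In
  part (i) the weight \<open>\<phi>\<close> is \<open>1 / (1 + x\<^sup>2)\<close> outside the gaps and \<open>0\<close> in them. In part (ii) the points
  \<open>x\<^sub>n\<close> are \<open>n\<close> and \<open>n \<plusminus> 1/4\<close> outside the gaps and only the integers in them, and \<open>y\<^sub>n\<close> is a twin of
  \<open>x\<^sub>n\<close> at distance \<open>exp (- m j)\<close> in the gaps and \<open>x\<^sub>n\<close> itself elsewhere.

  Upper bounds rest on \<open>gap_approximation\<close>: an entire function of arbitrarily large type can be
  imitated on \<open>\<bar>x\<bar> \<le> B\<close> by a transform of small type \<open>\<eta>\<close> that is tiny on \<open>\<bar>x\<bar> \<ge> Q * B\<close>, where \<open>Q\<close>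
  depends on the types alone. One takes a Taylor polynomial and a power of a cardinal sine, both of
  degree comparable to \<open>\<eta> * B\<close>. As the ratio \<open>j + 2\<close> of the gaps tends to infinity, the uncontrolled
  region fits into a gap. This gives type \<open>0\<close> in part (i) (\<open>dense_phi\<close>). In part (ii) the point masses
  are approximated; the gap is crossed with a factor \<open>sin (pi * x)\<close>, of type \<open>\<pi>\<close>, which vanishes at
  the integers, and with a second one whose zeros are moved to the twins for the other measure
  (\<open>dense_MX\<close>, \<open>dense_MXY\<close>).

  Lower bounds rest on a multiplier, a product of powers of cardinal sines that is at most
  \<open>exp (- m j)\<close> on the \<open>j\<close>-th gap at a cost in type of order \<open>m j / B j = (1/2) ^ j\<close>; this is summable,
  so the total cost is as small as one likes. In part (i) the multiplier times a character
  \<open>exp (\<i> * p * x)\<close> annihilates the transforms of type below \<open>p\<close> and, thanks to the smallness on the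
  gaps, stays in \<open>L\<^sup>2\<close> after division by the weight (\<open>not_dense_phi_plus\<close>). In part (ii) annihilating
  sequences come from residues. On the integers these are \<open>(-1) ^ n\<close> times a multiplier
  (\<open>not_dense_MX\<close>). For the other measure the starting point are the residues of \<open>H / cos (2 * pi * x)\<close>
  at \<open>n \<plusminus> 1/4\<close>, two nodes for each integer; in the gaps the two nodes are moved to \<open>n\<close> and its twin,
  where the residues are as large as \<open>exp (m j)\<close>, and the multiplier absorbs this (\<open>annihilator\<close>,
  \<open>not_dense_MXY\<close>). Only finitely many gaps can be treated in this way; their number is chosen after
  the transform that is to be annihilated, whose decay takes care of the remaining ones.
\<close>

section \<open>Smooth functions\<close>

abbreviation vderiv :: "(real \<Rightarrow> complex) \<Rightarrow> real \<Rightarrow> complex" where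
  "vderiv f \<equiv> \<lambda>t. vector_derivative f (at t)"

lemma smooth_has_vderiv: "smooth f \<Longrightarrow> (f has_vector_derivative vderiv f x) (at x)"
  unfolding smooth_def by (metis funpow_0 vector_derivative_works)

lemma smooth_vderiv: "smooth f \<Longrightarrow> smooth (vderiv f)"
  unfolding smooth_def by (metis comp_apply funpow_Suc_right)

lemma smooth_coinduct:
  assumes "f \<in> S"
    and step: "\<And>f. f \<in> S \<Longrightarrow> \<exists>f'\<in>S. \<forall>x. (f has_vector_derivative f' x) (at x)"
  shows "smooth f"
proof -
  have *: "vderiv f \<in> S \<and> (\<forall>x. f differentiable at x)" if "f \<in> S" for f
  proof -
    obtain f' where f': "f' \<in> S" "\<And>x. (f has_vector_derivative f' x) (at x)"
      using step \<open>f \<in> S\<close> by blast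
    then have "vderiv f = f'"
      by (auto intro!: vector_derivative_at)
    with f' show ?thesis
      by (metis differentiableI_vector)
  qed
  have "(vderiv ^^ n) f \<in> S" for n
    by (induction n) (use assms * in auto)
  with * show ?thesis
    unfolding smooth_def by blast
qed

text \<open>Finite orders of differentiability, the form in which closure under products goes by induction.\<close>

primrec C_k :: "nat \<Rightarrow> (real \<Rightarrow> complex) \<Rightarrow> bool" where
  "C_k 0 f \<longleftrightarrow> True"
| "C_k (Suc n) f \<longleftrightarrow> (\<exists>f'. (\<forall>x. (f has_vector_derivative f' x) (at x)) \<and> C_k n f')"

lemma C_k_Suc_imp: "C_k (Suc n) f \<Longrightarrow> C_k n f"
  by (induction n arbitrary: f) (simp, metis C_k.simps(2))

lemma smooth_iff_C_k: "smooth f \<longleftrightarrow> (\<forall>n. C_k n f)"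
proof
  assume "smooth f"
  have "C_k n f" for n
    using \<open>smooth f\<close>
    by (induction n arbitrary: f) (auto intro!: exI[of _ "vderiv _"] smooth_has_vderiv smooth_vderiv)
  then show "\<forall>n. C_k n f" ..
next
  assume "\<forall>n. C_k n f"
  then have "f \<in> {f. \<forall>n. C_k n f}" by simp
  then show "smooth f"
  proof (rule smooth_coinduct)
    fix f :: "real \<Rightarrow> complex"
    assume "f \<in> {f. \<forall>n. C_k n f}"
    then have C: "C_k n f" for n by auto
    obtain f' where f': "\<forall>x. (f has_vector_derivative f' x) (at x)"
      using C[of "Suc 0"] by auto
    have "C_k n f'" for n
    proof -
      obtain g where g: "\<forall>x. (f has_vector_derivative g x) (at x)" "C_k n g"
        using C[of "Suc n"] by auto
      then have "g = f'"
        using f' by (metis ext vector_derivative_unique_at)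
      with g show ?thesis by simp
    qed
    with f' show "\<exists>f'\<in>{f. \<forall>n. C_k n f}. \<forall>x. (f has_vector_derivative f' x) (at x)"
      by blast
  qed
qed

lemma C_k_add: "C_k n f \<Longrightarrow> C_k n g \<Longrightarrow> C_k n (\<lambda>x. f x + g x)"
proof (induction n arbitrary: f g)
  case (Suc n)
  then show ?case
    by (simp, metis (mono_tags) has_vector_derivative_add)
qed simp

lemma C_k_mult: "C_k n f \<Longrightarrow> C_k n g \<Longrightarrow> C_k n (\<lambda>x. f x * g x)"
proof (induction n arbitrary: f g)
  case (Suc n)
  obtain f' where f': "\<And>x. (f has_vector_derivative f' x) (at x)" "C_k n f'"
    using Suc.prems by auto
  obtain g' where g': "\<And>x. (g has_vector_derivative g' x) (at x)" "C_k n g'"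
    using Suc.prems by auto
  have fg: "C_k n f" "C_k n g"
    using Suc.prems C_k_Suc_imp by auto
  have "C_k n (\<lambda>x. f x * g' x + f' x * g x)"
    using Suc.IH fg f' g' by (intro C_k_add) auto
  moreover have "((\<lambda>x. f x * g x) has_vector_derivative f x * g' x + f' x * g x) (at x)" for x
    by (rule has_vector_derivative_mult[OF f'(1) g'(1)])
  ultimately show ?case
    unfolding C_k.simps by (intro exI[of _ "\<lambda>x. f x * g' x + f' x * g x"]) auto
qed simp

lemma smooth_add: "smooth f \<Longrightarrow> smooth g \<Longrightarrow> smooth (\<lambda>x. f x + g x)"
  and smooth_mult: "smooth f \<Longrightarrow> smooth g \<Longrightarrow> smooth (\<lambda>x. f x * g x)"
  by (simp_all add: smooth_iff_C_k C_k_add C_k_mult)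

lemma smooth_const: "smooth (\<lambda>x. c)"
proof (rule smooth_coinduct[of _ "range (\<lambda>c x. c)"])
  fix f :: "real \<Rightarrow> complex"
  assume "f \<in> range (\<lambda>c x. c)"
  then obtain c where "f = (\<lambda>x. c)" by blast
  then show "\<exists>f'\<in>range (\<lambda>c x. c). \<forall>x. (f has_vector_derivative f' x) (at x)"
    by (intro bexI[of _ "\<lambda>x. 0"]) auto
qed auto

lemma smooth_cmult: "smooth f \<Longrightarrow> smooth (\<lambda>x. c * f x)"
  by (intro smooth_mult smooth_const)

lemma smooth_exp: "smooth (\<lambda>x. exp (c * of_real x))"
proof (rule smooth_coinduct[of _ "range (\<lambda>d x. d * exp (c * of_real x))"])
  show "(\<lambda>x. exp (c * of_real x)) \<in> range (\<lambda>d (x::real). d * exp (c * of_real x))"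
    by (rule range_eqI[of _ _ 1]) simp
next
  fix f
  assume "f \<in> range (\<lambda>d (x::real). d * exp (c * of_real x))"
  then obtain d where f: "f = (\<lambda>x. d * exp (c * of_real x))" by blast
  have "(f has_vector_derivative (d * c) * exp (c * of_real x)) (at x)" for x
    unfolding f by (rule has_vector_derivative_real_field)
      (auto intro!: derivative_eq_intros simp: algebra_simps)
  then show "\<exists>f'\<in>range (\<lambda>d (x::real). d * exp (c * of_real x)).
               \<forall>x. (f has_vector_derivative f' x) (at x)"
    by (intro bexI[of _ "\<lambda>x. (d * c) * exp (c * of_real x)"]) auto
qed

lemma smooth_affine:
  assumes "smooth f"
  shows "smooth (\<lambda>x. f (r * x + s))"
proof (rule smooth_coinduct[of _ "{\<lambda>x. c * g (r * x + s) | c g. smooth g}"])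
  show "(\<lambda>x. f (r * x + s)) \<in> {\<lambda>x. c * g (r * x + s) | c g. smooth g}"
    by (rule CollectI, rule exI[of _ 1], rule exI[of _ f]) (use assms in simp)
next
  fix h
  assume "h \<in> {\<lambda>x. c * g (r * x + s) | c g. smooth g}"
  then obtain c g where h: "h = (\<lambda>x. c * g (r * x + s))" and g: "smooth g" by blast
  have "(h has_vector_derivative (c * of_real r) * vderiv g (r * x + s)) (at x)" for x
  proof -
    have "((g \<circ> (\<lambda>x. r * x + s)) has_vector_derivative r *\<^sub>R vderiv g (r * x + s)) (at x)"
      by (rule vector_diff_chain_at)
        (auto intro!: derivative_eq_intros smooth_has_vderiv[OF g]
           simp: has_real_derivative_iff_has_vector_derivative[symmetric])
    from has_vector_derivative_mult_right[OF this, of c] show ?thesis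
      unfolding h by (simp add: scaleR_conv_of_real mult_ac o_def)
  qed
  then show "\<exists>f'\<in>{\<lambda>x. c * g (r * x + s) | c g. smooth g}. \<forall>x. (h has_vector_derivative f' x) (at x)"
    using smooth_vderiv[OF g]
    by (intro bexI[of _ "\<lambda>x. (c * of_real r) * vderiv g (r * x + s)"])
       (auto intro!: exI[of _ "vderiv g"])
qed

lemma smooth_continuous: "smooth f \<Longrightarrow> continuous_on A f"
  using smooth_has_vderiv has_vector_derivative_continuous
  by (metis continuous_at_imp_continuous_on)

text \<open>The derivatives of the flat function \<open>exp (-1/x)\<close> are polynomials in \<open>1/x\<close> times that function,
  so this limit makes them vanish at the origin.\<close>

lemma poly_inverse_exp_tendsto_0:
  fixes p :: "real poly"
  shows "((\<lambda>h. poly p (1 / h) * exp (- (1 / h))) \<longlongrightarrow> 0) (at_right 0)"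
proof -
  have *: "((\<lambda>x. poly p x * exp (- x)) \<longlongrightarrow> 0) at_top"
  proof -
    have "((\<lambda>x. (\<Sum>i\<le>degree p. coeff p i * (x ^ i * exp (- x)))) \<longlongrightarrow> 0) at_top"
    proof (rule tendsto_eq_rhs[OF tendsto_sum])
      fix i
      have "((\<lambda>x::real. x ^ i * exp (- x)) \<longlongrightarrow> 0) at_top"
        using tendsto_power_div_exp_0[of i] by (simp add: exp_minus field_simps)
      then show "((\<lambda>x. coeff p i * (x ^ i * exp (- x))) \<longlongrightarrow> coeff p i * 0) at_top"
        by (intro tendsto_mult tendsto_const)
    qed simp
    then show ?thesis
      unfolding poly_altdef sum_distrib_right by (simp add: mult.assoc)
  qed
  have "filterlim (\<lambda>h::real. 1 / h) at_top (at_right 0)"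
    by (simp add: filterlim_inverse_at_top_right divide_inverse)
  from filterlim_compose[OF * this] show ?thesis .
qed

lemma smooth_flat:
  "smooth (\<lambda>x. if x > 0 then of_real (exp (- (1 / x))) else 0)"
proof -
  define flat :: "real poly \<Rightarrow> real \<Rightarrow> real"
    where "flat = (\<lambda>p x. if x > 0 then poly p (1 / x) * exp (- (1 / x)) else 0)"
  define S :: "(real \<Rightarrow> complex) set" where "S = range (\<lambda>p x. of_real (flat p x))"
  have deriv: "(flat p has_real_derivative flat ([:0, 0, 1:] * (p - pderiv p)) x) (at x)" for p x
  proof -
    consider "x > 0" | "x < 0" | "x = 0" by linarith
    then show ?thesis
    proof cases
      case 1
      have "((\<lambda>x. poly p (1 / x) * exp (- (1 / x))) has_real_derivative
              poly ([:0, 0, 1:] * (p - pderiv p)) (1 / x) * exp (- (1 / x))) (at x)"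
        using 1 by (auto intro!: derivative_eq_intros DERIV_chain2[OF poly_DERIV] simp: field_simps power2_eq_square)
      moreover have "eventually (\<lambda>y. y > 0) (nhds x)"
        using 1 by (simp add: eventually_nhds_in_open[of "{0<..}" x, simplified])
      ultimately show ?thesis
        using 1 by (subst DERIV_cong_ev[OF refl _ refl, where g = "\<lambda>x. poly p (1 / x) * exp (- (1 / x))"])
          (auto simp: flat_def elim: eventually_mono)
    next
      case 2
      have "((\<lambda>x. 0) has_real_derivative 0) (at x)" by simp
      moreover have "eventually (\<lambda>y. y < 0) (nhds x)"
        using 2 by (simp add: eventually_nhds_in_open[of "{..<0}" x, simplified])
      ultimately show ?thesis
        using 2 by (subst DERIV_cong_ev[OF refl _ refl, where g = "\<lambda>x. 0"])
          (auto simp: flat_def elim: eventually_mono)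
    next
      case 3
      have "((\<lambda>h. flat p h / h) \<longlongrightarrow> 0) (at_right 0)"
        using poly_inverse_exp_tendsto_0[of "[:0, 1:] * p"]
        by (rule tendsto_cong[THEN iffD1, rotated])
          (auto simp: flat_def eventually_at_right_field intro!: exI[of _ 1])
      moreover have "((\<lambda>h. flat p h / h) \<longlongrightarrow> 0) (at_left 0)"
        by (rule tendsto_cong[THEN iffD1, OF _ tendsto_const])
          (auto simp: flat_def eventually_at_left_field intro!: exI[of _ "-1"])
      ultimately have "((\<lambda>h. flat p h / h) \<longlongrightarrow> 0) (at 0)"
        by (simp add: filterlim_at_split)
      then show ?thesis
        unfolding 3 DERIV_def by (auto simp: flat_def)
    qed
  qed
  have "(\<lambda>x. if x > 0 then of_real (exp (- (1 / x))) else 0) \<in> S"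
    unfolding S_def by (rule range_eqI[of _ _ 1]) (auto simp: flat_def)
  then show ?thesis
  proof (rule smooth_coinduct)
    fix f
    assume "f \<in> S"
    then obtain p where "f = (\<lambda>x. of_real (flat p x))" unfolding S_def by blast
    then show "\<exists>f'\<in>S. \<forall>x. (f has_vector_derivative f' x) (at x)"
      using deriv[of p] unfolding S_def
      by (intro bexI[of _ "\<lambda>x. of_real (flat ([:0, 0, 1:] * (p - pderiv p)) x)"])
        (auto intro!: has_vector_derivative_of_real simp: has_real_derivative_iff_has_vector_derivative)
  qed
qed

lemma test_function_iff:
  assumes "a > 0"
  shows "f \<in> test_functions a \<longleftrightarrow> smooth f \<and> (\<exists>c. 0 \<le> c \<and> c < a \<and> (\<forall>x. \<bar>x\<bar> > c \<longrightarrow> f x = 0))"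
proof -
  let ?S = "{x. f x \<noteq> 0}"
  have "closure ?S \<subseteq> {-a<..<a} \<longleftrightarrow> (\<exists>c. 0 \<le> c \<and> c < a \<and> (\<forall>x. \<bar>x\<bar> > c \<longrightarrow> f x = 0))"
  proof
    assume sub: "closure ?S \<subseteq> {-a<..<a}"
    show "\<exists>c. 0 \<le> c \<and> c < a \<and> (\<forall>x. \<bar>x\<bar> > c \<longrightarrow> f x = 0)"
    proof (cases "?S = {}")
      case True
      then show ?thesis using assms by (intro exI[of _ 0]) auto
    next
      case False
      have "bounded (closure ?S)"
        by (rule bounded_subset[OF bounded_closed_interval[of "-a" a] order_trans[OF sub]]) auto
      then have "compact (closure ?S)"
        by (simp add: compact_eq_bounded_closed)
      then obtain z where z: "z \<in> closure ?S" "\<And>x. x \<in> closure ?S \<Longrightarrow> \<bar>x\<bar> \<le> \<bar>z\<bar>"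
        using continuous_attains_sup[of "closure ?S" abs, OF _ _ continuous_on_rabs[OF continuous_on_id]]
          False by auto
      have "z \<in> {-a<..<a}" using sub z(1) by (rule subsetD)
      then have "\<bar>z\<bar> < a" by auto
      moreover have "f x = 0" if "\<bar>x\<bar> > \<bar>z\<bar>" for x
      proof (rule ccontr)
        assume "f x \<noteq> 0"
        then have "x \<in> closure ?S" using closure_subset[of ?S] by blast
        with z(2)[of x] that show False by simp
      qed
      ultimately show ?thesis by (intro exI[of _ "\<bar>z\<bar>"]) auto
    qed
  next
    assume "\<exists>c. 0 \<le> c \<and> c < a \<and> (\<forall>x. \<bar>x\<bar> > c \<longrightarrow> f x = 0)"
    then obtain c where c: "c < a" "\<And>x. \<bar>x\<bar> > c \<Longrightarrow> f x = 0" by blast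
    have "closure ?S \<subseteq> {-c..c}"
    proof (rule closure_minimal)
      show "?S \<subseteq> {-c..c}"
      proof
        fix x assume "x \<in> ?S"
        then have "\<not> \<bar>x\<bar> > c" using c(2)[of x] by auto
        then show "x \<in> {-c..c}" by auto
      qed
    qed simp
    also have "\<dots> \<subseteq> {-a<..<a}" using c by auto
    finally show "closure ?S \<subseteq> {-a<..<a}" .
  qed
  then show ?thesis by (simp add: test_functions_def)
qed

lemma test_functionE:
  assumes "f \<in> test_functions a" "a > 0"
  obtains c where "smooth f" "0 \<le> c" "c < a" "\<And>x. \<bar>x\<bar> > c \<Longrightarrow> f x = 0"
  using assms by (auto simp: test_function_iff)

lemma test_functionI:
  assumes "smooth f" "c < a" "0 < a" "\<And>x. \<bar>x\<bar> > c \<Longrightarrow> f x = 0"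
  shows "f \<in> test_functions a"
  using assms by (subst test_function_iff) (auto intro!: exI[of _ "max 0 c"])

text \<open>The transforms of such bumps tend to one when the support shrinks.\<close>

lemma bump_exists:
  assumes "\<sigma> > (0::real)"
  obtains g :: "real \<Rightarrow> real" where "(\<lambda>x. of_real (g x)) \<in> test_functions \<sigma>" "\<And>x. g x \<ge> 0"
    "(\<integral>x. g x \<partial>lborel) = 1"
proof -
  define e :: "real \<Rightarrow> real" where "e = (\<lambda>x. if x > 0 then exp (- (1 / x)) else 0)"
  define h where "h = (\<lambda>x. e (x + \<sigma> / 2) * e (- x + \<sigma> / 2))"
  have e: "smooth (\<lambda>x. of_real (e x))"
    using smooth_flat by (simp add: e_def if_distrib cong: if_cong)
  have "smooth (\<lambda>x. complex_of_real (e (1 * x + \<sigma> / 2)) * complex_of_real (e ((-1) * x + \<sigma> / 2)))"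
    by (intro smooth_mult smooth_affine[OF e])
  then have sm: "smooth (\<lambda>x. of_real (h x))"
    by (simp add: h_def)
  have h0: "h x \<ge> 0" for x by (simp add: h_def e_def)
  have hz: "h x = 0" if "\<bar>x\<bar> > \<sigma> / 2" for x
    using that by (auto simp: h_def e_def)
  have "continuous_on UNIV (\<lambda>x. Re (of_real (h x)))"
    by (intro continuous_intros smooth_continuous[OF sm])
  then have cont: "continuous_on A h" for A
    using continuous_on_subset by auto
  have int: "integrable lborel (\<lambda>x. indicator {-\<sigma>/2..\<sigma>/2} x *\<^sub>R h x)"
    using borel_integrable_compact[of "{-\<sigma>/2..\<sigma>/2}" h] cont by simp
  have ind: "(\<lambda>x. indicator {-\<sigma>/2..\<sigma>/2} x *\<^sub>R h x) = h"
  proof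
    fix x show "indicator {-\<sigma>/2..\<sigma>/2} x *\<^sub>R h x = h x"
      using hz[of x] by (cases "\<bar>x\<bar> > \<sigma> / 2") (auto simp: indicator_def abs_le_iff)
  qed
  define I where "I = (\<integral>x. h x \<partial>lborel)"
  have inth: "integrable lborel h"
    using int ind by simp
  have "I \<noteq> 0"
  proof
    assume "I = 0"
    then have "AE x in lborel. h x = 0"
      using integral_nonneg_eq_0_iff_AE[OF inth] h0 by (auto simp: I_def)
    then have "AE x in lborel. x \<notin> {-\<sigma>/2<..<\<sigma>/2}"
      by (rule AE_mp) (auto simp: h_def e_def split: if_splits)
    then have "emeasure lborel {-\<sigma>/2<..<\<sigma>/2} = 0"
      by (subst (asm) AE_iff_measurable[where N = "{-\<sigma>/2<..<\<sigma>/2}"]) auto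
    then show False using assms by simp
  qed
  moreover have "I \<ge> 0" unfolding I_def using h0 by simp
  ultimately have I: "I > 0" by simp
  show ?thesis
  proof (rule that[of "\<lambda>x. h x / I"])
    have "smooth (\<lambda>x. (1 / of_real I) * of_real (h x))"
      by (rule smooth_cmult[OF sm])
    then have "smooth (\<lambda>x. of_real (h x / I))"
      by simp
    then show "(\<lambda>x. of_real (h x / I)) \<in> test_functions \<sigma>"
      using assms hz by (intro test_functionI[where c = "\<sigma>/2"]) auto
    show "h x / I \<ge> 0" for x using h0 I by simp
    show "(\<integral>x. h x / I \<partial>lborel) = 1"
      using I by (simp add: I_def)
  qed
qed

section \<open>Transforms of test functions\<close>

definition cfourier :: "(real \<Rightarrow> complex) \<Rightarrow> complex \<Rightarrow> complex" where
  "cfourier f z = (\<integral>x. f x * exp (- (\<i> * z * of_real x)) \<partial>lborel)"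

lemma fourier_eq_cfourier: "fourier f l = cfourier f (of_real l)"
  by (simp add: fourier_def cfourier_def)

lemma fourier_spaceE:
  assumes "F \<in> fourier_space a"
  obtains f where "f \<in> test_functions a" "F = (\<lambda>l. cfourier f (of_real l))"
  using assms by (auto simp: fourier_space_def fourier_eq_cfourier[abs_def])

lemma fourier_spaceI:
  assumes "f \<in> test_functions a" "\<And>l. F l = cfourier f (of_real l)"
  shows "F \<in> fourier_space a"
  unfolding fourier_space_def using assms
  by (intro image_eqI[of _ _ f]) (auto simp: fourier_eq_cfourier fun_eq_iff)

lemma integral_compact_support:
  fixes h :: "real \<Rightarrow> complex"
  assumes "continuous_on {-c..c} h" "\<And>x. \<bar>x\<bar> > c \<Longrightarrow> h x = 0"
  shows "integrable lborel h" "(\<integral>x. h x \<partial>lborel) = integral {-c..c} h"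
proof -
  have eq: "(\<lambda>x. indicator {-c..c} x *\<^sub>R h x) = h"
  proof
    fix x show "indicator {-c..c} x *\<^sub>R h x = h x"
      using assms(2)[of x] by (cases "\<bar>x\<bar> > c") (auto simp: indicator_def abs_le_iff)
  qed
  have int: "set_integrable lborel {-c..c} h"
    unfolding set_integrable_def
    by (rule borel_integrable_compact) (use assms in auto)
  from int show "integrable lborel h"
    by (simp add: set_integrable_def eq)
  show "(\<integral>x. h x \<partial>lborel) = integral {-c..c} h"
    using set_borel_integral_eq_integral(2)[OF int] by (simp add: set_lebesgue_integral_def eq)
qed

lemma cfourier_integrable:
  assumes "f \<in> test_functions a" "a > 0"
  shows "integrable lborel (\<lambda>x. f x * exp (- (\<i> * z * of_real x)))"
proof -
  obtain c where c: "smooth f" "0 \<le> c" "c < a" "\<And>x. \<bar>x\<bar> > c \<Longrightarrow> f x = 0"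
    using test_functionE[OF assms] by blast
  show ?thesis
    by (rule integral_compact_support(1)[where c = c])
      (use c smooth_continuous[OF c(1)] in \<open>auto intro!: continuous_intros\<close>)
qed

lemma integral_vderiv_eq_0:
  assumes "smooth h" "\<And>x. \<bar>x\<bar> > c \<Longrightarrow> h x = 0"
  shows "(\<integral>x. vderiv h x \<partial>lborel) = 0"
proof -
  define d where "d = \<bar>c\<bar> + 1"
  have d: "d > 0" "d > c" by (auto simp: d_def)
  have z: "vderiv h x = 0" if "\<bar>x\<bar> > d" for x
  proof (rule vector_derivative_at)
    have "((\<lambda>x. 0) has_vector_derivative 0) (at x)" by simp
    then show "(h has_vector_derivative 0) (at x)"
    proof (rule has_vector_derivative_transform_within_open)
      show "open {y. \<bar>y\<bar> > d}" by (intro open_Collect_less continuous_intros)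
    qed (use that assms d in auto)
  qed
  have "(vderiv h has_integral (h d - h (-d))) {-d..d}"
    by (rule fundamental_theorem_of_calculus)
      (use d in \<open>auto intro!: has_vector_derivative_at_within smooth_has_vderiv[OF assms(1)]\<close>)
  moreover have "h d = 0" "h (-d) = 0" using assms(2) d by auto
  ultimately have "integral {-d..d} (vderiv h) = 0" by auto
  then show ?thesis
    using integral_compact_support(2)[of d "vderiv h"] z smooth_continuous[OF smooth_vderiv[OF assms(1)]]
    by auto
qed

lemma test_function_vderiv:
  assumes "f \<in> test_functions a" "a > 0"
  shows "vderiv f \<in> test_functions a"
proof -
  obtain c where c: "smooth f" "0 \<le> c" "c < a" "\<And>x. \<bar>x\<bar> > c \<Longrightarrow> f x = 0"
    using test_functionE[OF assms] by blast
  have "vderiv f x = 0" if "\<bar>x\<bar> > c" for x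
  proof (rule vector_derivative_at)
    have "((\<lambda>x. 0) has_vector_derivative 0) (at x)" by simp
    then show "(f has_vector_derivative 0) (at x)"
    proof (rule has_vector_derivative_transform_within_open)
      show "open {y. \<bar>y\<bar> > c}" by (intro open_Collect_less continuous_intros)
    qed (use that c in auto)
  qed
  then show ?thesis
    using c assms smooth_vderiv by (intro test_functionI[where c = c]) auto
qed

lemma cfourier_vderiv:
  assumes "f \<in> test_functions a" "a > 0"
  shows "cfourier (vderiv f) z = \<i> * z * cfourier f z"
proof -
  obtain c where c: "smooth f" "0 \<le> c" "c < a" "\<And>x. \<bar>x\<bar> > c \<Longrightarrow> f x = 0"
    using test_functionE[OF assms] by blast
  define e :: "real \<Rightarrow> complex" where "e = (\<lambda>x. exp (- (\<i> * z) * of_real x))"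
  have e: "smooth e" unfolding e_def by (rule smooth_exp)
  have de: "(e has_vector_derivative - (\<i> * z) * e x) (at x)" for x
    unfolding e_def by (rule has_vector_derivative_real_field)
      (auto intro!: derivative_eq_intros)
  have "vderiv (\<lambda>x. f x * e x) = (\<lambda>x. f x * (- (\<i> * z) * e x) + vderiv f x * e x)"
    using has_vector_derivative_mult[OF smooth_has_vderiv[OF c(1)] de]
    by (intro ext vector_derivative_at)
  moreover have "(\<integral>x. vderiv (\<lambda>x. f x * e x) x \<partial>lborel) = 0"
    using c e by (intro integral_vderiv_eq_0[where c = c] smooth_mult) auto
  ultimately have "(\<integral>x. f x * (- (\<i> * z) * e x) + vderiv f x * e x \<partial>lborel) = 0"
    by simp
  also have "(\<lambda>x. f x * (- (\<i> * z) * e x) + vderiv f x * e x)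
      = (\<lambda>x. - (\<i> * z) * (f x * exp (- (\<i> * z * of_real x))) + vderiv f x * exp (- (\<i> * z * of_real x)))"
    by (auto simp: e_def mult_ac)
  also have "(\<integral>x. - (\<i> * z) * (f x * exp (- (\<i> * z * of_real x))) + vderiv f x * exp (- (\<i> * z * of_real x)) \<partial>lborel)
      = - (\<i> * z) * cfourier f z + cfourier (vderiv f) z"
    unfolding cfourier_def
    using cfourier_integrable[OF assms, of z] cfourier_integrable[OF test_function_vderiv[OF assms] assms(2), of z]
    by (subst Bochner_Integration.integral_add) auto
  finally show ?thesis by (simp add: algebra_simps)
qed

lemma fourier_space_mono: "a \<le> b \<Longrightarrow> fourier_space a \<subseteq> fourier_space b"
  unfolding fourier_space_def test_functions_def by (intro image_mono) force

lemma fourier_space_add: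
  assumes "a > 0" "F \<in> fourier_space a" "G \<in> fourier_space a"
  shows "(\<lambda>x. F x + G x) \<in> fourier_space a"
proof -
  obtain f where f: "f \<in> test_functions a" "F = (\<lambda>l. cfourier f (of_real l))"
    using assms by (elim fourier_spaceE)
  obtain g where g: "g \<in> test_functions a" "G = (\<lambda>l. cfourier g (of_real l))"
    using assms by (elim fourier_spaceE)
  obtain c where c: "smooth f" "0 \<le> c" "c < a" "\<And>x. \<bar>x\<bar> > c \<Longrightarrow> f x = 0"
    using test_functionE[OF f(1) assms(1)] by blast
  obtain d where d: "smooth g" "0 \<le> d" "d < a" "\<And>x. \<bar>x\<bar> > d \<Longrightarrow> g x = 0"
    using test_functionE[OF g(1) assms(1)] by blast
  show ?thesis
  proof (rule fourier_spaceI)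
    show "(\<lambda>x. f x + g x) \<in> test_functions a"
      using c d assms by (intro test_functionI[where c = "max c d"] smooth_add) auto
    show "F l + G l = cfourier (\<lambda>x. f x + g x) (of_real l)" for l
      unfolding f g cfourier_def distrib_right
      by (rule Bochner_Integration.integral_add[symmetric];
          rule cfourier_integrable[OF _ assms(1)]; fact f g)
  qed
qed

lemma fourier_space_cmult:
  assumes "a > 0" "F \<in> fourier_space a"
  shows "(\<lambda>x. k * F x) \<in> fourier_space a"
proof -
  obtain f where f: "f \<in> test_functions a" "F = (\<lambda>l. cfourier f (of_real l))"
    using assms by (elim fourier_spaceE)
  obtain c where c: "smooth f" "0 \<le> c" "c < a" "\<And>x. \<bar>x\<bar> > c \<Longrightarrow> f x = 0"
    using test_functionE[OF f(1) assms(1)] by blast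
  show ?thesis
  proof (rule fourier_spaceI)
    show "(\<lambda>x. k * f x) \<in> test_functions a"
      using c assms by (intro test_functionI[where c = c] smooth_cmult) auto
    show "k * F l = cfourier (\<lambda>x. k * f x) (of_real l)" for l
      unfolding f cfourier_def by (simp add: mult.assoc)
  qed
qed

lemma fourier_space_zero: "a > 0 \<Longrightarrow> (\<lambda>x. 0) \<in> fourier_space a"
  by (rule fourier_spaceI[of "\<lambda>x. 0"])
    (auto intro!: test_functionI[where c = 0] smooth_const simp: cfourier_def)

lemma fourier_space_sum:
  assumes "a > 0" "\<And>i. i \<in> I \<Longrightarrow> F i \<in> fourier_space a"
  shows "(\<lambda>x. \<Sum>i\<in>I. F i x) \<in> fourier_space a"
  using assms(2)
  by (induction I rule: infinite_finite_induct)
    (auto intro!: fourier_space_add fourier_space_zero assms(1))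

lemma fourier_space_diff:
  assumes "a > 0" "F \<in> fourier_space a" "G \<in> fourier_space a"
  shows "(\<lambda>x. F x - G x) \<in> fourier_space a"
  using fourier_space_add[OF assms(1,2) fourier_space_cmult[OF assms(1,3), of "-1"]] by simp

lemma fourier_space_shift:
  assumes "a > 0" "F \<in> fourier_space a"
  shows "(\<lambda>x. F (x - c)) \<in> fourier_space a"
proof -
  obtain f where f: "f \<in> test_functions a" "F = (\<lambda>l. cfourier f (of_real l))"
    using assms by (elim fourier_spaceE)
  obtain d where d: "smooth f" "0 \<le> d" "d < a" "\<And>x. \<bar>x\<bar> > d \<Longrightarrow> f x = 0"
    using test_functionE[OF f(1) assms(1)] by blast
  show ?thesis
  proof (rule fourier_spaceI)
    show "(\<lambda>x. f x * exp ((\<i> * of_real c) * of_real x)) \<in> test_functions a"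
      using d assms by (intro test_functionI[where c = d] smooth_mult smooth_exp) auto
    show "F (l - c) = cfourier (\<lambda>x. f x * exp ((\<i> * of_real c) * of_real x)) (of_real l)" for l
      unfolding f cfourier_def mult.assoc exp_add[symmetric]
      by (intro Bochner_Integration.integral_cong) (auto simp: algebra_simps)
  qed
qed

lemma fourier_space_mult_exp:
  assumes "a > 0" "F \<in> fourier_space a"
  shows "(\<lambda>x. exp (\<i> * of_real (s * x)) * F x) \<in> fourier_space (a + \<bar>s\<bar>)"
proof -
  obtain f where f: "f \<in> test_functions a" "F = (\<lambda>l. cfourier f (of_real l))"
    using assms by (elim fourier_spaceE)
  obtain d where d: "smooth f" "0 \<le> d" "d < a" "\<And>x. \<bar>x\<bar> > d \<Longrightarrow> f x = 0"
    using test_functionE[OF f(1) assms(1)] by blast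
  show ?thesis
  proof (rule fourier_spaceI)
    show "(\<lambda>x. f (1 * x + s)) \<in> test_functions (a + \<bar>s\<bar>)"
      using d assms by (intro test_functionI[where c = "d + \<bar>s\<bar>"] smooth_affine) auto
    show "exp (\<i> * of_real (s * l)) * F l = cfourier (\<lambda>x. f (1 * x + s)) (of_real l)" for l
    proof -
      have "cfourier f (of_real l) = (\<integral>x. f (s + 1 * x) * exp (- (\<i> * of_real l * of_real (s + 1 * x))) \<partial>lborel)"
        unfolding cfourier_def
        by (subst lborel_integral_real_affine[of 1 _ s]) auto
      also have "\<dots> = (\<integral>x. exp (- (\<i> * of_real (s * l))) * (f (1 * x + s) * exp (- (\<i> * of_real l * of_real x))) \<partial>lborel)"
        by (intro Bochner_Integration.integral_cong) (auto simp: algebra_simps exp_add[symmetric])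
      also have "\<dots> = exp (- (\<i> * of_real (s * l))) * cfourier (\<lambda>x. f (1 * x + s)) (of_real l)"
        unfolding cfourier_def by simp
      finally show ?thesis
        unfolding f by (simp add: exp_minus)
    qed
  qed
qed

lemma fourier_space_mult_cos_sin:
  assumes "a > 0" "F \<in> fourier_space a"
  shows "(\<lambda>x. of_real (cos (s * (x - c))) * F x) \<in> fourier_space (a + \<bar>s\<bar>)" (is ?C)
    and "(\<lambda>x. of_real (sin (s * (x - c))) * F x) \<in> fourier_space (a + \<bar>s\<bar>)" (is ?S)
proof -
  define E1 where "E1 = (\<lambda>x. exp (\<i> * of_real (s * (x - c))) * F x)"
  define E2 where "E2 = (\<lambda>x. exp (\<i> * of_real ((-s) * (x - c))) * F x)"
  have pos: "a + \<bar>s\<bar> > 0" using assms by simp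
  have "(\<lambda>x. exp (\<i> * of_real (t * (x - c))) * F x) \<in> fourier_space (a + \<bar>t\<bar>)" for t
  proof -
    have "(\<lambda>x. F (x - (-c))) \<in> fourier_space a"
      by (intro fourier_space_shift assms)
    then have "(\<lambda>x. exp (\<i> * of_real (t * x)) * F (x - (-c))) \<in> fourier_space (a + \<bar>t\<bar>)"
      by (intro fourier_space_mult_exp assms)
    from fourier_space_shift[OF _ this, of c] assms show ?thesis by simp
  qed
  from this[of s] this[of "-s"] have E: "E1 \<in> fourier_space (a + \<bar>s\<bar>)" "E2 \<in> fourier_space (a + \<bar>s\<bar>)"
    unfolding E1_def E2_def by auto
  have *: "of_real (cos t) = (exp (\<i> * of_real t) + exp (\<i> * of_real (- t))) / 2"
          "of_real (sin t) = (exp (\<i> * of_real t) - exp (\<i> * of_real (- t))) / (2 * \<i>)" for t :: real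
    by (simp_all add: cos_of_real[symmetric] sin_of_real[symmetric] cos_exp_eq sin_exp_eq
        del: cos_of_real sin_of_real)
  have "(\<lambda>x. (1/2) * (E1 x + E2 x)) \<in> fourier_space (a + \<bar>s\<bar>)"
    by (intro fourier_space_cmult fourier_space_add E pos)
  then show ?C
    unfolding E1_def E2_def * by (simp add: field_simps)
  have "(\<lambda>x. (1/(2*\<i>)) * (E1 x - E2 x)) \<in> fourier_space (a + \<bar>s\<bar>)"
    by (intro fourier_space_cmult fourier_space_diff E pos)
  then show ?S
    unfolding E1_def E2_def * by (simp add: field_simps)
qed

lemma fourier_space_mult_linear:
  assumes "a > 0" "F \<in> fourier_space a"
  shows "(\<lambda>x. (of_real x - c) * F x) \<in> fourier_space a"
proof -
  obtain f where f: "f \<in> test_functions a" "F = (\<lambda>l. cfourier f (of_real l))"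
    using assms by (elim fourier_spaceE)
  have "(\<lambda>x. of_real x * F x) \<in> fourier_space a"
  proof -
    have "(\<lambda>x. cfourier (vderiv f) (of_real x)) \<in> fourier_space a"
      by (rule fourier_spaceI[OF test_function_vderiv[OF f(1) assms(1)]]) simp
    then have "(\<lambda>x. (- \<i>) * cfourier (vderiv f) (of_real x)) \<in> fourier_space a"
      by (rule fourier_space_cmult[OF assms(1)])
    then show ?thesis
      unfolding cfourier_vderiv[OF f(1) assms(1)] f by (simp add: mult.assoc[symmetric])
  qed
  from fourier_space_diff[OF assms(1) this fourier_space_cmult[OF assms, of c]]
  show ?thesis by (simp add: left_diff_distrib)
qed

lemma fourier_space_mult_monom:
  assumes "a > 0" "F \<in> fourier_space a"
  shows "(\<lambda>x. of_real x ^ n * F x) \<in> fourier_space a"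
proof (induction n)
  case (Suc n)
  from fourier_space_mult_linear[OF assms(1) this, of 0] show ?case by (simp add: mult.assoc)
qed (use assms in simp)

text \<open>Division by a zero: if the transform vanishes at the origin, the antiderivative of the test
  function has compact support as well.\<close>

lemma fourier_space_divide:
  assumes "a > 0" "F \<in> fourier_space a" "F c = 0"
  obtains H where "H \<in> fourier_space a" "\<And>x. (of_real x - of_real c) * H x = F x"
proof -
  define F0 where "F0 = (\<lambda>x. F (x - (-c)))"
  have "F0 \<in> fourier_space a"
    unfolding F0_def by (intro fourier_space_shift assms)
  then obtain f where f: "f \<in> test_functions a" "F0 = (\<lambda>l. cfourier f (of_real l))"
    by (elim fourier_spaceE)
  obtain d where d: "smooth f" "0 \<le> d" "d < a" "\<And>x. \<bar>x\<bar> > d \<Longrightarrow> f x = 0"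
    using test_functionE[OF f(1) assms(1)] by blast
  have "F0 0 = 0" using assms by (simp add: F0_def)
  then have "(\<integral>x. f x \<partial>lborel) = 0"
    by (simp add: f cfourier_def)
  then have int0: "integral {-d..d} f = 0"
    using integral_compact_support(2)[of d f] d smooth_continuous by auto
  define g where "g = (\<lambda>x. if x \<le> -a then 0 else integral {-a..x} f)"
  have cont: "continuous_on A f" for A by (rule smooth_continuous[OF d(1)])
  have fint: "f integrable_on {u..v}" for u v
    by (rule integrable_continuous_real[OF cont])
  have gz: "g x = 0" if "x < -d" for x
  proof -
    have "integral {-a..x} f = integral {-a..x} (\<lambda>x. 0)"
      using that d by (intro integral_cong) auto
    then show ?thesis by (simp add: g_def)
  qed
  have gz2: "g x = 0" if "x > d" for x
  proof -
    have "integral {-a..x} f = integral {-a..-d} f + integral {-d..x} f"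
      using that d by (intro Henstock_Kurzweil_Integration.integral_combine[symmetric] fint) auto
    also have "integral {-d..x} f = integral {-d..d} f + integral {d..x} f"
      using that d by (intro Henstock_Kurzweil_Integration.integral_combine[symmetric] fint) auto
    also have "integral {-a..-d} f = integral {-a..-d} (\<lambda>x. 0)"
      using d by (intro integral_spike[of "{-d}"]) auto
    also have "integral {d..x} f = integral {d..x} (\<lambda>x. 0)"
      using d by (intro integral_spike[of "{d}"]) auto
    finally show ?thesis by (simp add: g_def int0)
  qed
  have dg: "(g has_vector_derivative f x) (at x)" for x
  proof (cases "x < -d")
    case True
    have "((\<lambda>x. 0) has_vector_derivative f x) (at x)" using d(4)[of x] True by simp
    then show ?thesis
      by (rule has_vector_derivative_transform_within_open[of _ _ _ "{..<-d}"])
        (use True gz in auto)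
  next
    case False
    have "((\<lambda>u. integral {-a..u} f) has_vector_derivative f x) (at x within {-a..x+1})"
      using integral_has_vector_derivative[OF cont, of x "-a" "x+1"] False d by auto
    then have "((\<lambda>u. integral {-a..u} f) has_vector_derivative f x) (at x)"
      by (subst (asm) at_within_interior) (use False d in auto)
    then show ?thesis
      by (rule has_vector_derivative_transform_within_open[of _ _ _ "{-a<..}"])
        (use False d in \<open>auto simp: g_def\<close>)
  qed
  have "smooth g"
  proof (rule smooth_coinduct[of g "insert g {f. smooth f}"])
    fix h assume "h \<in> insert g {f. smooth f}"
    then consider "h = g" | "smooth h" by auto
    then show "\<exists>f'\<in>insert g {f. smooth f}. \<forall>x. (h has_vector_derivative f' x) (at x)"
    proof cases
      case 1
      then show ?thesis using dg d(1) by (intro bexI[of _ f]) auto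
    next
      case 2
      then show ?thesis
        by (intro bexI[of _ "vderiv h"]) (auto intro: smooth_has_vderiv smooth_vderiv)
    qed
  qed simp
  have gt: "g \<in> test_functions a"
  proof (rule test_functionI[OF \<open>smooth g\<close> d(3) assms(1)])
    fix x :: real assume "\<bar>x\<bar> > d"
    then show "g x = 0" using gz[of x] gz2[of x] by (cases "x < 0") auto
  qed
  have "vderiv g = f" using dg by (auto intro: vector_derivative_at)
  then have fg: "F0 l = of_real l * (\<i> * cfourier g (of_real l))" for l
    using cfourier_vderiv[OF gt assms(1), of "of_real l"] by (simp add: f mult_ac)
  define H0 where "H0 = (\<lambda>l. \<i> * cfourier g (of_real l))"
  have "H0 \<in> fourier_space a"
    unfolding H0_def by (intro fourier_space_cmult assms(1) fourier_spaceI[OF gt]) simp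
  then have "(\<lambda>x. H0 (x - c)) \<in> fourier_space a"
    by (intro fourier_space_shift assms(1))
  moreover have "(of_real x - of_real c) * H0 (x - c) = F x" for x
    using fg[of "x - c"] by (simp add: H0_def F0_def)
  ultimately show ?thesis using that by blast
qed

section \<open>Entire extension\<close>

lemma cfourier_holomorphic:
  assumes "f \<in> test_functions a" "a > 0"
  shows "cfourier f holomorphic_on UNIV"
proof -
  obtain d where d: "smooth f" "0 \<le> d" "d < a" "\<And>x. \<bar>x\<bar> > d \<Longrightarrow> f x = 0"
    using test_functionE[OF assms] by blast
  have cont: "continuous_on A f" for A by (rule smooth_continuous[OF d(1)])
  have "cfourier f z = integral (cbox (-d) d) (\<lambda>x. f x * exp (- (\<i> * z * of_real x)))" for z
    unfolding cfourier_def box_real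
    by (rule integral_compact_support(2)) (use d cont in \<open>auto intro!: continuous_intros\<close>)
  then have eq: "cfourier f = (\<lambda>z. integral (cbox (-d) d) (\<lambda>x. f x * exp (- (\<i> * z * of_real x))))" ..
  show ?thesis
    unfolding eq
  proof (rule leibniz_rule_holomorphic)
    show "((\<lambda>z. f t * exp (- (\<i> * z * of_real t))) has_field_derivative
        f t * (- (\<i> * of_real t) * exp (- (\<i> * z * of_real t)))) (at z within UNIV)" for z t
      by (auto intro!: derivative_eq_intros)
    show "(\<lambda>x. f x * exp (- (\<i> * z * of_real x))) integrable_on cbox (-d) d" for z
      unfolding box_real by (intro integrable_continuous_real continuous_intros cont)
    show "continuous_on (UNIV \<times> cbox (- d) d) (\<lambda>(z, t). f t * (- (\<i> * of_real t) * exp (- (\<i> * z * of_real t))))"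
      unfolding split_beta
      by (intro continuous_intros continuous_on_compose2[OF cont[of UNIV]]) auto
  qed auto
qed

lemma cfourier_bound:
  assumes "f \<in> test_functions a" "a > 0"
  shows "\<exists>C. \<forall>z. cmod (cfourier f z) \<le> C * exp (a * \<bar>Im z\<bar>)"
proof -
  obtain d where d: "smooth f" "0 \<le> d" "d < a" "\<And>x. \<bar>x\<bar> > d \<Longrightarrow> f x = 0"
    using test_functionE[OF assms] by blast
  have int: "integrable lborel f"
    using cfourier_integrable[OF assms, of 0] by simp
  have "cmod (cfourier f z) \<le> (\<integral>x. cmod (f x) \<partial>lborel) * exp (a * \<bar>Im z\<bar>)" for z
  proof -
    have "cmod (cfourier f z) \<le> (\<integral>x. cmod (f x * exp (- (\<i> * z * of_real x))) \<partial>lborel)"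
      unfolding cfourier_def by (rule integral_norm_bound)
    also have "\<dots> \<le> (\<integral>x. cmod (f x) * exp (a * \<bar>Im z\<bar>) \<partial>lborel)"
    proof (rule integral_mono)
      show "integrable lborel (\<lambda>x. cmod (f x * exp (- (\<i> * z * of_real x))))"
        by (intro integrable_norm cfourier_integrable[OF assms])
      show "integrable lborel (\<lambda>x. cmod (f x) * exp (a * \<bar>Im z\<bar>))"
        using int by auto
      fix x :: real
      show "cmod (f x * exp (- (\<i> * z * of_real x))) \<le> cmod (f x) * exp (a * \<bar>Im z\<bar>)"
      proof (cases "\<bar>x\<bar> > d")
        case False
        have "Im z * x \<le> \<bar>Im z\<bar> * \<bar>x\<bar>" by (metis abs_ge_self abs_mult)
        also have "\<dots> \<le> \<bar>Im z\<bar> * a" using False d by (intro mult_left_mono) auto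
        finally show ?thesis by (auto simp: norm_mult mult_ac intro!: mult_left_mono)
      qed (use d in auto)
    qed
    finally show ?thesis by simp
  qed
  then show ?thesis by blast
qed

text \<open>The factor \<open>z\<^sup>2\<close> corresponds to the second derivative of the test function, so the
  previous bound improves by quadratic decay.\<close>

lemma fourier_space_entire:
  assumes "F \<in> fourier_space a" "a > 0"
  obtains Fc C where "Fc holomorphic_on UNIV" "\<And>x. Fc (of_real x) = F x" "C \<ge> 0"
    "\<And>z. cmod (Fc z) * (1 + cmod z ^ 2) \<le> C * exp (a * \<bar>Im z\<bar>)"
proof -
  obtain f where f: "f \<in> test_functions a" "F = (\<lambda>l. cfourier f (of_real l))"
    using assms by (elim fourier_spaceE)
  have f': "vderiv f \<in> test_functions a" and f'': "vderiv (vderiv f) \<in> test_functions a"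
    using test_function_vderiv assms(2) f by auto
  obtain C1 where C1: "\<And>z. cmod (cfourier f z) \<le> C1 * exp (a * \<bar>Im z\<bar>)"
    using cfourier_bound[OF f(1) assms(2)] by blast
  obtain C2 where C2: "\<And>z. cmod (cfourier (vderiv (vderiv f)) z) \<le> C2 * exp (a * \<bar>Im z\<bar>)"
    using cfourier_bound[OF f'' assms(2)] by blast
  have "cfourier (vderiv (vderiv f)) z = - (z^2 * cfourier f z)" for z
  proof -
    have "cfourier (vderiv (vderiv f)) z = (\<i> * \<i>) * (z^2 * cfourier f z)"
      unfolding cfourier_vderiv[OF f(1) assms(2)] cfourier_vderiv[OF f' assms(2)] power2_eq_square
      by (simp only: mult_ac)
    then show ?thesis by simp
  qed
  then have "cmod (cfourier f z) * cmod z ^ 2 = cmod (cfourier (vderiv (vderiv f)) z)" for z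
    by (simp add: norm_mult norm_power mult.commute)
  then have "cmod (cfourier f z) * (1 + cmod z ^ 2) \<le> (C1 + C2) * exp (a * \<bar>Im z\<bar>)" for z
    using C1[of z] C2[of z] by (simp add: algebra_simps)
  then show ?thesis
  proof (intro that[of "cfourier f" "C1 + C2"])
    have "0 \<le> C1"
      using order_trans[OF norm_ge_zero C1[of 0]] by simp
    moreover have "0 \<le> C2"
      using order_trans[OF norm_ge_zero C2[of 0]] by simp
    ultimately show "C1 + C2 \<ge> 0" by simp
  qed (use cfourier_holomorphic[OF f(1) assms(2)] f in auto)
qed

lemma fourier_space_decay:
  assumes "F \<in> fourier_space a" "a > 0"
  shows "continuous_on UNIV F" "\<exists>C\<ge>0. \<forall>x. cmod (F x) \<le> C / (1 + x^2)"
proof -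
  obtain Fc C where Fc: "Fc holomorphic_on UNIV" "\<And>x. Fc (of_real x) = F x" "C \<ge> 0"
    "\<And>z. cmod (Fc z) * (1 + cmod z ^ 2) \<le> C * exp (a * \<bar>Im z\<bar>)"
    using fourier_space_entire[OF assms] by blast
  have "continuous_on UNIV (\<lambda>x. Fc (of_real x))"
    by (intro continuous_on_compose2[OF holomorphic_on_imp_continuous_on[OF Fc(1)]] continuous_intros) auto
  then show "continuous_on UNIV F" by (simp add: Fc(2))
  have "cmod (F x) \<le> C / (1 + x^2)" for x
  proof -
    have "1 + x^2 > 0" by (simp add: add_pos_nonneg)
    then show ?thesis
      using Fc(4)[of "of_real x"] by (simp add: Fc(2) field_simps)
  qed
  with Fc(3) show "\<exists>C\<ge>0. \<forall>x. cmod (F x) \<le> C / (1 + x^2)" by (intro exI[of _ C]) simp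
qed

section \<open>Cardinal sine\<close>

definition Sinc :: "real \<Rightarrow> real" where
  "Sinc x = (if x = 0 then 1 else sin x / x)"

lemma Sinc_mult: "x * Sinc x = sin x"
  by (simp add: Sinc_def)

lemma isCont_Sinc: "isCont Sinc x"
proof (cases "x = 0")
  case True
  have "Sinc \<midarrow>0\<rightarrow> 1"
  proof -
    have "(\<lambda>h. (sin (0 + h) - sin 0) / h) \<midarrow>0\<rightarrow> (1::real)"
      using DERIV_sin[of "0::real"] unfolding DERIV_def by simp
    then show ?thesis
      by (rule tendsto_cong[THEN iffD1, rotated]) (auto simp: Sinc_def eventually_at intro!: exI[of _ 1])
  qed
  then show ?thesis using True by (simp add: isCont_def Sinc_def)
next
  case False
  have "isCont (\<lambda>x. sin x / x) x" using False by (intro continuous_intros) auto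
  moreover have "eventually (\<lambda>y. y \<in> - {0}) (nhds x)"
    using False by (intro eventually_nhds_in_open) auto
  then have "eventually (\<lambda>y. sin y / y = Sinc y) (nhds x)"
    by eventually_elim (auto simp: Sinc_def)
  ultimately show ?thesis using isCont_cong[of "\<lambda>x. sin x / x" Sinc x] by simp
qed

lemma abs_Sinc_le_1: "\<bar>Sinc x\<bar> \<le> 1"
proof (cases "x = 0")
  case False
  then show ?thesis using abs_sin_x_le_abs_x[of x] by (simp add: Sinc_def abs_divide)
qed (simp add: Sinc_def)

lemma abs_Sinc_le_inverse: "x \<noteq> 0 \<Longrightarrow> \<bar>Sinc x\<bar> \<le> 1 / \<bar>x\<bar>"
  using abs_sin_le_one[of x] by (simp add: Sinc_def abs_divide divide_right_mono)

text \<open>Away from \<open>c\<close> the product is \<open>sin (s * (x - c)) * F x\<close> divided by \<open>x - c\<close>, up to a constant, and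
  this quotient is a transform; at \<open>c\<close> the two agree by continuity.\<close>

lemma fourier_space_mult_Sinc:
  assumes "a > 0" "F \<in> fourier_space a" "s > 0"
  shows "(\<lambda>x. of_real (Sinc (s * (x - c))) * F x) \<in> fourier_space (a + s)"
proof -
  have "(\<lambda>x. of_real (sin (s * (x - c))) * F x) \<in> fourier_space (a + s)"
    using fourier_space_mult_cos_sin(2)[OF assms(1,2), of s c] assms(3) by simp
  from fourier_space_cmult[OF _ this, of "1 / s"]
  have "(\<lambda>x. 1 / of_real s * (of_real (sin (s * (x - c))) * F x)) \<in> fourier_space (a + s)"
    using assms by simp
  then obtain H where H: "H \<in> fourier_space (a + s)"
    "\<And>x. (of_real x - of_real c) * H x = 1 / of_real s * (of_real (sin (s * (x - c))) * F x)"
    by (rule fourier_space_divide[where c = c, rotated]) (use assms in auto)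
  have eq: "H x = of_real (Sinc (s * (x - c))) * F x" if "x \<noteq> c" for x
  proof -
    have "(of_real x - of_real c) * H x
        = (of_real x - of_real c) * (of_real (Sinc (s * (x - c))) * F x)"
      unfolding H(2) Sinc_mult[symmetric] using assms by simp
    then show ?thesis using that by simp
  qed
  have "isCont H c"
    using fourier_space_decay(1)[OF H(1)] assms by (simp add: continuous_on_eq_continuous_at)
  then have 1: "H \<midarrow>c\<rightarrow> H c" by (simp add: isCont_def)
  have "isCont (\<lambda>x. complex_of_real (Sinc (s * (x - c))) * F x) c"
    using fourier_space_decay(1)[OF assms(2,1)]
    by (intro continuous_intros isCont_o2[OF _ isCont_Sinc]) (auto simp: continuous_on_eq_continuous_at)
  then have "(\<lambda>x. complex_of_real (Sinc (s * (x - c))) * F x) \<midarrow>c\<rightarrow> of_real (Sinc (s * (c - c))) * F c"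
    by (simp add: isCont_def)
  then have 2: "H \<midarrow>c\<rightarrow> of_real (Sinc (s * (c - c))) * F c"
    by (rule tendsto_cong[THEN iffD1, rotated]) (auto simp: eventually_at eq intro!: exI[of _ 1])
  have "H c = of_real (Sinc (s * (c - c))) * F c"
    by (rule LIM_unique[OF 1 2])
  have "H = (\<lambda>x. of_real (Sinc (s * (x - c))) * F x)"
  proof
    show "H x = of_real (Sinc (s * (x - c))) * F x" for x
      by (cases "x = c") (use eq \<open>H c = _\<close> in auto)
  qed
  with H(1) show ?thesis by simp
qed

section \<open>Contour integrals of transforms\<close>

lemma contour_integral_rectpath_split:
  assumes "continuous_on (path_image (rectpath a1 a3)) f"
    and "a2 = Complex (Re a3) (Im a1)" "a4 = Complex (Re a1) (Im a3)"
  shows "contour_integral (rectpath a1 a3) f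
    = contour_integral (linepath a1 a2) f + contour_integral (linepath a2 a3) f
      + contour_integral (linepath a3 a4) f + contour_integral (linepath a4 a1) f"
    and "f contour_integrable_on linepath a1 a2" "f contour_integrable_on linepath a2 a3"
      "f contour_integrable_on linepath a3 a4" "f contour_integrable_on linepath a4 a1"
proof -
  have eq: "rectpath a1 a3 = linepath a1 a2 +++ linepath a2 a3 +++ linepath a3 a4 +++ linepath a4 a1"
    by (simp add: rectpath_def Let_def assms)
  have int: "f contour_integrable_on linepath u v"
    if "closed_segment u v \<subseteq> path_image (rectpath a1 a3)" for u v
    by (rule contour_integrable_continuous_linepath) (rule continuous_on_subset[OF assms(1) that])
  show i: "f contour_integrable_on linepath a1 a2" "f contour_integrable_on linepath a2 a3"
      "f contour_integrable_on linepath a3 a4" "f contour_integrable_on linepath a4 a1"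
    by (rule int; auto simp: eq path_image_join)+
  show "contour_integral (rectpath a1 a3) f
    = contour_integral (linepath a1 a2) f + contour_integral (linepath a2 a3) f
      + contour_integral (linepath a3 a4) f + contour_integral (linepath a4 a1) f"
    unfolding eq using i by (simp add: contour_integrable_joinI valid_path_join)
qed

lemma integral_eq_limit_symmetric:
  fixes g :: "real \<Rightarrow> complex"
  assumes "integrable lborel g" "continuous_on UNIV g"
  shows "(\<lambda>n. integral {-real n..real n} g) \<longlonglongrightarrow> (\<integral>x. g x \<partial>lborel)"
proof -
  have "(\<lambda>n. \<integral>x. indicator {-real n..real n} x *\<^sub>R g x \<partial>lborel) \<longlonglongrightarrow> (\<integral>x. g x \<partial>lborel)"
  proof (rule integral_dominated_convergence[where w = "\<lambda>x. norm (g x)"])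
    show "AE x in lborel. (\<lambda>n. indicator {-real n..real n} x *\<^sub>R g x) \<longlonglongrightarrow> g x"
    proof (rule AE_I2)
      fix x :: real
      obtain N where N: "\<bar>x\<bar> \<le> real N" using real_arch_simple by blast
      have "eventually (\<lambda>n. indicator {-real n..real n} x *\<^sub>R g x = g x) sequentially"
        using eventually_ge_at_top[of N] by eventually_elim (use N in \<open>auto simp: indicator_def\<close>)
      then show "(\<lambda>n. indicator {-real n..real n} x *\<^sub>R g x) \<longlonglongrightarrow> g x"
        by (rule tendsto_eventually)
    qed
  qed (use assms in \<open>auto simp: indicator_def\<close>)
  moreover have "(\<integral>x. indicator {-real n..real n} x *\<^sub>R g x \<partial>lborel) = integral {-real n..real n} g" for n
  proof -
    have "set_integrable lborel {-real n..real n} g"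
      unfolding set_integrable_def
      by (rule borel_integrable_compact) (use assms continuous_on_subset in auto)
    from set_borel_integral_eq_integral(2)[OF this] show ?thesis
      by (simp add: set_lebesgue_integral_def)
  qed
  ultimately show ?thesis by simp
qed

lemma integrable_quadratic_decay: "integrable lborel (\<lambda>x::real. C / (1 + x^2))"
proof -
  have "integrable lborel (\<lambda>x::real. inverse (1 + x^2))"
    using integrable_inverse_1_plus_square by (simp add: set_integrable_def)
  then have "integrable lborel (\<lambda>x::real. C * inverse (1 + x^2))" by (rule integrable_mult_right)
  then show ?thesis by (simp add: divide_inverse)
qed

lemma integrable_of_quadratic_decay:
  fixes g :: "real \<Rightarrow> complex"
  assumes "g \<in> borel_measurable borel" "\<And>x. cmod (g x) \<le> C / (1 + x^2)"
  shows "integrable lborel g"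
proof (rule Bochner_Integration.integrable_bound[OF integrable_quadratic_decay[of C]])
  show "AE x in lborel. norm (g x) \<le> norm (C / (1 + x^2))"
    unfolding real_norm_def by (intro AE_I2 order_trans[OF assms(2) abs_ge_self])
qed (use assms in auto)

text \<open>The frequency \<open>-p\<close> lies outside the support of the test function. When the line of integration
  moves upwards, \<open>exp (\<i> * p * z)\<close> decays at least as fast as the transform can grow.\<close>

lemma fourier_space_spectral_gap:
  assumes "H \<in> fourier_space a" "0 < a" "a \<le> p"
  shows "(\<integral>x. H x * exp (\<i> * of_real (p * x)) \<partial>lborel) = 0"
proof -
  obtain Hc C where Hc: "Hc holomorphic_on UNIV" "\<And>x. Hc (of_real x) = H x" "C \<ge> 0"
    "\<And>z. cmod (Hc z) * (1 + cmod z ^ 2) \<le> C * exp (a * \<bar>Im z\<bar>)"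
    using fourier_space_entire[OF assms(1,2)] by blast
  define g where "g = (\<lambda>z. Hc z * exp (\<i> * of_real p * z))"
  have hol: "g holomorphic_on UNIV"
    unfolding g_def by (intro holomorphic_intros Hc)
  have bound: "cmod (g z) \<le> C / (1 + r^2)" if "Im z \<ge> 0" "0 \<le> r" "r \<le> cmod z" for z r
  proof -
    have "cmod (g z) * (1 + r^2) \<le> cmod (g z) * (1 + cmod z ^ 2)"
      using that by (intro mult_left_mono add_left_mono power_mono) auto
    also have "\<dots> = cmod (Hc z) * (1 + cmod z ^ 2) * exp (- (p * Im z))"
      by (simp add: g_def norm_mult)
    also have "\<dots> \<le> C * exp (a * \<bar>Im z\<bar>) * exp (- (p * Im z))"
      by (intro mult_right_mono Hc) auto
    also have "\<dots> = C * exp ((a - p) * Im z)"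
      using that by (simp add: exp_add[symmetric] algebra_simps)
    also have "\<dots> \<le> C * 1"
      using assms that Hc by (intro mult_left_mono) (auto simp: mult_le_0_iff)
    finally have "cmod (g z) * (1 + r^2) \<le> C" by simp
    moreover have "1 + r^2 > 0" by (simp add: add_pos_nonneg)
    ultimately show ?thesis by (simp add: field_simps)
  qed
  have small: "cmod (integral {-real n..real n} (\<lambda>x. g (of_real x))) \<le> C / (1 + real n ^ 2) * (4 * real n)"
    if "n > 0" for n :: nat
  proof -
    define a1 a2 a3 a4 where "a1 = complex_of_real (- real n)" and "a2 = complex_of_real (real n)"
      and "a3 = Complex (real n) (real n)" and "a4 = Complex (- real n) (real n)"
    have eqs: "a2 = Complex (Re a3) (Im a1)" "a4 = Complex (Re a1) (Im a3)"
      by (simp_all add: a1_def a2_def a3_def a4_def complex_eq_iff)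
    note split = contour_integral_rectpath_split[OF holomorphic_on_imp_continuous_on[OF
        holomorphic_on_subset[OF hol subset_UNIV]] eqs]
    have "(g has_contour_integral 0) (rectpath a1 a3)"
      by (rule Cauchy_theorem_convex_simple[OF hol]) auto
    then have "contour_integral (rectpath a1 a3) g = 0"
      by (rule contour_integral_unique)
    then have "contour_integral (linepath a1 a2) g + (contour_integral (linepath a2 a3) g
            + contour_integral (linepath a3 a4) g + contour_integral (linepath a4 a1) g) = 0"
      unfolding split(1) by (simp only: add.assoc)
    then have "contour_integral (linepath a1 a2) g
      = - (contour_integral (linepath a2 a3) g + contour_integral (linepath a3 a4) g
            + contour_integral (linepath a4 a1) g)"
      by (simp only: add_eq_0_iff2)
    moreover have "contour_integral (linepath a1 a2) g = integral {-real n..real n} (\<lambda>x. g (of_real x))"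
      using that by (subst contour_integral_linepath_Reals_eq) (auto simp: a1_def a2_def)
    ultimately have I: "integral {-real n..real n} (\<lambda>x. g (of_real x))
      = - (contour_integral (linepath a2 a3) g + contour_integral (linepath a3 a4) g
            + contour_integral (linepath a4 a1) g)" by simp
    have b1: "cmod (contour_integral (linepath a2 a3) g) \<le> C / (1 + real n ^ 2) * cmod (a3 - a2)"
    proof (rule contour_integral_bound_linepath[OF split(3)])
      fix z assume "z \<in> closed_segment a2 a3"
      then have "Re z = real n \<and> Im z \<ge> 0"
        by (simp add: a2_def a3_def closed_segment_same_Re closed_segment_eq_real_ivl split: if_splits)
      then show "cmod (g z) \<le> C / (1 + real n ^ 2)"
        using bound[of z "real n"] abs_Re_le_cmod[of z] by auto
    qed (use Hc in auto)
    have b2: "cmod (contour_integral (linepath a3 a4) g) \<le> C / (1 + real n ^ 2) * cmod (a4 - a3)"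
    proof (rule contour_integral_bound_linepath[OF split(4)])
      fix z assume "z \<in> closed_segment a3 a4"
      then have "Im z = real n"
        by (simp add: a4_def a3_def closed_segment_same_Im)
      then show "cmod (g z) \<le> C / (1 + real n ^ 2)"
        using bound[of z "real n"] abs_Im_le_cmod[of z] by auto
    qed (use Hc in auto)
    have b3: "cmod (contour_integral (linepath a4 a1) g) \<le> C / (1 + real n ^ 2) * cmod (a1 - a4)"
    proof (rule contour_integral_bound_linepath[OF split(5)])
      fix z assume "z \<in> closed_segment a4 a1"
      then have "Re z = - real n \<and> Im z \<ge> 0"
        by (simp add: a1_def a4_def closed_segment_same_Re closed_segment_eq_real_ivl split: if_splits)
      then show "cmod (g z) \<le> C / (1 + real n ^ 2)"
        using bound[of z "real n"] abs_Re_le_cmod[of z] by auto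
    qed (use Hc in auto)
    have len: "cmod (a3 - a2) = n" "cmod (a4 - a3) = 2 * n" "cmod (a1 - a4) = n"
      by (auto simp: a1_def a2_def a3_def a4_def cmod_def real_sqrt_mult)
    define B where "B = C / (1 + real n ^ 2)"
    have "cmod (integral {-real n..real n} (\<lambda>x. g (of_real x))) \<le> B * n + B * (2 * n) + B * n"
      unfolding I norm_minus_cancel
      using b1 b2 b3 unfolding len B_def[symmetric]
      by (intro order_trans[OF norm_triangle_ineq] add_mono)
    also have "\<dots> = B * (4 * real n)" by (simp add: algebra_simps)
    finally show ?thesis unfolding B_def .
  qed
  have gx: "(\<lambda>x. g (of_real x)) = (\<lambda>x. H x * exp (\<i> * of_real (p * x)))"
    by (auto simp: g_def Hc mult.assoc)
  have cont: "continuous_on UNIV (\<lambda>x. g (of_real x))"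
    by (intro continuous_on_compose2[OF holomorphic_on_imp_continuous_on[OF hol]] continuous_intros) auto
  have "integrable lborel (\<lambda>x. g (of_real x))"
  proof (rule integrable_of_quadratic_decay)
    show "(\<lambda>x. g (of_real x)) \<in> borel_measurable borel"
      by (rule borel_measurable_continuous_onI[OF cont])
    show "cmod (g (of_real x)) \<le> C / (1 + x^2)" for x
      using bound[of "of_real x" "\<bar>x\<bar>"] by simp
  qed
  then have lim: "(\<lambda>n. integral {-real n..real n} (\<lambda>x. g (of_real x))) \<longlonglongrightarrow> (\<integral>x. g (of_real x) \<partial>lborel)"
    by (rule integral_eq_limit_symmetric[OF _ cont])
  have "(\<lambda>n. C / (1 + real n ^ 2) * (4 * real n)) \<longlonglongrightarrow> 0"
    by real_asymp
  then have "(\<lambda>n. integral {-real n..real n} (\<lambda>x. g (of_real x))) \<longlonglongrightarrow> 0"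
    by (rule Lim_null_comparison[rotated])
      (use small in \<open>auto simp: eventually_sequentially intro!: exI[of _ 1]\<close>)
  with lim have "(\<integral>x. g (of_real x) \<partial>lborel) = 0"
    using LIMSEQ_unique by blast
  then show ?thesis by (simp add: gx)
qed

lemma norm_cos_ge_diff:
  "cmod (cos w) \<ge> (exp \<bar>Im w\<bar> - exp (- \<bar>Im w\<bar>)) / 2"
proof -
  have e: "cmod (exp (\<i> * w)) = exp (- Im w)" "cmod (exp (- (\<i> * w))) = exp (Im w)"
    by simp_all
  have "exp \<bar>Im w\<bar> - exp (- \<bar>Im w\<bar>) \<le> \<bar>exp (- Im w) - exp (Im w)\<bar>"
    by (cases "Im w \<ge> 0") (auto simp: abs_if)
  also have "\<dots> \<le> cmod (exp (\<i> * w) + exp (- (\<i> * w)))"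
    using norm_triangle_ineq3[of "exp (\<i> * w)" "- exp (- (\<i> * w))"]
    by (simp only: norm_minus_cancel diff_minus_eq_add e)
  finally have "(exp \<bar>Im w\<bar> - exp (- \<bar>Im w\<bar>)) / 2 \<le> cmod (exp (\<i> * w) + exp (- (\<i> * w))) / 2"
    by (rule divide_right_mono) simp
  also have "\<dots> = cmod (cos w)"
    unfolding cos_exp_eq norm_divide by (simp only: norm_numeral)
  finally show ?thesis .
qed

text \<open>The vertical lines \<open>\<bar>Re z\<bar> = N + 1/2\<close> pass midway between zeros of the cosine, so that the bound
  holds on them down to the real axis.\<close>

lemma norm_cos_2pi_ge:
  assumes "\<bar>Re z\<bar> = real N + 1/2 \<or> \<bar>Im z\<bar> \<ge> 1"
  shows "cmod (cos (of_real (2 * pi) * z)) \<ge> exp (2 * pi * \<bar>Im z\<bar>) / 4"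
proof -
  define u where "u = 2 * pi * \<bar>Im z\<bar>"
  define w where "w = of_real (2 * pi) * z"
  have Imw: "\<bar>Im w\<bar> = u" by (simp add: w_def u_def abs_mult)
  have "cmod (cos w) \<ge> exp u / 4"
    using assms
  proof
    assume "\<bar>Im z\<bar> \<ge> 1"
    then have "2 * pi * 1 \<le> u" unfolding u_def by (intro mult_left_mono) simp_all
    then have "u \<ge> 1" using pi_gt3 by linarith
    then have "exp u \<ge> 2" "exp (- u) \<le> 1" using exp_ge_add_one_self[of u] by (linarith, simp)
    moreover have "2 \<le> p \<Longrightarrow> q \<le> 1 \<Longrightarrow> p / 4 \<le> (p - q) / 2" for p q :: real
      by (simp add: field_simps)
    ultimately have "exp u / 4 \<le> (exp u - exp (- u)) / 2" by blast
    also have "\<dots> \<le> cmod (cos w)" using norm_cos_ge_diff[of w] unfolding Imw .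
    finally show ?thesis .
  next
    assume re: "\<bar>Re z\<bar> = real N + 1/2"
    have "\<bar>Re w\<bar> = real (2 * N + 1) * pi"
      unfolding w_def by (simp add: abs_mult re algebra_simps)
    then have "sin \<bar>Re w\<bar> = 0" by (simp only: sin_npi)
    then have s: "sin (Re w) = 0" by (cases "Re w \<ge> 0") simp_all
    then have "(cos (Re w))\<^sup>2 = 1" using sin_cos_squared_add[of "Re w"] by simp
    moreover have "(cmod (cos w))\<^sup>2 = (cos (Re w))\<^sup>2 + (exp (Im w) - inverse (exp (Im w)))\<^sup>2 / 4"
      by (rule norm_cos_squared)
    moreover have "(exp u / 4)\<^sup>2 \<le> 1 + (exp (Im w) - inverse (exp (Im w)))\<^sup>2 / 4"
    proof -
      have "(exp (Im w) - inverse (exp (Im w)))\<^sup>2 = (exp u - inverse (exp u))\<^sup>2"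
        using Imw by (cases "Im w \<ge> 0") (auto simp: exp_minus power2_commute)
      also have "\<dots> = (exp u)\<^sup>2 + (inverse (exp u))\<^sup>2 - 2"
        by (simp add: power2_eq_square algebra_simps)
      moreover have "x / 16 \<le> 1 + (x + y - 2) / 4" if "x \<ge> 0" "y \<ge> 0" for x y :: real
        using that by (simp add: field_simps)
      ultimately show ?thesis by (simp add: power_divide)
    qed
    ultimately have "(exp u / 4)\<^sup>2 \<le> (cmod (cos w))\<^sup>2" by simp
    then show ?thesis by (rule power2_le_imp_le) simp
  qed
  then show ?thesis by (simp add: u_def w_def)
qed

text \<open>The residue theorem on growing squares. The polynomial with the zero set \<open>T\<close> changes the cosine
  in the denominator by a factor that is bounded below far out, so the square contributes nothing
  in the limit, as long as the type does not exceed that of the cosine.\<close>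

lemma transform_residue_sum:
  fixes T :: "real set"
  assumes H: "H \<in> fourier_space b" "0 < b" "b \<le> 2 * pi"
    and T: "finite T" "\<And>w. w \<in> T \<Longrightarrow> cos (2 * pi * w) \<noteq> 0"
  defines "W \<equiv> \<lambda>x::real. \<Prod>w\<in>T. x - w"
  shows "(\<lambda>N. (\<Sum>n\<in>{-int N..int N}.
             (H (of_int n - 1/4) / of_real (W (of_int n - 1/4))
               - H (of_int n + 1/4) / of_real (W (of_int n + 1/4))) / of_real (2 * pi))
           + (\<Sum>w\<in>T. H w / of_real (cos (2 * pi * w) * (\<Prod>v\<in>T - {w}. w - v)))) \<longlonglongrightarrow> 0"
    (is "?S \<longlonglongrightarrow> 0")
proof -
  obtain Hc C where Hc: "Hc holomorphic_on UNIV" "\<And>x. Hc (of_real x) = H x" "C \<ge> 0"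
    "\<And>z. cmod (Hc z) * (1 + cmod z ^ 2) \<le> C * exp (b * \<bar>Im z\<bar>)"
    using fourier_space_entire[OF H(1,2)] by blast
  have contH: "isCont Hc z" for z
    using holomorphic_on_imp_continuous_on[OF Hc(1)] by (simp add: continuous_on_eq_continuous_at)
  define Co where "Co = (\<lambda>z::complex. cos (of_real (2 * pi) * z))"
  define Wc where "Wc = (\<lambda>z. \<Prod>w\<in>T. z - complex_of_real w)"
  define f where "f = (\<lambda>z. Hc z / (Co z * Wc z))"
  \<comment> \<open>At the points of \<open>T\<close> the cosine does not vanish and \<open>Wc\<close> has a simple zero; at the other poles it is
    the reverse.\<close>
  define res where "res = (\<lambda>x. if x \<in> T then H x / of_real (cos (2 * pi * x) * (\<Prod>v\<in>T - {x}. x - v))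
      else H x / (of_real (- (2 * pi) * sin (2 * pi * x)) * of_real (W x)))"
  define L1 L2 where "L1 = (\<lambda>N. (\<lambda>n. real_of_int n - 1/4) ` {-int N..int N})"
    and "L2 = (\<lambda>N. (\<lambda>n. real_of_int n + 1/4) ` {-int N..int N})"
  have Co_real: "Co (of_real x) = of_real (cos (2 * pi * x))" for x
    unfolding Co_def of_real_mult[symmetric] cos_of_real by (rule refl)
  have cosL: "cos (2 * pi * (real_of_int n - 1/4)) = 0" "cos (2 * pi * (real_of_int n + 1/4)) = 0"
    "sin (2 * pi * (real_of_int n - 1/4)) = - 1" "sin (2 * pi * (real_of_int n + 1/4)) = 1" for n
  proof -
    have *: "2 * pi * (real_of_int n - 1/4) = 2 * pi * real_of_int n - pi / 2"
         "2 * pi * (real_of_int n + 1/4) = 2 * pi * real_of_int n + pi / 2"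
      by (simp_all add: field_simps)
    show "cos (2 * pi * (real_of_int n - 1/4)) = 0" "cos (2 * pi * (real_of_int n + 1/4)) = 0"
      "sin (2 * pi * (real_of_int n - 1/4)) = - 1" "sin (2 * pi * (real_of_int n + 1/4)) = 1"
      unfolding * cos_diff cos_add sin_diff sin_add cos_pi_half sin_pi_half cos_int_2pin sin_int_2pin
      by simp_all
  qed
  have Wc_real: "Wc (of_real x) = of_real (W x)" for x
    by (simp add: Wc_def W_def)
  have Wc0: "Wc z = 0 \<longleftrightarrow> z \<in> of_real ` T" for z
    using T(1) by (auto simp: Wc_def)
  have contC: "isCont Co z" "isCont Wc z" for z
    unfolding Co_def Wc_def by (intro continuous_intros)+
  have limT: "((\<lambda>z. f z * (z - of_real w)) \<longlongrightarrow> res w) (at (of_real w))" if "w \<in> T" for w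
  proof -
    define V where "V = (\<lambda>z. \<Prod>v\<in>T - {w}. z - complex_of_real v)"
    have "V (of_real w) \<noteq> 0" using T(1) by (auto simp: V_def)
    moreover have "isCont V z" for z unfolding V_def by (intro continuous_intros)
    moreover have "Co (of_real w) \<noteq> 0" using T(2)[OF that] by (simp add: Co_real)
    ultimately have "isCont (\<lambda>z. Hc z / (Co z * V z)) (of_real w)"
      using contH contC by (intro continuous_intros) auto
    then have "((\<lambda>z. Hc z / (Co z * V z)) \<longlongrightarrow> Hc (of_real w) / (Co (of_real w) * V (of_real w))) (at (of_real w))"
      by (simp add: isCont_def)
    moreover have "Hc (of_real w) / (Co (of_real w) * V (of_real w)) = res w"
      using that by (simp add: res_def Hc Co_real V_def)
    moreover have "f z * (z - of_real w) = Hc z / (Co z * V z)" if "z \<noteq> of_real w" for z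
    proof -
      have "Wc z = (z - of_real w) * V z"
        unfolding Wc_def V_def by (rule prod.remove[OF T(1) \<open>w \<in> T\<close>])
      then show ?thesis using that by (simp add: f_def)
    qed
    ultimately show ?thesis
      by (auto intro: tendsto_cong[THEN iffD1, rotated] simp: eventually_at_filter)
  qed
  have limL: "((\<lambda>z. f z * (z - of_real x)) \<longlongrightarrow> res x) (at (of_real x))"
    if "x \<notin> T" "cos (2 * pi * x) = 0" "sin (2 * pi * x) \<noteq> 0" for x
  proof -
    have "(Co has_field_derivative of_real (- (2 * pi) * sin (2 * pi * x))) (at (of_real x))"
    proof -
      have "(Co has_field_derivative - sin (of_real (2 * pi) * of_real x) * of_real (2 * pi)) (at (of_real x))"
        unfolding Co_def by (rule derivative_eq_intros refl | simp)+
      also have "- sin (of_real (2 * pi) * of_real x) * of_real (2 * pi)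
          = complex_of_real (- (2 * pi) * sin (2 * pi * x))"
        unfolding of_real_mult[symmetric] sin_of_real by simp
      finally show ?thesis .
    qed
    then have "((\<lambda>z. Co z / (z - of_real x)) \<longlongrightarrow> of_real (- (2 * pi) * sin (2 * pi * x))) (at (of_real x))"
      using that Co_real[of x] by (simp add: has_field_derivative_iff)
    then have "((\<lambda>z. (Hc z / Wc z) / (Co z / (z - of_real x))) \<longlongrightarrow>
        (Hc (of_real x) / Wc (of_real x)) / of_real (- (2 * pi) * sin (2 * pi * x))) (at (of_real x))"
      using contH[of "of_real x"] contC[of "of_real x"] Wc0[of "of_real x"] that
      by (intro tendsto_intros) (auto simp: isCont_def)
    moreover have "(Hc (of_real x) / Wc (of_real x)) / of_real (- (2 * pi) * sin (2 * pi * x)) = res x"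
      using that by (simp add: res_def Hc Wc_real mult.commute)
    moreover have "(Hc z / Wc z) / (Co z / (z - of_real x)) = f z * (z - of_real x)" for z
      by (simp add: f_def)
    ultimately show ?thesis by simp
  qed
  obtain M where M: "\<And>w. w \<in> T \<Longrightarrow> \<bar>w\<bar> \<le> M" "M \<ge> 0"
  proof (rule that[of "\<Sum>w\<in>T. \<bar>w\<bar>"])
    show "\<bar>w\<bar> \<le> (\<Sum>w\<in>T. \<bar>w\<bar>)" if "w \<in> T" for w
      using T(1) that by (intro member_le_sum) auto
  qed (simp add: sum_nonneg)
  have main: "cmod (?S N) \<le> 4 * C / (1 + real N ^ 2) * (4 * (2 * real N + 1))" if N: "real N \<ge> M + 1" for N
  proof -
    define pts where "pts = complex_of_real ` (T \<union> (L1 N \<union> L2 N))"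
    \<comment> \<open>The width \<open>7/10\<close> leaves room for the square of half side \<open>N + 1/2\<close> and excludes the next pole at \<open>N + 3/4\<close>.\<close>
    define S where "S = {z. \<bar>Re z\<bar> < real N + 7/10}"
    define r where "r = real N + 1/2"
    define a1 a3 where "a1 = Complex (-r) (-r)" and "a3 = Complex r r"
    have r: "r > 0" "r \<ge> 1" "r \<ge> N" using N M by (auto simp: r_def)
    have fin: "finite pts" unfolding pts_def L1_def L2_def using T(1) by blast
    have openS: "open S" unfolding S_def by (intro open_Collect_less continuous_intros)
    have "S = {z. Re z < real N + 7/10} \<inter> {z. Re z > - (real N + 7/10)}"
      by (auto simp: S_def)
    then have "convex S"
      by (simp add: convex_Int convex_halfspace_Re_lt convex_halfspace_Re_gt)
    have cosz: "z \<in> of_real ` (L1 N \<union> L2 N)" if "Co z = 0" "z \<in> S" for z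
    proof -
      from that(1) obtain k :: int where "of_real (2 * pi) * z = complex_of_real (k * pi) + of_real pi / 2"
        unfolding Co_def cos_eq_0 by blast
      then have "complex_of_real pi * (4 * z) = complex_of_real pi * (2 * of_int k + 1)"
        by (simp add: field_simps)
      then have "4 * z = 2 * of_int k + 1" by simp
      then have z: "z = of_real ((2 * of_int k + 1) / 4)"
        by (simp add: field_simps)
      show ?thesis
      proof (cases "even k")
        case True
        then obtain n where n: "k = 2 * n" by (elim evenE)
        then have zn: "z = of_real (of_int n + 1/4)" by (simp add: z field_simps)
        then have "\<bar>of_int n + 1/4\<bar> < real N + 7/10" using that(2) by (simp add: S_def)
        then have "n \<in> {-int N..int N}" by (auto simp: abs_less_iff)
        then show ?thesis unfolding zn L2_def by blast
      next
        case False
        then obtain m where m: "k = 2 * m + 1" by (elim oddE)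
        then have zn: "z = of_real (of_int (m + 1) - 1/4)" by (simp add: z field_simps)
        then have "\<bar>of_int (m + 1) - 1/4\<bar> < real N + 7/10" using that(2) by (simp add: S_def)
        then have "m + 1 \<in> {-int N..int N}" by (auto simp: abs_less_iff)
        then show ?thesis unfolding zn L1_def by blast
      qed
    qed
    have holf: "f holomorphic_on S - A" if "pts \<subseteq> A" for A
      unfolding f_def
    proof (intro holomorphic_intros)
      show "Hc holomorphic_on S - A" using Hc(1) holomorphic_on_subset by blast
      show "Co holomorphic_on S - A" "Wc holomorphic_on S - A"
        unfolding Co_def Wc_def by (intro holomorphic_intros)+
      fix z assume "z \<in> S - A"
      then show "Co z * Wc z \<noteq> 0"
        using cosz[of z] Wc0[of z] that unfolding pts_def by auto
    qed
    have ptsS: "\<bar>Re p\<bar> < r \<and> Im p = 0" if "p \<in> pts" for p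
    proof -
      from that obtain x where x: "p = of_real x" "x \<in> T \<union> (L1 N \<union> L2 N)" by (auto simp: pts_def)
      then consider "x \<in> T" | n where "n \<in> {-int N..int N}" "x = of_int n - 1/4"
        | n where "n \<in> {-int N..int N}" "x = of_int n + 1/4"
        unfolding L1_def L2_def by blast
      then have "\<bar>x\<bar> < r"
      proof cases
        case 1
        then show ?thesis using M(1)[of x] N by (simp add: r_def)
      next
        case 2
        then have "-real N \<le> of_int n" "of_int n \<le> real N" by auto
        then show ?thesis using 2 by (auto simp: r_def abs_less_iff)
      next
        case 3
        then have "-real N \<le> of_int n" "of_int n \<le> real N" by auto
        then show ?thesis using 3 by (auto simp: r_def abs_less_iff)
      qed
      with x show ?thesis by simp
    qed
    have img: "path_image (rectpath a1 a3) = {z. Re z \<in> {-r, r} \<and> Im z \<in> {-r..r}} \<union> {z. Im z \<in> {-r, r} \<and> Re z \<in> {-r..r}}"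
      using r by (subst path_image_rectpath) (auto simp: a1_def a3_def)
    have imgS: "path_image (rectpath a1 a3) \<subseteq> S - pts"
    proof
      fix z assume z: "z \<in> path_image (rectpath a1 a3)"
      then have "\<bar>Re z\<bar> \<le> r" using r unfolding img by auto
      then have "z \<in> S" by (simp add: S_def r_def)
      moreover have "z \<notin> pts" using ptsS[of z] z r unfolding img by auto
      ultimately show "z \<in> S - pts" by simp
    qed
    have "contour_integral (rectpath a1 a3) f = 2 * pi * \<i> * (\<Sum>p\<in>pts. winding_number (rectpath a1 a3) p * residue f p)"
    proof (rule Residue_theorem[OF openS _ fin holf _ _ imgS])
      show "connected S" using \<open>convex S\<close> by (rule convex_connected)
      show "\<forall>z. z \<notin> S \<longrightarrow> winding_number (rectpath a1 a3) z = 0"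
        using r by (auto intro!: winding_number_rectpath_outside
            simp: a1_def a3_def S_def r_def in_cbox_complex_iff)
    qed auto
    also have "(\<Sum>p\<in>pts. winding_number (rectpath a1 a3) p * residue f p) = (\<Sum>p\<in>pts. res (Re p))"
    proof (rule sum.cong[OF refl])
      fix p assume p: "p \<in> pts"
      have "winding_number (rectpath a1 a3) p = 1"
        by (rule winding_number_rectpath) (use ptsS[OF p] r in \<open>auto simp: in_box_complex_iff a1_def a3_def abs_less_iff\<close>)
      moreover have "residue f p = res (Re p)"
      proof (rule residue_simple')
        show "open (S - (pts - {p}))"
          using openS fin by (intro open_Diff finite_imp_closed) auto
        show "p \<in> S - (pts - {p})"
          using ptsS[OF p] by (auto simp: S_def r_def)
        have "S - (pts - {p}) - {p} = S - (pts \<union> {p})" using p by auto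
        then show "f holomorphic_on S - (pts - {p}) - {p}"
          using holf[of "pts \<union> {p}"] by auto
        from p obtain x where x: "p = of_real x" "x \<in> T \<union> (L1 N \<union> L2 N)" by (auto simp: pts_def)
        show "((\<lambda>w. f w * (w - p)) \<longlongrightarrow> res (Re p)) (at p)"
        proof (cases "x \<in> T")
          case True
          then show ?thesis using limT x by simp
        next
          case False
          then obtain n where "x = of_int n - 1/4 \<or> x = of_int n + 1/4"
            using x unfolding L1_def L2_def by blast
          then have "cos (2 * pi * x) = 0" "sin (2 * pi * x) \<noteq> 0"
            using cosL(1,2)[of n] cosL(3,4)[of n] by (elim disjE; simp only:; simp)+
          then show ?thesis using limL False x by simp
        qed
      qed
      ultimately show "winding_number (rectpath a1 a3) p * residue f p = res (Re p)" by simp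
    qed
    also have "\<dots> = (\<Sum>x\<in>T \<union> (L1 N \<union> L2 N). res x)"
      unfolding pts_def by (subst sum.reindex) (auto simp: inj_on_def)
    also have "\<dots> = (\<Sum>x\<in>T. res x) + ((\<Sum>x\<in>L1 N. res x) + (\<Sum>x\<in>L2 N. res x))"
    proof -
      have "T \<inter> (L1 N \<union> L2 N) = {}"
        using T(2) cosL unfolding L1_def L2_def by blast
      moreover have "L1 N \<inter> L2 N = {}"
      proof (rule ccontr)
        assume "L1 N \<inter> L2 N \<noteq> {}"
        then obtain m n where "real_of_int m - 1/4 = real_of_int n + 1/4"
          unfolding L1_def L2_def by blast
        then have "sin (2 * pi * (real_of_int m - 1/4)) = sin (2 * pi * (real_of_int n + 1/4))"
          by (simp only:)
        then show False unfolding cosL by simp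
      qed
      moreover have "finite (L1 N)" "finite (L2 N)" by (auto simp: L1_def L2_def)
      ultimately show ?thesis using T(1) by (simp add: sum.union_disjoint)
    qed
    also have "(\<Sum>x\<in>L1 N. res x) = (\<Sum>n\<in>{-int N..int N}. H (of_int n - 1/4) / of_real (W (of_int n - 1/4)) / of_real (2 * pi))"
      unfolding L1_def
    proof (subst sum.reindex)
      show "inj_on (\<lambda>n. real_of_int n - 1 / 4) {- int N..int N}" by (auto simp: inj_on_def)
      have "of_int n - 1/4 \<notin> T" for n using T(2) cosL(1) by blast
      then show "sum (res \<circ> (\<lambda>n. real_of_int n - 1 / 4)) {- int N..int N} =
        (\<Sum>n = - int N..int N. H (of_int n - 1/4) / of_real (W (of_int n - 1/4)) / of_real (2 * pi))"
        unfolding o_def res_def cosL by (intro sum.cong refl) simp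
    qed
    also have "(\<Sum>x\<in>L2 N. res x) = (\<Sum>n\<in>{-int N..int N}. - (H (of_int n + 1/4) / of_real (W (of_int n + 1/4)) / of_real (2 * pi)))"
      unfolding L2_def
    proof (subst sum.reindex)
      show "inj_on (\<lambda>n. real_of_int n + 1 / 4) {- int N..int N}" by (auto simp: inj_on_def)
      have "of_int n + 1/4 \<notin> T" for n using T(2) cosL(2) by blast
      then show "sum (res \<circ> (\<lambda>n. real_of_int n + 1 / 4)) {- int N..int N} =
        (\<Sum>n = - int N..int N. - (H (of_int n + 1/4) / of_real (W (of_int n + 1/4)) / of_real (2 * pi)))"
        unfolding o_def res_def cosL by (intro sum.cong refl) simp
    qed
    also have "(\<Sum>x\<in>T. res x) + ((\<Sum>n\<in>{-int N..int N}. H (of_int n - 1/4) / of_real (W (of_int n - 1/4)) / of_real (2 * pi))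
        + (\<Sum>n\<in>{-int N..int N}. - (H (of_int n + 1/4) / of_real (W (of_int n + 1/4)) / of_real (2 * pi)))) = ?S N"
    proof -
      have "(\<Sum>x\<in>T. res x) = (\<Sum>w\<in>T. H w / of_real (cos (2 * pi * w) * (\<Prod>v\<in>T - {w}. w - v)))"
        by (intro sum.cong refl) (simp add: res_def)
      then show ?thesis
        unfolding sum.distrib[symmetric] by (simp add: diff_divide_distrib)
    qed
    finally have int: "contour_integral (rectpath a1 a3) f = 2 * pi * \<i> * ?S N" .
    define B where "B = 4 * C / (1 + real N ^ 2)"
    have B: "B \<ge> 0" using Hc(3) by (simp add: B_def)
    have bound: "cmod (f z) \<le> B" if z: "z \<in> path_image (rectpath a1 a3)" for z
    proof -
      have zr: "\<bar>Re z\<bar> = r \<or> \<bar>Im z\<bar> = r" using z r unfolding img by auto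
      then have rz: "r \<le> cmod z" using abs_Re_le_cmod[of z] abs_Im_le_cmod[of z] by auto
      have co: "cmod (Co z) \<ge> exp (2 * pi * \<bar>Im z\<bar>) / 4"
        unfolding Co_def by (rule norm_cos_2pi_ge[of _ N]) (use zr r in \<open>auto simp: r_def\<close>)
      have "1 \<le> cmod (z - of_real w)" if "w \<in> T" for w
        using norm_triangle_ineq2[of z "of_real w"] M(1)[OF that] rz N by (simp add: r_def)
      then have wc: "1 \<le> cmod (Wc z)"
        unfolding Wc_def prod_norm[symmetric] by (intro prod_ge_1)
      have N2: "0 < 1 + real N ^ 2" by (simp add: add_pos_nonneg)
      have "cmod (Hc z) * (1 + real N ^ 2) \<le> cmod (Hc z) * (1 + cmod z ^ 2)"
        using rz r by (intro mult_left_mono add_left_mono power_mono) auto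
      also have "\<dots> \<le> C * exp (b * \<bar>Im z\<bar>)" by (rule Hc)
      also have "\<dots> \<le> C * exp (2 * pi * \<bar>Im z\<bar>)"
        using H Hc(3) by (intro mult_left_mono) (auto intro!: mult_right_mono)
      finally have "cmod (Hc z) \<le> B * (exp (2 * pi * \<bar>Im z\<bar>) / 4)"
        using N2 by (simp add: B_def field_simps)
      also have "\<dots> \<le> B * (cmod (Co z) * cmod (Wc z))"
        using co wc B mult_mono[OF co wc] by (intro mult_left_mono) auto
      finally have le: "cmod (Hc z) \<le> B * (cmod (Co z) * cmod (Wc z))" .
      have "cmod (Co z) * cmod (Wc z) > 0"
        using co wc exp_gt_zero[of "2 * pi * \<bar>Im z\<bar>"] by (intro mult_pos_pos) linarith+
      then show ?thesis
        using le by (simp add: f_def norm_divide norm_mult pos_divide_le_eq)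
    qed
    define a2 a4 where "a2 = Complex r (-r)" and "a4 = Complex (-r) r"
    have cont: "continuous_on (path_image (rectpath a1 a3)) f"
      using holomorphic_on_imp_continuous_on[OF holf[OF subset_refl]] continuous_on_subset[OF _ imgS] by blast
    have eqs: "a2 = Complex (Re a3) (Im a1)" "a4 = Complex (Re a1) (Im a3)"
      by (simp_all add: a1_def a2_def a3_def a4_def)
    note split = contour_integral_rectpath_split[OF cont eqs]
    have sub: "closed_segment a1 a2 \<subseteq> path_image (rectpath a1 a3)" "closed_segment a2 a3 \<subseteq> path_image (rectpath a1 a3)"
      "closed_segment a3 a4 \<subseteq> path_image (rectpath a1 a3)" "closed_segment a4 a1 \<subseteq> path_image (rectpath a1 a3)"
      by (simp_all add: rectpath_def Let_def eqs path_image_join Un_upper1 le_supI2)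
    have len: "cmod (a2 - a1) = 2 * r" "cmod (a3 - a2) = 2 * r" "cmod (a4 - a3) = 2 * r" "cmod (a1 - a4) = 2 * r"
      using r by (auto simp: a1_def a2_def a3_def a4_def cmod_def real_sqrt_mult)
    have side: "cmod (contour_integral (linepath u v) f) \<le> B * cmod (v - u)"
      if "f contour_integrable_on linepath u v" "closed_segment u v \<subseteq> path_image (rectpath a1 a3)" for u v
      by (rule contour_integral_bound_linepath[OF that(1) B bound]) (use that(2) in \<open>rule subsetD\<close>)
    have "cmod (contour_integral (rectpath a1 a3) f) \<le> B * (2 * r) + B * (2 * r) + B * (2 * r) + B * (2 * r)"
      unfolding split(1)
      using side[OF split(2) sub(1)] side[OF split(3) sub(2)] side[OF split(4) sub(3)] side[OF split(5) sub(4)]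
      unfolding len by (intro order_trans[OF norm_triangle_ineq] add_mono)
    also have "\<dots> = B * (4 * (2 * real N + 1))" by (simp add: r_def algebra_simps)
    finally have "2 * pi * cmod (?S N) \<le> B * (4 * (2 * real N + 1))"
      unfolding int by (simp add: norm_mult)
    moreover have "cmod (?S N) \<le> 2 * pi * cmod (?S N)"
      using pi_gt3 by (intro mult_le_cancel_right1[THEN iffD2]) auto
    ultimately show ?thesis unfolding B_def by linarith
  qed
  have lim: "(\<lambda>N. 4 * C / (1 + real N ^ 2) * (4 * (2 * real N + 1))) \<longlonglongrightarrow> 0"
    by real_asymp
  obtain N0 where N0: "real N0 \<ge> M + 1" using real_arch_simple by blast
  have ev: "eventually (\<lambda>N. cmod (?S N) \<le> 4 * C / (1 + real N ^ 2) * (4 * (2 * real N + 1))) sequentially"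
    using eventually_ge_at_top[of N0]
  proof eventually_elim
    case (elim N)
    then show ?case by (intro main order_trans[OF N0]) simp
  qed
  show ?thesis by (rule Lim_null_comparison[OF ev lim])
qed

section \<open>Approximation on both sides of a gap\<close>

definition csinc :: "complex \<Rightarrow> complex" where
  "csinc z = (if z = 0 then 1 else sin z / z)"

lemma csinc_of_real: "csinc (of_real x) = of_real (Sinc x)"
  by (simp add: csinc_def Sinc_def sin_of_real)

lemma holomorphic_csinc: "csinc holomorphic_on UNIV"
proof (rule no_isolated_singularity[where K = "{0}"])
  show "csinc holomorphic_on UNIV - {0}"
  proof (rule holomorphic_transform)
    show "(\<lambda>z. sin z / z) holomorphic_on UNIV - {0}" by (intro holomorphic_intros) auto
  qed (auto simp: csinc_def)
  have 0: "csinc \<midarrow>0\<rightarrow> 1"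
  proof -
    have "(\<lambda>h. (sin (0 + h) - sin 0) / h) \<midarrow>0\<rightarrow> (1::complex)"
      using DERIV_sin[of "0::complex"] unfolding DERIV_def by simp
    then show ?thesis
      by (rule tendsto_cong[THEN iffD1, rotated]) (auto simp: csinc_def eventually_at intro!: exI[of _ 1])
  qed
  show "continuous_on UNIV csinc"
  proof (rule continuous_at_imp_continuous_on, rule ballI)
    fix z :: complex
    show "isCont csinc z"
    proof (cases "z = 0")
      case True
      then show ?thesis using 0 by (simp add: isCont_def csinc_def)
    next
      case False
      have "isCont (\<lambda>z. sin z / z) z" using False by (intro continuous_intros) auto
      moreover have "eventually (\<lambda>y. y \<in> - {0}) (nhds z)"
        using False by (intro eventually_nhds_in_open) auto
      then have "eventually (\<lambda>y. sin y / y = csinc y) (nhds z)"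
        by eventually_elim (auto simp: csinc_def)
      ultimately show ?thesis using isCont_cong[of "\<lambda>x. sin x / x" csinc z] by simp
    qed
  qed
qed auto

lemma norm_csinc_diff_1:
  assumes "cmod z \<le> 1/2"
  shows "cmod (csinc z - 1) \<le> (cmod z)\<^sup>2"
proof (cases "z = 0")
  case False
  have "(\<Sum>k\<le>2. complex_of_real (sin_coeff k) * z ^ k) = z"
    by (simp add: numeral_2_eq_2 sin_coeff_def)
  then have "cmod (sin z - z) \<le> exp \<bar>Im z\<bar> * cmod z ^ 3 / 2"
    using Taylor_sin[of z 2] by (simp add: numeral_3_eq_3 fact_numeral)
  also have "\<dots> \<le> 2 * cmod z ^ 3 / 2"
  proof -
    have "\<bar>Im z\<bar> \<le> 1/2" using abs_Im_le_cmod[of z] assms by linarith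
    then have "exp \<bar>Im z\<bar> \<le> exp (1/2)" by simp
    also have "\<dots> \<le> (2::real)" using exp_half_le2 .
    finally show ?thesis by (intro divide_right_mono mult_right_mono) auto
  qed
  finally have "cmod (sin z - z) \<le> cmod z * (cmod z)\<^sup>2" by (simp add: power3_eq_cube power2_eq_square)
  moreover have "csinc z - 1 = (sin z - z) / z" using False by (simp add: csinc_def diff_divide_distrib)
  ultimately show ?thesis using False by (simp add: norm_divide pos_divide_le_eq mult.commute)
qed (simp add: csinc_def)

lemma norm_csinc_ge:
  assumes "cmod z \<le> 1/2"
  shows "cmod (csinc z) \<ge> 3/4"
proof -
  have "(cmod z)\<^sup>2 \<le> (1/2)\<^sup>2" using assms by (intro power_mono) auto
  then have "cmod (csinc z - 1) \<le> 1/4" using norm_csinc_diff_1[OF assms] by (simp add: power2_eq_square)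
  then show ?thesis using norm_triangle_ineq3[of "csinc z" 1] by simp
qed

lemma Sinc_ge:
  assumes "\<bar>u\<bar> \<le> 1/2"
  shows "Sinc u \<ge> 1 - u\<^sup>2"
proof -
  have "cmod (of_real (Sinc u - 1)) \<le> u\<^sup>2"
    using norm_csinc_diff_1[of "of_real u"] assms by (simp add: csinc_of_real)
  then show ?thesis unfolding norm_of_real by linarith
qed

lemma fourier_space_mult_Sinc_power:
  assumes "a > 0" "F \<in> fourier_space a" "s > 0"
  shows "(\<lambda>x. of_real (Sinc (s * (x - c))) ^ n * F x) \<in> fourier_space (a + real n * s)"
proof (induction n)
  case (Suc n)
  have "a + real n * s > 0" using assms by (simp add: add_pos_nonneg)
  from fourier_space_mult_Sinc[OF this Suc assms(3)] show ?case
    by (simp add: algebra_simps)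
qed (use assms in simp)

lemma fourier_space_mult_poly:
  assumes "a > 0" "F \<in> fourier_space a"
  shows "(\<lambda>x. (\<Sum>n\<le>N. c n * of_real x ^ n) * F x) \<in> fourier_space a"
proof -
  have "(\<lambda>x. \<Sum>n\<in>{..N}. c n * (of_real x ^ n * F x)) \<in> fourier_space a"
    by (intro fourier_space_sum fourier_space_cmult fourier_space_mult_monom assms)
  then show ?thesis by (simp add: sum_distrib_right mult.assoc)
qed

text \<open>Cardinal sines times polynomials decay too slowly to be transforms of smooth functions; the
  transform of a narrow bump supplies the missing decay and hardly changes them on bounded sets.\<close>

lemma fourier_space_cutoff:
  assumes "\<sigma> > 0"
  obtains E where "E \<in> fourier_space \<sigma>" "\<And>x. cmod (E x) \<le> 1" "\<And>x. cmod (E x - 1) \<le> \<sigma> * \<bar>x\<bar>"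
proof -
  obtain g :: "real \<Rightarrow> real" where g: "(\<lambda>x. complex_of_real (g x)) \<in> test_functions \<sigma>" "\<And>x. g x \<ge> 0"
    "(\<integral>x. g x \<partial>lborel) = 1"
    using bump_exists[OF assms] by blast
  obtain c where c: "smooth (\<lambda>x. complex_of_real (g x))" "0 \<le> c" "c < \<sigma>" "\<And>x. \<bar>x\<bar> > c \<Longrightarrow> complex_of_real (g x) = 0"
    using test_functionE[OF g(1) assms] by blast
  have intg: "integrable lborel g"
    using g(3) not_integrable_integral_eq[of lborel g] by fastforce
  have inte: "integrable lborel (\<lambda>x. complex_of_real (g x) * exp (- (\<i> * z * of_real x)))" for z
    by (rule cfourier_integrable[OF g(1) assms])
  define E where "E = (\<lambda>l. cfourier (\<lambda>x. complex_of_real (g x)) (of_real l))"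
  show ?thesis
  proof
    show "E \<in> fourier_space \<sigma>"
      by (rule fourier_spaceI[OF g(1)]) (simp add: E_def)
    fix l
    have n1: "cmod (exp (- (\<i> * of_real l * of_real x))) = 1" for x :: real
      by (simp add: norm_exp_eq_Re)
    have "cmod (E l) \<le> (\<integral>x. cmod (complex_of_real (g x) * exp (- (\<i> * of_real l * of_real x))) \<partial>lborel)"
      unfolding E_def cfourier_def by (rule integral_norm_bound)
    also have "\<dots> = (\<integral>x. g x \<partial>lborel)"
      using g(2) by (intro Bochner_Integration.integral_cong) (simp_all add: norm_mult n1)
    finally show "cmod (E l) \<le> 1" using g(3) by simp
    have "E l - 1 = (\<integral>x. complex_of_real (g x) * exp (- (\<i> * of_real l * of_real x)) \<partial>lborel) - (\<integral>x. complex_of_real (g x) \<partial>lborel)"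
      using g(3) by (simp add: E_def cfourier_def)
    also have "\<dots> = (\<integral>x. complex_of_real (g x) * exp (- (\<i> * of_real l * of_real x)) - complex_of_real (g x) \<partial>lborel)"
      using inte[of "of_real l"] inte[of 0] by (subst Bochner_Integration.integral_diff) auto
    finally have eq: "E l - 1 = (\<integral>x. complex_of_real (g x) * exp (- (\<i> * of_real l * of_real x)) - complex_of_real (g x) \<partial>lborel)" .
    have "cmod (E l - 1) \<le> (\<integral>x. cmod (complex_of_real (g x) * exp (- (\<i> * of_real l * of_real x)) - complex_of_real (g x)) \<partial>lborel)"
      unfolding eq by (rule integral_norm_bound)
    also have "\<dots> \<le> (\<integral>x. g x * (\<sigma> * \<bar>l\<bar>) \<partial>lborel)"
    proof (rule integral_mono)
      show "integrable lborel (\<lambda>x. cmod (complex_of_real (g x) * exp (- (\<i> * of_real l * of_real x)) - complex_of_real (g x)))"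
        using inte[of "of_real l"] inte[of 0] by (intro integrable_norm Bochner_Integration.integrable_diff) auto
      show "integrable lborel (\<lambda>x. g x * (\<sigma> * \<bar>l\<bar>))"
        using intg by auto
      fix x
      show "cmod (complex_of_real (g x) * exp (- (\<i> * of_real l * of_real x)) - complex_of_real (g x)) \<le> g x * (\<sigma> * \<bar>l\<bar>)"
      proof (cases "\<bar>x\<bar> > c")
        case True
        then show ?thesis using c(4)[of x] by simp
      next
        case False
        have "cmod (exp (- (\<i> * of_real l * of_real x)) - 1) \<le> \<bar>- (l * x)\<bar>"
          using iexp_approx1[of "- (l * x)" 0] by (simp add: mult.assoc)
        also have "\<dots> = \<bar>l\<bar> * \<bar>x\<bar>" by (simp add: abs_mult)
        also have "\<dots> \<le> \<bar>l\<bar> * \<sigma>" using False c(3) by (intro mult_left_mono) auto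
        finally have "g x * cmod (exp (- (\<i> * of_real l * of_real x)) - 1) \<le> g x * (\<sigma> * \<bar>l\<bar>)"
          using g(2) by (intro mult_left_mono) (auto simp: mult.commute)
        moreover have "cmod (complex_of_real (g x) * exp (- (\<i> * of_real l * of_real x)) - complex_of_real (g x))
            = cmod (complex_of_real (g x) * (exp (- (\<i> * of_real l * of_real x)) - 1))"
          by (simp add: right_diff_distrib)
        ultimately show ?thesis using g(2) by (simp add: norm_mult)
      qed
    qed
    also have "\<dots> = \<sigma> * \<bar>l\<bar>" using g(3) by simp
    finally show "cmod (E l - 1) \<le> \<sigma> * \<bar>l\<bar>" .
  qed
qed

text \<open>The coefficients of the Taylor polynomial \<open>P\<close> of \<open>f\<close> divided by a power of a cardinal sine are controlled
  by Cauchy's inequality on the circle of radius \<open>R\<close>. Inside the circle \<open>P\<close> times that power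
  reproduces \<open>f\<close>; outside, the power of degree \<open>2 * N\<close> beats the polynomial of degree \<open>N\<close>.\<close>

lemma Sinc_power_Taylor:
  fixes f :: "complex \<Rightarrow> complex"
  assumes f: "f holomorphic_on UNIV" and A: "\<And>z. cmod z \<le> R \<Longrightarrow> cmod (f z) * 2 ^ N \<le> A"
    and R: "R > 0"
  obtains c where
    "\<And>t. \<bar>t\<bar> \<le> R / 2 \<Longrightarrow> cmod (f (of_real t) - of_real (Sinc (t / (2 * R))) ^ (2 * N) * (\<Sum>n\<le>N. c n * of_real t ^ n))
        \<le> 2 * A * (\<bar>t\<bar> / R) ^ Suc N"
    "\<And>t. \<bar>t\<bar> \<ge> 2 * R \<Longrightarrow> cmod (of_real (Sinc (t / (2 * R))) ^ (2 * N) * (\<Sum>n\<le>N. c n * of_real t ^ n))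
        \<le> 2 * A * (4 * R / \<bar>t\<bar>) ^ N"
proof -
  define S where "S = (\<lambda>z. csinc (z / of_real (2 * R)) ^ (2 * N))"
  define g where "g = (\<lambda>z. f z / S z)"
  define c where "c = (\<lambda>n. (deriv ^^ n) g 0 / fact n)"
  have A0: "A \<ge> 0" using A[of 0] R by (simp add: order_trans[rotated])
  have Sge: "cmod (S z) * 2 ^ N \<ge> 1" if "cmod z \<le> R" for z
  proof -
    have "cmod (z / of_real (2 * R)) \<le> 1/2"
      using that R by (simp add: norm_divide norm_mult field_simps)
    then have "3/4 \<le> cmod (csinc (z / of_real (2 * R)))" by (rule norm_csinc_ge)
    then have "(3/4) ^ (2 * N) \<le> cmod (S z)"
      unfolding S_def norm_power by (rule power_mono) simp
    then have "(3/4) ^ (2 * N) * 2 ^ N \<le> cmod (S z) * 2 ^ N" by (rule mult_right_mono) simp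
    moreover have "(3/4) ^ (2 * N) * 2 ^ N = (9/8 :: real) ^ N"
      unfolding power_mult power_mult_distrib[symmetric] by (simp add: power2_eq_square)
    moreover have "1 \<le> (9/8 :: real) ^ N" by (rule one_le_power) simp
    ultimately show ?thesis by linarith
  qed
  have Sn0: "S z \<noteq> 0" if "cmod z \<le> R" for z
    using Sge[OF that] by auto
  have holS: "S holomorphic_on X" for X
    unfolding S_def
    by (intro holomorphic_intros holomorphic_on_compose_gen[OF _ holomorphic_csinc, unfolded o_def]) (use R in auto)
  have holg: "g holomorphic_on cball 0 R"
    unfolding g_def by (intro holomorphic_intros holS holomorphic_on_subset[OF f]) (use Sn0 in auto)
  have gA: "cmod (g z) \<le> A" if "cmod z \<le> R" for z
  proof -
    have "cmod (f z) \<le> cmod (f z) * (cmod (S z) * 2 ^ N)"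
      using Sge[OF that] by (intro mult_le_cancel_left1[THEN iffD2]) auto
    also have "\<dots> \<le> A * cmod (S z)"
      using mult_right_mono[OF A[OF that], of "cmod (S z)"] by (simp add: mult_ac)
    finally show ?thesis
      using Sn0[OF that] by (simp add: g_def norm_divide pos_divide_le_eq)
  qed
  have cb: "cmod (c n) \<le> A / R ^ n" for n
  proof -
    have "cmod ((deriv ^^ n) g 0) \<le> fact n * A / R ^ n"
      by (rule Cauchy_inequality[OF holomorphic_on_subset[OF holg ball_subset_cball]
            holomorphic_on_imp_continuous_on[OF holg] R]) (use gA in auto)
    then show ?thesis by (simp add: c_def norm_divide field_simps)
  qed
  have ct: "cmod (c n * of_real t ^ n) \<le> A * (\<bar>t\<bar> / R) ^ n" for n t
    using mult_right_mono[OF cb[of n], of "\<bar>t\<bar> ^ n"] by (simp add: norm_mult norm_power power_divide)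
  have SincS: "of_real (Sinc (t / (2 * R))) ^ (2 * N) = S (of_real t)" for t
    by (simp add: S_def csinc_of_real[symmetric])
  show ?thesis
  proof (rule that[of c])
    fix t :: real assume t: "\<bar>t\<bar> \<le> R / 2"
    define q where "q = \<bar>t\<bar> / R"
    have q: "0 \<le> q" "q \<le> 1/2" using t R by (auto simp: q_def field_simps)
    have "(\<lambda>n. c n * of_real t ^ n) sums g (of_real t)"
      using holomorphic_power_series[OF holomorphic_on_subset[OF holg ball_subset_cball], of "of_real t"] t R
      by (simp add: c_def)
    then have "(\<lambda>n. c (n + Suc N) * of_real t ^ (n + Suc N)) sums (g (of_real t) - (\<Sum>n<Suc N. c n * of_real t ^ n))"
      by (subst sums_iff_shift) simp
    then have s: "(\<lambda>n. c (n + Suc N) * of_real t ^ (n + Suc N)) sums (g (of_real t) - (\<Sum>n\<le>N. c n * of_real t ^ n))"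
      by (simp only: lessThan_Suc_atMost)
    have "(\<lambda>n. A * q ^ Suc N * q ^ n) sums (A * q ^ Suc N * (1 / (1 - q)))"
      by (intro sums_mult geometric_sums) (use q in auto)
    then have "cmod (g (of_real t) - (\<Sum>n\<le>N. c n * of_real t ^ n)) \<le> A * q ^ Suc N * (1 / (1 - q))"
    proof -
      assume geo: "(\<lambda>n. A * q ^ Suc N * q ^ n) sums (A * q ^ Suc N * (1 / (1 - q)))"
      have le: "cmod (c (n + Suc N) * of_real t ^ (n + Suc N)) \<le> A * q ^ Suc N * q ^ n" for n
        using ct[of "n + Suc N" t] by (simp add: q_def power_add mult_ac)
      show ?thesis
        using norm_suminf_le[OF le sums_summable[OF geo]] s geo by (simp add: sums_iff)
    qed
    also have "\<dots> \<le> A * q ^ Suc N * 2"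
      using q A0 by (intro mult_left_mono) (auto simp: field_simps)
    finally have g: "cmod (g (of_real t) - (\<Sum>n\<le>N. c n * of_real t ^ n)) \<le> 2 * A * q ^ Suc N" by (simp add: mult_ac)
    have tR: "cmod (of_real t) \<le> R" using t R by simp
    have "f (of_real t) - S (of_real t) * (\<Sum>n\<le>N. c n * of_real t ^ n)
        = S (of_real t) * (g (of_real t) - (\<Sum>n\<le>N. c n * of_real t ^ n))"
      using Sn0[OF tR] by (simp add: g_def field_simps)
    moreover have "cmod (S (of_real t)) \<le> 1"
      unfolding SincS[symmetric] norm_power by (rule power_le_one) (use abs_Sinc_le_1 in auto)
    ultimately have "cmod (f (of_real t) - S (of_real t) * (\<Sum>n\<le>N. c n * of_real t ^ n))
        \<le> 1 * cmod (g (of_real t) - (\<Sum>n\<le>N. c n * of_real t ^ n))"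
      by (simp only: norm_mult) (rule mult_right_mono, auto)
    with g show "cmod (f (of_real t) - of_real (Sinc (t / (2 * R))) ^ (2 * N) * (\<Sum>n\<le>N. c n * of_real t ^ n))
        \<le> 2 * A * (\<bar>t\<bar> / R) ^ Suc N"
      unfolding SincS q_def by linarith
  next
    fix t :: real assume t: "\<bar>t\<bar> \<ge> 2 * R"
    define q where "q = \<bar>t\<bar> / R"
    have q: "q \<ge> 2" using t R by (simp add: q_def field_simps)
    have "cmod (\<Sum>n\<le>N. c n * of_real t ^ n) \<le> (\<Sum>n\<le>N. A * q ^ n)"
      by (rule order_trans[OF norm_sum sum_mono]) (use ct in \<open>auto simp: q_def\<close>)
    also have "\<dots> \<le> A * (2 * q ^ N)"
    proof -
      have "(\<Sum>n\<le>M. q ^ n) \<le> 2 * q ^ M" for M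
      proof (induction M)
        case (Suc M)
        have "2 * q ^ M \<le> q * q ^ M" using q by (intro mult_right_mono) auto
        then show ?case using Suc by simp
      qed simp
      then show ?thesis unfolding sum_distrib_left[symmetric] using A0 by (intro mult_left_mono)
    qed
    finally have P: "cmod (\<Sum>n\<le>N. c n * of_real t ^ n) \<le> 2 * A * q ^ N" by (simp add: mult_ac)
    have "\<bar>Sinc (t / (2 * R))\<bar> \<le> 1 / \<bar>t / (2 * R)\<bar>"
      using t R by (intro abs_Sinc_le_inverse) auto
    also have "\<dots> = 2 / q" using R by (simp add: q_def field_simps)
    finally have "\<bar>Sinc (t / (2 * R))\<bar> ^ (2 * N) \<le> (2 / q) ^ (2 * N)" by (rule power_mono) simp
    with P have "cmod (\<Sum>n\<le>N. c n * of_real t ^ n) * \<bar>Sinc (t / (2 * R))\<bar> ^ (2 * N) \<le> (2 * A * q ^ N) * (2 / q) ^ (2 * N)"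
      by (rule mult_mono) (use A0 q in auto)
    also have "\<dots> = 2 * A * (4 / q) ^ N"
    proof -
      have "q * (2 / q)\<^sup>2 = 4 / q" using q by (simp add: power2_eq_square)
      then have "q ^ N * (2 / q) ^ (2 * N) = (4 / q) ^ N"
        by (simp only: power_mult power_mult_distrib[symmetric])
      then show ?thesis by simp
    qed
    also have "4 / q = 4 * R / \<bar>t\<bar>" by (simp add: q_def)
    finally show "cmod (of_real (Sinc (t / (2 * R))) ^ (2 * N) * (\<Sum>n\<le>N. c n * of_real t ^ n)) \<le> 2 * A * (4 * R / \<bar>t\<bar>) ^ N"
      by (simp add: norm_mult norm_power mult.commute)
  qed
qed

text \<open>A function of arbitrarily large exponential type is approximated by elements of arbitrarily small
  type \<open>\<eta>\<close>, provided that nothing is asked on \<open>B < \<bar>t\<bar> < q * B\<close>. The point is that the ratio \<open>q\<close>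
  depends on the two types only, neither on \<open>B\<close> nor on the precision.\<close>

lemma gap_approximation:
  fixes f :: "complex \<Rightarrow> complex"
  assumes f: "f holomorphic_on UNIV" "\<And>z. cmod (f z) \<le> C * exp (l * cmod z)" "l \<ge> 0" and eta: "\<eta> > 0"
  obtains Q where "Q \<ge> 1"
    "\<And>\<delta>. \<delta> > 0 \<Longrightarrow> \<exists>B0. \<forall>B\<ge>B0. \<exists>F\<in>fourier_space \<eta>.
        (\<forall>t. \<bar>t\<bar> \<le> B \<longrightarrow> cmod (F t - f (of_real t)) \<le> \<delta> / (1 + t^2)) \<and>
        (\<forall>t. \<bar>t\<bar> \<ge> Q * B \<longrightarrow> cmod (F t) \<le> \<delta> / (1 + t^2))"
proof -
  have C: "C \<ge> 0" using order_trans[OF norm_ge_zero f(2)[of 0]] by simp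
  \<comment> \<open>With Taylor degree \<open>N \<approx> \<eta> * R / 2\<close> the choice of \<open>q\<close> makes \<open>(2 / q) ^ N\<close> at most a constant
    times \<open>exp (- (l + 1) * R)\<close>, which beats the growth \<open>exp (l * R)\<close> of \<open>f\<close> on the circle of radius \<open>R\<close>.\<close>
  define \<kappa> where "\<kappa> = 2 * (l + 1) / \<eta>"
  have \<kappa>: "\<kappa> > 0" using f(3) eta by (simp add: \<kappa>_def)
  define q where "q = 4 * exp \<kappa>"
  have q: "q \<ge> 4" using \<kappa> by (simp add: q_def)
  define K where "K = 32 * q^2 * C * exp \<kappa>"
  show ?thesis
  \<comment> \<open>One factor \<open>q\<close> separates \<open>B\<close> from the radius \<open>R\<close> of Cauchy's inequality, two more separate \<open>R\<close> from
    the outer region.\<close>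
  proof (rule that[of "q ^ 3"])
    show "q ^ 3 \<ge> 1" using q by (intro one_le_power) simp
    fix \<delta> :: real assume \<delta>: "\<delta> > 0"
    have "((\<lambda>R. K * exp (- R) * (1 + R^2)) \<longlongrightarrow> 0) at_top" by real_asymp
    then have "eventually (\<lambda>R. K * exp (- R) * (1 + R^2) < \<delta> / 2) at_top"
      by (rule order_tendstoD) (use \<delta> in simp)
    then obtain R0 where R0: "\<And>R. R \<ge> R0 \<Longrightarrow> K * exp (- R) * (1 + R^2) < \<delta> / 2"
      by (auto simp: eventually_at_top_linorder)
    show "\<exists>B0. \<forall>B\<ge>B0. \<exists>F\<in>fourier_space \<eta>.
        (\<forall>t. \<bar>t\<bar> \<le> B \<longrightarrow> cmod (F t - f (of_real t)) \<le> \<delta> / (1 + t^2)) \<and>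
        (\<forall>t. \<bar>t\<bar> \<ge> q ^ 3 * B \<longrightarrow> cmod (F t) \<le> \<delta> / (1 + t^2))"
    proof (intro exI[of _ "max (max R0 1) (6 / \<eta>)"] allI impI)
      fix B assume "B \<ge> max (max R0 1) (6 / \<eta>)"
      then have B: "B \<ge> R0" "B \<ge> 1" "B \<ge> 6 / \<eta>" by auto
      define R where "R = q * B"
      have "1 * B \<le> R" unfolding R_def using q B by (intro mult_right_mono) auto
      then have RB: "R \<ge> B" by simp
      then have R: "R > 0" "R \<ge> R0" "R \<ge> 1" using B by auto
      have "6 \<le> \<eta> * B" using B(3) eta by (simp add: pos_divide_le_eq mult.commute)
      also have "\<dots> \<le> \<eta> * R" using RB eta by (intro mult_left_mono) auto
      finally have "6 \<le> \<eta> * R" .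
      define N where "N = nat \<lfloor>\<eta> * R / 2\<rfloor>"
      have N: "real N \<le> \<eta> * R / 2" "real N \<ge> \<eta> * R / 2 - 1"
        using \<open>6 \<le> \<eta> * R\<close> unfolding N_def by linarith+
      \<comment> \<open>Two of the \<open>N\<close> factors in the outer region are spent on quadratic decay.\<close>
      have N2: "N \<ge> 2" using N(2) \<open>6 \<le> \<eta> * R\<close> by linarith
      define A where "A = C * exp (l * R) * 2 ^ N"
      have A: "cmod (f z) * 2 ^ N \<le> A" if "cmod z \<le> R" for z
      proof -
        have "cmod (f z) \<le> C * exp (l * cmod z)" by (rule f)
        also have "\<dots> \<le> C * exp (l * R)" using that C f(3) by (intro mult_left_mono) (auto intro: mult_left_mono)
        finally show ?thesis unfolding A_def by (rule mult_right_mono) simp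
      qed
      have A0: "A \<ge> 0" using C by (simp add: A_def)
      obtain c where c:
        "\<And>t. \<bar>t\<bar> \<le> R / 2 \<Longrightarrow> cmod (f (of_real t) - of_real (Sinc (t / (2 * R))) ^ (2 * N) * (\<Sum>n\<le>N. c n * of_real t ^ n))
          \<le> 2 * A * (\<bar>t\<bar> / R) ^ Suc N"
        "\<And>t. \<bar>t\<bar> \<ge> 2 * R \<Longrightarrow> cmod (of_real (Sinc (t / (2 * R))) ^ (2 * N) * (\<Sum>n\<le>N. c n * of_real t ^ n))
          \<le> 2 * A * (4 * R / \<bar>t\<bar>) ^ N"
        using Sinc_power_Taylor[OF f(1) A R(1)] by blast
      define F0 where "F0 = (\<lambda>t. of_real (Sinc (t / (2 * R))) ^ (2 * N) * (\<Sum>n\<le>N. c n * complex_of_real t ^ n))"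
      define D where "D = A / q ^ N"
      have "D \<le> C * exp \<kappa> * exp (- R)"
      proof -
        have "2 / q \<le> exp (- \<kappa>)" by (simp add: q_def exp_minus field_simps)
        then have "(2 / q) ^ N \<le> exp (- \<kappa>) ^ N" by (rule power_mono) (use q in simp)
        also have "\<dots> = exp (- \<kappa> * real N)" by (simp add: exp_of_nat_mult[symmetric] mult.commute)
        also have "\<dots> \<le> exp (- \<kappa> * (\<eta> * R / 2 - 1))"
          using N(2) \<kappa> by simp
        also have "- \<kappa> * (\<eta> * R / 2 - 1) = \<kappa> - (l + 1) * R"
          using eta by (simp add: \<kappa>_def field_simps)
        finally have "(2 / q) ^ N \<le> exp (\<kappa> - (l + 1) * R)" .
        then have "C * exp (l * R) * (2 / q) ^ N \<le> C * exp (l * R) * exp (\<kappa> - (l + 1) * R)"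
          using C by (intro mult_left_mono) auto
        also have "\<dots> = C * exp \<kappa> * exp (- R)"
          by (simp add: exp_add[symmetric] exp_diff exp_minus field_simps)
        finally show ?thesis by (simp add: D_def A_def power_divide)
      qed
      define M where "M = 32 * q^2 * D"
      have D0: "D \<ge> 0" using A0 q by (simp add: D_def)
      have "M \<le> 32 * q^2 * (C * exp \<kappa> * exp (- R))"
        unfolding M_def by (intro mult_left_mono) (use \<open>D \<le> _\<close> in auto)
      then have "M * (1 + R^2) \<le> K * exp (- R) * (1 + R^2)"
        unfolding K_def by (intro mult_right_mono) (auto simp: mult_ac)
      then have M: "M * (1 + R^2) \<le> \<delta> / 2" using R0[OF R(2)] by linarith
      have M0: "M \<ge> 0" using D0 by (simp add: M_def)
      have pos: "1 + t^2 > 0" for t :: real by (simp add: add_pos_nonneg)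
      have near: "cmod (F0 t - f (of_real t)) \<le> \<delta> / 2 / (1 + t^2)" if t: "\<bar>t\<bar> \<le> B" for t
      proof -
        have tq: "\<bar>t\<bar> / R \<le> 1 / q" using t q B R by (simp add: R_def field_simps)
        have "B \<le> R / 2" unfolding R_def using q B by simp
        then have "cmod (f (of_real t) - F0 t) \<le> 2 * A * (\<bar>t\<bar> / R) ^ Suc N"
          unfolding F0_def using t by (intro c(1)) linarith
        also have "\<dots> \<le> 2 * A * (1 / q) ^ Suc N"
          using A0 R by (intro mult_left_mono power_mono tq) auto
        also have "\<dots> \<le> 2 * A * (1 / q) ^ N"
          using A0 q by (intro mult_left_mono power_decreasing) auto
        also have "\<dots> = 2 * D" by (simp add: D_def power_divide)
        also have "\<dots> \<le> M"
        proof -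
          have "1 \<le> q^2" using q by (intro one_le_power) simp
          then have "2 * D \<le> 32 * q^2 * D" using D0 by (intro mult_right_mono) auto
          then show ?thesis by (simp add: M_def)
        qed
        also have "M \<le> M * (1 + R^2) / (1 + t^2)"
        proof -
          have "t^2 \<le> R^2" using t RB by (intro abs_le_square_iff[THEN iffD1]) auto
          then have "M * (1 + t^2) \<le> M * (1 + R^2)" using M0 by (intro mult_left_mono) auto
          then show ?thesis using pos[of t] by (simp add: pos_le_divide_eq)
        qed
        also have "\<dots> \<le> \<delta> / 2 / (1 + t^2)" using M pos[of t] by (intro divide_right_mono) auto
        finally show ?thesis by (simp add: norm_minus_commute)
      qed
      have far: "cmod (F0 t) \<le> \<delta> / 2 / (1 + t^2)" if t: "\<bar>t\<bar> \<ge> q ^ 3 * B" for t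
      proof -
        have t2: "\<bar>t\<bar> \<ge> q^2 * R" using t by (simp add: R_def power2_eq_square power3_eq_cube mult_ac)
        have q2: "4 * q \<le> q^2" using q by (simp add: power2_eq_square)
        have "1 * R \<le> q^2 * R" "2 * R \<le> q^2 * R" using q2 q R by (intro mult_right_mono; linarith)+
        then have tR: "\<bar>t\<bar> \<ge> R" "\<bar>t\<bar> \<ge> 2 * R" "\<bar>t\<bar> > 0" using t2 R by linarith+
        have "4 * R * q \<le> q^2 * R" using mult_right_mono[OF q2, of R] R by (simp add: mult_ac)
        then have "4 * R * q \<le> \<bar>t\<bar>" using t2 by linarith
        then have le: "4 * R / \<bar>t\<bar> \<le> 1 / q" using tR q by (simp add: field_simps)
        obtain n where n: "N = n + 2" using N2 le_Suc_ex by (metis add.commute)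
        have "cmod (F0 t) \<le> 2 * A * (4 * R / \<bar>t\<bar>) ^ N"
          unfolding F0_def by (intro c(2) tR)
        also have "\<dots> = 2 * A * ((4 * R / \<bar>t\<bar>) ^ n * (4 * R / \<bar>t\<bar>) ^ 2)" unfolding n power_add ..
        also have "\<dots> \<le> 2 * A * ((1 / q) ^ n * (4 * R / \<bar>t\<bar>) ^ 2)"
          using A0 R by (intro mult_left_mono mult_right_mono power_mono le) auto
        also have "\<dots> = M * (R^2 / t^2)"
        proof -
          have "(4 * R / \<bar>t\<bar>) ^ 2 = 16 * (R^2 / t^2)"
            by (simp add: power_divide power_mult_distrib)
          moreover have "(1 / q) ^ n = q^2 / q ^ N"
            using q by (simp add: n power_add power_divide power2_eq_square)
          ultimately show ?thesis by (simp add: M_def D_def)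
        qed
        also have "\<dots> \<le> M * ((1 + R^2) / (1 + t^2))"
        proof (rule mult_left_mono[OF _ M0])
          have "R^2 \<le> t^2" using tR R by (intro abs_le_square_iff[THEN iffD1]) auto
          moreover have "t^2 > 0" using tR by simp
          ultimately show "R^2 / t^2 \<le> (1 + R^2) / (1 + t^2)"
            using pos[of t] by (simp add: frac_le_eq field_simps divide_le_0_iff)
        qed
        also have "\<dots> \<le> \<delta> / 2 / (1 + t^2)"
          using M pos[of t] divide_right_mono[of "M * (1 + R^2)" "\<delta> / 2" "1 + t^2"] by simp
        finally show ?thesis .
      qed
      define Z where "Z = C * exp (l * B) + \<delta>"
      have Z0: "Z > 0" using C \<delta> by (simp add: Z_def add_nonneg_pos)
      have Z: "cmod (F0 t) \<le> Z" if t: "\<bar>t\<bar> \<le> B" for t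
      proof -
        have "cmod (F0 t - f (of_real t)) \<le> \<delta> / 2 / (1 + t^2)" by (rule near[OF t])
        also have "\<dots> \<le> \<delta> / 2 / 1" using \<delta> pos[of t] by (intro divide_left_mono) auto
        finally have "cmod (F0 t - f (of_real t)) \<le> \<delta>" using \<delta> by simp
        moreover have "cmod (f (of_real t)) \<le> C * exp (l * B)"
        proof (rule order_trans[OF f(2)])
          show "C * exp (l * cmod (complex_of_real t)) \<le> C * exp (l * B)"
            using C t f(3) by (intro mult_left_mono) (auto intro!: mult_left_mono)
        qed
        ultimately show ?thesis
          using norm_triangle_ineq[of "F0 t - f (of_real t)" "f (of_real t)"] by (simp add: Z_def)
      qed
      define \<sigma> where "\<sigma> = min (\<eta> / 2) (\<delta> / (2 * Z * B * (1 + B^2)))"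
      have den: "2 * Z * B * (1 + B^2) > 0" using Z0 B pos[of B] by simp
      have \<sigma>: "\<sigma> > 0" using eta \<delta> den by (simp add: \<sigma>_def)
      obtain E where E: "E \<in> fourier_space \<sigma>" "\<And>x. cmod (E x) \<le> 1" "\<And>x. cmod (E x - 1) \<le> \<sigma> * \<bar>x\<bar>"
        using fourier_space_cutoff[OF \<sigma>] by blast
      define F where "F = (\<lambda>t. F0 t * E t)"
      have "F \<in> fourier_space \<eta>"
      proof -
        have "(\<lambda>x. (\<Sum>n\<le>N. c n * of_real x ^ n) * E x) \<in> fourier_space \<sigma>"
          by (rule fourier_space_mult_poly[OF \<sigma> E(1)])
        from fourier_space_mult_Sinc_power[OF \<sigma> this, of "1 / (2 * R)" 0 "2 * N"]
        have "F \<in> fourier_space (\<sigma> + real (2 * N) * (1 / (2 * R)))"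
          using R by (simp add: F_def F0_def mult.assoc)
        moreover have "\<sigma> + real (2 * N) * (1 / (2 * R)) \<le> \<eta>"
        proof -
          have "real (2 * N) * (1 / (2 * R)) \<le> \<eta> / 2" using N(1) R by (simp add: field_simps)
          moreover have "\<sigma> \<le> \<eta> / 2" unfolding \<sigma>_def by (rule min.cobounded1)
          ultimately show ?thesis by linarith
        qed
        ultimately show ?thesis using fourier_space_mono by blast
      qed
      moreover have "cmod (F t - f (of_real t)) \<le> \<delta> / (1 + t^2)" if t: "\<bar>t\<bar> \<le> B" for t
      proof -
        have "cmod (F0 t * (E t - 1)) \<le> Z * (\<sigma> * B)"
          unfolding norm_mult using Z[OF t] E(3)[of t] t \<sigma> Z0
          by (intro mult_mono order_trans[OF E(3)] mult_left_mono) auto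
        also have "\<dots> \<le> Z * (\<delta> / (2 * Z * B * (1 + B^2)) * B)"
          using Z0 B by (intro mult_left_mono mult_right_mono) (auto simp: \<sigma>_def)
        also have "\<dots> = \<delta> / 2 / (1 + B^2)" using Z0 B by simp
        also have "\<dots> \<le> \<delta> / 2 / (1 + t^2)"
        proof -
          have "t^2 \<le> B^2" using t by (intro abs_le_square_iff[THEN iffD1]) auto
          then show ?thesis using \<delta> pos[of t] pos[of B] by (intro divide_left_mono) auto
        qed
        finally have "cmod (F0 t * (E t - 1)) \<le> \<delta> / 2 / (1 + t^2)" .
        moreover have "F t - f (of_real t) = F0 t * (E t - 1) + (F0 t - f (of_real t))"
          by (simp add: F_def algebra_simps)
        ultimately have "cmod (F t - f (of_real t)) \<le> \<delta> / 2 / (1 + t^2) + \<delta> / 2 / (1 + t^2)"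
          using near[OF t] by (simp only:) (rule norm_triangle_le, linarith)
        also have "\<delta> / 2 / (1 + t^2) + \<delta> / 2 / (1 + t^2) = \<delta> / (1 + t^2)"
          unfolding add_divide_distrib[symmetric] by simp
        finally show ?thesis .
      qed
      moreover have "cmod (F t) \<le> \<delta> / (1 + t^2)" if t: "\<bar>t\<bar> \<ge> q ^ 3 * B" for t
      proof -
        have "cmod (F t) \<le> cmod (F0 t) * 1" unfolding F_def norm_mult using E(2) by (intro mult_left_mono) auto
        also have "\<dots> \<le> \<delta> / 2 / (1 + t^2)" using far[OF t] by simp
        also have "\<dots> \<le> \<delta> / (1 + t^2)" using \<delta> pos[of t] by (intro divide_right_mono) auto
        finally show ?thesis .
      qed
      ultimately show "\<exists>F\<in>fourier_space \<eta>.
        (\<forall>t. \<bar>t\<bar> \<le> B \<longrightarrow> cmod (F t - f (of_real t)) \<le> \<delta> / (1 + t^2)) \<and>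
        (\<forall>t. \<bar>t\<bar> \<ge> q ^ 3 * B \<longrightarrow> cmod (F t) \<le> \<delta> / (1 + t^2))"
        by (intro bexI[of _ F]) auto
    qed
  qed
qed

section \<open>Density in weighted square-integrable spaces\<close>

lemma measure_type_le:
  assumes "a > 0" "dense_in_L2 M (fourier_space a)"
  shows "measure_type M \<le> ereal a"
  unfolding measure_type_def using assms by (intro Inf_lower) auto

lemma measure_type_ge:
  assumes "\<And>a. 0 < a \<Longrightarrow> ereal a < t \<Longrightarrow> \<not> dense_in_L2 M (fourier_space a)"
  shows "t \<le> measure_type M"
  unfolding measure_type_def
proof (rule Inf_greatest)
  fix u assume "u \<in> {ereal a |a. 0 < a \<and> dense_in_L2 M (fourier_space a)}"
  then show "t \<le> u" using assms not_le by blast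
qed

lemma L2_D: "g \<in> L2 M \<Longrightarrow> g \<in> borel_measurable M" "g \<in> L2 M \<Longrightarrow> integrable M (\<lambda>x. (cmod (g x))\<^sup>2)"
  by (auto simp: L2_def)

lemma norm_add_squared_le:
  fixes a b :: complex
  shows "(cmod (a + b))\<^sup>2 \<le> 2 * (cmod a)\<^sup>2 + 2 * (cmod b)\<^sup>2"
proof -
  have "(cmod (a + b))\<^sup>2 \<le> (cmod a + cmod b)\<^sup>2"
    by (intro power_mono norm_triangle_ineq) simp
  also have "\<dots> \<le> 2 * (cmod a)\<^sup>2 + 2 * (cmod b)\<^sup>2"
    using sum_squares_bound[of "cmod a" "cmod b"] by (simp add: power2_sum)
  finally show ?thesis .
qed

lemma L2_bound:
  assumes "g \<in> borel_measurable M" "integrable M w" "AE x in M. (cmod (g x))\<^sup>2 \<le> w x"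
  shows "g \<in> L2 M"
proof -
  have "integrable M (\<lambda>x. (cmod (g x))\<^sup>2)"
  proof (rule Bochner_Integration.integrable_bound[OF assms(2)])
    show "AE x in M. norm ((cmod (g x))\<^sup>2) \<le> norm (w x)"
      using assms(3) by eventually_elim simp
  qed (use assms(1) in measurable)
  with assms(1) show ?thesis by (simp add: L2_def)
qed

lemma L2_add:
  assumes "f \<in> L2 M" "g \<in> L2 M"
  shows "(\<lambda>x. f x + g x) \<in> L2 M"
proof (rule L2_bound)
  show "integrable M (\<lambda>x. 2 * (cmod (f x))\<^sup>2 + 2 * (cmod (g x))\<^sup>2)"
    using assms by (intro Bochner_Integration.integrable_add integrable_mult_right) (auto simp: L2_def)
qed (use assms in \<open>auto simp: L2_def norm_add_squared_le\<close>)

lemma L2_cmult: "f \<in> L2 M \<Longrightarrow> (\<lambda>x. c * f x) \<in> L2 M"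
  by (auto simp: L2_def norm_mult power_mult_distrib)

lemma L2_diff: "f \<in> L2 M \<Longrightarrow> g \<in> L2 M \<Longrightarrow> (\<lambda>x. f x - g x) \<in> L2 M"
  using L2_add[of f M "\<lambda>x. (-1) * g x"] L2_cmult[of g M "-1"] by simp

text \<open>Squared distances keep roots out of the estimates.\<close>

definition L2_closure :: "'a measure \<Rightarrow> ('a \<Rightarrow> complex) set \<Rightarrow> ('a \<Rightarrow> complex) set" where
  "L2_closure M S = {g \<in> L2 M. \<forall>e>0. \<exists>F\<in>S. (\<integral>x. (cmod (g x - F x))\<^sup>2 \<partial>M) < e}"

lemma dense_in_L2_iff: "dense_in_L2 M S \<longleftrightarrow> S \<subseteq> L2 M \<and> L2 M \<subseteq> L2_closure M S"
proof -
  have "(\<forall>e>0. \<exists>h\<in>S. L2_norm M (\<lambda>x. g x - h x) < e) \<longleftrightarrow>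
      (\<forall>e>0. \<exists>F\<in>S. (\<integral>x. (cmod (g x - F x))\<^sup>2 \<partial>M) < e)" for g
  proof safe
    fix e :: real assume "\<forall>e>0. \<exists>h\<in>S. L2_norm M (\<lambda>x. g x - h x) < e" "e > 0"
    then obtain h where h: "h \<in> S" "L2_norm M (\<lambda>x. g x - h x) < sqrt e"
      using real_sqrt_gt_0_iff by blast
    then show "\<exists>F\<in>S. (\<integral>x. (cmod (g x - F x))\<^sup>2 \<partial>M) < e"
      by (intro bexI[of _ h]) (auto simp: L2_norm_def)
  next
    fix e :: real assume *: "\<forall>e>0. \<exists>F\<in>S. (\<integral>x. (cmod (g x - F x))\<^sup>2 \<partial>M) < e" "e > 0"
    then obtain h where h: "h \<in> S" "(\<integral>x. (cmod (g x - h x))\<^sup>2 \<partial>M) < e\<^sup>2"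
      by (metis zero_less_power)
    then have "sqrt (\<integral>x. (cmod (g x - h x))\<^sup>2 \<partial>M) < sqrt (e\<^sup>2)" by (simp only: real_sqrt_less_iff)
    then show "\<exists>h\<in>S. L2_norm M (\<lambda>x. g x - h x) < e"
      using h(1) \<open>e > 0\<close> by (intro bexI[of _ h]) (auto simp: L2_norm_def)
  qed
  then show ?thesis unfolding dense_in_L2_def L2_closure_def by auto
qed

lemma L2_closure_closed:
  assumes "g \<in> L2 M" "S \<subseteq> L2 M"
    and "\<And>e. e > 0 \<Longrightarrow> \<exists>h\<in>L2_closure M S. (\<integral>x. (cmod (g x - h x))\<^sup>2 \<partial>M) < e"
  shows "g \<in> L2_closure M S"
  unfolding L2_closure_def
proof (intro CollectI conjI allI impI assms(1))
  fix e :: real assume "e > 0"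
  then obtain h where h: "h \<in> L2_closure M S" "(\<integral>x. (cmod (g x - h x))\<^sup>2 \<partial>M) < e / 4"
    using assms(3)[of "e / 4"] by auto
  then obtain F where F: "F \<in> S" "(\<integral>x. (cmod (h x - F x))\<^sup>2 \<partial>M) < e / 4"
    using \<open>e > 0\<close> unfolding L2_closure_def by (auto dest!: spec[of _ "e / 4"])
  have L: "h \<in> L2 M" "F \<in> L2 M" using h F assms by (auto simp: L2_closure_def)
  have "(\<integral>x. (cmod (g x - F x))\<^sup>2 \<partial>M) \<le> (\<integral>x. 2 * (cmod (g x - h x))\<^sup>2 + 2 * (cmod (h x - F x))\<^sup>2 \<partial>M)"
  proof (rule integral_mono)
    show "integrable M (\<lambda>x. (cmod (g x - F x))\<^sup>2)"
      by (rule L2_D(2)[OF L2_diff[OF assms(1) L(2)]])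
    show "integrable M (\<lambda>x. 2 * (cmod (g x - h x))\<^sup>2 + 2 * (cmod (h x - F x))\<^sup>2)"
      by (intro Bochner_Integration.integrable_add integrable_mult_right L2_D(2) L2_diff assms(1) L)
    show "(cmod (g x - F x))\<^sup>2 \<le> 2 * (cmod (g x - h x))\<^sup>2 + 2 * (cmod (h x - F x))\<^sup>2" for x
      using norm_add_squared_le[of "g x - h x" "h x - F x"] by simp
  qed
  also have "\<dots> = 2 * (\<integral>x. (cmod (g x - h x))\<^sup>2 \<partial>M) + 2 * (\<integral>x. (cmod (h x - F x))\<^sup>2 \<partial>M)"
    by (subst Bochner_Integration.integral_add)
      (auto intro!: L2_D(2) L2_diff assms(1) L integrable_mult_right)
  also have "\<dots> < e" using h(2) F(2) by linarith
  finally show "\<exists>F\<in>S. (\<integral>x. (cmod (g x - F x))\<^sup>2 \<partial>M) < e" using F(1) by blast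
qed

lemma L2_closure_limit:
  assumes "S \<subseteq> L2 M" "\<And>n. g n \<in> L2_closure M S" "g' \<in> borel_measurable M"
    and "AE x in M. (\<lambda>n. g n x) \<longlonglongrightarrow> g' x"
    and "integrable M w" "\<And>n. AE x in M. (cmod (g n x))\<^sup>2 \<le> w x"
  shows "g' \<in> L2_closure M S"
proof (rule L2_closure_closed[OF _ assms(1)])
  have gm: "g n \<in> borel_measurable M" for n
    using assms(2)[of n] by (simp add: L2_closure_def L2_def)
  have w: "AE x in M. \<forall>n. (cmod (g n x))\<^sup>2 \<le> w x"
    using assms(6) by (simp add: AE_all_countable)
  have g'w: "AE x in M. (cmod (g' x))\<^sup>2 \<le> w x"
    using w assms(4)
  proof eventually_elim
    case (elim x)
    have "(\<lambda>n. (cmod (g n x))\<^sup>2) \<longlonglongrightarrow> (cmod (g' x))\<^sup>2" by (intro tendsto_intros elim)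
    then show ?case by (rule LIMSEQ_le_const2) (use elim in auto)
  qed
  show g': "g' \<in> L2 M" by (rule L2_bound[OF assms(3,5) g'w])
  have "(\<lambda>n. \<integral>x. (cmod (g' x - g n x))\<^sup>2 \<partial>M) \<longlonglongrightarrow> (\<integral>x. 0 \<partial>M)"
  proof (rule integral_dominated_convergence[where w = "\<lambda>x. 4 * w x"])
    show "integrable M (\<lambda>x. 4 * w x)" using assms(5) by auto
    show "AE x in M. (\<lambda>n. (cmod (g' x - g n x))\<^sup>2) \<longlonglongrightarrow> 0"
      using assms(4)
    proof eventually_elim
      case (elim x)
      have "(\<lambda>n. (cmod (g' x - g n x))\<^sup>2) \<longlonglongrightarrow> (cmod (g' x - g' x))\<^sup>2" by (intro tendsto_intros elim)
      then show ?case by simp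
    qed
    show "AE x in M. norm ((cmod (g' x - g n x))\<^sup>2) \<le> 4 * w x" for n
      using w g'w
    proof eventually_elim
      case (elim x)
      then have "(cmod (g n x))\<^sup>2 \<le> w x" by blast
      with elim(2) norm_add_squared_le[of "g' x" "- g n x"] show ?case by simp
    qed
  qed (use gm assms(3) in auto)
  then have lim: "(\<lambda>n. \<integral>x. (cmod (g' x - g n x))\<^sup>2 \<partial>M) \<longlonglongrightarrow> 0" by simp
  fix e :: real assume "e > 0"
  then have "eventually (\<lambda>n. (\<integral>x. (cmod (g' x - g n x))\<^sup>2 \<partial>M) < e) sequentially"
    using order_tendstoD(2)[OF lim] by simp
  then obtain n where "(\<integral>x. (cmod (g' x - g n x))\<^sup>2 \<partial>M) < e"
    by (auto simp: eventually_sequentially)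
  then show "\<exists>h\<in>L2_closure M S. (\<integral>x. (cmod (g' x - h x))\<^sup>2 \<partial>M) < e"
    using assms(2) by blast
qed

text \<open>The measures that occur below satisfy the growth condition with exponent one.\<close>

definition quadratic_growth :: "real measure \<Rightarrow> bool" where
  "quadratic_growth M \<longleftrightarrow> sets M = sets borel \<and> integrable M (\<lambda>t. 1 / (1 + t\<^sup>2))"

lemma poly_growth_if_quadratic_growth:
  assumes "quadratic_growth M"
  shows "poly_growth M"
proof -
  have "1 + \<bar>t\<bar> powr (2 * 1) = 1 + t\<^sup>2" for t :: real
    by (cases "t = 0") (auto simp: powr_numeral)
  then have "(\<integral>\<^sup>+ t. ennreal (1 / (1 + \<bar>t\<bar> powr (2 * 1))) \<partial>M) = (\<integral>\<^sup>+ t. ennreal (1 / (1 + t\<^sup>2)) \<partial>M)"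
    by simp
  also have "\<dots> < \<infinity>"
    using assms unfolding quadratic_growth_def
    by (subst nn_integral_eq_integral) auto
  finally show ?thesis
    using assms unfolding poly_growth_def quadratic_growth_def by (intro conjI exI[of _ 1]) auto
qed

lemma L2_of_decay:
  assumes "quadratic_growth M" "F \<in> borel_measurable borel"
    and "AE x in M. cmod (F x) \<le> C / (1 + x\<^sup>2)"
  shows "F \<in> L2 M" "(\<integral>x. (cmod (F x))\<^sup>2 \<partial>M) \<le> C\<^sup>2 * (\<integral>x. 1 / (1 + x\<^sup>2) \<partial>M)"
proof -
  have int: "integrable M (\<lambda>x. C\<^sup>2 * (1 / (1 + x\<^sup>2)))"
    using assms(1) unfolding quadratic_growth_def by (intro integrable_mult_right) auto
  have AE: "AE x in M. (cmod (F x))\<^sup>2 \<le> C\<^sup>2 * (1 / (1 + x\<^sup>2))"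
    using assms(3)
  proof eventually_elim
    case (elim x)
    have p: "1 + x\<^sup>2 \<ge> 1" by simp
    have "(cmod (F x))\<^sup>2 \<le> (C / (1 + x\<^sup>2))\<^sup>2" using elim by (intro power_mono) auto
    also have "\<dots> = C\<^sup>2 / (1 + x\<^sup>2) / (1 + x\<^sup>2)" by (simp add: power2_eq_square)
    also have "\<dots> \<le> C\<^sup>2 / (1 + x\<^sup>2) / 1"
      using p by (intro divide_left_mono) (auto intro!: add_pos_nonneg)
    finally show ?case by simp
  qed
  have "F \<in> borel_measurable M"
    using assms(1,2) unfolding quadratic_growth_def by (simp cong: measurable_cong_sets)
  then show L: "F \<in> L2 M" by (rule L2_bound[OF _ int AE])
  have "(\<integral>x. (cmod (F x))\<^sup>2 \<partial>M) \<le> (\<integral>x. C\<^sup>2 * (1 / (1 + x\<^sup>2)) \<partial>M)"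
    by (rule integral_mono_AE[OF L2_D(2)[OF L] int AE])
  then show "(\<integral>x. (cmod (F x))\<^sup>2 \<partial>M) \<le> C\<^sup>2 * (\<integral>x. 1 / (1 + x\<^sup>2) \<partial>M)"
    by (simp only: Bochner_Integration.integral_mult_right_zero)
qed

lemma fourier_space_borel:
  assumes "F \<in> fourier_space a" "a > 0"
  shows "F \<in> borel_measurable borel"
  by (rule borel_measurable_continuous_onI[OF fourier_space_decay(1)[OF assms]])

lemma fourier_space_subset_L2:
  assumes "quadratic_growth M" "a > 0"
  shows "fourier_space a \<subseteq> L2 M"
proof
  fix F assume F: "F \<in> fourier_space a"
  obtain C where "\<And>x. cmod (F x) \<le> C / (1 + x\<^sup>2)"
    using fourier_space_decay(2)[OF F assms(2)] by blast
  then show "F \<in> L2 M"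
    using fourier_space_borel[OF F assms(2)] by (intro L2_of_decay(1)[OF assms(1)]) auto
qed

lemma L2_closure_add:
  assumes "quadratic_growth M" "a > 0"
    and g: "g \<in> L2_closure M (fourier_space a)" and h: "h \<in> L2_closure M (fourier_space a)"
  shows "(\<lambda>x. g x + h x) \<in> L2_closure M (fourier_space a)"
  unfolding L2_closure_def
proof (intro CollectI conjI allI impI)
  have L: "g \<in> L2 M" "h \<in> L2 M" using g h by (auto simp: L2_closure_def)
  show "(\<lambda>x. g x + h x) \<in> L2 M" by (rule L2_add[OF L])
  fix e :: real assume "e > 0"
  then obtain F G where F: "F \<in> fourier_space a" "(\<integral>x. (cmod (g x - F x))\<^sup>2 \<partial>M) < e / 4"
    and G: "G \<in> fourier_space a" "(\<integral>x. (cmod (h x - G x))\<^sup>2 \<partial>M) < e / 4"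
    using g h unfolding L2_closure_def by (auto dest!: spec[of _ "e / 4"])
  have FG: "F \<in> L2 M" "G \<in> L2 M"
    using F G fourier_space_subset_L2[OF assms(1,2)] by auto
  have "(\<integral>x. (cmod (g x + h x - (F x + G x)))\<^sup>2 \<partial>M) \<le> (\<integral>x. 2 * (cmod (g x - F x))\<^sup>2 + 2 * (cmod (h x - G x))\<^sup>2 \<partial>M)"
  proof (rule integral_mono)
    show "integrable M (\<lambda>x. (cmod (g x + h x - (F x + G x)))\<^sup>2)"
      by (intro L2_D(2) L2_diff L2_add L FG)
    show "integrable M (\<lambda>x. 2 * (cmod (g x - F x))\<^sup>2 + 2 * (cmod (h x - G x))\<^sup>2)"
      by (intro Bochner_Integration.integrable_add integrable_mult_right L2_D(2) L2_diff L FG)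
    show "(cmod (g x + h x - (F x + G x)))\<^sup>2 \<le> 2 * (cmod (g x - F x))\<^sup>2 + 2 * (cmod (h x - G x))\<^sup>2" for x
      using norm_add_squared_le[of "g x - F x" "h x - G x"] by (simp add: algebra_simps)
  qed
  also have "\<dots> = 2 * (\<integral>x. (cmod (g x - F x))\<^sup>2 \<partial>M) + 2 * (\<integral>x. (cmod (h x - G x))\<^sup>2 \<partial>M)"
    by (subst Bochner_Integration.integral_add) (auto intro!: L2_D(2) L2_diff L FG integrable_mult_right)
  also have "\<dots> < e" using F(2) G(2) by linarith
  finally show "\<exists>F\<in>fourier_space a. (\<integral>x. (cmod (g x + h x - F x))\<^sup>2 \<partial>M) < e"
    using fourier_space_add[OF assms(2) F(1) G(1)] by (intro bexI[of _ "\<lambda>x. F x + G x"])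
qed

lemma L2_closure_cmult:
  assumes "a > 0" "g \<in> L2_closure M (fourier_space a)"
  shows "(\<lambda>x. c * g x) \<in> L2_closure M (fourier_space a)"
  unfolding L2_closure_def
proof (intro CollectI conjI allI impI)
  show "(\<lambda>x. c * g x) \<in> L2 M" using assms by (intro L2_cmult) (auto simp: L2_closure_def)
  fix e :: real assume "e > 0"
  define d where "d = 1 + (cmod c)\<^sup>2"
  have d: "d > 0" by (simp add: d_def add_pos_nonneg)
  then obtain F where F: "F \<in> fourier_space a" "(\<integral>x. (cmod (g x - F x))\<^sup>2 \<partial>M) < e / d"
    using assms(2) \<open>e > 0\<close> unfolding L2_closure_def by (auto dest!: spec[of _ "e / d"])
  have "(\<integral>x. (cmod (c * g x - c * F x))\<^sup>2 \<partial>M) = (cmod c)\<^sup>2 * (\<integral>x. (cmod (g x - F x))\<^sup>2 \<partial>M)"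
    unfolding right_diff_distrib[symmetric] norm_mult power_mult_distrib by simp
  also have "\<dots> \<le> d * (\<integral>x. (cmod (g x - F x))\<^sup>2 \<partial>M)"
    by (intro mult_right_mono) (auto simp: d_def)
  also have "\<dots> < e" using F(2) d by (simp add: pos_less_divide_eq mult.commute)
  finally show "\<exists>F\<in>fourier_space a. (\<integral>x. (cmod (c * g x - F x))\<^sup>2 \<partial>M) < e"
    by (intro bexI[OF _ fourier_space_cmult[OF assms(1) F(1), of c]])
qed

lemma L2_closure_zero:
  assumes "a > 0"
  shows "(\<lambda>x. 0) \<in> L2_closure M (fourier_space a)"
  unfolding L2_closure_def
  by (auto simp: L2_def intro!: bexI[OF _ fourier_space_zero[OF assms]])

lemma L2_closure_sum:
  assumes "quadratic_growth M" "a > 0" "\<And>i. i \<in> I \<Longrightarrow> g i \<in> L2_closure M (fourier_space a)"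
  shows "(\<lambda>x. \<Sum>i\<in>I. g i x) \<in> L2_closure M (fourier_space a)"
  using assms(3)
  by (induction I rule: infinite_finite_induct)
    (auto intro!: L2_closure_add[OF assms(1,2)] L2_closure_zero assms(2))

section \<open>Density for finite measures on the line\<close>

text \<open>This class consists of functions to which the approximation across a gap applies, and it is
  closed under products, which polynomials in cosines require.\<close>

definition bounded_exp_type :: "(real \<Rightarrow> complex) \<Rightarrow> bool" where
  "bounded_exp_type f \<longleftrightarrow> (\<exists>h C l. h holomorphic_on UNIV \<and> l \<ge> 0 \<and> (\<forall>z. cmod (h z) \<le> C * exp (l * cmod z)) \<and>
     (\<forall>x. h (of_real x) = f x)) \<and> (\<exists>D. \<forall>x. cmod (f x) \<le> D)"

lemma bounded_exp_typeI:
  assumes "h holomorphic_on UNIV" "l \<ge> 0" "\<And>z. cmod (h z) \<le> C * exp (l * cmod z)"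
    "\<And>x. h (of_real x) = f x" "\<And>x. cmod (f x) \<le> D"
  shows "bounded_exp_type f"
  unfolding bounded_exp_type_def using assms by blast

lemma bounded_exp_typeD:
  assumes "bounded_exp_type f"
  shows "\<exists>h C l D. h holomorphic_on UNIV \<and> l \<ge> 0 \<and> C \<ge> 0 \<and> (\<forall>z. cmod (h z) \<le> C * exp (l * cmod z)) \<and>
    (\<forall>x. h (of_real x) = f x) \<and> D \<ge> 0 \<and> (\<forall>x. cmod (f x) \<le> D)"
proof -
  obtain h C l D where h: "h holomorphic_on UNIV" "l \<ge> 0" "\<forall>z. cmod (h z) \<le> C * exp (l * cmod z)"
    "\<forall>x. h (of_real x) = f x" "\<forall>x. cmod (f x) \<le> D"
    using assms unfolding bounded_exp_type_def by blast
  have "C \<ge> 0" using order_trans[OF norm_ge_zero h(3)[rule_format, of 0]] by simp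
  moreover have "D \<ge> 0" using order_trans[OF norm_ge_zero h(5)[rule_format, of 0]] .
  ultimately show ?thesis using h by (intro exI[of _ h] exI[of _ C] exI[of _ l] exI[of _ D]) simp
qed

lemma bounded_exp_type_const: "bounded_exp_type (\<lambda>x. c)"
  by (rule bounded_exp_typeI[of "\<lambda>z. c" 0 "cmod c" _ "cmod c"]) auto

lemma bounded_exp_type_add:
  assumes "bounded_exp_type f" "bounded_exp_type g"
  shows "bounded_exp_type (\<lambda>x. f x + g x)"
proof -
  obtain h C l D where h: "h holomorphic_on UNIV" "l \<ge> 0" "C \<ge> 0" "\<And>z. cmod (h z) \<le> C * exp (l * cmod z)"
    "\<And>x. h (of_real x) = f x" "D \<ge> 0" "\<And>x. cmod (f x) \<le> D"
    using bounded_exp_typeD[OF assms(1)] by auto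
  obtain h' C' l' D' where h': "h' holomorphic_on UNIV" "l' \<ge> 0" "C' \<ge> 0" "\<And>z. cmod (h' z) \<le> C' * exp (l' * cmod z)"
    "\<And>x. h' (of_real x) = g x" "D' \<ge> 0" "\<And>x. cmod (g x) \<le> D'"
    using bounded_exp_typeD[OF assms(2)] by auto
  show ?thesis
  proof (rule bounded_exp_typeI[of "\<lambda>z. h z + h' z" "l + l'" "C + C'" _ "D + D'"])
    fix z
    have "C * exp (l * cmod z) \<le> C * exp ((l + l') * cmod z)"
      using h h' by (intro mult_left_mono) (auto intro!: mult_right_mono)
    moreover have "C' * exp (l' * cmod z) \<le> C' * exp ((l + l') * cmod z)"
      using h h' by (intro mult_left_mono) (auto intro!: mult_right_mono)
    ultimately show "cmod (h z + h' z) \<le> (C + C') * exp ((l + l') * cmod z)"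
      using h(4)[of z] h'(4)[of z] norm_triangle_ineq[of "h z" "h' z"] unfolding distrib_right[of C C'] by linarith
    show "cmod (f x + g x) \<le> D + D'" for x
      using h(7)[of x] h'(7)[of x] norm_triangle_ineq[of "f x" "g x"] by linarith
  qed (use h h' in \<open>auto intro!: holomorphic_intros\<close>)
qed

lemma bounded_exp_type_mult:
  assumes "bounded_exp_type f" "bounded_exp_type g"
  shows "bounded_exp_type (\<lambda>x. f x * g x)"
proof -
  obtain h C l D where h: "h holomorphic_on UNIV" "l \<ge> 0" "C \<ge> 0" "\<And>z. cmod (h z) \<le> C * exp (l * cmod z)"
    "\<And>x. h (of_real x) = f x" "D \<ge> 0" "\<And>x. cmod (f x) \<le> D"
    using bounded_exp_typeD[OF assms(1)] by auto
  obtain h' C' l' D' where h': "h' holomorphic_on UNIV" "l' \<ge> 0" "C' \<ge> 0" "\<And>z. cmod (h' z) \<le> C' * exp (l' * cmod z)"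
    "\<And>x. h' (of_real x) = g x" "D' \<ge> 0" "\<And>x. cmod (g x) \<le> D'"
    using bounded_exp_typeD[OF assms(2)] by auto
  show ?thesis
  proof (rule bounded_exp_typeI[of "\<lambda>z. h z * h' z" "l + l'" "C * C'" _ "D * D'"])
    fix z
    have "cmod (h z) * cmod (h' z) \<le> (C * exp (l * cmod z)) * (C' * exp (l' * cmod z))"
      using h(3,4) h'(4) by (intro mult_mono) auto
    also have "\<dots> = C * C' * exp ((l + l') * cmod z)" by (simp add: distrib_right exp_add)
    finally show "cmod (h z * h' z) \<le> C * C' * exp ((l + l') * cmod z)" by (simp add: norm_mult)
    show "cmod (f x * g x) \<le> D * D'" for x
      unfolding norm_mult using h h' by (intro mult_mono) auto
  qed (use h h' in \<open>auto intro!: holomorphic_intros\<close>)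
qed

lemma norm_cos_le_exp: "cmod (cos z) \<le> exp (cmod z)"
proof -
  have "cmod (exp (\<i> * z) + exp (- (\<i> * z))) \<le> exp (cmod z) + exp (cmod z)"
    using norm_exp[of "\<i> * z"] norm_exp[of "- (\<i> * z)"]
    by (intro norm_triangle_le add_mono) (simp_all add: norm_mult)
  then show ?thesis unfolding cos_exp_eq norm_divide by simp
qed

lemma bounded_exp_type_cos: "bounded_exp_type (\<lambda>x. of_real (cos (w * (x - t))))"
proof (rule bounded_exp_typeI[of "\<lambda>z. cos (of_real w * (z - of_real t))" "\<bar>w\<bar>" "exp (\<bar>w\<bar> * \<bar>t\<bar>)" _ 1])
  fix z :: complex
  have "cmod (cos (of_real w * (z - of_real t))) \<le> exp (cmod (of_real w * (z - of_real t)))"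
    by (rule norm_cos_le_exp)
  also have "\<dots> \<le> exp (\<bar>w\<bar> * (cmod z + \<bar>t\<bar>))"
    using norm_triangle_ineq4[of z "of_real t"] by (simp add: norm_mult mult_left_mono)
  also have "\<dots> = exp (\<bar>w\<bar> * \<bar>t\<bar>) * exp (\<bar>w\<bar> * cmod z)" by (simp add: distrib_left exp_add)
  finally show "cmod (cos (of_real w * (z - of_real t))) \<le> exp (\<bar>w\<bar> * \<bar>t\<bar>) * exp (\<bar>w\<bar> * cmod z)" .
  show "cos (of_real w * (of_real x - of_real t)) = complex_of_real (cos (w * (x - t)))" for x
    unfolding of_real_diff[symmetric] of_real_mult[symmetric] cos_of_real ..
qed (auto intro!: holomorphic_intros)

lemma bounded_exp_type_poly_cos:
  assumes "real_polynomial_function p"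
  shows "bounded_exp_type (\<lambda>x. of_real (p (cos (w * (x - t)))))"
  using assms
proof induction
  case (linear f)
  then obtain k where "f = (\<lambda>x. x * k)" by (auto simp: real_bounded_linear)
  then show ?case
    using bounded_exp_type_mult[OF bounded_exp_type_cos bounded_exp_type_const] by simp
next
  case (const c)
  then show ?case by (rule bounded_exp_type_const)
next
  case (add f g)
  then show ?case using bounded_exp_type_add by simp
next
  case (mult f g)
  then show ?case using bounded_exp_type_mult by simp
qed

text \<open>For a finite measure the bounded entire functions of exponential type suffice: polynomials in
  \<open>cos (w * (x - t))\<close> converge boundedly to the indicator of \<open>cos (w * (x - t)) > cos (w * r)\<close>, which
  is a periodic union of intervals, and all but the one around \<open>t\<close> escape to infinity when \<open>w\<close> tends
  to zero.\<close>

lemma dense_if_bounded_exp_type_approx: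
  assumes fin: "finite_measure M" and M: "quadratic_growth M" and a: "a > 0"
    and approx: "\<And>f. bounded_exp_type f \<Longrightarrow> f \<in> L2_closure M (fourier_space a)"
  shows "dense_in_L2 M (fourier_space a)"
proof -
  interpret finite_measure M by (rule fin)
  define V where "V = L2_closure M (fourier_space a)"
  have sets: "sets M = sets borel" using M by (simp add: quadratic_growth_def)
  then have space: "space M = UNIV" by (metis sets_eq_imp_space_eq space_borel)
  have meas: "g \<in> borel_measurable M \<longleftrightarrow> g \<in> borel_measurable borel" for g :: "real \<Rightarrow> complex"
    using sets by (simp cong: measurable_cong_sets)
  have sub: "fourier_space a \<subseteq> L2 M" by (rule fourier_space_subset_L2[OF M a])
  have lim: "g' \<in> V" if "\<And>n. g n \<in> V" "g' \<in> borel_measurable borel" "\<And>x. (\<lambda>n. g n x) \<longlonglongrightarrow> g' x"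
    "\<And>n x. cmod (g n x) \<le> D" for g g' D
    unfolding V_def
  proof (rule L2_closure_limit[OF sub, where g = g])
    show "integrable M (\<lambda>x. D\<^sup>2)" by simp
    show "AE x in M. (cmod (g n x))\<^sup>2 \<le> D\<^sup>2" for n
      using that(4) by (intro AE_I2 power_mono) auto
  qed (use that meas in \<open>auto simp: V_def\<close>)
  \<comment> \<open>Continuous functions of a cosine are uniform limits of polynomials in it.\<close>
  have cont: "(\<lambda>x. of_real (h (cos (w * (x - t))))) \<in> V" if h: "continuous_on {-1..1} h" for h and w t :: real
  proof -
    have "\<exists>p. real_polynomial_function p \<and> (\<forall>u\<in>{-1..1}. \<bar>h u - p u\<bar> < 1 / real (Suc n))" for n
    proof -
      obtain p where "real_polynomial_function p" "\<And>u. u \<in> {-1..1} \<Longrightarrow> \<bar>h u - p u\<bar> < 1 / real (Suc n)"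
        using Stone_Weierstrass_real_polynomial_function[OF compact_Icc h, of "1 / real (Suc n)"] by auto
      then show ?thesis by auto
    qed
    then obtain p where p: "\<And>n. real_polynomial_function (p n)" "\<And>n u. u \<in> {-1..1} \<Longrightarrow> \<bar>h u - p n u\<bar> < 1 / real (Suc n)"
      by metis
    have "compact (h ` {-1..1})" using compact_continuous_image[OF h] by simp
    then have "bounded (h ` {-1..1})" by (rule compact_imp_bounded)
    then obtain D where "\<forall>y\<in>h ` {-1..1}. norm y \<le> D" unfolding bounded_iff by blast
    then have D: "\<bar>h u\<bar> \<le> D" if "u \<in> {-1..1}" for u using that by auto
    have c: "cos y \<in> {-1..1}" for y :: real by simp
    show ?thesis
    proof (rule lim[where D = "D + 1"])
      show "(\<lambda>x. complex_of_real (p n (cos (w * (x - t))))) \<in> V" for n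
        unfolding V_def by (intro approx bounded_exp_type_poly_cos p)
      have "continuous_on UNIV (\<lambda>x. complex_of_real (h (cos (w * (x - t)))))"
        by (intro continuous_intros continuous_on_compose2[OF h]) auto
      then show "(\<lambda>x. complex_of_real (h (cos (w * (x - t))))) \<in> borel_measurable borel"
        by (rule borel_measurable_continuous_onI)
      fix x
      define u where "u = cos (w * (x - t))"
      have u: "u \<in> {-1..1}" by (simp add: u_def)
      have "(\<lambda>n. p n u) \<longlonglongrightarrow> h u"
      proof (rule LIM_zero_cancel, rule Lim_null_comparison)
        show "eventually (\<lambda>n. norm (p n u - h u) \<le> 1 / real (Suc n)) sequentially"
          using p(2)[OF u] by (intro always_eventually) (simp add: abs_minus_commute less_imp_le)
        show "(\<lambda>n. 1 / real (Suc n)) \<longlonglongrightarrow> 0"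
          using LIMSEQ_inverse_real_of_nat by (simp add: inverse_eq_divide)
      qed
      then show "(\<lambda>n. complex_of_real (p n (cos (w * (x - t))))) \<longlonglongrightarrow> complex_of_real (h (cos (w * (x - t))))"
        unfolding u_def by (intro tendsto_of_real)
      fix n
      have "\<bar>h u - p n u\<bar> < 1" using p(2)[OF u, of n] by (rule order_less_le_trans) simp
      then have "\<bar>p n u\<bar> \<le> D + 1" using D[OF u] by linarith
      then show "cmod (complex_of_real (p n (cos (w * (x - t))))) \<le> D + 1" by (simp add: u_def)
    qed
  qed
  have level: "indicator {x. cos (w * (x - t)) > k} \<in> V" for w t k :: real
  proof (rule lim[where D = 1])
    show "(\<lambda>x. complex_of_real (min 1 (max 0 (real n * (cos (w * (x - t)) - k))))) \<in> V" for n
      by (rule cont[where h = "\<lambda>u. min 1 (max 0 (real n * (u - k)))"]) (intro continuous_intros)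
    have "{x. cos (w * (x - t)) > k} \<in> sets borel"
      by (intro borel_open open_Collect_less continuous_intros)
    then show "indicator {x. cos (w * (x - t)) > k} \<in> borel_measurable borel" by measurable
    fix x
    define u where "u = cos (w * (x - t)) - k"
    have "(\<lambda>n. min 1 (max 0 (real n * u))) \<longlonglongrightarrow> (if u > 0 then 1 else 0)"
    proof (cases "u > 0")
      case True
      obtain N where N: "real N * u > 1" using ex_less_of_nat_mult[OF True] by blast
      have "eventually (\<lambda>n. min 1 (max 0 (real n * u)) = 1) sequentially"
        using eventually_ge_at_top[of N]
      proof eventually_elim
        case (elim n)
        then have "real N * u \<le> real n * u" using True by (intro mult_right_mono) auto
        then show ?case using N by auto
      qed
      then show ?thesis using True by (auto intro: tendsto_eventually)
    next
      case False
      then have "real n * u \<le> 0" for n by (simp add: mult_le_0_iff)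
      then have "min 1 (max 0 (real n * u)) = 0" for n by (simp add: max_absorb1)
      then show ?thesis using False by simp
    qed
    then have "(\<lambda>n. complex_of_real (min 1 (max 0 (real n * u)))) \<longlonglongrightarrow> of_real (if u > 0 then 1 else 0)"
      by (rule tendsto_of_real)
    moreover have "indicator {x. cos (w * (x - t)) > k} x = complex_of_real (if u > 0 then 1 else 0)"
      by (simp add: u_def indicator_def)
    ultimately show "(\<lambda>n. complex_of_real (min 1 (max 0 (real n * (cos (w * (x - t)) - k))))) \<longlonglongrightarrow> indicator {x. cos (w * (x - t)) > k} x"
      by (simp only: u_def)
  qed auto
  \<comment> \<open>For \<open>w\<close> small, \<open>w * \<bar>x - t\<bar>\<close> and \<open>w * r\<close> lie in \<open>[0, pi]\<close>, where the cosine is decreasing.\<close>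
  have interval: "indicator {b<..<c} \<in> V" for b c :: real
  proof (cases "b < c")
    case False
    then have "indicator {b<..<c} = (\<lambda>x. 0 :: complex)" by (auto simp: indicator_def)
    then show ?thesis unfolding V_def using L2_closure_zero[OF a] by simp
  next
    case True
    define t r where "t = (b + c) / 2" and "r = (c - b) / 2"
    have r: "r > 0" using True by (simp add: r_def)
    have bc: "x \<in> {b<..<c} \<longleftrightarrow> \<bar>x - t\<bar> < r" for x by (auto simp: t_def r_def abs_less_iff field_simps)
    define w where "w = (\<lambda>n. 1 / real (Suc n))"
    show ?thesis
    proof (rule lim[where D = 1])
      show "indicator {x. cos (w n * (x - t)) > cos (w n * r)} \<in> V" for n by (rule level)
      fix x
      obtain N where N: "real N > max \<bar>x - t\<bar> r" using reals_Archimedean2 by blast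
      have "eventually (\<lambda>n. indicator {x. cos (w n * (x - t)) > cos (w n * r)} x = (indicator {b<..<c} x :: complex)) sequentially"
        using eventually_ge_at_top[of N]
      proof eventually_elim
        case (elim n)
        have wn: "w n > 0" by (simp add: w_def)
        have "\<bar>x - t\<bar> \<le> real (Suc n)" "r \<le> real (Suc n)" using N elim by auto
        then have "w n * \<bar>x - t\<bar> \<le> 1" "w n * r \<le> 1" by (simp_all add: w_def divide_le_eq)
        then have le: "w n * \<bar>x - t\<bar> \<le> pi" "w n * r \<le> pi" using pi_gt3 by linarith+
        have "cos (w n * (x - t)) = cos (w n * \<bar>x - t\<bar>)"
          by (cases "x - t \<ge> 0") (simp_all only: abs_of_nonneg abs_of_neg not_le mult_minus_right cos_minus)
        moreover have "cos (w n * r) < cos (w n * \<bar>x - t\<bar>) \<longleftrightarrow> w n * \<bar>x - t\<bar> < w n * r"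
          by (rule cos_mono_less_eq) (use le wn r in auto)
        ultimately have "x \<in> {x. cos (w n * (x - t)) > cos (w n * r)} \<longleftrightarrow> x \<in> {b<..<c}"
          unfolding bc mem_Collect_eq using wn by simp
        then show ?case by (simp add: indicator_def)
      qed
      then show "(\<lambda>n. indicator {x. cos (w n * (x - t)) > cos (w n * r)} x) \<longlonglongrightarrow> (indicator {b<..<c} x :: complex)"
        by (rule tendsto_eventually)
    qed (auto simp: indicator_def)
  qed
  have one: "(\<lambda>x. 1) \<in> V" unfolding V_def by (intro approx bounded_exp_type_const)
  have add: "(\<lambda>x. g x + h x) \<in> V" if "g \<in> V" "h \<in> V" for g h
    using that L2_closure_add[OF M a] unfolding V_def by blast
  have cmult: "(\<lambda>x. c * g x) \<in> V" if "g \<in> V" for g c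
    using that L2_closure_cmult[OF a] unfolding V_def by blast
  have sum: "(\<lambda>x. \<Sum>i\<in>I. g i x) \<in> V" if "\<And>i. i \<in> I \<Longrightarrow> g i \<in> V" for g and I :: "'i set"
    using that L2_closure_sum[OF M a] unfolding V_def by blast
  have borel: "indicator A \<in> V" if "A \<in> sets borel" for A
  proof -
    define G where "G = range (\<lambda>(a::real, b). box a b)"
    have stable: "Int_stable G"
      unfolding Int_stable_def
    proof (intro ballI)
      fix X Y assume "X \<in> G" "Y \<in> G"
      then obtain b c b' c' where XY: "X = box b c" "Y = box b' c'" unfolding G_def by auto
      have "X \<inter> Y = box (max b b') (min c c')" unfolding XY by auto
      then show "X \<inter> Y \<in> G" unfolding G_def by (intro range_eqI[of _ _ "(max b b', min c c')"]) simp
    qed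
    have GG: "G \<subseteq> Pow UNIV" by simp
    have "A \<in> sigma_sets UNIV G"
      using that unfolding borel_eq_box G_def by simp
    from stable GG this show ?thesis
    proof (induction rule: sigma_sets_induct_disjoint)
      case (basic A)
      then show ?case unfolding G_def using interval by (auto simp: box_real)
    next
      case empty
      then show ?case using L2_closure_zero[OF a, of M] by (simp add: V_def)
    next
      case (compl A)
      have "indicator (UNIV - A) = (\<lambda>x. 1 + (-1) * indicator A x :: complex)" by (auto simp: indicator_def)
      then show ?case using add[OF one cmult[OF compl.IH, of "-1"]] by simp
    next
      case (union A)
      show ?case
      proof (rule lim[where D = 1])
        have eq: "(\<Sum>i<n. indicator (A i) x) = (indicator (\<Union>i<n. A i) x :: complex)" for n x
          by (rule indicator_UN_disjoint[symmetric])
            (use union(1) in \<open>auto simp: disjoint_family_on_def\<close>)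
        have "(\<lambda>x. \<Sum>i<n. indicator (A i) x) \<in> V" for n by (rule sum) (rule union.IH)
        then show "indicator (\<Union>i<n. A i) \<in> V" for n unfolding eq .
        have "A i \<in> sets borel" for i
          using union(2) unfolding borel_eq_box G_def by auto
        then show "indicator (\<Union>i. A i) \<in> borel_measurable borel" by measurable
        fix x
        have "eventually (\<lambda>n. indicator (\<Union>i<n. A i) x = (indicator (\<Union>i. A i) x :: complex)) sequentially"
        proof (cases "x \<in> (\<Union>i. A i)")
          case True
          then obtain i where i: "x \<in> A i" by blast
          show ?thesis using eventually_gt_at_top[of i]
            by eventually_elim (use i in \<open>auto simp: indicator_def\<close>)
        qed (auto simp: indicator_def)
        then show "(\<lambda>n. indicator (\<Union>i<n. A i) x) \<longlonglongrightarrow> (indicator (\<Union>i. A i) x :: complex)"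
          by (rule tendsto_eventually)
      qed (auto simp: indicator_def)
    qed
  qed
  have "L2 M \<subseteq> V"
  proof
    fix g assume g: "g \<in> L2 M"
    obtain s where s: "\<And>i. simple_function M (s i)" "\<And>x. x \<in> space M \<Longrightarrow> (\<lambda>i. s i x) \<longlonglongrightarrow> g x"
      "\<And>i x. x \<in> space M \<Longrightarrow> dist (s i x) 0 \<le> 2 * dist (g x) 0"
      using borel_measurable_implies_sequence_metric[OF L2_D(1)[OF g], of 0] by blast
    show "g \<in> V"
      unfolding V_def
    proof (rule L2_closure_limit[OF sub])
      show "s i \<in> L2_closure M (fourier_space a)" for i
      proof -
        have f: "finite (range (s i))" using simple_functionD(1)[OF s(1)] by (simp add: space)
        have "(\<lambda>x. \<Sum>y\<in>range (s i). y * indicator (s i -` {y}) x) \<in> V"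
        proof (intro sum cmult borel)
          show "s i -` {y} \<in> sets borel" for y
            using simple_functionD(2)[OF s(1), of i "{y}"] by (simp add: space sets)
        qed
        also have "(\<lambda>x. \<Sum>y\<in>range (s i). y * indicator (s i -` {y}) x) = s i"
          using f by (auto simp: fun_eq_iff indicator_def if_distrib cong: if_cong)
        finally show ?thesis by (simp add: V_def)
      qed
      show "AE x in M. (\<lambda>n. s n x) \<longlonglongrightarrow> g x" using s(2) by (intro AE_I2)
      show "integrable M (\<lambda>x. 4 * (cmod (g x))\<^sup>2)" using L2_D(2)[OF g] by auto
      show "AE x in M. (cmod (s n x))\<^sup>2 \<le> 4 * (cmod (g x))\<^sup>2" for n
      proof (rule AE_I2)
        fix x assume "x \<in> space M"
        then have "cmod (s n x) \<le> 2 * cmod (g x)" using s(3)[of x n] by simp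
        then have "(cmod (s n x))\<^sup>2 \<le> (2 * cmod (g x))\<^sup>2" by (rule power_mono) simp
        then show "(cmod (s n x))\<^sup>2 \<le> 4 * (cmod (g x))\<^sup>2" by (simp add: power_mult_distrib)
      qed
    qed (rule L2_D(1)[OF g])
  qed
  with sub show ?thesis unfolding dense_in_L2_iff V_def by blast
qed

section \<open>Sums of point masses\<close>

lemma sum_measure_dirac: "sum_measure (\<lambda>i. dirac (p i)) = distr (count_space UNIV) borel p"
proof (rule measure_eqI)
  fix A assume "A \<in> sets (sum_measure (\<lambda>i. dirac (p i)))"
  then have A: "A \<in> sets borel" by simp
  have "emeasure (sum_measure (\<lambda>i. dirac (p i))) A = (\<integral>\<^sup>+ i. emeasure (dirac (p i)) A \<partial>count_space UNIV)"
    by (rule emeasure_sum_measure) (use A in simp_all)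
  also have "\<dots> = (\<integral>\<^sup>+ i. indicator (p -` A) i \<partial>count_space UNIV)"
    using A by (intro nn_integral_cong) (auto simp: indicator_def)
  also have "\<dots> = emeasure (distr (count_space UNIV) borel p) A"
    using A by (simp add: emeasure_distr)
  finally show "emeasure (sum_measure (\<lambda>i. dirac (p i))) A = emeasure (distr (count_space UNIV) borel p) A" .
qed simp

lemma sum_measure_add_dirac:
  "sum_measure (\<lambda>i::'i::countable. add_measure (dirac (x i)) (dirac (y i)))
    = distr (count_space UNIV) borel (\<lambda>(i, b). if b then x i else y i)"
proof (rule measure_eqI)
  fix A assume "A \<in> sets (sum_measure (\<lambda>i. add_measure (dirac (x i)) (dirac (y i))))"
  then have A: "A \<in> sets borel" by simp
  define p where "p = (\<lambda>(i, b). if b then x i else y i)"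
  have B: "(\<integral>\<^sup>+ b. f b \<partial>count_space UNIV) = f True + f False" for f :: "bool \<Rightarrow> ennreal"
    by (subst nn_integral_count_space_finite) (auto simp: UNIV_bool add.commute)
  have "emeasure (sum_measure (\<lambda>i. add_measure (dirac (x i)) (dirac (y i)))) A
      = (\<integral>\<^sup>+ i. emeasure (add_measure (dirac (x i)) (dirac (y i))) A \<partial>count_space UNIV)"
    by (rule emeasure_sum_measure) (use A in simp_all)
  also have "\<dots> = (\<integral>\<^sup>+ i. (\<integral>\<^sup>+ b. indicator (p -` A) (i, b) \<partial>count_space UNIV) \<partial>count_space UNIV)"
    unfolding B using A
    by (intro nn_integral_cong) (auto simp: emeasure_add_measure indicator_def p_def)
  also have "\<dots> = (\<integral>\<^sup>+ z. indicator (p -` A) z \<partial>count_space UNIV)"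
    by (rule nn_integral_fst_count_space)
  also have "\<dots> = emeasure (distr (count_space UNIV) borel p) A"
    using A by (simp add: emeasure_distr)
  finally show "emeasure (sum_measure (\<lambda>i. add_measure (dirac (x i)) (dirac (y i)))) A
    = emeasure (distr (count_space UNIV) borel (\<lambda>(i, b). if b then x i else y i)) A"
    by (simp add: p_def)
qed simp

lemma AE_distr_count_space:
  assumes "{x. P x} \<in> sets borel"
  shows "(AE x in distr (count_space UNIV) borel p. P x) \<longleftrightarrow> (\<forall>i. P (p i))"
  using assms by (subst AE_distr_iff) (auto simp: AE_count_space)

text \<open>Countably many points carry all the mass, so every element of \<open>L\<^sup>2\<close> is the dominated limit of its
  restrictions to finitely many of them.\<close>

lemma dense_if_atoms_approx:
  fixes p :: "'i::countable \<Rightarrow> real"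
  defines "M \<equiv> distr (count_space UNIV) borel p"
  assumes M: "quadratic_growth M" and a: "a > 0"
    and atoms: "\<And>i. indicator {p i} \<in> L2_closure M (fourier_space a)"
  shows "dense_in_L2 M (fourier_space a)"
proof -
  have sub: "fourier_space a \<subseteq> L2 M" by (rule fourier_space_subset_L2[OF M a])
  have "L2 M \<subseteq> L2_closure M (fourier_space a)"
  proof
    fix g assume g: "g \<in> L2 M"
    define P where "P = (\<lambda>n::nat. p ` {i. to_nat i < n})"
    have "{i::'i. to_nat i < n} \<subseteq> from_nat ` {..<n}" for n
    proof
      fix i :: 'i assume "i \<in> {i. to_nat i < n}"
      then show "i \<in> from_nat ` {..<n}" by (intro image_eqI[of _ _ "to_nat i"]) simp_all
    qed
    then have fin: "finite (P n)" for n
      unfolding P_def by (rule finite_imageI[OF finite_subset]) simp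
    have gb: "g \<in> borel_measurable borel"
      using L2_D(1)[OF g] by (simp add: M_def)
    show "g \<in> L2_closure M (fourier_space a)"
    proof (rule L2_closure_limit[OF sub _ _ _ L2_D(2)[OF g]])
      show "(\<lambda>x. \<Sum>l\<in>P n. g l * indicator {l} x) \<in> L2_closure M (fourier_space a)" for n
      proof (rule L2_closure_sum[OF M a])
        fix l assume "l \<in> P n"
        then obtain i where "l = p i" by (auto simp: P_def)
        then show "(\<lambda>x. g l * indicator {l} x) \<in> L2_closure M (fourier_space a)"
          using L2_closure_cmult[OF a atoms[of i]] by simp
      qed
      have eq: "(\<Sum>l\<in>P n. g l * indicator {l} x) = (if x \<in> P n then g x else 0)" for n x
      proof -
        have "(\<Sum>l\<in>P n. g l * indicator {l} x) = (\<Sum>l\<in>P n. if x = l then g l else 0)"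
          by (intro sum.cong refl) (simp add: indicator_def)
        then show ?thesis by (simp only: sum.delta'[OF fin])
      qed
      show "g \<in> borel_measurable M" by (rule L2_D(1)[OF g])
      have "countable (range p)" by (rule countable_image) (rule countableI_type)
      then have "range p \<in> sets borel" by (rule sets.countable[rotated]) simp
      then have "{x. x \<in> range p} \<in> sets borel" by simp
      then have "AE x in M. x \<in> range p"
        unfolding M_def AE_distr_count_space[OF \<open>{x. x \<in> range p} \<in> sets borel\<close>] by simp
      then show "AE x in M. (\<lambda>n. \<Sum>l\<in>P n. g l * indicator {l} x) \<longlonglongrightarrow> g x"
      proof eventually_elim
        case (elim x)
        then obtain i where i: "x = p i" by blast
        have "eventually (\<lambda>n. (\<Sum>l\<in>P n. g l * indicator {l} x) = g x) sequentially"
          using eventually_gt_at_top[of "to_nat i"]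
        proof eventually_elim
          case (elim n)
          then have "x \<in> P n" unfolding P_def i by blast
          then show ?case unfolding eq by simp
        qed
        then show ?case by (rule tendsto_eventually)
      qed
      show "AE x in M. (cmod (\<Sum>l\<in>P n. g l * indicator {l} x))\<^sup>2 \<le> (cmod (g x))\<^sup>2" for n
        unfolding eq by (intro AE_I2) auto
    qed
  qed
  with sub show ?thesis unfolding dense_in_L2_iff by blast
qed

section \<open>Sparse gaps and a multiplier that is small on them\<close>

text \<open>Gap \<open>j\<close> extends from \<open>B j\<close> to \<open>Q j\<close>. The ratio \<open>Q j / B j\<close> tends to infinity, as the approximation
  across the gaps requires, while \<open>m j / B j\<close> is summable, as the multiplier requires. The assumption
  \<open>few\<close> makes a displacement of every integer of gap \<open>j\<close> by \<open>exp (- m j)\<close> small in total.\<close>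

locale gap_scales =
  fixes m :: "nat \<Rightarrow> nat"
  assumes m_ge: "m j \<ge> 256"
    and sparse: "(j + 2) * (2 ^ j * m j) < 2 ^ Suc j * m (Suc j)"
    and few: "real (2 * ((j + 2) * (2 ^ j * m j)) + 1) * exp (- real (m j)) \<le> (1/2) ^ j / 64"
begin

definition B :: "nat \<Rightarrow> nat" where "B j = 2 ^ j * m j"
definition Q :: "nat \<Rightarrow> nat" where "Q j = (j + 2) * B j"
definition gap :: "nat \<Rightarrow> real set" where "gap j = {x. real (B j) \<le> \<bar>x\<bar> \<and> \<bar>x\<bar> \<le> real (Q j)}"
definition gaps :: "real set" where "gaps = (\<Union>j. gap j)"

lemma B_ge: "B j \<ge> 256" "B j \<ge> j"
proof -
  have "(1::nat) * m j \<le> 2 ^ j * m j" by (intro mult_right_mono) simp_all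
  then have "m j \<le> B j" by (simp only: B_def mult_1)
  then show "B j \<ge> 256" using m_ge[of j] by linarith
  have "j \<le> 2 ^ j" by (simp add: less_imp_le)
  also have "\<dots> * 1 \<le> 2 ^ j * m j" using m_ge[of j] by (intro mult_left_mono) simp_all
  finally show "B j \<ge> j" by (simp add: B_def)
qed

lemma B_le_Q: "B j \<le> Q j"
  by (simp add: Q_def)

lemma Q_less_B_Suc: "Q j < B (Suc j)"
  using sparse[of j] by (simp add: Q_def B_def)

lemma Q_less_B:
  assumes "j < k"
  shows "Q j < B k"
  using assms
proof (induction k)
  case (Suc k)
  show ?case
  proof (cases "j = k")
    case False
    then have "Q j < B k" using Suc by simp
    also have "\<dots> \<le> Q k" by (rule B_le_Q)
    also have "\<dots> < B (Suc k)" by (rule Q_less_B_Suc)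
    finally show ?thesis .
  qed (simp add: Q_less_B_Suc)
qed simp

lemma B_mono: "j \<le> k \<Longrightarrow> B j \<le> B k"
  using Q_less_B[of j k] B_le_Q[of j] by (cases "j = k") auto

lemma gap_unique:
  assumes "x \<in> gap j" "x \<in> gap k"
  shows "j = k"
proof (rule ccontr)
  assume "j \<noteq> k"
  then consider "j < k" | "k < j" by linarith
  then show False
  proof cases
    case 1
    then have "real (Q j) < real (B k)" using Q_less_B by simp
    then show False using assms by (simp add: gap_def)
  next
    case 2
    then have "real (Q k) < real (B j)" using Q_less_B by simp
    then show False using assms by (simp add: gap_def)
  qed
qed

lemma gaps_borel [measurable]: "gaps \<in> sets borel"
proof -
  have "closed (gap j)" for j
    unfolding gap_def by (intro closed_Collect_conj closed_Collect_le continuous_intros)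
  then show ?thesis unfolding gaps_def by (intro sets.countable_UN) (auto intro: borel_closed)
qed

text \<open>The factor of index \<open>j\<close> is at most \<open>exp (- m j)\<close> beyond \<open>B j\<close>, at the price of an exponential
  type \<open>4 * m j / B j = 4 * (1/2) ^ j\<close>, which is summable.\<close>

definition gap_multiplier :: "real \<Rightarrow> nat \<Rightarrow> nat \<Rightarrow> real \<Rightarrow> real" where
  "gap_multiplier \<eta> j0 k x = Sinc (\<eta> * x) ^ 2 * (\<Prod>j\<in>{j0..<k}. Sinc (4 / real (B j) * x) ^ m j)"

lemma B_pos: "real (B j) > 0"
  using B_ge(1)[of j] by simp

lemma gap_multiplier_fourier:
  assumes "a > 0" "F \<in> fourier_space a" "\<eta> > 0"
  shows "(\<lambda>x. of_real (gap_multiplier \<eta> j0 k x) * F x) \<in> fourier_space (a + 2 * \<eta> + 8 * (1/2) ^ j0)"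
proof -
  define t where "t = (\<lambda>k. \<Sum>j\<in>{j0..<k}. 4 * (1/2) ^ j :: real)"
  have pos: "t k \<ge> 0" for k unfolding t_def by (intro sum_nonneg) simp
  have 0: "(\<lambda>x. of_real (Sinc (\<eta> * x)) ^ 2 * F x) \<in> fourier_space (a + 2 * \<eta>)"
    using fourier_space_mult_Sinc_power[OF assms, of 0 2] by simp
  have "(\<lambda>x. of_real (gap_multiplier \<eta> j0 k x) * F x) \<in> fourier_space (a + 2 * \<eta> + t k)" for k
  proof (induction k)
    case 0
    then show ?case using \<open>(\<lambda>x. of_real (Sinc (\<eta> * x)) ^ 2 * F x) \<in> _\<close> by (simp add: gap_multiplier_def t_def)
  next
    case (Suc k)
    show ?case
    proof (cases "j0 \<le> k")
      case True
      then have eq: "{j0..<Suc k} = insert k {j0..<k}" by auto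
      have ap: "a + 2 * \<eta> + t k > 0" using assms pos[of k] by (intro add_pos_nonneg) auto
      have "(\<lambda>x. of_real (Sinc (4 / real (B k) * (x - 0))) ^ m k * (of_real (gap_multiplier \<eta> j0 k x) * F x))
          \<in> fourier_space (a + 2 * \<eta> + t k + real (m k) * (4 / real (B k)))"
        by (rule fourier_space_mult_Sinc_power[OF ap Suc.IH]) (use B_pos in simp)
      also have "a + 2 * \<eta> + t k + real (m k) * (4 / real (B k)) = a + 2 * \<eta> + t (Suc k)"
        using m_ge[of k] by (simp add: t_def eq B_def power_divide)
      finally show ?thesis by (simp add: gap_multiplier_def eq mult_ac)
    next
      case False
      then have "{j0..<Suc k} = {j0..<k}" by auto
      then show ?thesis using Suc.IH by (simp add: gap_multiplier_def t_def)
    qed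
  qed
  moreover have "t k \<le> 8 * (1/2) ^ j0"
  proof -
    have "t (j0 + n) = 8 * (1/2) ^ j0 - 8 * (1/2) ^ (j0 + n)" for n
      by (induction n) (simp_all add: t_def)
    then have "t (j0 + n) \<le> 8 * (1/2) ^ j0" for n by simp
    moreover have "t k = 0" if "k \<le> j0" using that by (simp add: t_def)
    ultimately show ?thesis
      by (cases "k \<le> j0") (simp, metis le_add_diff_inverse nat_le_linear)
  qed
  then have "a + 2 * \<eta> + t k \<le> a + 2 * \<eta> + 8 * (1/2) ^ j0" by simp
  ultimately show ?thesis using fourier_space_mono by blast
qed

lemma gap_multiplier_le:
  assumes "\<eta> > 0"
  shows "\<bar>gap_multiplier \<eta> j0 k x\<bar> \<le> (1 + 1 / \<eta>\<^sup>2) / (1 + x\<^sup>2)"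
    and "j0 \<le> j \<Longrightarrow> j < k \<Longrightarrow> \<bar>x\<bar> \<ge> 3/4 * real (B j) \<Longrightarrow>
      \<bar>gap_multiplier \<eta> j0 k x\<bar> \<le> (1 + 1 / \<eta>\<^sup>2) / (1 + x\<^sup>2) * exp (- real (m j))"
proof -
  define P where "P = (\<Prod>j\<in>{j0..<k}. Sinc (4 / real (B j) * x) ^ m j)"
  have fac: "\<bar>Sinc (4 / real (B j) * x) ^ m j\<bar> \<le> 1" for j
    unfolding power_abs by (rule power_le_one) (use abs_Sinc_le_1 in auto)
  have P1: "\<bar>P\<bar> \<le> 1"
    unfolding P_def abs_prod by (rule prod_le_1) (use fac in auto)
  have pos: "1 + x\<^sup>2 > 0" by (simp add: add_pos_nonneg)
  have "(1 + x\<^sup>2) * (Sinc (\<eta> * x))\<^sup>2 \<le> 1 + 1 / \<eta>\<^sup>2"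
  proof -
    have "(Sinc (\<eta> * x))\<^sup>2 \<le> 1" using abs_Sinc_le_1[of "\<eta> * x"] by (simp add: abs_square_le_1)
    moreover have "x\<^sup>2 * (Sinc (\<eta> * x))\<^sup>2 = (sin (\<eta> * x))\<^sup>2 / \<eta>\<^sup>2"
    proof -
      have "\<eta> * (x * Sinc (\<eta> * x)) = sin (\<eta> * x)" using Sinc_mult[of "\<eta> * x"] by (simp add: mult.assoc)
      then have "x * Sinc (\<eta> * x) = sin (\<eta> * x) / \<eta>" using assms by (simp add: field_simps)
      then show ?thesis unfolding power_mult_distrib[symmetric] power_divide[symmetric] by simp
    qed
    moreover have "(sin (\<eta> * x))\<^sup>2 / \<eta>\<^sup>2 \<le> 1 / \<eta>\<^sup>2"
      by (intro divide_right_mono) (simp_all add: abs_square_le_1)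
    ultimately show ?thesis by (simp add: distrib_right)
  qed
  then have S: "(Sinc (\<eta> * x))\<^sup>2 \<le> (1 + 1 / \<eta>\<^sup>2) / (1 + x\<^sup>2)"
    using pos by (simp add: pos_le_divide_eq mult.commute)
  have Geq: "\<bar>gap_multiplier \<eta> j0 k x\<bar> = (Sinc (\<eta> * x))\<^sup>2 * \<bar>P\<bar>"
    by (simp add: gap_multiplier_def P_def abs_mult)
  also have "\<dots> \<le> (Sinc (\<eta> * x))\<^sup>2 * 1" using P1 by (intro mult_left_mono) auto
  finally show "\<bar>gap_multiplier \<eta> j0 k x\<bar> \<le> (1 + 1 / \<eta>\<^sup>2) / (1 + x\<^sup>2)" using S by simp
  assume j: "j0 \<le> j" "j < k" "\<bar>x\<bar> \<ge> 3/4 * real (B j)"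
  have "\<bar>P\<bar> = \<bar>Sinc (4 / real (B j) * x) ^ m j\<bar> * (\<Prod>i\<in>{j0..<k} - {j}. \<bar>Sinc (4 / real (B i) * x) ^ m i\<bar>)"
    unfolding P_def abs_prod using j by (intro prod.remove) auto
  also have "\<dots> \<le> \<bar>Sinc (4 / real (B j) * x) ^ m j\<bar> * 1"
    by (intro mult_left_mono prod_le_1) (use fac in auto)
  also have "\<dots> \<le> exp (- real (m j))"
  proof -
    have u: "\<bar>4 / real (B j) * x\<bar> \<ge> 3"
      using j(3) B_pos[of j] by (simp add: abs_mult pos_le_divide_eq)
    then have "\<bar>Sinc (4 / real (B j) * x)\<bar> \<le> 1 / \<bar>4 / real (B j) * x\<bar>"
      using B_pos[of j] by (intro abs_Sinc_le_inverse) auto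
    also have "\<dots> \<le> 1 / 3"
    proof -
      have "1 / v \<le> 1 / 3" if "v \<ge> 3" for v :: real using that by (simp add: field_simps)
      then show ?thesis using u .
    qed
    also have "1 / 3 \<le> exp (-1 :: real)"
      using exp_le by (simp add: exp_minus field_simps)
    finally have "\<bar>Sinc (4 / real (B j) * x)\<bar> ^ m j \<le> exp (-1) ^ m j" by (rule power_mono) simp
    then show ?thesis by (simp add: power_abs exp_of_nat_mult[symmetric])
  qed
  finally have "\<bar>P\<bar> \<le> exp (- real (m j))" .
  then show "\<bar>gap_multiplier \<eta> j0 k x\<bar> \<le> (1 + 1 / \<eta>\<^sup>2) / (1 + x\<^sup>2) * exp (- real (m j))"
    unfolding Geq using S by (intro mult_mono) auto
qed

text \<open>Near the origin the factor of index \<open>j\<close> is \<open>1 - O (m j / B j ^ 2)\<close>, and the sum of these defects is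
  small.\<close>

lemma gap_multiplier_ge_half:
  assumes "\<bar>x\<bar> \<le> 1" "0 < \<eta>" "\<eta> \<le> 1/4"
  shows "gap_multiplier \<eta> j0 k x \<ge> 1/2"
proof -
  have fac: "Sinc (4 / real (B j) * x) ^ m j \<ge> 1 - (1/2) ^ j / 16 \<and> Sinc (4 / real (B j) * x) ^ m j \<ge> 0" for j
  proof -
    define u where "u = 4 / real (B j)"
    have u: "0 < u" "u \<le> 1/64" using B_ge(1)[of j] B_pos[of j] by (simp_all add: u_def divide_le_eq)
    have ux: "\<bar>u * x\<bar> \<le> u" using u assms by (simp add: abs_mult mult_left_le)
    then have ux2: "(u * x)\<^sup>2 \<le> u\<^sup>2" using u by (metis abs_ge_zero power2_abs power_mono)
    have u1: "u\<^sup>2 \<le> 1" using u by (simp add: power_le_one)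
    have "1 - u\<^sup>2 \<le> Sinc (u * x)" using Sinc_ge[of "u * x"] ux u ux2 by linarith
    then have "(1 - u\<^sup>2) ^ m j \<le> Sinc (u * x) ^ m j" using u1 by (intro power_mono) auto
    moreover have "1 - real (m j) * u\<^sup>2 \<le> (1 - u\<^sup>2) ^ m j"
      using Bernoulli_inequality[of "- u\<^sup>2" "m j"] u1 by simp
    moreover have "real (m j) * u\<^sup>2 \<le> (1/2) ^ j / 16"
    proof -
      have "real (m j) * u\<^sup>2 = 16 * (1/2) ^ j / real (B j)"
        using m_ge[of j] by (simp add: u_def B_def power2_eq_square power_divide)
      also have "\<dots> \<le> 16 * (1/2) ^ j / 256" using B_ge(1)[of j] by (intro divide_left_mono) auto
      finally show ?thesis by simp
    qed
    moreover have "(1/2) ^ j \<le> (1::real)" by (rule power_le_one) auto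
    ultimately show ?thesis unfolding u_def[symmetric] by linarith
  qed
  have "(\<Prod>j\<in>{j0..<k}. Sinc (4 / real (B j) * x) ^ m j) \<ge> 1 - (\<Sum>j\<in>{j0..<k}. (1/2) ^ j / 16)"
  proof (induction k)
    case (Suc k)
    show ?case
    proof (cases "j0 \<le> k")
      case True
      then have eq: "{j0..<Suc k} = insert k {j0..<k}" by auto
      define p where "p = (\<Prod>j\<in>{j0..<k}. Sinc (4 / real (B j) * x) ^ m j)"
      define s where "s = (\<Sum>j\<in>{j0..<k}. (1/2) ^ j / 16 :: real)"
      define c where "c = Sinc (4 / real (B k) * x) ^ m k"
      have p: "p \<ge> 0" unfolding p_def by (intro prod_nonneg) (use fac in auto)
      have p1: "p \<le> 1" unfolding p_def
      proof (rule prod_le_1)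
        fix j
        have "\<bar>Sinc (4 / real (B j) * x) ^ m j\<bar> \<le> 1"
          unfolding power_abs by (rule power_le_one) (use abs_Sinc_le_1 in auto)
        then show "0 \<le> Sinc (4 / real (B j) * x) ^ m j \<and> Sinc (4 / real (B j) * x) ^ m j \<le> 1"
          using fac[of j] by auto
      qed
      define d where "d = (1/2 :: real) ^ k / 16"
      have "(1 - d) * p \<le> c * p" using fac[of k] p unfolding c_def d_def by (intro mult_right_mono) auto
      then have "p - d * p \<le> c * p" by (simp only: left_diff_distrib mult_1)
      moreover have "d * p \<le> d" using p1 by (intro mult_left_le) (simp_all add: d_def)
      moreover have "p \<ge> 1 - s" using Suc unfolding p_def s_def .
      ultimately have "c * p \<ge> 1 - ((1/2) ^ k / 16 + s)" unfolding d_def by linarith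
      then show ?thesis by (simp add: eq p_def c_def s_def)
    next
      case False
      then have "{j0..<Suc k} = {j0..<k}" by auto
      then show ?thesis using Suc by simp
    qed
  qed simp
  moreover have "(\<Sum>j\<in>{j0..<k}. (1/2) ^ j / 16 :: real) \<le> 1/8"
  proof -
    have "(\<Sum>j\<in>{j0..<k}. (1/2) ^ j / 16 :: real) \<le> (\<Sum>j<k. (1/2) ^ j / 16)"
      by (intro sum_mono2) auto
    also have "\<dots> = 1/8 - (1/2) ^ k / 8"
      by (induction k) simp_all
    also have "\<dots> \<le> 1/8" by simp
    finally show ?thesis .
  qed
  ultimately have P: "(\<Prod>j\<in>{j0..<k}. Sinc (4 / real (B j) * x) ^ m j) \<ge> 7/8" by linarith
  have "\<bar>\<eta> * x\<bar> \<le> 1/4" using assms mult_mono[of \<eta> "1/4" "\<bar>x\<bar>" 1] by (simp add: abs_mult)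
  then have "(\<eta> * x)\<^sup>2 \<le> (1/4)\<^sup>2" by (metis abs_ge_zero power2_abs power_mono)
  then have "Sinc (\<eta> * x) \<ge> 15/16" using Sinc_ge[of "\<eta> * x"] \<open>\<bar>\<eta> * x\<bar> \<le> 1/4\<close> by (simp add: power2_eq_square)
  then have "(15/16)\<^sup>2 \<le> (Sinc (\<eta> * x))\<^sup>2" by (rule power_mono) simp
  then have "(15/16)\<^sup>2 * (7/8) \<le> gap_multiplier \<eta> j0 k x"
    unfolding gap_multiplier_def using P by (intro mult_mono) auto
  then show ?thesis by (simp add: power2_eq_square)
qed

section \<open>The absolutely continuous example\<close>

definition phi :: "real \<Rightarrow> real" where
  "phi x = (if x \<in> gaps then 0 else 1 / (1 + x\<^sup>2))"

lemma phi_nonneg: "phi x \<ge> 0"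
  by (simp add: phi_def)

lemma phi_le: "phi x \<le> 1 / (1 + x\<^sup>2)"
  by (simp add: phi_def)

lemma phi_borel [measurable]: "phi \<in> borel_measurable borel"
proof -
  have [measurable]: "Measurable.pred borel (\<lambda>x. x \<in> gaps)"
    using gaps_borel by measurable
  show ?thesis unfolding phi_def[abs_def] by measurable
qed

lemma tail_tendsto_0:
  fixes f :: "real \<Rightarrow> real"
  assumes "integrable lborel f"
  shows "(\<lambda>k. \<integral>x. indicator {x. \<bar>x\<bar> \<ge> real (B k)} x * f x \<partial>lborel) \<longlonglongrightarrow> 0"
proof -
  have [measurable]: "{x. \<bar>x\<bar> \<ge> real (B k)} \<in> sets borel" for k
    by (intro borel_closed closed_Collect_le continuous_intros)
  have "(\<lambda>k. \<integral>x. indicator {x. \<bar>x\<bar> \<ge> real (B k)} x * f x \<partial>lborel) \<longlonglongrightarrow> (\<integral>x. 0 \<partial>(lborel :: real measure))"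
  proof (rule integral_dominated_convergence[where w = "\<lambda>x. norm (f x)"])
    show "(\<lambda>x. indicator {x. \<bar>x\<bar> \<ge> real (B k)} x * f x) \<in> borel_measurable lborel" for k
      using borel_measurable_integrable[OF assms] by measurable
    show "AE x in lborel. (\<lambda>k. indicator {x. \<bar>x\<bar> \<ge> real (B k)} x * f x) \<longlonglongrightarrow> 0"
    proof (rule AE_I2)
      fix x :: real
      obtain N where N: "real N > \<bar>x\<bar>" using reals_Archimedean2 by blast
      have "eventually (\<lambda>k. indicator {x. \<bar>x\<bar> \<ge> real (B k)} x * f x = 0) sequentially"
        using eventually_ge_at_top[of N]
      proof eventually_elim
        case (elim k)
        then have "real N \<le> real (B k)" using B_ge(2)[of k] by simp
        then show ?case using N by (simp add: indicator_def)
      qed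
      then show "(\<lambda>k. indicator {x. \<bar>x\<bar> \<ge> real (B k)} x * f x) \<longlonglongrightarrow> 0" by (rule tendsto_eventually)
    qed
  qed (use assms in \<open>auto simp: indicator_def\<close>)
  then show ?thesis by simp
qed

text \<open>A single gap, far out, suffices for a given function: the approximation across it is good where
  \<open>\<bar>x\<bar> \<le> B k\<close>, the weight vanishes in the gap, and beyond it the approximant is small and little of
  the weight is left.\<close>

lemma dense_phi:
  assumes a: "a > 0"
  shows "dense_in_L2 (density lborel (\<lambda>x. ennreal (phi x))) (fourier_space a)"
proof -
  define M where "M = density lborel (\<lambda>x. ennreal (phi x))"
  have int1: "integrable lborel (\<lambda>x::real. 1 / (1 + x\<^sup>2))" by (rule integrable_quadratic_decay)
  have intphi: "integrable lborel phi"
    by (rule Bochner_Integration.integrable_bound[OF int1]) (auto intro!: AE_I2 simp: phi_nonneg phi_le)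
  have intM: "integrable M g \<longleftrightarrow> integrable lborel (\<lambda>x. phi x * g x)" if "g \<in> borel_measurable borel" for g :: "real \<Rightarrow> real"
    unfolding M_def using that by (subst integrable_density) (auto simp: phi_nonneg)
  have integM: "(\<integral>x. g x \<partial>M) = (\<integral>x. phi x * g x \<partial>lborel)" if "g \<in> borel_measurable borel" for g :: "real \<Rightarrow> real"
    unfolding M_def using that by (subst integral_density) (auto simp: phi_nonneg)
  have fin: "finite_measure M"
  proof
    have "emeasure M (space M) = (\<integral>\<^sup>+ x. ennreal (phi x) \<partial>lborel)"
      unfolding M_def by (subst emeasure_density) auto
    also have "\<dots> = ennreal (\<integral>x. phi x \<partial>lborel)"
      by (rule nn_integral_eq_integral[OF intphi]) (simp add: phi_nonneg)
    finally show "emeasure M (space M) \<noteq> \<infinity>" by simp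
  qed
  interpret finite_measure M by (rule fin)
  have sets: "sets M = sets borel" by (simp add: M_def)
  have M: "quadratic_growth M"
    unfolding quadratic_growth_def
  proof
    have "norm (1 / (1 + x\<^sup>2)) \<le> 1" for x :: real
      by (simp add: divide_le_eq add_pos_nonneg)
    then show "integrable M (\<lambda>t. 1 / (1 + t\<^sup>2))"
      by (intro integrable_const_bound[where B = 1]) (auto intro!: AE_I2 simp: sets cong: measurable_cong_sets)
  qed (rule sets)
  show ?thesis
    unfolding M_def[symmetric]
  proof (rule dense_if_bounded_exp_type_approx[OF fin M a])
    fix f assume "bounded_exp_type f"
    then obtain h C l D where h: "h holomorphic_on UNIV" "l \<ge> 0" "C \<ge> 0" "\<forall>z. cmod (h z) \<le> C * exp (l * cmod z)"
      "\<forall>x. h (of_real x) = f x" "D \<ge> 0" "\<forall>x. cmod (f x) \<le> D"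
      using bounded_exp_typeD by blast
    have "continuous_on UNIV (\<lambda>x. h (of_real x))"
      by (intro continuous_on_compose2[OF holomorphic_on_imp_continuous_on[OF h(1)]] continuous_intros) auto
    then have fb: "f \<in> borel_measurable borel"
      using h(5) by (intro borel_measurable_continuous_onI) simp
    have fL: "f \<in> L2 M"
    proof (rule L2_bound)
      show "integrable M (\<lambda>x. D\<^sup>2)" by simp
      show "AE x in M. (cmod (f x))\<^sup>2 \<le> D\<^sup>2" using h by (intro AE_I2 power_mono) auto
      show "f \<in> borel_measurable M" using fb sets by (simp cong: measurable_cong_sets)
    qed
    obtain R where R: "R \<ge> 1"
      "\<And>\<delta>. \<delta> > 0 \<Longrightarrow> \<exists>B0. \<forall>B\<ge>B0. \<exists>F\<in>fourier_space a.
        (\<forall>t. \<bar>t\<bar> \<le> B \<longrightarrow> cmod (F t - h (of_real t)) \<le> \<delta> / (1 + t^2)) \<and>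
        (\<forall>t. \<bar>t\<bar> \<ge> R * B \<longrightarrow> cmod (F t) \<le> \<delta> / (1 + t^2))"
      using gap_approximation[OF h(1) h(4)[rule_format] h(2) a] by blast
    define I where "I = (\<integral>x. 1 / (1 + x\<^sup>2) \<partial>(lborel :: real measure))"
    have I: "I \<ge> 0" unfolding I_def by simp
    show "f \<in> L2_closure M (fourier_space a)"
      unfolding L2_closure_def
    proof (intro CollectI conjI allI impI fL)
      fix e :: real assume e: "e > 0"
      define \<delta> where "\<delta> = sqrt (e / (8 * (I + 1)))"
      have \<delta>: "\<delta> > 0" "\<delta>\<^sup>2 = e / (8 * (I + 1))" using e I by (simp_all add: \<delta>_def)
      obtain B0 where B0: "\<And>B. B \<ge> B0 \<Longrightarrow> \<exists>F\<in>fourier_space a.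
        (\<forall>t. \<bar>t\<bar> \<le> B \<longrightarrow> cmod (F t - h (of_real t)) \<le> \<delta> / (1 + t^2)) \<and>
        (\<forall>t. \<bar>t\<bar> \<ge> R * B \<longrightarrow> cmod (F t) \<le> \<delta> / (1 + t^2))"
        using R(2)[OF \<delta>(1)] by blast
      define T where "T = (\<lambda>k. \<integral>x. indicator {x. \<bar>x\<bar> \<ge> real (B k)} x * (1 / (1 + x\<^sup>2)) \<partial>lborel)"
      have "T \<longlonglongrightarrow> 0" unfolding T_def by (rule tail_tendsto_0[OF int1])
      then have "eventually (\<lambda>k. T k < e / (8 * (D\<^sup>2 + 1))) sequentially"
        by (rule order_tendstoD) (use e in \<open>auto intro!: divide_pos_pos add_nonneg_pos\<close>)
      then obtain k1 where k1: "\<And>k. k \<ge> k1 \<Longrightarrow> T k < e / (8 * (D\<^sup>2 + 1))"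
        by (auto simp: eventually_sequentially)
      obtain k2 where k2: "real k2 \<ge> max R B0" using real_arch_simple by blast
      define k where "k = max k1 k2"
      have kk: "k \<ge> k1" "real k \<ge> R" "real k \<ge> B0" using k2 by (auto simp: k_def)
      have "real (B k) \<ge> B0" using kk(3) B_ge(2)[of k] by (metis of_nat_mono order_trans)
      then obtain F where F: "F \<in> fourier_space a"
        "\<And>t. \<bar>t\<bar> \<le> real (B k) \<Longrightarrow> cmod (F t - h (of_real t)) \<le> \<delta> / (1 + t^2)"
        "\<And>t. \<bar>t\<bar> \<ge> R * real (B k) \<Longrightarrow> cmod (F t) \<le> \<delta> / (1 + t^2)"
        using B0[of "real (B k)"] by blast
      have RQ: "R * real (B k) \<le> real (Q k)"
      proof -
        have "R * real (B k) \<le> real (k + 2) * real (B k)" using kk by (intro mult_right_mono) auto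
        then show ?thesis unfolding Q_def of_nat_mult .
      qed
      have Fb: "F \<in> borel_measurable borel" by (rule fourier_space_borel[OF F(1) a])
      define X where "X = {x. \<bar>x\<bar> \<ge> real (B k)}"
      have [measurable]: "X \<in> sets borel" unfolding X_def
        by (intro borel_closed closed_Collect_le continuous_intros)
      have pw: "phi x * (cmod (f x - F x))\<^sup>2 \<le> 2 * \<delta>\<^sup>2 * (1 / (1 + x\<^sup>2)) + 2 * D\<^sup>2 * (indicator X x * (1 / (1 + x\<^sup>2)))" for x
      proof -
        have p: "1 + x\<^sup>2 \<ge> 1" by simp
        have "\<delta> / (1 + x\<^sup>2) \<le> \<delta> / 1" by (rule divide_left_mono) (use p \<delta>(1) in \<open>auto simp: add_pos_nonneg\<close>)
        then have dl: "\<delta> / (1 + x\<^sup>2) \<le> \<delta>" by simp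
        have n: "0 \<le> 1 / (1 + x\<^sup>2)" by simp
        consider "\<bar>x\<bar> \<le> real (B k)" | "x \<in> gap k" | "\<bar>x\<bar> > real (Q k)" unfolding gap_def by force
        then show ?thesis
        proof cases
          case 1
          have "cmod (f x - F x) \<le> \<delta>" using F(2)[OF 1] h(5) dl by (simp add: norm_minus_commute)
          then have "(cmod (f x - F x))\<^sup>2 \<le> \<delta>\<^sup>2" by (rule power_mono) simp
          then have "(cmod (f x - F x))\<^sup>2 \<le> 2 * \<delta>\<^sup>2" using zero_le_power2[of \<delta>] by linarith
          then have "phi x * (cmod (f x - F x))\<^sup>2 \<le> (1 / (1 + x\<^sup>2)) * (2 * \<delta>\<^sup>2)"
            using phi_le[of x] n by (intro mult_mono) auto
          then have "phi x * (cmod (f x - F x))\<^sup>2 \<le> 2 * \<delta>\<^sup>2 * (1 / (1 + x\<^sup>2))"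
            by (simp only: mult.commute[of "1 / (1 + x\<^sup>2)"])
          moreover have "0 \<le> 2 * D\<^sup>2 * (indicator X x * (1 / (1 + x\<^sup>2)))" by simp
          ultimately show ?thesis by linarith
        next
          case 2
          then have "phi x = 0" by (auto simp: phi_def gaps_def)
          then show ?thesis by simp
        next
          case 3
          then have "\<bar>x\<bar> \<ge> R * real (B k)" using RQ by linarith
          then have "cmod (F x) \<le> \<delta>" using F(3) dl by force
          then have "(cmod (F x))\<^sup>2 \<le> \<delta>\<^sup>2" by (rule power_mono) simp
          moreover have "(cmod (f x))\<^sup>2 \<le> D\<^sup>2" using h by (intro power_mono) auto
          ultimately have "(cmod (f x - F x))\<^sup>2 \<le> 2 * D\<^sup>2 + 2 * \<delta>\<^sup>2"
            using norm_add_squared_le[of "f x" "- F x"] by simp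
          then have "phi x * (cmod (f x - F x))\<^sup>2 \<le> (1 / (1 + x\<^sup>2)) * (2 * D\<^sup>2 + 2 * \<delta>\<^sup>2)"
            using phi_le[of x] n by (intro mult_mono) auto
          moreover have "x \<in> X" using 3 B_le_Q[of k] by (simp add: X_def)
          ultimately show ?thesis by (simp add: algebra_simps add_divide_distrib)
        qed
      qed
      have intT: "integrable lborel (\<lambda>x. indicator X x * (1 / (1 + x\<^sup>2)))"
        using integrable_mult_indicator[OF _ int1, of X] by simp
      have intr: "integrable lborel (\<lambda>x. 2 * \<delta>\<^sup>2 * (1 / (1 + x\<^sup>2)) + 2 * D\<^sup>2 * (indicator X x * (1 / (1 + x\<^sup>2))))"
        by (intro Bochner_Integration.integrable_add integrable_mult_right int1 intT)
      have "(\<integral>x. (cmod (f x - F x))\<^sup>2 \<partial>M) = (\<integral>x. phi x * (cmod (f x - F x))\<^sup>2 \<partial>lborel)"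
        by (rule integM) (use fb Fb in measurable)
      also have "\<dots> \<le> (\<integral>x. 2 * \<delta>\<^sup>2 * (1 / (1 + x\<^sup>2)) + 2 * D\<^sup>2 * (indicator X x * (1 / (1 + x\<^sup>2))) \<partial>lborel)"
      proof (rule integral_mono[OF _ intr pw])
        show "integrable lborel (\<lambda>x. phi x * (cmod (f x - F x))\<^sup>2)"
          by (rule Bochner_Integration.integrable_bound[OF intr])
            (use fb Fb pw in \<open>auto intro!: AE_I2 order_trans[OF pw] simp: phi_nonneg abs_mult\<close>)
      qed
      also have "\<dots> = 2 * \<delta>\<^sup>2 * I + 2 * D\<^sup>2 * T k"
        unfolding I_def T_def X_def[symmetric]
        by (subst Bochner_Integration.integral_add)
          (intro integrable_mult_right int1 intT, intro integrable_mult_right int1 intT,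
           simp only: Bochner_Integration.integral_mult_right_zero)
      also have "\<dots> < e"
      proof -
        have cancel: "u * (e / (8 * u)) = e / 8" if "u > 0" for u :: real
          using that by (simp add: field_simps)
        have "\<delta>\<^sup>2 * I \<le> (I + 1) * (e / (8 * (I + 1)))"
          unfolding \<delta>(2)[symmetric] by (simp add: distrib_right mult.commute)
        also have "\<dots> = e / 8" by (rule cancel) (use I in linarith)
        finally have 1: "\<delta>\<^sup>2 * I \<le> e / 8" .
        have T0: "T k \<ge> 0" unfolding T_def by (intro integral_nonneg_AE AE_I2) simp
        have "D\<^sup>2 * T k \<le> (D\<^sup>2 + 1) * T k" using T0 by (intro mult_right_mono) auto
        also have "\<dots> \<le> (D\<^sup>2 + 1) * (e / (8 * (D\<^sup>2 + 1)))"
          using k1[OF kk(1)] by (intro mult_left_mono) auto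
        also have "\<dots> = e / 8"
          by (rule cancel) (simp add: add_nonneg_pos)
        finally have 2: "D\<^sup>2 * T k \<le> e / 8" .
        show ?thesis using 1 2 e by linarith
      qed
      finally show "\<exists>F\<in>fourier_space a. (\<integral>x. (cmod (f x - F x))\<^sup>2 \<partial>M) < e" using F(1) by blast
    qed
  qed
qed

text \<open>With the exponentially small weight on the gaps, the multiplier times a character of frequency \<open>p\<close>
  annihilates all transforms of type below \<open>p\<close>. A finite product suffices, since its length \<open>k\<close>
  is chosen after the transform, whose integral beyond \<open>B k\<close> is then small.\<close>

lemma not_dense_phi_plus:
  fixes psi :: "real \<Rightarrow> real"
  assumes psi: "psi \<in> borel_measurable borel" "\<And>x. psi x > 0" "\<And>x. psi x \<le> 1"
    and large: "\<And>j x. x \<in> gap j \<Longrightarrow> psi x \<ge> exp (- real (m j))"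
    and a: "a > 0"
  shows "\<not> dense_in_L2 (density lborel (\<lambda>x. ennreal (phi x + psi x))) (fourier_space a)"
proof
  define w where "w = (\<lambda>x. phi x + psi x)"
  define M where "M = density lborel (\<lambda>x. ennreal (w x))"
  have w0: "w x > 0" for x using phi_nonneg[of x] psi(2)[of x] by (simp add: w_def)
  have wb [measurable]: "w \<in> borel_measurable borel" unfolding w_def using psi(1) by measurable
  have w2: "w x \<le> 2" for x
  proof -
    have "1 / (1 + x\<^sup>2) \<le> 1" by (simp add: divide_le_eq add_pos_nonneg)
    then show ?thesis using phi_le[of x] psi(3)[of x] unfolding w_def by linarith
  qed
  assume "dense_in_L2 (density lborel (\<lambda>x. ennreal (phi x + psi x))) (fourier_space a)"
  then have dense: "dense_in_L2 M (fourier_space a)" by (simp add: M_def w_def)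
  have intM: "integrable M g \<longleftrightarrow> integrable lborel (\<lambda>x. w x * g x)" if "g \<in> borel_measurable borel" for g :: "real \<Rightarrow> real"
    unfolding M_def using that w0 by (subst integrable_density) (auto simp: less_imp_le)
  have integM: "(\<integral>x. g x \<partial>M) = (\<integral>x. w x * g x \<partial>lborel)" if "g \<in> borel_measurable borel" for g :: "real \<Rightarrow> real"
    unfolding M_def using that w0 by (subst integral_density) (auto simp: less_imp_le)
  \<comment> \<open>The multiplier with parameters \<open>1/4\<close> and \<open>5\<close> raises the type by \<open>1/2 + 1/4\<close>, which is less than \<open>p - a\<close>.\<close>
  define p where "p = a + 1"
  define D where "D = 1 + 1 / (1/4 :: real)\<^sup>2"
  define \<Gamma> where "\<Gamma> = gap_multiplier (1/4) 5"
  have \<Gamma>1: "\<bar>\<Gamma> k x\<bar> \<le> D / (1 + x\<^sup>2)" for k x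
    unfolding \<Gamma>_def D_def by (rule gap_multiplier_le) simp
  have \<Gamma>2: "\<bar>\<Gamma> k x\<bar> \<le> D / (1 + x\<^sup>2) * exp (- real (m j))" if "5 \<le> j" "j < k" "x \<in> gap j" for k j x
    unfolding \<Gamma>_def D_def by (rule gap_multiplier_le(2)) (use that B_pos[of j] in \<open>auto simp: gap_def\<close>)
  have D0: "D > 0" by (simp add: D_def power2_eq_square)
  \<comment> \<open>The weight may be as small as \<open>exp (- m j)\<close> on the gaps below \<open>5\<close>, where the multiplier is not small.\<close>
  define N5 where "N5 = (\<Sum>j<5. real (m j))"
  define C where "C = D\<^sup>2 * exp N5"
  have N5: "exp N5 \<ge> 1" unfolding N5_def by (simp add: sum_nonneg)
  have quot: "(\<Gamma> k x)\<^sup>2 / w x \<le> C / (1 + x\<^sup>2)" if "\<bar>x\<bar> < real (B k)" for k x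
  proof -
    have p: "1 + x\<^sup>2 > 0" "1 / (1 + x\<^sup>2) \<le> 1" by (simp_all add: divide_le_eq add_pos_nonneg)
    have sq: "(D / (1 + x\<^sup>2))\<^sup>2 \<le> D\<^sup>2 / (1 + x\<^sup>2) * (1 / (1 + x\<^sup>2))"
      by (simp add: power2_eq_square)
    have sq1: "(D / (1 + x\<^sup>2))\<^sup>2 \<le> D\<^sup>2 / (1 + x\<^sup>2)"
    proof -
      have "D\<^sup>2 / (1 + x\<^sup>2) * (1 / (1 + x\<^sup>2)) \<le> D\<^sup>2 / (1 + x\<^sup>2) * 1"
        using p by (intro mult_left_mono) auto
      with sq show ?thesis by linarith
    qed
    have sqG: "(\<Gamma> k x)\<^sup>2 \<le> (D / (1 + x\<^sup>2))\<^sup>2"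
      using power_mono[OF \<Gamma>1[of k x], of 2] by simp
    have D2: "D\<^sup>2 / (1 + x\<^sup>2) \<ge> 0" using p by simp
    have "(\<Gamma> k x)\<^sup>2 \<le> C / (1 + x\<^sup>2) * w x"
    proof (cases "x \<in> gaps")
      case False
      then have "1 / (1 + x\<^sup>2) \<le> w x" using psi(2)[of x] by (simp add: w_def phi_def less_imp_le)
      then have "D\<^sup>2 / (1 + x\<^sup>2) * (1 / (1 + x\<^sup>2)) \<le> D\<^sup>2 / (1 + x\<^sup>2) * w x"
        using D2 by (rule mult_left_mono)
      also have "\<dots> \<le> exp N5 * (D\<^sup>2 / (1 + x\<^sup>2) * w x)"
        using N5 D2 w0[of x] mult_right_mono[OF N5, of "D\<^sup>2 / (1 + x\<^sup>2) * w x"] by simp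
      finally show ?thesis using sqG sq by (simp add: C_def mult_ac)
    next
      case True
      then obtain j where j: "x \<in> gap j" by (auto simp: gaps_def)
      then have wj: "exp (- real (m j)) \<le> w x" using large[OF j] phi_nonneg[of x] by (simp add: w_def)
      have "real (B j) < real (B k)" using j that by (simp add: gap_def)
      then have jk: "j < k" using B_mono[of k j] by (cases "j < k") auto
      show ?thesis
      proof (cases "5 \<le> j")
        case True
        have "(\<Gamma> k x)\<^sup>2 \<le> (D / (1 + x\<^sup>2) * exp (- real (m j)))\<^sup>2"
          using power_mono[OF \<Gamma>2[OF True jk j], of 2] by simp
        also have "\<dots> = (D / (1 + x\<^sup>2))\<^sup>2 * (exp (- real (m j)) * exp (- real (m j)))"
          by (simp add: power2_eq_square)
        also have "\<dots> \<le> D\<^sup>2 / (1 + x\<^sup>2) * (1 * w x)"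
          using sq1 wj D2 by (intro mult_mono) auto
        also have "\<dots> \<le> exp N5 * (D\<^sup>2 / (1 + x\<^sup>2) * w x)"
          using N5 D2 w0[of x] mult_right_mono[OF N5, of "D\<^sup>2 / (1 + x\<^sup>2) * w x"] by simp
        finally show ?thesis by (simp add: C_def mult_ac)
      next
        case False
        then have "real (m j) \<le> N5" unfolding N5_def by (intro member_le_sum) auto
        then have "1 \<le> exp N5 * exp (- real (m j))" by (simp add: exp_add[symmetric])
        also have "\<dots> \<le> exp N5 * w x" using wj by (intro mult_left_mono) auto
        finally have "1 \<le> exp N5 * w x" .
        then have "D\<^sup>2 / (1 + x\<^sup>2) * 1 \<le> D\<^sup>2 / (1 + x\<^sup>2) * (exp N5 * w x)"
          using D2 by (rule mult_left_mono)
        then show ?thesis using sqG sq1 by (simp add: C_def mult_ac)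
      qed
    qed
    then show ?thesis using w0[of x] by (simp add: pos_divide_le_eq)
  qed
  define I where "I = (\<integral>x. 1 / (1 + x\<^sup>2) \<partial>(lborel :: real measure))"
  have I: "I \<ge> 0" unfolding I_def by simp
  have C0: "C \<ge> 0" by (simp add: C_def)
  define e where "e = 1 / (4 * (1 + C * I))"
  have e: "e > 0" using C0 I by (simp add: e_def add_pos_nonneg)
  define g where "g = (\<lambda>x. exp (- (\<i> * of_real (p * x))) * indicator {-1..1::real} x)"
  have gb [measurable]: "g \<in> borel_measurable borel"
  proof -
    have "continuous_on UNIV (\<lambda>x. exp (- (\<i> * of_real (p * x))))" by (intro continuous_intros)
    then have [measurable]: "(\<lambda>x. exp (- (\<i> * of_real (p * x)))) \<in> borel_measurable borel"
      by (rule borel_measurable_continuous_onI)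
    show ?thesis unfolding g_def by measurable
  qed
  have g1: "cmod (g x) = indicator {-1..1} x" for x by (simp add: g_def norm_mult indicator_def)
  have "g \<in> L2 M"
  proof -
    have "integrable lborel (\<lambda>x. w x * (cmod (g x))\<^sup>2)"
    proof (rule Bochner_Integration.integrable_bound)
      show "integrable lborel (\<lambda>x. 2 * indicator {-1..1::real} x :: real)" by simp
      show "AE x in lborel. norm (w x * (cmod (g x))\<^sup>2) \<le> norm (2 * indicator {-1..1::real} x :: real)"
        using w2 w0 by (intro AE_I2) (auto simp: g1 indicator_def less_imp_le)
    qed measurable
    then show ?thesis
      unfolding L2_def using intM[of "\<lambda>x. (cmod (g x))\<^sup>2"] gb by (simp add: M_def)
  qed
  then have "g \<in> L2_closure M (fourier_space a)" using dense by (auto simp: dense_in_L2_iff)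
  then obtain F where F: "F \<in> fourier_space a" "(\<integral>x. (cmod (g x - F x))\<^sup>2 \<partial>M) < e\<^sup>2"
    using e unfolding L2_closure_def by (auto dest!: spec[of _ "e\<^sup>2"])
  have Fb [measurable]: "F \<in> borel_measurable borel" by (rule fourier_space_borel[OF F(1) a])
  have FL: "F \<in> L2 M" using dense F(1) by (auto simp: dense_in_L2_iff)
  have intgF: "integrable lborel (\<lambda>x. w x * (cmod (g x - F x))\<^sup>2)"
    using L2_D(2)[OF L2_diff[OF \<open>g \<in> L2 M\<close> FL]] by (subst (asm) intM) auto
  have intgF_le: "(\<integral>x. w x * (cmod (g x - F x))\<^sup>2 \<partial>lborel) < e\<^sup>2"
    using F(2) by (subst (asm) integM) auto
  obtain CF where CF: "\<And>x. cmod (F x) \<le> CF / (1 + x\<^sup>2)"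
    using fourier_space_decay(2)[OF F(1) a] by blast
  have intF: "integrable lborel F" by (rule integrable_of_quadratic_decay[OF Fb CF])
  define T where "T = (\<lambda>k. \<integral>x. indicator {x. \<bar>x\<bar> \<ge> real (B k)} x * cmod (F x) \<partial>lborel)"
  have "T \<longlonglongrightarrow> 0" unfolding T_def by (intro tail_tendsto_0 integrable_norm intF)
  then have "eventually (\<lambda>k. T k < 1 / (4 * D)) sequentially"
    by (rule order_tendstoD) (use D0 in simp)
  then obtain k where k: "T k < 1 / (4 * D)" by (auto simp: eventually_sequentially)
  define h where "h = (\<lambda>x. complex_of_real (\<Gamma> k x) * exp (\<i> * of_real (p * x)))"
  define X where "X = {x. \<bar>x\<bar> \<ge> real (B k)}"
  have [measurable]: "X \<in> sets borel" unfolding X_def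
    by (intro borel_closed closed_Collect_le continuous_intros)
  have \<Gamma>c: "continuous_on A (\<Gamma> k)" for A
    unfolding \<Gamma>_def gap_multiplier_def
    by (intro continuous_intros continuous_at_imp_continuous_on ballI isCont_o2[OF _ isCont_Sinc])
  have hb [measurable]: "h \<in> borel_measurable borel"
    unfolding h_def by (intro borel_measurable_continuous_onI continuous_intros \<Gamma>c)
  have hn: "cmod (h x) = \<bar>\<Gamma> k x\<bar>" for x by (simp add: h_def norm_mult)
  have inth: "integrable lborel h"
    by (rule integrable_of_quadratic_decay[OF hb, of D]) (simp add: hn \<Gamma>1)
  have hD: "\<bar>\<Gamma> k x\<bar> \<le> D" for x
  proof -
    have "D / (1 + x\<^sup>2) \<le> D / 1" using D0 by (intro divide_left_mono) (auto simp: add_pos_nonneg)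
    then show ?thesis using \<Gamma>1[of k x] by simp
  qed
  have "(\<integral>x. F x * h x \<partial>lborel) = 0"
  proof -
    have 1: "(\<lambda>x. of_real (\<Gamma> k x) * F x) \<in> fourier_space (a + 2 * (1/4) + 8 * (1/2) ^ 5)"
      unfolding \<Gamma>_def by (rule gap_multiplier_fourier[OF a F(1)]) simp
    have "(\<integral>x. (of_real (\<Gamma> k x) * F x) * exp (\<i> * of_real (p * x)) \<partial>lborel) = 0"
      by (rule fourier_space_spectral_gap[OF 1]) (use a in \<open>simp_all add: p_def power_divide\<close>)
    then show ?thesis by (simp add: h_def mult_ac)
  qed
  have intFh: "integrable lborel (\<lambda>x. F x * h x)"
  proof (rule Bochner_Integration.integrable_bound)
    show "integrable lborel (\<lambda>x. D * cmod (F x))" using intF by auto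
    show "AE x in lborel. norm (F x * h x) \<le> norm (D * cmod (F x))"
    proof (rule AE_I2)
      fix x
      show "norm (F x * h x) \<le> norm (D * cmod (F x))"
        using mult_left_mono[OF hD[of x] norm_ge_zero[of "F x"]] D0 by (simp add: norm_mult hn mult.commute)
    qed
  qed measurable
  have intgh: "integrable lborel (\<lambda>x. g x * h x)"
  proof (rule Bochner_Integration.integrable_bound)
    show "integrable lborel (\<lambda>x. cmod (h x))" using inth by auto
    show "AE x in lborel. norm (g x * h x) \<le> norm (cmod (h x))"
      by (intro AE_I2) (auto simp: norm_mult g1 indicator_def)
  qed measurable
  have gh: "g x * h x = of_real (indicator {-1..1} x * \<Gamma> k x)" for x
    by (simp add: g_def h_def indicator_def exp_minus)
  have "1 \<le> (\<integral>x. indicator {-1..1} x * \<Gamma> k x \<partial>lborel)"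
  proof -
    have "(\<integral>x. indicator {-1..1::real} x * (1/2 :: real) \<partial>lborel) \<le> (\<integral>x. indicator {-1..1} x * \<Gamma> k x \<partial>lborel)"
    proof (rule integral_mono)
      show "integrable lborel (\<lambda>x. indicator {-1..1::real} x * (1/2) :: real)" by simp
      have "integrable lborel (\<lambda>x. Re (g x * h x))" using intgh by (rule integrable_Re)
      then show "integrable lborel (\<lambda>x. indicator {-1..1} x * \<Gamma> k x)" unfolding gh by simp
      show "indicator {-1..1} x * (1/2) \<le> indicator {-1..1} x * \<Gamma> k x" for x :: real
        using gap_multiplier_ge_half[of x "1/4" 5 k] unfolding \<Gamma>_def by (auto simp: indicator_def)
    qed
    then show ?thesis by simp
  qed
  also have "\<dots> = cmod (\<integral>x. g x * h x \<partial>lborel)"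
  proof -
    have "(\<integral>x. indicator {-1..1} x * \<Gamma> k x \<partial>lborel) \<ge> 0" using calculation by linarith
    then show ?thesis unfolding gh by (simp only: integral_complex_of_real norm_of_real abs_of_nonneg)
  qed
  also have "(\<integral>x. g x * h x \<partial>lborel) = (\<integral>x. g x * h x - F x * h x \<partial>lborel)"
    using intgh intFh \<open>(\<integral>x. F x * h x \<partial>lborel) = 0\<close> by simp
  also have "cmod \<dots> \<le> (\<integral>x. cmod (g x * h x - F x * h x) \<partial>lborel)" by (rule integral_norm_bound)
  also have "\<dots> \<le> (\<integral>x. (1 / (2 * e)) * (w x * (cmod (g x - F x))\<^sup>2) + (e * C / 2) * (1 / (1 + x\<^sup>2))
        + D * (indicator X x * cmod (F x)) \<partial>lborel)"
  proof (rule integral_mono)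
    show "integrable lborel (\<lambda>x. cmod (g x * h x - F x * h x))" using intgh intFh by auto
    have "integrable lborel (\<lambda>x. indicator X x * cmod (F x))"
      using integrable_mult_indicator[OF _ integrable_norm[OF intF], of X] by simp
    then show "integrable lborel (\<lambda>x. (1 / (2 * e)) * (w x * (cmod (g x - F x))\<^sup>2) + (e * C / 2) * (1 / (1 + x\<^sup>2))
        + D * (indicator X x * cmod (F x)))"
      by (intro Bochner_Integration.integrable_add integrable_mult_right intgF integrable_quadratic_decay)
    fix x :: real
    define u where "u = cmod (g x - F x)"
    define v where "v = \<bar>\<Gamma> k x\<bar>"
    have uv: "cmod (g x * h x - F x * h x) = u * v"
      unfolding left_diff_distrib[symmetric] norm_mult hn u_def v_def ..
    have nn: "(1 / (2 * e)) * (w x * u\<^sup>2) \<ge> 0" "(e * C / 2) * (1 / (1 + x\<^sup>2)) \<ge> 0" "D * (indicator X x * cmod (F x)) \<ge> 0"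
      using e w0[of x] C0 D0 by (auto simp: less_imp_le)
    show "cmod (g x * h x - F x * h x) \<le> (1 / (2 * e)) * (w x * (cmod (g x - F x))\<^sup>2) + (e * C / 2) * (1 / (1 + x\<^sup>2))
        + D * (indicator X x * cmod (F x))"
    proof (cases "x \<in> X")
      case True
      then have "g x = 0" using B_ge(1)[of k] by (auto simp: X_def g_def indicator_def)
      then have "u * v \<le> D * (indicator X x * cmod (F x))"
        using mult_left_mono[OF hD[of x] norm_ge_zero[of "F x"]] True by (simp add: u_def v_def mult.commute)
      then show ?thesis using nn unfolding uv u_def by linarith
    next
      case False
      then have q: "v\<^sup>2 / w x \<le> C / (1 + x\<^sup>2)" using quot[of x k] by (simp add: X_def v_def)
      have "u * v \<le> (1 / (2 * e)) * (w x * u\<^sup>2) + (e / 2) * (v\<^sup>2 / w x)"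
      proof -
        have "0 \<le> (w x * u - e * v)\<^sup>2 / (2 * e * w x)" using e w0[of x] by simp
        also have "\<dots> = (1 / (2 * e)) * (w x * u\<^sup>2) + (e / 2) * (v\<^sup>2 / w x) - u * v"
          using e w0[of x] by (simp add: power2_eq_square field_simps)
        finally show ?thesis by simp
      qed
      also have "(e / 2) * (v\<^sup>2 / w x) \<le> (e / 2) * (C / (1 + x\<^sup>2))"
        using q e by (intro mult_left_mono) auto
      finally have "u * v \<le> (1 / (2 * e)) * (w x * u\<^sup>2) + (e * C / 2) * (1 / (1 + x\<^sup>2))" by simp
      then show ?thesis using nn unfolding uv u_def by linarith
    qed
  qed
  also have "\<dots> = (1 / (2 * e)) * (\<integral>x. w x * (cmod (g x - F x))\<^sup>2 \<partial>lborel) + (e * C / 2) * I + D * T k"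
  proof -
    have i3: "integrable lborel (\<lambda>x. indicator X x * cmod (F x))"
      using integrable_mult_indicator[OF _ integrable_norm[OF intF], of X] by simp
    show ?thesis
      unfolding I_def T_def X_def[symmetric]
      by (subst Bochner_Integration.integral_add;
          (intro Bochner_Integration.integrable_add integrable_mult_right intgF integrable_quadratic_decay i3)?)
         (subst Bochner_Integration.integral_add;
          (intro integrable_mult_right intgF integrable_quadratic_decay)?;
          (simp only: Bochner_Integration.integral_mult_right_zero)?)
  qed
  also have "\<dots> \<le> (1 / (2 * e)) * e\<^sup>2 + (e * C / 2) * I + D * (1 / (4 * D))"
    using intgF_le k e D0 C0 by (intro add_mono mult_left_mono) auto
  also have "\<dots> = e * (1 + C * I) / 2 + 1 / 4"
    using e D0 by (simp add: power2_eq_square field_simps)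
  also have "\<dots> = 1 / 8 + 1 / 4"
  proof -
    have "1 + C * I > 0" using C0 I by (simp add: add_pos_nonneg)
    then have "e * (1 + C * I) = 1 / 4" by (simp add: e_def)
    then show ?thesis by simp
  qed
  finally show False by simp
qed

end

section \<open>The discrete example: the points\<close>

context gap_scales
begin

definition tau :: "int \<Rightarrow> real" where
  "tau n = (if of_int n \<in> gaps then exp (- real (m (THE j. of_int n \<in> gap j))) else 0)"

definition twin :: "int \<Rightarrow> real" where "twin n = of_int n + tau n"

lemma tau_eq:
  assumes "of_int n \<in> gap j"
  shows "tau n = exp (- real (m j))"
proof -
  have "(THE j. real_of_int n \<in> gap j) = j"
    using assms gap_unique by (intro the_equality) auto
  then show ?thesis using assms by (auto simp: tau_def gaps_def)
qed

lemma exp_m_le: "exp (- real (m j)) \<le> 1/64"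
proof -
  have "1 * exp (- real (m j)) \<le> real (2 * ((j + 2) * (2 ^ j * m j)) + 1) * exp (- real (m j))"
    by (intro mult_right_mono) auto
  also have "\<dots> \<le> (1/2) ^ j / 64" by (rule few)
  also have "\<dots> \<le> 1 / 64" by (intro divide_right_mono power_le_one) auto
  finally show ?thesis by simp
qed

lemma tau_bounds: "0 \<le> tau n" "tau n \<le> 1/64" "of_int n \<in> gaps \<Longrightarrow> tau n > 0"
  using exp_m_le by (auto simp: tau_def)

lemma gap_int_bounded: "of_int n \<in> gap j \<Longrightarrow> n \<in> {- int (Q j)..int (Q j)}"
proof -
  assume "real_of_int n \<in> gap j"
  then have "real_of_int \<bar>n\<bar> \<le> real_of_int (int (Q j))" by (simp add: gap_def)
  then have "\<bar>n\<bar> \<le> int (Q j)" by (simp only: of_int_le_iff)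
  then show ?thesis by auto
qed

definition levels :: "nat \<Rightarrow> int set" where
  "levels k = {n. \<exists>j<k. of_int n \<in> gap j}"

lemma finite_levels: "finite (levels k)"
proof -
  have "levels k \<subseteq> (\<Union>j<k. {- int (Q j)..int (Q j)})"
    unfolding levels_def using gap_int_bounded by blast
  then show ?thesis by (rule finite_subset) simp
qed

lemma sum_tau_le:
  assumes "finite S"
  shows "(\<Sum>n\<in>S. tau n) \<le> 1/32"
proof -
  define J where "J = (\<lambda>j. {n. real_of_int n \<in> gap j})"
  have finJ: "finite (J j)" for j
    unfolding J_def by (rule finite_subset[of _ "{- int (Q j)..int (Q j)}"]) (use gap_int_bounded in auto)
  have Jsum: "(\<Sum>n\<in>J j. tau n) \<le> (1/2) ^ j / 64" for j
  proof -
    have "card (J j) \<le> card {- int (Q j)..int (Q j)}"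
      unfolding J_def by (rule card_mono) (use gap_int_bounded in auto)
    then have c: "card (J j) \<le> 2 * Q j + 1" by simp
    have "(\<Sum>n\<in>J j. tau n) = real (card (J j)) * exp (- real (m j))"
      by (simp add: J_def tau_eq)
    also have "\<dots> \<le> real (2 * Q j + 1) * exp (- real (m j))"
      using c by (intro mult_right_mono) (simp_all only: of_nat_le_iff exp_ge_zero)
    also have "\<dots> \<le> (1/2) ^ j / 64" using few[of j] by (simp only: Q_def B_def)
    finally show ?thesis .
  qed
  obtain k where k: "\<And>n. n \<in> S \<Longrightarrow> real_of_int \<bar>n\<bar> < real k"
  proof -
    have "bdd_above ((\<lambda>n. real_of_int \<bar>n\<bar>) ` S)" using assms by simp
    then obtain u where u: "\<And>n. n \<in> S \<Longrightarrow> real_of_int \<bar>n\<bar> \<le> u" by (auto simp: bdd_above_def)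
    obtain k where "u < real k" using reals_Archimedean2 by blast
    show ?thesis
    proof (rule that[of k])
      fix n assume "n \<in> S"
      then show "real_of_int \<bar>n\<bar> < real k" using u[of n] \<open>u < real k\<close> by linarith
    qed
  qed
  have "(\<Sum>n\<in>S. tau n) = (\<Sum>n\<in>S \<inter> {n. of_int n \<in> gaps}. tau n)"
    using assms by (intro sum.mono_neutral_right) (auto simp: tau_def)
  also have "\<dots> \<le> (\<Sum>n\<in>(\<Union>j<k. J j). tau n)"
  proof (rule sum_mono2)
    show "S \<inter> {n. of_int n \<in> gaps} \<subseteq> (\<Union>j<k. J j)"
    proof
      fix n assume n: "n \<in> S \<inter> {n. of_int n \<in> gaps}"
      then obtain j where j: "real_of_int n \<in> gap j" by (auto simp: gaps_def)
      have "real (B j) \<le> real_of_int \<bar>n\<bar>" using j by (simp add: gap_def)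
      also have "\<dots> < real k" using k n by blast
      finally have "j < k" using B_ge(2)[of j] by simp
      then show "n \<in> (\<Union>j<k. J j)" using j by (auto simp: J_def)
    qed
  qed (use finJ tau_bounds in auto)
  also have "\<dots> = (\<Sum>j<k. \<Sum>n\<in>J j. tau n)"
    using finJ gap_unique by (intro sum.UNION_disjoint) (auto simp: J_def)
  also have "\<dots> \<le> (\<Sum>j<k. (1/2) ^ j / 64)" by (intro sum_mono Jsum)
  also have "\<dots> = 1/32 - (1/2) ^ k / 32" by (induction k) simp_all
  also have "\<dots> \<le> 1/32" by simp
  finally show ?thesis .
qed

text \<open>Blocks of three consecutive indices share an integer \<open>n\<close>. Outside the gaps the three points are \<open>n\<close>
  and \<open>n \<plusminus> 1/4\<close>; in the gaps they coincide, so that there the points have only one location per unit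
  length. The repetition changes the measure by bounded weights only.\<close>

definition xs :: "int \<Rightarrow> real" where
  "xs i = (if of_int (i div 3) \<in> gaps then of_int (i div 3)
           else of_int (i div 3) + (of_int (i mod 3) - 1) / 4)"

definition ys :: "int \<Rightarrow> real" where
  "ys i = (if of_int (i div 3) \<in> gaps then twin (i div 3) else xs i)"

definition xys :: "int \<times> bool \<Rightarrow> real" where
  "xys = (\<lambda>(i, b). if b then xs i else ys i)"

lemma xs_cases:
  obtains n where "xs i = of_int n"
  | n where "of_int n \<notin> gaps" "xs i = of_int n - 1/4 \<or> xs i = of_int n + 1/4"
proof (cases "of_int (i div 3) \<in> gaps")
  case True
  then show ?thesis using that(1)[of "i div 3"] by (simp add: xs_def)
next
  case False
  have "i mod 3 \<in> {0, 1, 2}" by auto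
  then consider "i mod 3 = 0" | "i mod 3 = 1" | "i mod 3 = 2" by blast
  then show ?thesis
    using that(1)[of "i div 3"] that(2)[of "i div 3"] False by cases (simp_all add: xs_def)
qed

lemma xys_cases:
  obtains n where "xys z = of_int n"
  | n where "of_int n \<notin> gaps" "xys z = of_int n - 1/4 \<or> xys z = of_int n + 1/4"
  | n where "of_int n \<in> gaps" "xys z = twin n"
proof (cases z)
  case (Pair i b)
  show ?thesis
  proof (cases "b \<or> of_int (i div 3) \<notin> gaps")
    case True
    then have e: "xys z = xs i" by (auto simp: Pair xys_def ys_def)
    show ?thesis by (rule xs_cases[of i]) (use that e in auto)
  next
    case False
    then show ?thesis using that(3)[of "i div 3"] by (auto simp: Pair xys_def ys_def)
  qed
qed

lemma integrable_int_decay: "integrable (count_space UNIV) (\<lambda>i::int. C / (1 + (of_int i)\<^sup>2) :: real)"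
proof -
  have "summable (\<lambda>n. inverse (real n ^ 2))" by (rule inverse_power_summable) simp
  then have s: "Infinite_Set_Sum.abs_summable_on (\<lambda>n::nat. 1 / (1 + (real n)\<^sup>2)) UNIV"
    unfolding Infinite_Set_Sum.abs_summable_on_nat_iff'
  proof (rule summable_comparison_test[rotated], intro exI[of _ 1] allI impI)
    fix n :: nat assume "n \<ge> 1"
    then have "inverse (1 + real n ^ 2) \<le> inverse (real n ^ 2)"
      by (intro le_imp_inverse_le) auto
    then show "norm (norm (1 / (1 + (real n)\<^sup>2))) \<le> inverse (real n ^ 2)"
      by (simp add: inverse_eq_divide)
  qed
  let ?f = "\<lambda>i::int. 1 / (1 + (of_int i)\<^sup>2) :: real"
  have "Infinite_Set_Sum.abs_summable_on ?f (range int)"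
    by (subst Infinite_Set_Sum.abs_summable_on_reindex_iff[symmetric]) (simp_all add: inj_on_def s)
  moreover have "Infinite_Set_Sum.abs_summable_on ?f (range (\<lambda>n. - int n))"
    by (subst Infinite_Set_Sum.abs_summable_on_reindex_iff[symmetric]) (simp_all add: inj_on_def s)
  ultimately have "Infinite_Set_Sum.abs_summable_on ?f (range int \<union> range (\<lambda>n. - int n))"
    by (rule Infinite_Set_Sum.abs_summable_on_union)
  moreover have "range int \<union> range (\<lambda>n. - int n) = UNIV"
  proof -
    have "i \<in> range int \<union> range (\<lambda>n. - int n)" for i :: int
      by (cases i rule: int_cases2) auto
    then show ?thesis by auto
  qed
  ultimately have "integrable (count_space UNIV) ?f"
    unfolding Infinite_Set_Sum.abs_summable_on_def by simp
  then have "integrable (count_space UNIV) (\<lambda>i. C * ?f i)"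
    by (rule integrable_mult_right)
  then show ?thesis by simp
qed

lemma xys_far: "1 / (1 + (xys (i, b))\<^sup>2) \<le> 100 / (1 + (of_int i)\<^sup>2)"
proof -
  define n where "n = \<bar>real_of_int (i div 3)\<bar>"
  have r: "0 \<le> real_of_int (i mod 3)" "real_of_int (i mod 3) \<le> 2"
  proof -
    have "0 \<le> i mod 3" "i mod 3 \<le> 2" by auto
    then show "0 \<le> real_of_int (i mod 3)" "real_of_int (i mod 3) \<le> 2" by linarith+
  qed
  have "real_of_int (3 * (i div 3) + i mod 3) = real_of_int i" by simp
  then have i: "real_of_int i = 3 * real_of_int (i div 3) + real_of_int (i mod 3)"
    unfolding of_int_add of_int_mult by simp
  then have "\<bar>real_of_int i\<bar> \<le> 3 * n + 2" using r unfolding n_def by linarith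
  then have "\<bar>real_of_int i\<bar>\<^sup>2 \<le> (3 * n + 2)\<^sup>2" by (rule power_mono) simp
  then have i2: "(real_of_int i)\<^sup>2 \<le> (3 * n + 2)\<^sup>2" by simp
  have "\<bar>xys (i, b) - real_of_int (i div 3)\<bar> \<le> 1/2"
    using r tau_bounds(1,2)[of "i div 3"] by (auto simp: xys_def xs_def ys_def twin_def)
  then have "\<bar>xys (i, b)\<bar> \<ge> n - 1/2" unfolding n_def by linarith
  then have "\<bar>xys (i, b)\<bar> \<ge> max 0 (n - 1/2)" by simp
  then have "(max 0 (n - 1/2))\<^sup>2 \<le> \<bar>xys (i, b)\<bar>\<^sup>2" by (rule power_mono) simp
  then have x2: "(max 0 (n - 1/2))\<^sup>2 \<le> (xys (i, b))\<^sup>2" by simp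
  have "1 + (3 * n + 2)\<^sup>2 \<le> 100 * (1 + (max 0 (n - 1/2))\<^sup>2)"
  proof (cases "n \<ge> 1/2")
    case True
    have "0 \<le> 91 * (n - 1)\<^sup>2 + 70 * n + 29" using True by (intro add_nonneg_nonneg) auto
    then show ?thesis using True by (simp add: power2_eq_square algebra_simps)
  next
    case False
    then have "3 * n + 2 \<le> 4" "0 \<le> 3 * n + 2" by (auto simp: n_def)
    then have "(3 * n + 2)\<^sup>2 \<le> 4\<^sup>2" by (intro power_mono) auto
    then show ?thesis using False by simp
  qed
  also have "100 * (1 + (max 0 (n - 1/2))\<^sup>2) \<le> 100 * (1 + (xys (i, b))\<^sup>2)" using x2 by simp
  finally have "1 + (real_of_int i)\<^sup>2 \<le> 100 * (1 + (xys (i, b))\<^sup>2)" using i2 by linarith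
  moreover have "1 + (xys (i, b))\<^sup>2 > 0" "1 + (real_of_int i)\<^sup>2 > 0" by (auto simp: add_pos_nonneg)
  ultimately show ?thesis by (simp add: divide_le_eq pos_le_divide_eq mult.commute)
qed

definition MX :: "real measure" where "MX = distr (count_space UNIV) borel xs"
definition MXY :: "real measure" where "MXY = distr (count_space UNIV) borel xys"

lemma quadratic_growth_MX: "quadratic_growth MX"
  unfolding quadratic_growth_def
proof
  have "integrable (count_space UNIV) (\<lambda>i. 1 / (1 + (xs i)\<^sup>2))"
  proof (rule Bochner_Integration.integrable_bound[OF integrable_int_decay[of 100]])
    show "AE i in count_space UNIV. norm (1 / (1 + (xs i)\<^sup>2)) \<le> norm (100 / (1 + (real_of_int i)\<^sup>2))"
      using xys_far[of _ True] by (intro AE_I2) (simp add: xys_def)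
  qed simp
  then show "integrable MX (\<lambda>t. 1 / (1 + t\<^sup>2))"
    unfolding MX_def by (subst integrable_distr_eq) auto
qed (simp add: MX_def)

lemma quadratic_growth_MXY: "quadratic_growth MXY"
  unfolding quadratic_growth_def
proof
  have b: "integrable (count_space UNIV) (\<lambda>i. 1 / (1 + (xys (i, b))\<^sup>2))" for b
  proof (rule Bochner_Integration.integrable_bound[OF integrable_int_decay[of 100]])
    show "AE i in count_space UNIV. norm (1 / (1 + (xys (i, b))\<^sup>2)) \<le> norm (100 / (1 + (real_of_int i)\<^sup>2))"
      using xys_far[of _ b] by (intro AE_I2) simp
  qed simp
  let ?f = "\<lambda>z. 1 / (1 + (xys z)\<^sup>2)"
  have "Infinite_Set_Sum.abs_summable_on ?f (range (\<lambda>i. (i, b)))" for b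
    by (subst Infinite_Set_Sum.abs_summable_on_reindex_iff[symmetric])
      (simp_all add: inj_on_def Infinite_Set_Sum.abs_summable_on_def b)
  then have "Infinite_Set_Sum.abs_summable_on ?f (range (\<lambda>i. (i, True)) \<union> range (\<lambda>i. (i, False)))"
    by (intro Infinite_Set_Sum.abs_summable_on_union)
  moreover have "range (\<lambda>i. (i, True)) \<union> range (\<lambda>i. (i, False)) = (UNIV :: (int \<times> bool) set)"
  proof -
    have "(i, b) \<in> range (\<lambda>i. (i, True)) \<union> range (\<lambda>i. (i, False))" for i :: int and b
      by (cases b) auto
    then show ?thesis by auto
  qed
  ultimately have "integrable (count_space UNIV) ?f"
    unfolding Infinite_Set_Sum.abs_summable_on_def by simp
  then show "integrable MXY (\<lambda>t. 1 / (1 + t\<^sup>2))"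
    unfolding MXY_def by (subst integrable_distr_eq) auto
qed (simp add: MXY_def)

section \<open>Upper bounds: approximating point masses\<close>

text \<open>The point mass at \<open>q\<close> is approximated by \<open>A k\<close> times an element of small type \<open>\<eta>\<close> which
  imitates \<open>f\<close> up to the scale \<open>B k\<close>: inside, \<open>A k * f\<close> vanishes at all points but \<open>q\<close>; in the gap,
  \<open>A k\<close> alone vanishes; and beyond, the imitation is small.\<close>

lemma atom_approx:
  fixes p :: "'i \<Rightarrow> real" and f :: "complex \<Rightarrow> complex" and A :: "nat \<Rightarrow> real \<Rightarrow> real"
  defines "M \<equiv> distr (count_space UNIV) borel p"
  assumes M: "quadratic_growth M" and a: "a > 0" and eta: "\<eta> > 0"
    and f: "f holomorphic_on UNIV" "\<And>z. cmod (f z) \<le> C * exp (l * cmod z)" "l \<ge> 0"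
    and A1: "\<And>k H. H \<in> fourier_space \<eta> \<Longrightarrow> (\<lambda>x. of_real (A k x) * H x) \<in> fourier_space a"
    and A2: "\<And>k i. \<bar>A k (p i)\<bar> \<le> CA"
    and A3: "\<And>k i. p i \<noteq> q \<Longrightarrow> \<bar>p i\<bar> \<le> real (B k) \<Longrightarrow> of_real (A k (p i)) * f (of_real (p i)) = 0"
    and A4: "\<And>k i. p i \<noteq> q \<Longrightarrow> \<bar>p i\<bar> > real (B k) \<Longrightarrow> \<bar>p i\<bar> < real (Q k) \<Longrightarrow> A k (p i) = 0"
    and A5: "\<And>k. cmod (of_real (A k q) * f (of_real q)) \<ge> c" "c > 0" "q \<in> range p"
  shows "indicator {q} \<in> L2_closure M (fourier_space a)"
  unfolding L2_closure_def
proof (intro CollectI conjI allI impI)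
  have CA: "CA \<ge> 0" by (rule order_trans[OF abs_ge_zero A2[of 0 undefined]])
  have ind_b: "(indicator {q} :: real \<Rightarrow> complex) \<in> borel_measurable borel" by measurable
  show "indicator {q} \<in> L2 M"
  proof (rule L2_of_decay(1)[OF M ind_b])
    have "1 + q\<^sup>2 > 0" by (simp add: add_pos_nonneg)
    then have "1 + q\<^sup>2 \<noteq> 0" by linarith
    then show "AE x in M. cmod (indicator {q} x) \<le> (1 + q\<^sup>2) / (1 + x\<^sup>2)"
      by (intro AE_I2) (auto simp: indicator_def add_pos_nonneg divide_nonneg_nonneg)
  qed
  fix e :: real assume e: "e > 0"
  define I where "I = (\<integral>x. 1 / (1 + x\<^sup>2) \<partial>M)"
  have I: "I \<ge> 0" unfolding I_def by simp
  define \<delta> where "\<delta> = sqrt (e / (2 * (I + 1))) * c / (CA + 1)"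
  have \<delta>: "\<delta> > 0" using e I CA A5(2) by (simp add: \<delta>_def)
  obtain R where R: "R \<ge> 1"
    "\<And>\<delta>. \<delta> > 0 \<Longrightarrow> \<exists>B0. \<forall>B\<ge>B0. \<exists>F\<in>fourier_space \<eta>.
      (\<forall>t. \<bar>t\<bar> \<le> B \<longrightarrow> cmod (F t - f (of_real t)) \<le> \<delta> / (1 + t^2)) \<and>
      (\<forall>t. \<bar>t\<bar> \<ge> R * B \<longrightarrow> cmod (F t) \<le> \<delta> / (1 + t^2))"
    using gap_approximation[OF f eta] by blast
  obtain B0 where B0: "\<And>B. B \<ge> B0 \<Longrightarrow> \<exists>F\<in>fourier_space \<eta>.
      (\<forall>t. \<bar>t\<bar> \<le> B \<longrightarrow> cmod (F t - f (of_real t)) \<le> \<delta> / (1 + t^2)) \<and>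
      (\<forall>t. \<bar>t\<bar> \<ge> R * B \<longrightarrow> cmod (F t) \<le> \<delta> / (1 + t^2))"
    using R(2)[OF \<delta>] by blast
  obtain k where "real k \<ge> max (max R B0) \<bar>q\<bar>" using real_arch_simple by blast
  then have k: "real k \<ge> R" "real k \<ge> B0" "real k \<ge> \<bar>q\<bar>" by auto
  have Bk: "real (B k) \<ge> real k" using B_ge(2)[of k] by simp
  have "real (B k) \<ge> B0" using Bk k by linarith
  then obtain H where H: "H \<in> fourier_space \<eta>"
    "\<And>t. \<bar>t\<bar> \<le> real (B k) \<Longrightarrow> cmod (H t - f (of_real t)) \<le> \<delta> / (1 + t^2)"
    "\<And>t. \<bar>t\<bar> \<ge> R * real (B k) \<Longrightarrow> cmod (H t) \<le> \<delta> / (1 + t^2)"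
    using B0[of "real (B k)"] by blast
  have RQ: "R * real (B k) \<le> real (Q k)"
  proof -
    have "R * real (B k) \<le> real (k + 2) * real (B k)" using k by (intro mult_right_mono) auto
    then show ?thesis unfolding Q_def of_nat_mult .
  qed
  define w where "w = of_real (A k q) * f (of_real q)"
  have w: "cmod w \<ge> c" "w \<noteq> 0" using A5(1)[of k] A5(2) by (auto simp: w_def)
  define F where "F = (\<lambda>x. (1 / w) * (of_real (A k x) * H x))"
  have F: "F \<in> fourier_space a" unfolding F_def by (intro fourier_space_cmult a A1 H)
  have Fb: "F \<in> borel_measurable borel" by (rule fourier_space_borel[OF F a])
  define E where "E = CA * \<delta> / c"
  have pw: "cmod (indicator {q} (p i) - F (p i)) \<le> E / (1 + (p i)\<^sup>2)" for i
  proof -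
    define x where "x = p i"
    have pos: "1 + x\<^sup>2 > 0" by (simp add: add_pos_nonneg)
    have bound: "cmod ((1 / w) * (of_real (A k x) * u)) \<le> E / (1 + x\<^sup>2)" if "cmod u \<le> \<delta> / (1 + x\<^sup>2)" for u
    proof -
      have "cmod ((1 / w) * (of_real (A k x) * u)) = (1 / cmod w) * (\<bar>A k x\<bar> * cmod u)"
        by (simp add: norm_mult norm_divide)
      also have "\<dots> \<le> (1 / c) * (CA * (\<delta> / (1 + x\<^sup>2)))"
        using w A5(2) A2[of k i] that CA unfolding x_def[symmetric]
        by (intro mult_mono frac_le) auto
      also have "\<dots> = E / (1 + x\<^sup>2)" by (simp add: E_def)
      finally show ?thesis .
    qed
    have E0: "E / (1 + x\<^sup>2) \<ge> 0" using CA \<delta> A5(2) pos by (simp add: E_def)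
    consider "x = q" | "x \<noteq> q" "\<bar>x\<bar> \<le> real (B k)" | "x \<noteq> q" "\<bar>x\<bar> > real (B k)" "\<bar>x\<bar> < real (Q k)" | "x \<noteq> q" "\<bar>x\<bar> \<ge> real (Q k)"
      by linarith
    then have "cmod (indicator {q} x - F x) \<le> E / (1 + x\<^sup>2)"
    proof cases
      case 1
      have "indicator {q} x - F x = (1 / w) * (of_real (A k x) * (f (of_real x) - H x))"
        using 1 w(2) by (simp add: F_def w_def right_diff_distrib diff_divide_distrib)
      moreover have "cmod (f (of_real x) - H x) \<le> \<delta> / (1 + x\<^sup>2)"
        using H(2)[of x] 1 k Bk by (simp add: norm_minus_commute)
      ultimately show ?thesis using bound by simp
    next
      case 2
      have "indicator {q} x - F x = (1 / w) * (of_real (A k x) * (f (of_real x) - H x))"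
        using 2 A3[of i k] unfolding x_def by (simp add: F_def right_diff_distrib diff_divide_distrib)
      moreover have "cmod (f (of_real x) - H x) \<le> \<delta> / (1 + x\<^sup>2)"
        using H(2)[of x] 2 by (simp add: norm_minus_commute)
      ultimately show ?thesis using bound by simp
    next
      case 3
      then have "A k x = 0" using A4[of i k] unfolding x_def by blast
      then show ?thesis using 3 E0 by (simp add: F_def)
    next
      case 4
      then have "cmod (H x) \<le> \<delta> / (1 + x\<^sup>2)" using H(3)[of x] RQ by linarith
      then show ?thesis using bound[of "H x"] 4 by (simp add: F_def)
    qed
    then show ?thesis by (simp add: x_def)
  qed
  have db: "(\<lambda>x. indicator {q} x - F x) \<in> borel_measurable borel" using Fb by measurable
  have "{x. cmod (indicator {q} x - F x) \<le> E / (1 + x\<^sup>2)} \<in> sets borel" using db by measurable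
  then have "AE x in M. cmod (indicator {q} x - F x) \<le> E / (1 + x\<^sup>2)"
    unfolding M_def by (subst AE_distr_count_space) (use pw in auto)
  from L2_of_decay(2)[OF M db this]
  have "(\<integral>x. (cmod (indicator {q} x - F x))\<^sup>2 \<partial>M) \<le> E\<^sup>2 * I" by (simp only: I_def)
  also have "\<dots> < e"
  proof -
    have "E = CA / (CA + 1) * sqrt (e / (2 * (I + 1)))" using A5(2) by (simp add: E_def \<delta>_def)
    also have "\<dots> \<le> 1 * sqrt (e / (2 * (I + 1)))"
      using CA e I by (intro mult_right_mono) auto
    finally have "E \<le> sqrt (e / (2 * (I + 1)))" by simp
    moreover have "E \<ge> 0" using CA \<delta> A5(2) by (simp add: E_def)
    ultimately have "E\<^sup>2 \<le> (sqrt (e / (2 * (I + 1))))\<^sup>2" by (rule power_mono)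
    then have "E\<^sup>2 \<le> e / (2 * (I + 1))" using e I by simp
    then have "E\<^sup>2 * I \<le> e / (2 * (I + 1)) * (I + 1)" using e I by (intro mult_mono) auto
    also have "\<dots> = e / 2" using I by (simp add: field_simps)
    finally show ?thesis using e by linarith
  qed
  finally show "\<exists>F\<in>fourier_space a. (\<integral>x. (cmod (indicator {q} x - F x))\<^sup>2 \<partial>M) < e" using F by blast
qed

text \<open>The factor that moves the zeros of a transform from the integers in \<open>U\<close> to their twins. At these
  integers themselves its value is \<open>0\<close>, by division by zero.\<close>

definition rho :: "int set \<Rightarrow> real \<Rightarrow> real" where
  "rho U x = (\<Prod>n\<in>U. (x - twin n) / (x - of_int n))"

lemma rho_fourier:
  assumes "finite U" "b > 0" "F \<in> fourier_space b" "\<And>n. n \<in> U \<Longrightarrow> F (of_int n) = 0"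
  obtains F' where "F' \<in> fourier_space b" "\<And>x. x \<notin> of_int ` U \<Longrightarrow> F' x = of_real (rho U x) * F x"
  using assms(1,4)
proof (induction U arbitrary: thesis)
  case empty
  then show ?case using assms(3) by (auto simp: rho_def)
next
  case (insert n U)
  obtain F' where F': "F' \<in> fourier_space b" "\<And>x. x \<notin> of_int ` U \<Longrightarrow> F' x = of_real (rho U x) * F x"
    using insert.IH insert.prems(2) by auto
  have "of_int n \<notin> real_of_int ` U" using insert.hyps(2) by auto
  then have "F' (of_int n) = 0" using F'(2) insert.prems(2) by simp
  then obtain H where H: "H \<in> fourier_space b" "\<And>x. (of_real x - of_real (of_int n)) * H x = F' x"
    using fourier_space_divide[OF assms(2) F'(1)] by blast
  define F'' where "F'' = (\<lambda>x. (of_real x - complex_of_real (twin n)) * H x)"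
  have "F'' \<in> fourier_space b"
    unfolding F''_def by (rule fourier_space_mult_linear[OF assms(2) H(1)])
  moreover have "F'' x = of_real (rho (insert n U) x) * F x" if "x \<notin> of_int ` insert n U" for x
  proof -
    have xn: "x - of_int n \<noteq> 0" using that by auto
    have "H x = F' x / of_real (x - of_int n)"
    proof -
      have "of_real (x - of_int n) * H x = F' x" using H(2)[of x] by (simp only: of_real_diff)
      moreover have "complex_of_real (x - of_int n) \<noteq> 0" unfolding of_real_eq_0_iff using xn .
      ultimately show ?thesis by (metis nonzero_mult_div_cancel_left)
    qed
    then have "F'' x = of_real (x - twin n) * (of_real (rho U x) * F x / of_real (x - of_int n))"
      using F'(2)[of x] that by (simp add: F''_def)
    also have "\<dots> = of_real ((x - twin n) / (x - of_int n) * rho U x) * F x"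
      by simp
    also have "(x - twin n) / (x - of_int n) * rho U x = rho (insert n U) x"
      using insert.hyps by (simp add: rho_def)
    finally show ?thesis .
  qed
  ultimately show ?case by (rule insert.prems(1))
qed

lemma prod_one_minus_ge:
  fixes t :: "'a \<Rightarrow> real"
  assumes "finite U" "\<And>n. n \<in> U \<Longrightarrow> 0 \<le> t n \<and> t n \<le> 1"
  shows "(\<Prod>n\<in>U. 1 - t n) \<ge> 1 - (\<Sum>n\<in>U. t n)"
  using assms
proof (induction U)
  case (insert n U)
  have p: "0 \<le> (\<Prod>n\<in>U. 1 - t n)" "(\<Prod>n\<in>U. 1 - t n) \<le> 1"
    using insert.prems by (auto intro!: prod_nonneg prod_le_1)
  have "t n * (\<Prod>n\<in>U. 1 - t n) \<le> t n" using p insert.prems by (intro mult_left_le) auto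
  then have "(1 - t n) * (\<Prod>n\<in>U. 1 - t n) \<ge> (\<Prod>n\<in>U. 1 - t n) - t n"
    by (simp add: left_diff_distrib)
  moreover have "(\<Prod>n\<in>U. 1 - t n) \<ge> 1 - (\<Sum>n\<in>U. t n)" using insert by auto
  ultimately have "(1 - t n) * (\<Prod>n\<in>U. 1 - t n) \<ge> 1 - (t n + (\<Sum>n\<in>U. t n))" by linarith
  then show ?case using insert.hyps by simp
qed simp

lemma prod_one_plus_le_exp:
  fixes t :: "'a \<Rightarrow> real"
  assumes "finite U" "\<And>n. n \<in> U \<Longrightarrow> 0 \<le> t n"
  shows "(\<Prod>n\<in>U. 1 + t n) \<le> exp (\<Sum>n\<in>U. t n)"
proof -
  have "(\<Prod>n\<in>U. 1 + t n) \<le> (\<Prod>n\<in>U. exp (t n))"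
    using assms by (intro prod_mono) (auto intro: exp_ge_add_one_self add_nonneg_nonneg)
  then show ?thesis using assms(1) by (simp add: exp_sum)
qed

lemma rho_bounds:
  assumes "finite U" "\<And>n. n \<in> U \<Longrightarrow> \<bar>x - of_int n\<bar> \<ge> 1/4"
  shows "1/2 \<le> rho U x" "rho U x \<le> 2"
proof -
  have fac: "1 - 4 * tau n \<le> (x - twin n) / (x - of_int n) \<and> (x - twin n) / (x - of_int n) \<le> 1 + 4 * tau n
      \<and> 0 \<le> 1 - 4 * tau n" if "n \<in> U" for n
  proof -
    define u where "u = x - of_int n"
    have u: "\<bar>u\<bar> \<ge> 1/4" using assms(2)[OF that] by (simp add: u_def)
    then have u0: "u \<noteq> 0" by auto
    have "(x - twin n) / (x - of_int n) = 1 - tau n / u"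
      using u0 unfolding u_def twin_def by (simp add: field_simps)
    moreover have "\<bar>tau n / u\<bar> \<le> 4 * tau n"
    proof -
      have "\<bar>tau n / u\<bar> = tau n / \<bar>u\<bar>" using tau_bounds(1)[of n] by (simp add: abs_divide)
      also have "\<dots> \<le> tau n / (1/4)" using u tau_bounds(1)[of n] by (intro divide_left_mono) auto
      finally show ?thesis by simp
    qed
    then have "tau n / u \<le> 4 * tau n" "- (tau n / u) \<le> 4 * tau n" by linarith+
    ultimately show ?thesis using tau_bounds(2)[of n] by linarith
  qed
  then have fac0: "0 \<le> (x - twin n) / (x - of_int n)" if "n \<in> U" for n
    using that order_trans by blast
  have s: "(\<Sum>n\<in>U. 4 * tau n) \<le> 1/8"
    using sum_tau_le[OF assms(1)] unfolding sum_distrib_left[symmetric] by simp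
  have "1 - (\<Sum>n\<in>U. 4 * tau n) \<le> (\<Prod>n\<in>U. 1 - 4 * tau n)"
    by (rule prod_one_minus_ge[OF assms(1)]) (use fac tau_bounds(1) in force)
  also have "\<dots> \<le> rho U x" unfolding rho_def by (intro prod_mono) (use fac in auto)
  finally show "1/2 \<le> rho U x" using s by linarith
  have "rho U x \<le> (\<Prod>n\<in>U. 1 + 4 * tau n)"
    unfolding rho_def by (intro prod_mono) (use fac fac0 in auto)
  also have "\<dots> \<le> exp (\<Sum>n\<in>U. 4 * tau n)"
    by (rule prod_one_plus_le_exp[OF assms(1)]) (simp add: tau_bounds)
  also have "\<dots> \<le> exp (1/2)" using s by simp
  also have "\<dots> \<le> 2" by (rule exp_half_le2)
  finally show "rho U x \<le> 2" .
qed

lemma rho_eq_0: "finite U \<Longrightarrow> n \<in> U \<Longrightarrow> x = twin n \<or> x = of_int n \<Longrightarrow> rho U x = 0"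
  unfolding rho_def by (subst prod_zero_iff) auto

lemma levels_Suc_iff:
  assumes "of_int n \<in> gaps" "\<bar>twin n\<bar> < real (Q k)"
  shows "n \<in> levels (Suc k)"
proof -
  obtain j where j: "of_int n \<in> gap j" using assms(1) by (auto simp: gaps_def)
  have "\<not> k < j"
  proof
    assume "k < j"
    then have "real (Q k) + 1 \<le> real (B j)" using Q_less_B[of k j] by linarith
    also have "\<dots> \<le> \<bar>of_int n\<bar>" using j by (simp add: gap_def)
    finally show False using assms(2) tau_bounds[of n] unfolding twin_def by linarith
  qed
  then show ?thesis using j unfolding levels_def by (auto simp: not_less less_Suc_eq_le)
qed

lemma gap_of_quarter:
  assumes "of_int n \<notin> gaps" "x = of_int n - 1/4 \<or> x = of_int n + 1/4" "\<bar>x\<bar> > real (B k)" "\<bar>x\<bar> < real (Q k)"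
  shows False
proof -
  have "real_of_int (int (B k)) < real_of_int (\<bar>n\<bar> + 1)" "real_of_int \<bar>n\<bar> < real_of_int (int (Q k) + 1)"
    using assms(2-4) by auto
  then have "int (B k) < \<bar>n\<bar> + 1" "\<bar>n\<bar> < int (Q k) + 1" by (simp_all only: of_int_less_iff)
  then have "int (B k) \<le> \<bar>n\<bar>" "\<bar>n\<bar> \<le> int (Q k)" by linarith+
  then have "real_of_int (int (B k)) \<le> real_of_int \<bar>n\<bar>" "real_of_int \<bar>n\<bar> \<le> real_of_int (int (Q k))"
    by (simp_all only: of_int_le_iff)
  then have "of_int n \<in> gap k" by (simp add: gap_def)
  then show False using assms(1) by (auto simp: gaps_def)
qed

lemma xs_in_gap:
  assumes "\<bar>xs i\<bar> > real (B k)" "\<bar>xs i\<bar> < real (Q k)"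
  obtains n where "xs i = of_int n"
  by (cases rule: xs_cases[of i]) (use gap_of_quarter[OF _ _ assms] that in blast)+

lemma xys_in_gap:
  assumes "\<bar>xys z\<bar> > real (B k)" "\<bar>xys z\<bar> < real (Q k)"
  obtains n where "xys z = of_int n" | n where "of_int n \<in> gaps" "xys z = twin n"
  by (cases rule: xys_cases[of z]) (use gap_of_quarter[OF _ _ assms] that in blast)+

lemma int_far: "n \<noteq> n' \<Longrightarrow> 1 \<le> \<bar>real_of_int n - of_int n'\<bar>"
proof -
  assume "n \<noteq> n'"
  then have "1 \<le> \<bar>n - n'\<bar>" by auto
  then have "real_of_int 1 \<le> real_of_int \<bar>n - n'\<bar>" by (simp only: of_int_le_iff)
  then show ?thesis by simp
qed

lemma quarter_far:
  assumes "x = real_of_int n - 1/4 \<or> x = of_int n + 1/4"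
  shows "1/4 \<le> \<bar>x - of_int n'\<bar>"
proof (cases "n = n'")
  case True
  then show ?thesis using assms by auto
next
  case False
  show ?thesis using assms int_far[OF False] by (elim disjE) (simp only:, linarith)+
qed

lemma sin_pi_int [simp]: "sin (pi * of_int n) = 0"
  using sin_zero_iff_int2 by (metis mult.commute)

lemma Sinc_pi_int: "n \<noteq> n0 \<Longrightarrow> Sinc (pi * (of_int n - of_int n0)) = 0"
  using sin_pi_int[of "n - n0"] by (simp add: Sinc_def)

lemma cos_2pi_quarter:
  assumes "x = of_int n - 1/4 \<or> x = of_int n + 1/4"
  shows "cos (2 * pi * x) = 0"
proof -
  have *: "2 * pi * (real_of_int n - 1/4) = 2 * pi * real_of_int n - pi / 2"
       "2 * pi * (real_of_int n + 1/4) = 2 * pi * real_of_int n + pi / 2"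
    by (simp_all add: field_simps)
  have "cos (2 * pi * (real_of_int n - 1/4)) = 0" "cos (2 * pi * (real_of_int n + 1/4)) = 0"
    unfolding * cos_add cos_diff sin_int_2pin cos_pi_half by simp_all
  then show ?thesis using assms by auto
qed

lemma Sinc_2pi_quarter:
  assumes "x = of_int n - 1/4 \<or> x = of_int n + 1/4" "q = of_int n' - 1/4 \<or> q = of_int n' + 1/4" "x \<noteq> q"
  shows "Sinc (2 * pi * (x - q)) = 0"
proof -
  have "\<exists>k::int. 2 * (x - q) = of_int k"
    using assms(1,2)
  proof (elim disjE)
    assume "x = of_int n - 1/4" "q = of_int n' - 1/4"
    then show ?thesis by (intro exI[of _ "2 * (n - n')"]) simp
  next
    assume "x = of_int n + 1/4" "q = of_int n' + 1/4"
    then show ?thesis by (intro exI[of _ "2 * (n - n')"]) simp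
  next
    assume "x = of_int n - 1/4" "q = of_int n' + 1/4"
    then show ?thesis by (intro exI[of _ "2 * (n - n') - 1"]) simp
  next
    assume "x = of_int n + 1/4" "q = of_int n' - 1/4"
    then show ?thesis by (intro exI[of _ "2 * (n - n') + 1"]) simp
  qed
  then obtain k :: int where k: "2 * (x - q) = of_int k" by blast
  have "2 * pi * (x - q) = pi * (2 * (x - q))" by simp
  then have "sin (2 * pi * (x - q)) = 0" unfolding k by (simp only: sin_pi_int)
  moreover have "2 * pi * (x - q) \<noteq> 0" using assms(3) by simp
  ultimately show ?thesis by (simp only: Sinc_def if_False div_0)
qed

lemma cos_growth: "cmod (cos (of_real (2 * pi) * z)) \<le> 1 * exp (2 * pi * cmod z)"
  using norm_cos_le_exp[of "of_real (2 * pi) * z"] by (simp add: norm_mult)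

lemma cos_complex_real: "cos (of_real (2 * pi) * of_real x) = complex_of_real (cos (2 * pi * x))"
  unfolding of_real_mult[symmetric] cos_of_real ..

lemma csinc_growth: "cmod (csinc z) \<le> 2 * exp (cmod z)"
proof (cases "cmod z \<le> 1/2")
  case True
  have "(cmod z)\<^sup>2 \<le> (1/2)\<^sup>2" using True by (intro power_mono) auto
  then have "cmod (csinc z - 1) \<le> 1" using norm_csinc_diff_1[OF True] by (simp add: power2_eq_square)
  then have "cmod (csinc z) \<le> 2" using norm_triangle_ineq[of "csinc z - 1" 1] by simp
  moreover have "1 \<le> exp (cmod z)" by simp
  ultimately show ?thesis by linarith
next
  case False
  then have z: "z \<noteq> 0" by auto
  have "cmod (sin z) \<le> exp \<bar>Im z\<bar>" using cmod_sin_le_exp[of 1 z] by simp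
  also have "\<dots> \<le> exp (cmod z)" using abs_Im_le_cmod[of z] by simp
  also have "1/2 * (2 * exp (cmod z)) \<le> cmod z * (2 * exp (cmod z))"
    using False by (intro mult_right_mono) auto
  then have "exp (cmod z) \<le> cmod z * (2 * exp (cmod z))" by simp
  finally show ?thesis using z by (simp add: csinc_def norm_divide pos_divide_le_eq mult.commute)
qed

lemma csinc_shift:
  shows "(\<lambda>z. csinc (of_real (2 * pi) * (z - of_real q))) holomorphic_on UNIV"
    and "cmod (csinc (of_real (2 * pi) * (z - of_real q))) \<le> 2 * exp (2 * pi * \<bar>q\<bar>) * exp (2 * pi * cmod z)"
    and "csinc (of_real (2 * pi) * (of_real x - of_real q)) = of_real (Sinc (2 * pi * (x - q)))"
proof -
  show "(\<lambda>z. csinc (of_real (2 * pi) * (z - of_real q))) holomorphic_on UNIV"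
    by (rule holomorphic_on_compose_gen[OF _ holomorphic_csinc, unfolded o_def]) (auto intro!: holomorphic_intros)
  have "cmod (of_real (2 * pi) * (z - of_real q)) = 2 * pi * cmod (z - of_real q)"
    by (simp add: norm_mult)
  also have "\<dots> \<le> 2 * pi * (cmod z + \<bar>q\<bar>)"
    using norm_triangle_ineq4[of z "of_real q"] by (intro mult_left_mono) auto
  finally have le: "cmod (of_real (2 * pi) * (z - of_real q)) \<le> 2 * pi * \<bar>q\<bar> + 2 * pi * cmod z"
    by (simp add: distrib_left)
  have "cmod (csinc (of_real (2 * pi) * (z - of_real q))) \<le> 2 * exp (cmod (of_real (2 * pi) * (z - of_real q)))"
    by (rule csinc_growth)
  also have "\<dots> \<le> 2 * exp (2 * pi * \<bar>q\<bar> + 2 * pi * cmod z)" using le by (intro mult_left_mono) auto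
  finally show "cmod (csinc (of_real (2 * pi) * (z - of_real q))) \<le> 2 * exp (2 * pi * \<bar>q\<bar>) * exp (2 * pi * cmod z)"
    by (simp add: exp_add)
  show "csinc (of_real (2 * pi) * (of_real x - of_real q)) = of_real (Sinc (2 * pi * (x - q)))"
    unfolding of_real_diff[symmetric] of_real_mult[symmetric] csinc_of_real ..
qed

lemma B_less_Q: "B k < Q k"
  using B_ge(1)[of k] by (simp add: Q_def)

lemma sin_pi_quarter: "x = of_int n - 1/4 \<or> x = of_int n + 1/4 \<Longrightarrow> (sin (pi * x))\<^sup>2 = 1/2"
  using cos_2pi_quarter[of x n] cos_double_sin[of "pi * x"] by (simp add: mult_ac)

text \<open>In a gap the points are integers, where a factor of type \<open>pi\<close> vanishes. The quarters near the origin
  are among the zeros of \<open>cos (2 * pi * x)\<close>, whose type is irrelevant because it is only imitated.\<close>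

lemma dense_MX:
  assumes "a > pi"
  shows "dense_in_L2 MX (fourier_space a)"
  unfolding MX_def
proof (rule dense_if_atoms_approx[OF quadratic_growth_MX[unfolded MX_def]])
  show a: "a > 0" using assms pi_gt_zero by linarith
  have eta: "a - pi > 0" using assms by simp
  fix i
  show "indicator {xs i} \<in> L2_closure (distr (count_space UNIV) borel xs) (fourier_space a)"
  proof (cases rule: xs_cases[of i])
    case (1 n0)
    show ?thesis
    proof (rule atom_approx[OF quadratic_growth_MX[unfolded MX_def] a eta, where A = "\<lambda>k x. Sinc (pi * (x - of_int n0))"
          and f = "\<lambda>z. cos (of_real (2 * pi) * z)" and C = 1 and l = "2 * pi" and CA = 1 and c = 1])
      show "(\<lambda>x. of_real (Sinc (pi * (x - of_int n0))) * H x) \<in> fourier_space a"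
        if "H \<in> fourier_space (a - pi)" for H
        using fourier_space_mult_Sinc[OF eta that pi_gt_zero, of "of_int n0"] by simp
      show "of_real (Sinc (pi * (xs i' - of_int n0))) * cos (of_real (2 * pi) * of_real (xs i')) = (0::complex)"
        if "xs i' \<noteq> xs i" for i'
        unfolding cos_complex_real
        by (cases rule: xs_cases[of i']) (use that 1 Sinc_pi_int cos_2pi_quarter in auto)
      show "Sinc (pi * (xs i' - of_int n0)) = 0"
        if "xs i' \<noteq> xs i" "\<bar>xs i'\<bar> > real (B k)" "\<bar>xs i'\<bar> < real (Q k)" for k i'
        by (rule xs_in_gap[OF that(2,3)]) (use that 1 Sinc_pi_int in auto)
      show "1 \<le> cmod (of_real (Sinc (pi * (xs i - of_int n0))) * cos (of_real (2 * pi) * of_real (xs i)))"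
        unfolding cos_complex_real 1 by (simp add: Sinc_def)
    qed (use cos_growth abs_Sinc_le_1 in \<open>auto intro!: holomorphic_intros\<close>)
  next
    case (2 n0)
    define q where "q = xs i"
    have s: "(sin (pi * q))\<^sup>2 = 1/2" unfolding q_def by (rule sin_pi_quarter[OF 2(2)])
    show ?thesis
    proof (rule atom_approx[OF quadratic_growth_MX[unfolded MX_def] a eta, where A = "\<lambda>k x. sin (pi * x)"
          and f = "\<lambda>z. csinc (of_real (2 * pi) * (z - of_real q))" and C = "2 * exp (2 * pi * \<bar>q\<bar>)" and l = "2 * pi"
          and CA = 1 and c = "\<bar>sin (pi * q)\<bar>"])
      show "(\<lambda>x. of_real (sin (pi * x)) * H x) \<in> fourier_space a"
        if "H \<in> fourier_space (a - pi)" for H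
        using fourier_space_mult_cos_sin(2)[OF eta that, of pi 0] by simp
      show "of_real (sin (pi * xs i')) * csinc (of_real (2 * pi) * (of_real (xs i') - of_real q)) = 0"
        if "xs i' \<noteq> xs i" for i'
        unfolding csinc_shift(3)
        by (cases rule: xs_cases[of i']) (use that 2 Sinc_2pi_quarter[of "xs i'" _ q n0] in \<open>auto simp: q_def\<close>)
      show "sin (pi * xs i') = 0"
        if "xs i' \<noteq> xs i" "\<bar>xs i'\<bar> > real (B k)" "\<bar>xs i'\<bar> < real (Q k)" for k i'
        by (rule xs_in_gap[OF that(2,3)]) simp
      show "\<bar>sin (pi * q)\<bar> \<le> cmod (of_real (sin (pi * xs i)) * csinc (of_real (2 * pi) * (of_real (xs i) - of_real q)))"
        unfolding csinc_shift(3) q_def by (simp add: Sinc_def norm_mult)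
      show "\<bar>sin (pi * q)\<bar> > 0" using s by auto
      show "cmod (csinc (of_real (2 * pi) * (z - of_real q))) \<le> 2 * exp (2 * pi * \<bar>q\<bar>) * exp (2 * pi * cmod z)" for z
        by (rule csinc_shift(2))
    qed (use csinc_shift(1) in auto)
  qed
qed

text \<open>Both \<open>s1\<close> and \<open>s2\<close> vanish at the integers in \<open>U\<close>; the zeros of \<open>s1\<close> are moved to the twins, those of
  \<open>s2\<close> remain.\<close>

lemma twin_factor:
  assumes "finite U" "b > 0"
    and s1: "(\<lambda>x. of_real (s1 x) * H x) \<in> fourier_space b"
    and s2: "\<And>F. F \<in> fourier_space b \<Longrightarrow> (\<lambda>x. of_real (s2 x) * F x) \<in> fourier_space a"
    and zeros: "\<And>n. n \<in> U \<Longrightarrow> s1 (of_int n) = 0" "\<And>n. n \<in> U \<Longrightarrow> s2 (of_int n) = 0"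
  shows "(\<lambda>x. of_real (s1 x * s2 x * rho U x) * H x) \<in> fourier_space a"
proof -
  obtain F where F: "F \<in> fourier_space b" "\<And>x. x \<notin> of_int ` U \<Longrightarrow> F x = of_real (rho U x) * (of_real (s1 x) * H x)"
    by (rule rho_fourier[OF assms(1,2) s1]) (use zeros in auto)
  have "of_real (s1 x * s2 x * rho U x) * H x = of_real (s2 x) * F x" for x
  proof (cases "x \<in> of_int ` U")
    case True
    then show ?thesis using zeros by auto
  next
    case False
    then show ?thesis using F(2) by simp
  qed
  then have "(\<lambda>x. of_real (s1 x * s2 x * rho U x) * H x) = (\<lambda>x. of_real (s2 x) * F x)" by (rule ext)
  then show ?thesis using s2[OF F(1)] by (simp only:)
qed

lemma rho_at_points:
  assumes "finite U"
  shows "\<bar>rho U (xys z)\<bar> \<le> 2"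
proof -
  have far: ?thesis if "\<And>n. n \<in> U \<Longrightarrow> \<bar>xys z - of_int n\<bar> \<ge> 1/4"
    using rho_bounds[OF assms that] by auto
  show ?thesis
  proof (cases rule: xys_cases[of z])
    case (1 n)
    show ?thesis
    proof (cases "n \<in> U")
      case True
      then show ?thesis using rho_eq_0[OF assms True] 1 by simp
    next
      case False
      show ?thesis
      proof (rule far)
        fix n' assume "n' \<in> U"
        then show "\<bar>xys z - of_int n'\<bar> \<ge> 1/4" using int_far[of n n'] False 1 by (cases "n = n'") auto
      qed
    qed
  next
    case (2 n)
    then show ?thesis using quarter_far by (intro far) blast
  next
    case (3 n)
    show ?thesis
    proof (cases "n \<in> U")
      case True
      then show ?thesis using rho_eq_0[OF assms True] 3 by simp
    next
      case False
      show ?thesis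
      proof (rule far)
        fix n' assume "n' \<in> U"
        then have "n \<noteq> n'" using False by auto
        then show "\<bar>xys z - of_int n'\<bar> \<ge> 1/4"
          using int_far[of n n'] tau_bounds(1,2)[of n] 3 unfolding twin_def by linarith
      qed
    qed
  qed
qed

text \<open>In a gap two factors of type \<open>pi\<close> are needed, one for the integers and one for the twins.\<close>

lemma dense_MXY:
  assumes "a > 2 * pi"
  shows "dense_in_L2 MXY (fourier_space a)"
  unfolding MXY_def
proof (rule dense_if_atoms_approx[OF quadratic_growth_MXY[unfolded MXY_def]])
  show a: "a > 0" using assms pi_gt_zero by linarith
  define \<eta> where "\<eta> = a - 2 * pi"
  have eta: "\<eta> > 0" using assms by (simp add: \<eta>_def)
  have b: "\<eta> + pi > 0" using eta pi_gt_zero by linarith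
  have apt: "a = (\<eta> + pi) + pi" by (simp add: \<eta>_def)
  have mult_sin: "(\<lambda>x. of_real (sin (pi * x)) * F x) \<in> fourier_space (b + pi)"
    if "F \<in> fourier_space b" "b > 0" for F b
    using fourier_space_mult_cos_sin(2)[OF that(2,1), of pi 0] by simp
  have mult_Sinc: "(\<lambda>x. of_real (Sinc (pi * (x - of_int n))) * F x) \<in> fourier_space (b + pi)"
    if "F \<in> fourier_space b" "b > 0" for F b n
    by (rule fourier_space_mult_Sinc[OF that(2,1) pi_gt_zero])
  define V where "V = (\<lambda>k N. levels (Suc k) - N)"
  have finV: "finite (V k N)" for k N by (simp add: V_def finite_levels)
  have twin0: "rho (V k N) (xys z) = 0"
    if "of_int n \<in> gaps" "xys z = twin n" "n \<notin> N" "\<bar>xys z\<bar> < real (Q k)" for k N z n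
    using rho_eq_0[OF finV] levels_Suc_iff[OF that(1), of k] that by (auto simp: V_def)
  have BQ: "\<bar>x\<bar> \<le> real (B k) \<Longrightarrow> \<bar>x\<bar> < real (Q k)" for x k
    using B_less_Q[of k] by linarith
  note approx = atom_approx[OF quadratic_growth_MXY[unfolded MXY_def] a eta]
  fix z
  define q where "q = xys z"
  have qr: "q \<in> range xys" by (simp add: q_def)
  have "indicator {q} \<in> L2_closure (distr (count_space UNIV) borel xys) (fourier_space a)"
  proof (cases rule: xys_cases[of z, folded q_def])
    case (2 n0)
    have s: "(sin (pi * q))\<^sup>2 = 1/2" by (rule sin_pi_quarter[OF 2(2)])
    show ?thesis
    proof (rule approx[where A = "\<lambda>k x. sin (pi * x) * sin (pi * x) * rho (V k {}) x"
          and f = "\<lambda>z. csinc (of_real (2 * pi) * (z - of_real q))" and C = "2 * exp (2 * pi * \<bar>q\<bar>)" and l = "2 * pi"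
          and CA = 2 and c = "1/4"])
      fix k
      show "(\<lambda>x. of_real (sin (pi * x) * sin (pi * x) * rho (V k {}) x) * H x) \<in> fourier_space a"
        if "H \<in> fourier_space \<eta>" for H
        by (rule twin_factor[OF finV b mult_sin[OF that eta]]) (use mult_sin[OF _ b] apt in auto)
      have "\<bar>sin (pi * x) * sin (pi * x)\<bar> * \<bar>rho (V k {}) (xys z')\<bar> \<le> (1 * 1) * 2" for x z'
        unfolding abs_mult by (intro mult_mono rho_at_points finV) auto
      then show "\<bar>sin (pi * xys z') * sin (pi * xys z') * rho (V k {}) (xys z')\<bar> \<le> 2" for z'
        by (simp add: abs_mult)
      show "of_real (sin (pi * xys z') * sin (pi * xys z') * rho (V k {}) (xys z'))
          * csinc (of_real (2 * pi) * (of_real (xys z') - of_real q)) = 0"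
        if "xys z' \<noteq> q" "\<bar>xys z'\<bar> \<le> real (B k)" for z'
        unfolding csinc_shift(3)
      proof (cases rule: xys_cases[of z'])
        case (2 n)
        then show "of_real (sin (pi * xys z') * sin (pi * xys z') * rho (V k {}) (xys z')) * complex_of_real (Sinc (2 * pi * (xys z' - q))) = 0"
          using Sinc_2pi_quarter[OF 2(2) \<open>q = _ \<or> q = _\<close> that(1)] by simp
      qed (use twin0[of _ z' "{}" k] BQ[OF that(2)] in auto)
      show "sin (pi * xys z') * sin (pi * xys z') * rho (V k {}) (xys z') = 0"
        if "xys z' \<noteq> q" "\<bar>xys z'\<bar> > real (B k)" "\<bar>xys z'\<bar> < real (Q k)" for z'
        by (rule xys_in_gap[OF that(2,3)]) (use that twin0[of _ z' "{}" k] in auto)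
      have "1/4 \<le> \<bar>q - of_int n'\<bar>" for n' by (rule quarter_far[OF 2(2)])
      then have "1/2 \<le> rho (V k {}) q" by (intro rho_bounds(1) finV)
      then have "1/2 * (1/2) \<le> (sin (pi * q))\<^sup>2 * \<bar>rho (V k {}) q\<bar>" using s by (intro mult_mono) auto
      then show "1/4 \<le> cmod (of_real (sin (pi * q) * sin (pi * q) * rho (V k {}) q) * csinc (of_real (2 * pi) * (of_real q - of_real q)))"
        unfolding csinc_shift(3) by (simp add: Sinc_def norm_mult abs_mult power2_eq_square)
      show "cmod (csinc (of_real (2 * pi) * (z - of_real q))) \<le> 2 * exp (2 * pi * \<bar>q\<bar>) * exp (2 * pi * cmod z)" for z
        by (rule csinc_shift(2))
    qed (use csinc_shift(1) qr in auto)
  next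
    case (1 n0)
    define v where "v = (\<lambda>x. if of_int n0 \<in> gaps then x - twin n0 else 1)"
    define c where "c = \<bar>v q\<bar> / 2"
    have c: "c > 0" using tau_bounds(3)[of n0] 1 by (auto simp: c_def v_def twin_def)
    have v: "(\<lambda>x. of_real (v x) * F x) \<in> fourier_space b" if "F \<in> fourier_space b" "b > 0" for F b
      using fourier_space_mult_linear[OF that(2,1), of "of_real (twin n0)"] that(1)
      by (cases "of_int n0 \<in> gaps") (simp_all add: v_def)
    define s1 where "s1 = (\<lambda>x. v x * Sinc (pi * (x - of_int n0)))"
    have s1: "\<bar>s1 x\<bar> \<le> 2" for x
    proof -
      have "\<bar>v x\<bar> \<le> \<bar>x - of_int n0\<bar> + 1" using tau_bounds(1,2)[of n0] by (auto simp: v_def twin_def)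
      then have "\<bar>s1 x\<bar> \<le> (\<bar>x - of_int n0\<bar> + 1) * \<bar>Sinc (pi * (x - of_int n0))\<bar>"
        unfolding s1_def abs_mult by (intro mult_right_mono) auto
      also have "\<dots> = \<bar>(x - of_int n0) * Sinc (pi * (x - of_int n0))\<bar> + \<bar>Sinc (pi * (x - of_int n0))\<bar>"
        by (simp add: distrib_right abs_mult)
      also have "\<bar>(x - of_int n0) * Sinc (pi * (x - of_int n0))\<bar> \<le> 1"
      proof -
        have "pi * ((x - of_int n0) * Sinc (pi * (x - of_int n0))) = sin (pi * (x - of_int n0))"
          unfolding Sinc_mult[symmetric] by (simp only: mult.assoc)
        then have "pi * \<bar>(x - of_int n0) * Sinc (pi * (x - of_int n0))\<bar> = \<bar>sin (pi * (x - of_int n0))\<bar>"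
          by (metis abs_mult abs_of_pos pi_gt_zero)
        also have "\<dots> \<le> 1" by simp
        finally have "pi * \<bar>(x - of_int n0) * Sinc (pi * (x - of_int n0))\<bar> \<le> 1" .
        moreover have "1 * \<bar>(x - of_int n0) * Sinc (pi * (x - of_int n0))\<bar> \<le> pi * \<bar>(x - of_int n0) * Sinc (pi * (x - of_int n0))\<bar>"
          using pi_gt3 by (intro mult_right_mono) auto
        ultimately show ?thesis by linarith
      qed
      finally show ?thesis using abs_Sinc_le_1[of "pi * (x - of_int n0)"] by linarith
    qed
    show ?thesis
    proof (rule approx[where A = "\<lambda>k x. s1 x * Sinc (pi * (x - of_int n0)) * rho (V k {n0}) x"
          and f = "\<lambda>z. cos (of_real (2 * pi) * z)" and C = 1 and l = "2 * pi" and CA = 4 and c = c])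
      fix k
      show "(\<lambda>x. of_real (s1 x * Sinc (pi * (x - of_int n0)) * rho (V k {n0}) x) * H x) \<in> fourier_space a"
        if "H \<in> fourier_space \<eta>" for H
      proof (rule twin_factor[OF finV b])
        show "(\<lambda>x. of_real (s1 x) * H x) \<in> fourier_space (\<eta> + pi)"
          using v[OF mult_Sinc[OF that eta] b] by (simp add: s1_def mult.assoc)
        show "(\<lambda>x. of_real (Sinc (pi * (x - of_int n0))) * F x) \<in> fourier_space a"
          if "F \<in> fourier_space (\<eta> + pi)" for F
          using mult_Sinc[OF that b] apt by simp
        show "Sinc (pi * (of_int n - of_int n0)) = 0" "s1 (of_int n) = 0" if "n \<in> V k {n0}" for n
          using that Sinc_pi_int[of n n0] by (auto simp: V_def s1_def)
      qed
      have "\<bar>s1 x * Sinc (pi * (x - of_int n0))\<bar> * \<bar>rho (V k {n0}) (xys z')\<bar> \<le> (2 * 1) * 2" for x z'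
        using s1 abs_Sinc_le_1 unfolding abs_mult by (intro mult_mono rho_at_points finV) auto
      then show "\<bar>s1 (xys z') * Sinc (pi * (xys z' - of_int n0)) * rho (V k {n0}) (xys z')\<bar> \<le> 4" for z'
        by (simp add: abs_mult)
      have twin: "s1 (xys z') * Sinc (pi * (xys z' - of_int n0)) * rho (V k {n0}) (xys z') = 0"
        if "of_int n \<in> gaps" "xys z' = twin n" "\<bar>xys z'\<bar> < real (Q k)" for z' n
      proof (cases "n = n0")
        case True
        then show ?thesis using that by (simp add: s1_def v_def)
      next
        case False
        then show ?thesis using twin0[OF that(1,2), of "{n0}" k] that(3) by simp
      qed
      show "of_real (s1 (xys z') * Sinc (pi * (xys z' - of_int n0)) * rho (V k {n0}) (xys z'))
          * cos (of_real (2 * pi) * of_real (xys z')) = (0 :: complex)"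
        if "xys z' \<noteq> q" "\<bar>xys z'\<bar> \<le> real (B k)" for z'
        unfolding cos_complex_real
        by (cases rule: xys_cases[of z'])
          (use that 1 Sinc_pi_int cos_2pi_quarter twin BQ[OF that(2)] in \<open>auto simp del: of_real_mult\<close>)
      show "s1 (xys z') * Sinc (pi * (xys z' - of_int n0)) * rho (V k {n0}) (xys z') = 0"
        if "xys z' \<noteq> q" "\<bar>xys z'\<bar> > real (B k)" "\<bar>xys z'\<bar> < real (Q k)" for z'
        by (rule xys_in_gap[OF that(2,3)])
          (use that 1 Sinc_pi_int twin in \<open>auto simp del: mult_eq_0_iff\<close>)
      have "1/2 \<le> rho (V k {n0}) q"
        by (rule rho_bounds(1)[OF finV]) (use int_far[of n0] 1 in \<open>force simp: V_def\<close>)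
      then have "\<bar>v q\<bar> * (1/2) \<le> \<bar>v q\<bar> * \<bar>rho (V k {n0}) q\<bar>" by (intro mult_left_mono) auto
      then show "c \<le> cmod (of_real (s1 q * Sinc (pi * (q - of_int n0)) * rho (V k {n0}) q) * cos (of_real (2 * pi) * of_real q))"
        unfolding cos_complex_real by (simp add: 1 c_def s1_def Sinc_def norm_mult abs_mult)
    qed (use cos_growth c qr in \<open>auto intro!: holomorphic_intros\<close>)
  next
    case (3 n0)
    have t: "0 < pi * tau n0" "pi * tau n0 \<le> pi / 64"
      using tau_bounds(2,3)[of n0] 3 by (auto intro!: mult_left_mono[of _ "1/64", simplified])
    have sp: "sin (pi * tau n0) > 0" using t pi_gt_zero by (intro sin_gt_zero) linarith+
    define c where "c = \<bar>Sinc (pi * (q - of_int n0)) * sin (pi * q) * cos (2 * pi * q)\<bar> / 2"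
    have c: "c > 0"
    proof -
      have "Sinc (pi * (q - of_int n0)) > 0" using sp t by (simp add: 3 twin_def Sinc_def)
      moreover have "sin (pi * q) \<noteq> 0"
      proof -
        have "sin (pi * q) = cos (pi * of_int n0) * sin (pi * tau n0)"
          by (simp add: 3 twin_def distrib_left sin_add)
        moreover have "cos (pi * of_int n0) \<noteq> 0"
          using sin_cos_squared_add[of "pi * of_int n0"] by auto
        ultimately show ?thesis using sp by simp
      qed
      moreover have "cos (2 * pi * q) \<noteq> 0"
      proof -
        have "cos (2 * pi * q) = cos (2 * (pi * tau n0))"
          unfolding 3(2) twin_def distrib_left cos_add cos_int_2pin sin_int_2pin by (simp add: mult.assoc)
        moreover have "cos (2 * (pi * tau n0)) > 0" using t pi_gt_zero by (intro cos_gt_zero_pi) linarith+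
        ultimately show ?thesis by simp
      qed
      ultimately show ?thesis by (simp add: c_def)
    qed
    show ?thesis
    proof (rule approx[where A = "\<lambda>k x. Sinc (pi * (x - of_int n0)) * sin (pi * x) * rho (V k {n0}) x"
          and f = "\<lambda>z. cos (of_real (2 * pi) * z)" and C = 1 and l = "2 * pi" and CA = 2 and c = c])
      fix k
      show "(\<lambda>x. of_real (Sinc (pi * (x - of_int n0)) * sin (pi * x) * rho (V k {n0}) x) * H x) \<in> fourier_space a"
        if "H \<in> fourier_space \<eta>" for H
        by (rule twin_factor[OF finV b mult_Sinc[OF that eta]])
          (use mult_sin[OF _ b] apt Sinc_pi_int in \<open>auto simp: V_def\<close>)
      have "\<bar>Sinc (pi * (x - of_int n0)) * sin (pi * x)\<bar> * \<bar>rho (V k {n0}) (xys z')\<bar> \<le> (1 * 1) * 2" for x z'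
        using abs_Sinc_le_1 unfolding abs_mult by (intro mult_mono rho_at_points finV) auto
      then show "\<bar>Sinc (pi * (xys z' - of_int n0)) * sin (pi * xys z') * rho (V k {n0}) (xys z')\<bar> \<le> 2" for z'
        by (simp add: abs_mult)
      have twin: "rho (V k {n0}) (xys z') = 0"
        if "of_int n \<in> gaps" "xys z' = twin n" "\<bar>xys z'\<bar> < real (Q k)" "xys z' \<noteq> q" for z' n
      proof -
        have "n \<noteq> n0" using that 3 by auto
        then show ?thesis using twin0[OF that(1,2), of "{n0}" k] that(3) by simp
      qed
      show "of_real (Sinc (pi * (xys z' - of_int n0)) * sin (pi * xys z') * rho (V k {n0}) (xys z'))
          * cos (of_real (2 * pi) * of_real (xys z')) = (0 :: complex)"
        if "xys z' \<noteq> q" "\<bar>xys z'\<bar> \<le> real (B k)" for z'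
        unfolding cos_complex_real
        by (cases rule: xys_cases[of z'])
          (use that cos_2pi_quarter twin BQ[OF that(2)] in auto)
      show "Sinc (pi * (xys z' - of_int n0)) * sin (pi * xys z') * rho (V k {n0}) (xys z') = 0"
        if "xys z' \<noteq> q" "\<bar>xys z'\<bar> > real (B k)" "\<bar>xys z'\<bar> < real (Q k)" for z'
        by (rule xys_in_gap[OF that(2,3)]) (use that twin in auto)
      have "1/4 \<le> \<bar>q - of_int n\<bar>" if "n \<in> V k {n0}" for n
      proof -
        have "1 \<le> \<bar>real_of_int n0 - of_int n\<bar>" using that by (intro int_far) (auto simp: V_def)
        then show ?thesis using tau_bounds(1,2)[of n0] unfolding 3(2) twin_def by linarith
      qed
      then have "1/2 \<le> rho (V k {n0}) q" by (rule rho_bounds(1)[OF finV])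
      then have "\<bar>Sinc (pi * (q - of_int n0)) * sin (pi * q) * cos (2 * pi * q)\<bar> * (1/2)
          \<le> \<bar>Sinc (pi * (q - of_int n0)) * sin (pi * q) * cos (2 * pi * q)\<bar> * \<bar>rho (V k {n0}) q\<bar>"
        by (intro mult_left_mono) auto
      then show "c \<le> cmod (of_real (Sinc (pi * (q - of_int n0)) * sin (pi * q) * rho (V k {n0}) q) * cos (of_real (2 * pi) * of_real q))"
        unfolding cos_complex_real c_def by (simp add: norm_mult abs_mult mult_ac)
    qed (use cos_growth c qr in \<open>auto intro!: holomorphic_intros\<close>)
  qed
  then show "indicator {xys z} \<in> L2_closure (distr (count_space UNIV) borel xys) (fourier_space a)"
    by (simp only: q_def)
qed

end

section \<open>Lower bounds: sequences that annihilate transforms\<close>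

lemma sum_le_integral_count_space:
  fixes f :: "'i \<Rightarrow> real"
  assumes "integrable (count_space UNIV) f" "\<And>i. f i \<ge> 0" "finite J"
  shows "(\<Sum>i\<in>J. f i) \<le> (\<integral>i. f i \<partial>count_space UNIV)"
proof -
  define h where "h = (\<lambda>i. if i \<in> J then f i else 0)"
  have fin: "finite {i \<in> UNIV. h i \<noteq> 0}"
    using assms(3) by (rule finite_subset[rotated]) (auto simp: h_def)
  have "(\<Sum>i\<in>J. f i) = (\<Sum>i\<in>{i \<in> UNIV. h i \<noteq> 0}. h i)"
    using assms(3) by (intro sum.mono_neutral_cong_right) (auto simp: h_def)
  also have "\<dots> = (\<integral>i. h i \<partial>count_space UNIV)"
    using lebesgue_integral_count_space_finite_support[OF fin] by simp
  also have "\<dots> \<le> (\<integral>i. f i \<partial>count_space UNIV)"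
  proof (rule integral_mono[OF _ assms(1)])
    show "integrable (count_space UNIV) h"
      by (rule Bochner_Integration.integrable_bound[OF assms(1)]) (use assms(2) in \<open>auto simp: h_def\<close>)
    show "h i \<le> f i" for i using assms(2)[of i] by (simp add: h_def)
  qed
  finally show ?thesis .
qed

lemma sum_le_integral_distr:
  fixes p :: "'i \<Rightarrow> real"
  assumes "f \<in> L2 (distr (count_space UNIV) borel p)" "finite X" "inj_on \<iota> X"
  shows "(\<Sum>n\<in>X. (cmod (f (p (\<iota> n))))\<^sup>2) \<le> (\<integral>x. (cmod (f x))\<^sup>2 \<partial>distr (count_space UNIV) borel p)"
proof -
  have fb [measurable]: "f \<in> borel_measurable borel" using L2_D(1)[OF assms(1)] by simp
  have "integrable (count_space UNIV) (\<lambda>i. (cmod (f (p i)))\<^sup>2)"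
    using L2_D(2)[OF assms(1)] by (subst (asm) integrable_distr_eq) auto
  from sum_le_integral_count_space[OF this, of "\<iota> ` X"] assms(2,3)
  have "(\<Sum>n\<in>X. (cmod (f (p (\<iota> n))))\<^sup>2) \<le> (\<integral>i. (cmod (f (p i)))\<^sup>2 \<partial>count_space UNIV)"
    by (simp add: sum.reindex)
  also have "\<dots> = (\<integral>x. (cmod (f x))\<^sup>2 \<partial>distr (count_space UNIV) borel p)"
    by (subst integral_distr) auto
  finally show ?thesis .
qed

lemma norm_sum_mult_le:
  fixes c f :: "'i \<Rightarrow> complex"
  assumes "e > 0" "(\<Sum>n\<in>X. (cmod (f n))\<^sup>2) \<le> e\<^sup>2" "(\<Sum>n\<in>X. (cmod (c n))\<^sup>2) \<le> C"
  shows "cmod (\<Sum>n\<in>X. c n * f n) \<le> e * (1 + C) / 2"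
proof -
  have "cmod (\<Sum>n\<in>X. c n * f n) \<le> (\<Sum>n\<in>X. cmod (c n) * cmod (f n))"
    by (rule order_trans[OF norm_sum]) (simp add: norm_mult)
  also have "\<dots> \<le> (\<Sum>n\<in>X. (1 / (2 * e)) * (cmod (f n))\<^sup>2 + (e / 2) * (cmod (c n))\<^sup>2)"
  proof (rule sum_mono)
    fix n
    define u v where "u = cmod (f n)" and "v = cmod (c n)"
    have "0 \<le> (u - e * v)\<^sup>2 / (2 * e)" using assms(1) by simp
    also have "\<dots> = (1 / (2 * e)) * u\<^sup>2 + (e / 2) * v\<^sup>2 - v * u"
      using assms(1) by (simp add: power2_eq_square field_simps)
    finally show "cmod (c n) * cmod (f n) \<le> (1 / (2 * e)) * (cmod (f n))\<^sup>2 + (e / 2) * (cmod (c n))\<^sup>2"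
      by (simp add: u_def v_def)
  qed
  also have "\<dots> = (1 / (2 * e)) * (\<Sum>n\<in>X. (cmod (f n))\<^sup>2) + (e / 2) * (\<Sum>n\<in>X. (cmod (c n))\<^sup>2)"
    by (simp only: sum.distrib sum_distrib_left)
  also have "\<dots> \<le> (1 / (2 * e)) * e\<^sup>2 + (e / 2) * C"
    using assms by (intro add_mono mult_left_mono) auto
  also have "\<dots> = e * (1 + C) / 2" using assms(1) by (simp add: power2_eq_square field_simps)
  finally show ?thesis .
qed

context gap_scales
begin

definition int_decay_total :: real where "int_decay_total = (\<integral>i. 1 / (1 + (real_of_int i)\<^sup>2) \<partial>count_space UNIV)"

lemma sum_le_int_decay_total:
  assumes "finite X"
  shows "(\<Sum>n\<in>X. 1 / (1 + (real_of_int n)\<^sup>2)) \<le> int_decay_total"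
  unfolding int_decay_total_def by (rule sum_le_integral_count_space[OF integrable_int_decay _ assms]) simp

lemma int_decay_total_nonneg: "int_decay_total \<ge> 0"
  using sum_le_int_decay_total[of "{}"] by simp

lemma zero_notin_gaps: "0 \<notin> gaps"
  using B_pos by (auto simp: gaps_def gap_def)

lemma sum_squares_le_int_decay_total:
  assumes "finite X" "\<And>n. n \<in> X \<Longrightarrow> \<bar>c n\<bar> \<le> C / (1 + (real_of_int n)\<^sup>2)"
  shows "(\<Sum>n\<in>X. (c n)\<^sup>2) \<le> C\<^sup>2 * int_decay_total"
proof -
  have "(c n)\<^sup>2 \<le> C\<^sup>2 * (1 / (1 + (real_of_int n)\<^sup>2))" if "n \<in> X" for n
  proof -
    have p: "1 + (real_of_int n)\<^sup>2 > 0" "1 / (1 + (real_of_int n)\<^sup>2) \<le> 1"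
      by (simp_all add: divide_le_eq add_pos_nonneg)
    have "\<bar>c n\<bar>\<^sup>2 \<le> (C / (1 + (real_of_int n)\<^sup>2))\<^sup>2" by (rule power_mono[OF assms(2)[OF that]]) simp
    also have "\<dots> = C\<^sup>2 * (1 / (1 + (real_of_int n)\<^sup>2)) * (1 / (1 + (real_of_int n)\<^sup>2))"
      by (simp add: power2_eq_square)
    also have "\<dots> \<le> C\<^sup>2 * (1 / (1 + (real_of_int n)\<^sup>2)) * 1"
      using p by (intro mult_left_mono) auto
    finally show ?thesis by simp
  qed
  then have "(\<Sum>n\<in>X. (c n)\<^sup>2) \<le> (\<Sum>n\<in>X. C\<^sup>2 * (1 / (1 + (real_of_int n)\<^sup>2)))" by (rule sum_mono)
  also have "\<dots> \<le> C\<^sup>2 * int_decay_total"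
    unfolding sum_distrib_left[symmetric] by (intro mult_left_mono sum_le_int_decay_total assms(1)) simp
  finally show ?thesis .
qed

lemma Sinc_square_le: "\<eta> > 0 \<Longrightarrow> (Sinc (\<eta> * x))\<^sup>2 \<le> (1 + 1 / \<eta>\<^sup>2) / (1 + x\<^sup>2)"
  using gap_multiplier_le(1)[of \<eta> 0 0 x] by (simp add: gap_multiplier_def)

text \<open>The annihilating sequence lives on the integers, where it is \<open>(-1) ^ n\<close> times a multiplier. The
  factor \<open>cos (pi * x)\<close>, for which there is room in the type, removes the half-integers from the
  residue sum.\<close>

lemma not_dense_MX:
  assumes a: "0 < a" "a < pi"
  shows "\<not> dense_in_L2 MX (fourier_space a)"
proof
  assume dense: "dense_in_L2 MX (fourier_space a)"
  define \<eta> where "\<eta> = (pi - a) / 4"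
  have eta: "\<eta> > 0" using a by (simp add: \<eta>_def)
  define D where "D = 1 + 1 / \<eta>\<^sup>2"
  define C where "C = D\<^sup>2 * int_decay_total"
  have C: "C \<ge> 0" using int_decay_total_nonneg by (simp add: C_def)
  define e where "e = 1 / (2 * (1 + C))"
  have e: "e > 0" using C by (simp add: e_def)
  define g :: "real \<Rightarrow> complex" where "g = indicator {0}"
  have gb: "g \<in> borel_measurable borel" unfolding g_def by measurable
  have gL: "g \<in> L2 MX"
    by (rule L2_of_decay(1)[OF quadratic_growth_MX gb, where C = 1]) (simp add: g_def indicator_def)
  then have "g \<in> L2_closure MX (fourier_space a)" using dense by (auto simp: dense_in_L2_iff)
  then obtain F where F: "F \<in> fourier_space a" "(\<integral>x. (cmod (g x - F x))\<^sup>2 \<partial>MX) < e\<^sup>2"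
    using e unfolding L2_closure_def by (auto dest!: spec[of _ "e\<^sup>2"])
  have FL: "F \<in> L2 MX" using dense F(1) by (auto simp: dense_in_L2_iff)
  define c where "c = (\<lambda>n::int. cos (pi * of_int n) * (Sinc (\<eta> * of_int n))\<^sup>2)"
  define P where "P = (\<lambda>x. of_real (cos (pi * x)) * (of_real (Sinc (\<eta> * x)) ^ 2 * F x))"
  have "(\<lambda>x. of_real (Sinc (\<eta> * (x - 0))) ^ 2 * F x) \<in> fourier_space (a + real 2 * \<eta>)"
    by (rule fourier_space_mult_Sinc_power[OF a(1) F(1) eta])
  from fourier_space_mult_cos_sin(1)[OF _ this, of pi 0]
  have P: "P \<in> fourier_space (a + 2 * \<eta> + pi)" using a eta by (simp add: P_def)
  \<comment> \<open>The shift carries the nodes \<open>n - 1/4\<close> and \<open>n + 1/4\<close> of the residue sum to \<open>n\<close> and \<open>n + 1/2\<close>.\<close>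
  define H where "H = (\<lambda>x. P (x - (-1/4)))"
  have b: "a + 2 * \<eta> + pi > 0" "a + 2 * \<eta> + pi \<le> 2 * pi"
    using a by (simp_all add: \<eta>_def field_simps add_pos_pos)
  have H: "H \<in> fourier_space (a + 2 * \<eta> + pi)"
    unfolding H_def by (rule fourier_space_shift[OF b(1) P])
  have H1: "H (of_int n - 1/4) = of_real (c n) * F (of_int n)" for n
    by (simp add: H_def P_def c_def)
  have H2: "H (of_int n + 1/4) = 0" for n
  proof -
    have "pi * (1/2 + real_of_int n) = pi * of_int n + pi / 2" by (simp add: field_simps)
    then have "cos (pi * (1/2 + real_of_int n)) = 0" by (simp add: cos_add)
    then show ?thesis by (simp add: H_def P_def)
  qed
  have lim: "(\<lambda>N. \<Sum>n\<in>{-int N..int N}. of_real (c n) * F (of_int n) / of_real (2 * pi)) \<longlonglongrightarrow> 0"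
    using transform_residue_sum[OF H b, of "{}"] by (simp add: H1 H2)
  have big: "3/4 \<le> cmod (\<Sum>n\<in>{-int N..int N}. of_real (c n) * F (of_int n))" for N
  proof -
    define X where "X = {-int N..int N}"
    have fX: "finite X" by (simp add: X_def)
    have xs: "xs (3 * n + 1) = of_int n" for n by (simp add: xs_def)
    have "(\<Sum>n\<in>X. (cmod (g (of_int n) - F (of_int n)))\<^sup>2) \<le> (\<integral>x. (cmod (g x - F x))\<^sup>2 \<partial>MX)"
      using sum_le_integral_distr[OF L2_diff[OF gL FL, unfolded MX_def] fX, of "\<lambda>n. 3 * n + 1"]
      by (simp add: xs MX_def inj_on_def)
    then have 1: "(\<Sum>n\<in>X. (cmod (g (of_int n) - F (of_int n)))\<^sup>2) \<le> e\<^sup>2" using F(2) by linarith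
    have "\<bar>c n\<bar> \<le> D / (1 + (of_int n)\<^sup>2)" for n
    proof -
      have "\<bar>c n\<bar> \<le> 1 * (Sinc (\<eta> * of_int n))\<^sup>2"
        unfolding c_def abs_mult by (intro mult_mono) auto
      then show ?thesis using Sinc_square_le[OF eta, of "of_int n"] unfolding D_def by linarith
    qed
    then have "(\<Sum>n\<in>X. (c n)\<^sup>2) \<le> C" unfolding C_def by (intro sum_squares_le_int_decay_total fX)
    then have 2: "(\<Sum>n\<in>X. (cmod (of_real (c n)))\<^sup>2) \<le> C" by simp
    have "cmod (\<Sum>n\<in>X. of_real (c n) * (g (of_int n) - F (of_int n))) \<le> e * (1 + C) / 2"
      by (rule norm_sum_mult_le[OF e 1 2])
    also have "\<dots> = 1/4" using C by (simp add: e_def)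
    finally have small: "cmod (\<Sum>n\<in>X. of_real (c n) * (g (of_int n) - F (of_int n))) \<le> 1/4" .
    have "(\<Sum>n\<in>X. of_real (c n) * g (of_int n)) = (\<Sum>n\<in>{0}. of_real (c n) * g (of_int n))"
      by (rule sum.mono_neutral_right) (auto simp: X_def g_def indicator_def)
    then have one: "(\<Sum>n\<in>X. of_real (c n) * g (of_int n)) = 1" by (simp add: c_def g_def Sinc_def)
    have "1 = (\<Sum>n\<in>X. of_real (c n) * (g (of_int n) - F (of_int n))) + (\<Sum>n\<in>X. of_real (c n) * F (of_int n))"
      unfolding sum.distrib[symmetric] one[symmetric] by (simp add: right_diff_distrib)
    then have "1 \<le> cmod (\<Sum>n\<in>X. of_real (c n) * (g (of_int n) - F (of_int n))) + cmod (\<Sum>n\<in>X. of_real (c n) * F (of_int n))"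
      using norm_triangle_ineq[of "\<Sum>n\<in>X. of_real (c n) * (g (of_int n) - F (of_int n))" "\<Sum>n\<in>X. of_real (c n) * F (of_int n)"]
      by simp
    then show ?thesis using small unfolding X_def by linarith
  qed
  have "(\<lambda>N. of_real (2 * pi) * (\<Sum>n\<in>{-int N..int N}. of_real (c n) * F (of_int n) / of_real (2 * pi))) \<longlonglongrightarrow> of_real (2 * pi) * 0"
    by (intro tendsto_mult lim tendsto_const)
  then have "(\<lambda>N. \<Sum>n\<in>{-int N..int N}. of_real (c n) * F (of_int n)) \<longlonglongrightarrow> 0"
    by (simp add: sum_distrib_left)
  then have "(\<lambda>N. cmod (\<Sum>n\<in>{-int N..int N}. of_real (c n) * F (of_int n))) \<longlonglongrightarrow> 0"
    by (rule tendsto_norm_zero)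
  then have "3/4 \<le> (0::real)" by (rule LIMSEQ_le_const) (use big in auto)
  then show False by simp
qed

text \<open>The factor by which the residues change when the two points \<open>n \<plusminus> 1/4\<close> are replaced by \<open>n\<close> and
  its twin, for all \<open>n\<close> in \<open>U\<close>.\<close>

definition kappa :: "int set \<Rightarrow> real \<Rightarrow> real" where
  "kappa U x = (\<Prod>n\<in>U. ((x - of_int n)\<^sup>2 - 1/16) / ((x - of_int n) * (x - twin n)))"

lemma kappa_bounds:
  assumes "finite U" "\<And>n. n \<in> U \<Longrightarrow> \<bar>x - of_int n\<bar> \<ge> 3/4"
  shows "0 \<le> kappa U x" "kappa U x \<le> 2"
proof -
  have fac: "0 \<le> ((x - of_int n)\<^sup>2 - 1/16) / ((x - of_int n) * (x - twin n)) \<and>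
      ((x - of_int n)\<^sup>2 - 1/16) / ((x - of_int n) * (x - twin n)) \<le> 1 + 2 * tau n" if "n \<in> U" for n
  proof -
    define u t where "u = x - of_int n" and "t = tau n"
    have t: "0 \<le> t" "t \<le> 1/64" using tau_bounds(1,2) by (simp_all add: t_def)
    have u: "\<bar>u\<bar> \<ge> 3/4" using assms(2)[OF that] by (simp add: u_def)
    have den: "u * (u - t) > 0 \<and> t * (u * (2 * u - 1 - 2 * t)) \<ge> 0"
    proof (cases "u > 0")
      case True
      then have "u - t > 0" "2 * u - 1 - 2 * t \<ge> 0" using u t by auto
      then show ?thesis using True t by (intro conjI mult_pos_pos mult_nonneg_nonneg) auto
    next
      case False
      then have "u < 0" "u - t < 0" "2 * u - 1 - 2 * t \<le> 0" using u t by auto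
      then show ?thesis using t by (intro conjI mult_neg_neg mult_nonneg_nonneg mult_nonpos_nonpos) auto
    qed
    have "(3/4)\<^sup>2 \<le> \<bar>u\<bar>\<^sup>2" using u by (rule power_mono) simp
    then have num: "u\<^sup>2 - 1/16 \<ge> 0" by (simp add: power2_eq_square)
    have "(1 + 2 * t) * (u * (u - t)) = u\<^sup>2 + t * (u * (2 * u - 1 - 2 * t))"
      by (simp add: power2_eq_square algebra_simps)
    then have "u\<^sup>2 - 1/16 \<le> (1 + 2 * t) * (u * (u - t))" using den by linarith
    then have "(u\<^sup>2 - 1/16) / (u * (u - t)) \<le> 1 + 2 * t" using den by (simp add: pos_divide_le_eq)
    moreover have "(u\<^sup>2 - 1/16) / (u * (u - t)) \<ge> 0" using num den by (intro divide_nonneg_nonneg) auto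
    moreover have "x - twin n = u - t" by (simp add: u_def t_def twin_def)
    ultimately show ?thesis unfolding u_def[symmetric] t_def[symmetric] by simp
  qed
  show "0 \<le> kappa U x" unfolding kappa_def by (intro prod_nonneg) (use fac in auto)
  have "kappa U x \<le> (\<Prod>n\<in>U. 1 + 2 * tau n)"
    unfolding kappa_def by (intro prod_mono) (use fac in auto)
  also have "\<dots> \<le> exp (\<Sum>n\<in>U. 2 * tau n)"
    by (rule prod_one_plus_le_exp[OF assms(1)]) (simp add: tau_bounds)
  also have "\<dots> \<le> exp (1/2)"
    using sum_tau_le[OF assms(1)] unfolding sum_distrib_left[symmetric] by simp
  also have "\<dots> \<le> 2" by (rule exp_half_le2)
  finally show "kappa U x \<le> 2" .
qed

text \<open>The factor belonging to \<open>n\<close> differs from one by \<open>O (1 / n\<^sup>2 + tau n)\<close>, which is summable; hence the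
  bound does not depend on \<open>U\<close>.\<close>

lemma kappa_quarter_ge:
  assumes "finite U" "\<And>n. n \<in> U \<Longrightarrow> of_int n \<in> gaps"
  shows "kappa U (1/4) \<ge> exp (- 2 * (int_decay_total + 1))"
proof -
  define t where "t = (\<lambda>n. 1 / (1 + (real_of_int n)\<^sup>2) + tau n)"
  have fac: "exp (- 2 * t n) \<le> ((1/4 - of_int n)\<^sup>2 - 1/16) / ((1/4 - of_int n) * (1/4 - twin n))" if "n \<in> U" for n
  proof -
    define u N where "u = 1/4 - real_of_int n" and "N = \<bar>real_of_int n\<bar>"
    have "of_int n \<in> gaps" by (rule assms(2)[OF that])
    then obtain j where j: "of_int n \<in> gap j" by (auto simp: gaps_def)
    have N: "N \<ge> 256" using j B_ge(1)[of j] by (simp add: gap_def N_def)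
    have tn: "0 \<le> tau n" "tau n \<le> 1/64" by (rule tau_bounds)+
    have N2: "1 + N\<^sup>2 \<ge> 4" using power_mono[of 256 N 2] N by simp
    have t0: "0 \<le> t n" "t n \<le> 1/2"
    proof -
      have "1 / (1 + N\<^sup>2) \<le> 1 / 4" using N2 by (intro divide_left_mono) auto
      then show "0 \<le> t n" "t n \<le> 1/2" using tn by (auto simp: t_def N_def)
    qed
    have u: "\<bar>u\<bar> \<ge> N - 1/4" "\<bar>u\<bar> \<ge> 1" using N by (auto simp: u_def N_def)
    have "(N - 1/4)\<^sup>2 \<le> \<bar>u\<bar>\<^sup>2" using u N by (intro power_mono) auto
    moreover have "1 + N\<^sup>2 \<le> 16 * (N - 1/4)\<^sup>2"
    proof -
      have "16 * (N - 1/4)\<^sup>2 = 16 * N\<^sup>2 - 8 * N + 1" by (simp add: power2_eq_square algebra_simps)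
      moreover have "N * 256 \<le> N * N" using N by (intro mult_left_mono) auto
      ultimately show ?thesis using N by (simp add: power2_eq_square)
    qed
    ultimately have "1 + N\<^sup>2 \<le> 16 * u\<^sup>2" by simp
    then have q: "1/16 \<le> u\<^sup>2 / (1 + N\<^sup>2)" using N2 by (simp add: pos_le_divide_eq)
    have "\<bar>u\<bar> * 1 \<le> \<bar>u\<bar> * \<bar>u\<bar>" using u by (intro mult_left_mono) auto
    then have uu: "\<bar>u\<bar> \<le> u\<^sup>2" by (simp add: power2_eq_square)
    have den: "u * (u - tau n) > 0"
    proof (cases "u > 0")
      case True then show ?thesis using u tn by (intro mult_pos_pos) auto
    next
      case False then show ?thesis using u tn by (intro mult_neg_neg) auto
    qed
    have "(1 - t n) * (u * (u - tau n)) \<le> (1 - t n) * (u\<^sup>2 + \<bar>u\<bar> * tau n)"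
    proof (rule mult_left_mono)
      have "- (u * tau n) \<le> \<bar>u\<bar> * tau n" using tn by (metis abs_ge_minus_self abs_mult abs_of_nonneg)
      then show "u * (u - tau n) \<le> u\<^sup>2 + \<bar>u\<bar> * tau n" by (simp add: power2_eq_square right_diff_distrib)
    qed (use t0 in simp)
    also have "\<dots> \<le> u\<^sup>2 + \<bar>u\<bar> * tau n - t n * u\<^sup>2"
    proof -
      have "0 \<le> t n * (\<bar>u\<bar> * tau n)" using t0 tn by simp
      then show ?thesis by (simp add: algebra_simps)
    qed
    also have "t n * u\<^sup>2 = u\<^sup>2 / (1 + N\<^sup>2) + tau n * u\<^sup>2" by (simp add: t_def N_def algebra_simps)
    also have "u\<^sup>2 + \<bar>u\<bar> * tau n - (u\<^sup>2 / (1 + N\<^sup>2) + tau n * u\<^sup>2) \<le> u\<^sup>2 - 1/16"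
    proof -
      have "\<bar>u\<bar> * tau n \<le> tau n * u\<^sup>2"
        using mult_right_mono[OF uu tn(1)] by (simp only: mult.commute)
      then show ?thesis using q by linarith
    qed
    finally have "1 - t n \<le> (u\<^sup>2 - 1/16) / (u * (u - tau n))" using den by (simp add: pos_le_divide_eq)
    moreover have "exp (- 2 * t n) \<le> 1 - t n"
    proof -
      have "0 \<le> t n * (1 - 2 * t n)" using t0 by (intro mult_nonneg_nonneg) auto
      then have "1 \<le> (1 + 2 * t n) * (1 - t n)" by (simp add: algebra_simps)
      also have "\<dots> \<le> exp (2 * t n) * (1 - t n)"
        using exp_ge_add_one_self[of "2 * t n"] t0 by (intro mult_right_mono) auto
      finally show ?thesis by (simp add: exp_minus field_simps)
    qed
    ultimately have "exp (- 2 * t n) \<le> (u\<^sup>2 - 1/16) / (u * (u - tau n))" by linarith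
    moreover have "1/4 - twin n = u - tau n" by (simp add: u_def twin_def)
    ultimately show ?thesis unfolding u_def[symmetric] by simp
  qed
  have "(\<Sum>n\<in>U. t n) \<le> int_decay_total + 1"
    using sum_le_int_decay_total[OF assms(1)] sum_tau_le[OF assms(1)] by (simp add: t_def sum.distrib)
  then have "exp (- 2 * (int_decay_total + 1)) \<le> exp (\<Sum>n\<in>U. - 2 * t n)"
    unfolding sum_distrib_left[symmetric] by simp
  also have "\<dots> = (\<Prod>n\<in>U. exp (- 2 * t n))" by (rule exp_sum[OF assms(1)])
  also have "\<dots> \<le> kappa U (1/4)"
    unfolding kappa_def by (intro prod_mono) (use fac in auto)
  finally show ?thesis .
qed

definition first_node :: "int set \<Rightarrow> int \<Rightarrow> real" where
  "first_node S n = (if n \<in> S then of_int n else of_int n - 1/4)"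

definition second_node :: "int set \<Rightarrow> int \<Rightarrow> real" where
  "second_node S n = (if n \<in> S then twin n else of_int n + 1/4)"

text \<open>The residues at the poles of \<open>1 / cos (2 * pi * x)\<close> after its poles near \<open>S\<close> have been moved
  to \<open>S\<close> and its twins.\<close>

definition first_residue :: "int set \<Rightarrow> int \<Rightarrow> real" where
  "first_residue S n = (if n \<in> S then kappa (S - {n}) (of_int n) / (16 * tau n)
             else kappa S (of_int n - 1/4) / (2 * pi))"

definition second_residue :: "int set \<Rightarrow> int \<Rightarrow> real" where
  "second_residue S n = (if n \<in> S then ((tau n)\<^sup>2 - 1/16) / (cos (2 * pi * twin n) * tau n) * kappa (S - {n}) (twin n)
             else - kappa S (of_int n + 1/4) / (2 * pi))"

lemma cos_2pi_twin: "cos (2 * pi * twin n) = cos (2 * pi * tau n)"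
  unfolding twin_def distrib_left cos_add cos_int_2pin sin_int_2pin by simp

lemma cos_2pi_tau_ge: "cos (2 * pi * tau n) \<ge> 1/2"
proof -
  have "0 \<le> 2 * pi * tau n" using tau_bounds(1) by simp
  moreover have "2 * pi * tau n \<le> 2 * pi * (1/64)"
    using tau_bounds(2) by (intro mult_left_mono) auto
  then have "2 * pi * tau n \<le> pi / 3" by simp
  ultimately have "cos (pi / 3) \<le> cos (2 * pi * tau n)"
    by (intro cos_monotone_0_pi_le) auto
  then show ?thesis by (simp add: cos_60)
qed

lemma twin_inj: "inj twin"
proof (rule injI)
  fix n l assume "twin n = twin l"
  then have "\<bar>real_of_int n - of_int l\<bar> < 1"
    using tau_bounds(1,2)[of n] tau_bounds(1,2)[of l] unfolding twin_def by linarith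
  then show "n = l" using int_far[of n l] by force
qed

lemma twin_ne_int:
  assumes "of_int n \<in> gaps"
  shows "twin n \<noteq> of_int l"
proof
  assume "twin n = of_int l"
  then have "\<bar>real_of_int n - of_int l\<bar> < 1" "real_of_int n \<noteq> of_int l"
    using tau_bounds[of n] assms unfolding twin_def by linarith+
  then show False using int_far[of n l] by force
qed

text \<open>The residue sum for the transform \<open>P\<close> times \<open>\<Prod>n\<in>S. (x - n)\<^sup>2 - 1/16\<close>, which kills the poles
  \<open>n \<plusminus> 1/4\<close>, divided by \<open>\<Prod>n\<in>S. (x - n) * (x - twin n)\<close>, which creates the new ones.\<close>

lemma annihilator:
  assumes P: "P \<in> fourier_space b" "0 < b" "b \<le> 2 * pi"
    and S: "finite S" "\<And>n. n \<in> S \<Longrightarrow> of_int n \<in> gaps"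
  shows "(\<lambda>N. \<Sum>n\<in>{-int N..int N}. of_real (first_residue S n) * P (first_node S n) + of_real (second_residue S n) * P (second_node S n))
           \<longlonglongrightarrow> 0"
proof -
  define Z where "Z = (\<lambda>U x. \<Prod>n\<in>U. (x - real_of_int n)\<^sup>2 - 1/16)"
  define H where "H = (\<lambda>x. of_real (Z S x) * P x)"
  define T where "T = real_of_int ` S \<union> twin ` S"
  define W where "W = (\<lambda>x. \<Prod>w\<in>T. x - w)"
  have "(\<lambda>x. of_real (Z U x) * P x) \<in> fourier_space b" if "finite U" for U
    using that
  proof induction
    case empty
    then show ?case using P(1) by (simp add: Z_def)
  next
    case (insert n U)
    have "(\<lambda>x. (of_real x - of_real (of_int n - 1/4)) * ((of_real x - of_real (of_int n + 1/4)) * (of_real (Z U x) * P x)))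
        \<in> fourier_space b"
      by (intro fourier_space_mult_linear P(2) insert.IH)
    moreover have "Z (insert n U) x = (x - (of_int n - 1/4)) * ((x - (of_int n + 1/4)) * Z U x)" for x
    proof -
      have "(x - of_int n)\<^sup>2 - 1/16 = (x - (of_int n - 1/4)) * (x - (of_int n + 1/4))"
        by (simp add: power2_eq_square field_simps)
      then show ?thesis unfolding Z_def prod.insert[OF insert.hyps] by (simp only: mult.assoc)
    qed
    then have "(of_real x - of_real (of_int n - 1/4)) * ((of_real x - of_real (of_int n + 1/4)) * (of_real (Z U x) * P x))
        = of_real (Z (insert n U) x) * P x" for x
      by (simp only: of_real_mult of_real_diff mult.assoc)
    ultimately show ?case by (simp only:)
  qed
  then have H: "H \<in> fourier_space b" unfolding H_def using S(1) .
  have finT: "finite T" by (simp add: T_def S(1))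
  have disj: "real_of_int ` U \<inter> twin ` V = {}" if "V \<subseteq> S" for U V
  proof -
    have "real_of_int l \<noteq> twin n" if "n \<in> V" for l n
      using twin_ne_int[OF S(2)] \<open>V \<subseteq> S\<close> that by (metis subsetD)
    then show ?thesis by blast
  qed
  have prods: "(\<Prod>w\<in>real_of_int ` U \<union> twin ` V. f w) = (\<Prod>n\<in>U. f (of_int n)) * (\<Prod>n\<in>V. f (twin n))"
    if "finite U" "V \<subseteq> S" for U V and f :: "real \<Rightarrow> real"
  proof -
    have "finite V" using finite_subset[OF that(2) S(1)] .
    then show ?thesis
      using that disj[OF that(2), of U] twin_inj
      by (simp add: prod.union_disjoint prod.reindex inj_on_def)
  qed
  have kap: "Z U x / ((\<Prod>n\<in>U. x - of_int n) * (\<Prod>n\<in>U. x - twin n)) = kappa U x" for U x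
    by (simp add: Z_def kappa_def prod_dividef prod.distrib)
  have cosT: "cos (2 * pi * w) \<noteq> 0" if "w \<in> T" for w
  proof -
    have "w \<in> range real_of_int \<or> w \<in> range twin" using that by (auto simp: T_def)
    then show ?thesis
    proof
      assume "w \<in> range real_of_int"
      then obtain n where "w = of_int n" by auto
      then show ?thesis using cos_int_2pin[of n] by simp
    next
      assume "w \<in> range twin"
      then obtain n where "w = twin n" by auto
      then show ?thesis using cos_2pi_tau_ge[of n] cos_2pi_twin[of n] by simp
    qed
  qed
  have latt: "H x / of_real (W x) = of_real (kappa S x) * P x" for x
  proof -
    have "W x = (\<Prod>n\<in>S. x - of_int n) * (\<Prod>n\<in>S. x - twin n)"
      unfolding W_def T_def by (rule prods[OF S(1) order_refl])
    then have "kappa S x = Z S x / W x" using kap[of S x] by simp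
    then show ?thesis by (simp add: H_def)
  qed
  have kap0: "kappa S (of_int n - 1/4) = 0" "kappa S (of_int n + 1/4) = 0" if "n \<in> S" for n
    unfolding kappa_def using that S(1) by (auto intro!: prod_zero bexI[of _ n] simp: power2_eq_square)
  have ZZ: "Z S x = ((x - of_int n)\<^sup>2 - 1/16) * Z (S - {n}) x" if "n \<in> S" for n x
    unfolding Z_def by (rule prod.remove[OF S(1) that])
  have res1: "H (of_int n) / of_real (cos (2 * pi * of_int n) * (\<Prod>v\<in>T - {of_int n}. of_int n - v))
      = of_real (first_residue S n) * P (first_node S n)" if n: "n \<in> S" for n
  proof -
    have "T - {of_int n} = real_of_int ` (S - {n}) \<union> twin ` S"
      using disj[of S "{n}"] n by (auto simp: T_def)
    then have "(\<Prod>v\<in>T - {of_int n}. real_of_int n - v)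
        = (\<Prod>l\<in>S - {n}. of_int n - of_int l) * (\<Prod>l\<in>S. of_int n - twin l)"
      using prods[of "S - {n}" S] S(1) by simp
    also have "(\<Prod>l\<in>S. of_int n - twin l) = - tau n * (\<Prod>l\<in>S - {n}. of_int n - twin l)"
      unfolding prod.remove[OF S(1) n] by (simp add: twin_def)
    finally have W: "(\<Prod>v\<in>T - {of_int n}. real_of_int n - v)
        = - tau n * ((\<Prod>l\<in>S - {n}. of_int n - of_int l) * (\<Prod>l\<in>S - {n}. of_int n - twin l))"
      by (simp add: mult_ac)
    have "Z S (of_int n) / (cos (2 * pi * of_int n) * (\<Prod>v\<in>T - {of_int n}. real_of_int n - v)) = first_residue S n"
      unfolding W cos_int_2pin ZZ[OF n] using n kap[of "S - {n}" "of_int n", symmetric] by (simp add: first_residue_def)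
    then show ?thesis
      unfolding H_def times_divide_eq_left[symmetric] of_real_divide[symmetric] using n by (simp only: first_node_def if_True)
  qed
  have res2: "H (twin n) / of_real (cos (2 * pi * twin n) * (\<Prod>v\<in>T - {twin n}. twin n - v))
      = of_real (second_residue S n) * P (second_node S n)" if n: "n \<in> S" for n
  proof -
    have "T - {twin n} = real_of_int ` S \<union> twin ` (S - {n})"
      using disj[of "{n}" S] n injD[OF twin_inj] by (auto simp: T_def)
    then have "(\<Prod>v\<in>T - {twin n}. twin n - v)
        = (\<Prod>l\<in>S. twin n - of_int l) * (\<Prod>l\<in>S - {n}. twin n - twin l)"
      using prods[of S "S - {n}"] S(1) by simp
    also have "(\<Prod>l\<in>S. twin n - of_int l) = tau n * (\<Prod>l\<in>S - {n}. twin n - of_int l)"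
      unfolding prod.remove[OF S(1) n] by (simp add: twin_def)
    finally have W: "(\<Prod>v\<in>T - {twin n}. twin n - v)
        = tau n * ((\<Prod>l\<in>S - {n}. twin n - of_int l) * (\<Prod>l\<in>S - {n}. twin n - twin l))"
      by (simp add: mult_ac)
    have "twin n - of_int n = tau n" by (simp add: twin_def)
    then have "Z S (twin n) / (cos (2 * pi * twin n) * (\<Prod>v\<in>T - {twin n}. twin n - v)) = second_residue S n"
      unfolding W ZZ[OF n] using n kap[of "S - {n}" "twin n", symmetric] by (simp add: second_residue_def)
    then show ?thesis
      unfolding H_def times_divide_eq_left[symmetric] of_real_divide[symmetric] using n by (simp only: second_node_def if_True)
  qed
  define lat where "lat = (\<lambda>n. (H (of_int n - 1/4) / of_real (W (of_int n - 1/4))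
      - H (of_int n + 1/4) / of_real (W (of_int n + 1/4))) / of_real (2 * pi))"
  define tot where "tot = (\<lambda>n. of_real (first_residue S n) * P (first_node S n) + of_real (second_residue S n) * P (second_node S n))"
  have lat0: "lat n = 0" if "n \<in> S" for n using that by (simp add: lat_def latt kap0)
  have lat1: "lat n = tot n" if "n \<notin> S" for n
    using that by (simp add: lat_def tot_def latt first_residue_def second_residue_def first_node_def second_node_def field_simps)
  have Tsum: "(\<Sum>w\<in>T. H w / of_real (cos (2 * pi * w) * (\<Prod>v\<in>T - {w}. w - v))) = (\<Sum>n\<in>S. tot n)"
  proof -
    have "sum f T = (\<Sum>n\<in>S. f (of_int n)) + (\<Sum>n\<in>S. f (twin n))" for f :: "real \<Rightarrow> complex"
      unfolding T_def using S(1) disj[of S S] twin_inj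
      by (simp add: sum.union_disjoint sum.reindex inj_on_def)
    then show ?thesis unfolding tot_def sum.distrib by (simp only: res1 res2 cong: sum.cong)
  qed
  have lim: "(\<lambda>N. (\<Sum>n\<in>{-int N..int N}. lat n) + (\<Sum>n\<in>S. tot n)) \<longlonglongrightarrow> 0"
    unfolding lat_def W_def Tsum[symmetric] by (rule transform_residue_sum[OF H P(2,3) finT cosT])
  obtain N0 where N0: "\<And>n. n \<in> S \<Longrightarrow> \<bar>n\<bar> \<le> N0"
    using finite_imageI[OF S(1), of abs, THEN bdd_above_finite] by (auto simp: bdd_above_def)
  have "eventually (\<lambda>N. (\<Sum>n\<in>{-int N..int N}. lat n) + (\<Sum>n\<in>S. tot n) = (\<Sum>n\<in>{-int N..int N}. tot n)) sequentially"
  proof (rule eventually_sequentiallyI[of "nat N0"])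
    fix N assume "nat N0 \<le> N"
    then have sub: "S \<subseteq> {-int N..int N}" using N0 by force
    have "(\<Sum>n\<in>{-int N..int N}. f n) = (\<Sum>n\<in>{-int N..int N} - S. f n) + (\<Sum>n\<in>S. f n)" for f :: "int \<Rightarrow> complex"
      by (rule sum.subset_diff[OF sub]) simp
    moreover have "(\<Sum>n\<in>{-int N..int N} - S. lat n) = (\<Sum>n\<in>{-int N..int N} - S. tot n)"
      by (rule sum.cong) (use lat1 in auto)
    ultimately show "(\<Sum>n\<in>{-int N..int N}. lat n) + (\<Sum>n\<in>S. tot n) = (\<Sum>n\<in>{-int N..int N}. tot n)"
      by (simp add: lat0)
  qed
  then show ?thesis using lim unfolding tot_def by (rule Lim_transform_eventually[rotated])
qed

lemma near_int_square:
  fixes x :: real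
  assumes "\<bar>x - of_int n\<bar> \<le> 1/4"
  shows "1 / (1 + x\<^sup>2) \<le> 2 / (1 + (real_of_int n)\<^sup>2)"
proof -
  define d where "d = real_of_int n - x"
  have "\<bar>d\<bar>\<^sup>2 \<le> (1/4)\<^sup>2" using assms by (intro power_mono) (simp_all add: d_def abs_minus_commute)
  then have "d\<^sup>2 \<le> 1/16" by (simp add: power2_eq_square)
  moreover have "0 \<le> (x - d)\<^sup>2" by simp
  moreover have "(real_of_int n)\<^sup>2 = 2 * x\<^sup>2 + 2 * d\<^sup>2 - (x - d)\<^sup>2"
    by (simp add: d_def power2_eq_square algebra_simps)
  ultimately have "1 + (real_of_int n)\<^sup>2 \<le> 2 * (1 + x\<^sup>2)" unfolding distrib_left by linarith
  moreover have "1 + x\<^sup>2 > 0" "1 + (real_of_int n)\<^sup>2 > 0" by (auto simp: add_pos_nonneg)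
  ultimately show ?thesis by (simp add: divide_le_eq pos_le_divide_eq mult.commute)
qed

lemma levels_gaps: "n \<in> levels K \<Longrightarrow> of_int n \<in> gaps"
  by (auto simp: levels_def gaps_def)

text \<open>The multiplier pays for the large residues at the twins. The finitely many levels below \<open>j0\<close>,
  where it is not small, only contribute a constant independent of \<open>K\<close>.\<close>

lemma mult_gap_multiplier_le:
  assumes eta: "\<eta> > 0" and x: "\<bar>x - of_int n\<bar> \<le> 1/4"
    and c: "n \<notin> levels K \<Longrightarrow> \<bar>c\<bar> \<le> 1" "n \<in> levels K \<Longrightarrow> \<bar>c\<bar> \<le> 1 / tau n"
  shows "\<bar>c * gap_multiplier \<eta> j0 K x\<bar> \<le> 2 * (1 + 1 / \<eta>\<^sup>2) * exp (\<Sum>j<j0. real (m j)) / (1 + (real_of_int n)\<^sup>2)"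
proof -
  define D where "D = (1 + 1 / \<eta>\<^sup>2) / (1 + x\<^sup>2)"
  define E where "E = exp (\<Sum>j<j0. real (m j))"
  have E: "E \<ge> 1" unfolding E_def by (simp add: sum_nonneg)
  have D: "D \<ge> 0" unfolding D_def by (intro divide_nonneg_nonneg) auto
  have G1: "\<bar>gap_multiplier \<eta> j0 K x\<bar> \<le> D" unfolding D_def by (rule gap_multiplier_le(1)[OF eta])
  have "\<bar>c\<bar> * \<bar>gap_multiplier \<eta> j0 K x\<bar> \<le> E * D"
  proof (cases "n \<in> levels K")
    case False
    then show ?thesis using c(1) E G1 by (intro mult_mono) auto
  next
    case True
    then obtain j where j: "j < K" "of_int n \<in> gap j" by (auto simp: levels_def)
    have cj: "\<bar>c\<bar> \<le> exp (real (m j))" using c(2)[OF True] tau_eq[OF j(2)] by (simp add: exp_minus inverse_eq_divide)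
    show ?thesis
    proof (cases "j0 \<le> j")
      case True
      have "real (B j) \<le> \<bar>real_of_int n\<bar>" "real (B j) \<ge> 256" using j(2) B_ge(1)[of j] by (simp_all add: gap_def)
      then have "\<bar>x\<bar> \<ge> 3/4 * real (B j)" using x by linarith
      from gap_multiplier_le(2)[OF eta True j(1) this] have "\<bar>gap_multiplier \<eta> j0 K x\<bar> \<le> D * exp (- real (m j))" by (simp only: D_def)
      then have "\<bar>c\<bar> * \<bar>gap_multiplier \<eta> j0 K x\<bar> \<le> exp (real (m j)) * (D * exp (- real (m j)))"
        using cj by (intro mult_mono) auto
      also have "\<dots> = 1 * D" by (simp add: exp_minus)
      also have "\<dots> \<le> E * D" using E D by (rule mult_right_mono)
      finally show ?thesis .
    next
      case False
      then have "real (m j) \<le> (\<Sum>j<j0. real (m j))" by (intro member_le_sum) auto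
      then have "exp (real (m j)) \<le> E" by (simp add: E_def)
      then have "\<bar>c\<bar> \<le> E" using cj by linarith
      then show ?thesis using G1 E by (intro mult_mono) auto
    qed
  qed
  also have "E * D = E * (1 + 1 / \<eta>\<^sup>2) * (1 / (1 + x\<^sup>2))" by (simp add: D_def)
  also have "\<dots> \<le> E * (1 + 1 / \<eta>\<^sup>2) * (2 / (1 + (real_of_int n)\<^sup>2))"
    using E by (intro mult_left_mono near_int_square[OF x]) auto
  also have "\<dots> = 2 * (1 + 1 / \<eta>\<^sup>2) * E / (1 + (real_of_int n)\<^sup>2)" by simp
  finally show ?thesis by (simp only: abs_mult E_def)
qed

lemma kappa_le_2:
  assumes "finite U" "\<bar>x - of_int n\<bar> \<le> 1/4" "n \<notin> U"
  shows "\<bar>kappa U x\<bar> \<le> 2"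
proof -
  have "\<bar>x - of_int l\<bar> \<ge> 3/4" if "l \<in> U" for l
  proof -
    have "1 \<le> \<bar>real_of_int n - of_int l\<bar>" using that assms(3) by (intro int_far) auto
    then show ?thesis using assms(2) by linarith
  qed
  then show ?thesis using kappa_bounds[OF assms(1), of x] by auto
qed

lemma residue_bounds:
  assumes S: "finite S" "\<And>n. n \<in> S \<Longrightarrow> of_int n \<in> gaps"
  shows "n \<notin> S \<Longrightarrow> \<bar>first_residue S n\<bar> \<le> 1" "n \<notin> S \<Longrightarrow> \<bar>second_residue S n\<bar> \<le> 1"
    and "n \<in> S \<Longrightarrow> \<bar>first_residue S n\<bar> \<le> 1 / tau n" "n \<in> S \<Longrightarrow> \<bar>second_residue S n\<bar> \<le> 1 / tau n"
proof -
  show "\<bar>first_residue S n\<bar> \<le> 1" "\<bar>second_residue S n\<bar> \<le> 1" if "n \<notin> S"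
    using that kappa_le_2[OF S(1), of "of_int n - 1/4" n] kappa_le_2[OF S(1), of "of_int n + 1/4" n] pi_gt3
    by (auto simp: first_residue_def second_residue_def divide_le_eq)
  assume n: "n \<in> S"
  have t: "0 < tau n" "tau n \<le> 1/64" using tau_bounds S(2)[OF n] by auto
  have k1: "\<bar>kappa (S - {n}) (of_int n)\<bar> \<le> 2" by (rule kappa_le_2[of _ _ n]) (use S in auto)
  have k2: "\<bar>kappa (S - {n}) (twin n)\<bar> \<le> 2"
    by (rule kappa_le_2[of _ _ n]) (use S t in \<open>auto simp: twin_def\<close>)
  show "\<bar>first_residue S n\<bar> \<le> 1 / tau n" using n k1 t by (simp add: first_residue_def abs_mult field_simps)
  have "\<bar>((tau n)\<^sup>2 - 1/16)\<bar> \<le> 1/16"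
  proof -
    have "(tau n)\<^sup>2 \<le> (1/64)\<^sup>2" using t by (intro power_mono) auto
    then show ?thesis by (simp add: power2_eq_square abs_le_iff)
  qed
  then have "\<bar>((tau n)\<^sup>2 - 1/16)\<bar> / (cos (2 * pi * tau n) * tau n) * \<bar>kappa (S - {n}) (twin n)\<bar>
      \<le> (1/16) / (1/2 * tau n) * 2"
    using t cos_2pi_tau_ge[of n] k2
    by (intro mult_mono frac_le mult_right_mono mult_pos_pos divide_nonneg_nonneg mult_nonneg_nonneg) auto
  also have "\<dots> \<le> 1 / tau n" using t by (simp add: field_simps)
  finally show "\<bar>second_residue S n\<bar> \<le> 1 / tau n"
    using n t cos_2pi_tau_ge[of n] by (simp add: second_residue_def cos_2pi_twin abs_mult)
qed

text \<open>A transform \<open>F\<close> close to the point mass at \<open>1/4\<close> contradicts the annihilating sequence. The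
  level \<open>K\<close> is chosen after \<open>F\<close>: the levels beyond \<open>K\<close>, where the annihilating sequence lives off
  the support of the measure, are controlled by the decay of \<open>F\<close>.\<close>

lemma not_dense_MXY:
  assumes a: "0 < a" "a < 2 * pi"
  shows "\<not> dense_in_L2 MXY (fourier_space a)"
proof
  assume dense: "dense_in_L2 MXY (fourier_space a)"
  define \<eta> where "\<eta> = min (1/4) ((2 * pi - a) / 8)"
  have eta: "\<eta> > 0" "\<eta> \<le> 1/4" "\<eta> \<le> (2 * pi - a) / 8"
    using a by (simp_all only: \<eta>_def min_less_iff_conj min.cobounded1 min.cobounded2) simp
  obtain j0 where j0: "(1/2 :: real) ^ j0 < (2 * pi - a) / 32"
    using real_arch_pow_inv[of "(2 * pi - a) / 32" "1/2"] a by auto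
  define b where "b = a + 2 * \<eta> + 8 * (1/2) ^ j0"
  have b: "0 < b" "b \<le> 2 * pi" using a eta(1) eta(3) j0 by (auto simp: b_def add_pos_nonneg)
  define C1 where "C1 = 2 * (1 + 1 / \<eta>\<^sup>2) * exp (\<Sum>j<j0. real (m j))"
  have C1: "C1 \<ge> 0" unfolding C1_def by simp
  \<comment> \<open>A lower bound for the coefficient of the node \<open>1/4\<close>, uniform in the number of levels.\<close>
  define \<kappa> where "\<kappa> = exp (- 2 * (int_decay_total + 1)) / (2 * pi) * (1/2)"
  have \<kappa>: "\<kappa> > 0" by (simp add: \<kappa>_def)
  define C where "C = C1\<^sup>2 * int_decay_total"
  have C: "C \<ge> 0" using int_decay_total_nonneg by (simp add: C_def)
  define e where "e = \<kappa> / (4 * (1 + C))"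
  have e: "e > 0" using C \<kappa> by (simp add: e_def)
  define g :: "real \<Rightarrow> complex" where "g = indicator {1/4}"
  have gb: "g \<in> borel_measurable borel" unfolding g_def by measurable
  have "cmod (g x) \<le> 2 / (1 + x\<^sup>2)" for x
  proof (cases "x = 1/4")
    case True
    show ?thesis unfolding True g_def by (simp add: power2_eq_square)
  qed (simp add: g_def)
  then have gL: "g \<in> L2 MXY"
    by (intro L2_of_decay(1)[OF quadratic_growth_MXY gb]) auto
  then have "g \<in> L2_closure MXY (fourier_space a)" using dense by (auto simp: dense_in_L2_iff)
  then obtain F where F: "F \<in> fourier_space a" "(\<integral>x. (cmod (g x - F x))\<^sup>2 \<partial>MXY) < e\<^sup>2"
    using e unfolding L2_closure_def by (auto dest!: spec[of _ "e\<^sup>2"])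
  have FL: "F \<in> L2 MXY" using dense F(1) by (auto simp: dense_in_L2_iff)
  obtain CF where CF: "\<And>x. cmod (F x) \<le> CF / (1 + x\<^sup>2)"
    using fourier_space_decay(2)[OF F(1) a(1)] by blast
  have "cmod (F 0) \<le> CF" using CF[of 0] by simp
  then have CF0: "CF \<ge> 0" by (rule order_trans[OF norm_ge_zero])
  obtain K where K: "16 * C1 * CF * int_decay_total / \<kappa> < real K" using reals_Archimedean2 by blast
  define S where "S = levels K"
  have S: "finite S" "\<And>n. n \<in> S \<Longrightarrow> of_int n \<in> gaps" by (auto simp: S_def finite_levels levels_gaps)
  define u where "u = (\<lambda>n. first_residue S n * gap_multiplier \<eta> j0 K (first_node S n))"
  define v where "v = (\<lambda>n. second_residue S n * gap_multiplier \<eta> j0 K (second_node S n))"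
  have near: "\<bar>first_node S n - of_int n\<bar> \<le> 1/4" "\<bar>second_node S n - of_int n\<bar> \<le> 1/4" for n
    using tau_bounds(1,2)[of n] by (auto simp: first_node_def second_node_def twin_def)
  have uv: "\<bar>u n\<bar> \<le> C1 / (1 + (real_of_int n)\<^sup>2)" "\<bar>v n\<bar> \<le> C1 / (1 + (real_of_int n)\<^sup>2)" for n
    unfolding u_def v_def C1_def
    by (rule mult_gap_multiplier_le[OF eta(1) near(1)]; use residue_bounds[OF S] in \<open>simp add: S_def\<close>)
      (rule mult_gap_multiplier_le[OF eta(1) near(2)]; use residue_bounds[OF S] in \<open>simp add: S_def\<close>)
  have lim: "(\<lambda>N. \<Sum>n\<in>{-int N..int N}. of_real (u n) * F (first_node S n) + of_real (v n) * F (second_node S n)) \<longlonglongrightarrow> 0"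
    using annihilator[OF gap_multiplier_fourier[OF a(1) F(1) eta(1), of j0 K, folded b_def] b S]
    by (simp add: u_def v_def mult.assoc)
  have big: "\<kappa> / 2 \<le> cmod (\<Sum>n\<in>{-int N..int N}. of_real (u n) * F (first_node S n) + of_real (v n) * F (second_node S n))" for N
  proof -
    define Y where "Y = {-int N..int N}"
    \<comment> \<open>Here the nodes are \<open>n \<plusminus> 1/4\<close>, which carry no mass.\<close>
    define Bad where "Bad = {n \<in> Y. of_int n \<in> gaps \<and> n \<notin> S}"
    define X where "X = Y - Bad"
    have "Bad \<subseteq> Y" by (auto simp: Bad_def)
    then have fin: "finite Y" "finite X" "finite Bad"
      by (simp_all add: X_def Y_def finite_subset)
    \<comment> \<open>Injective enumerations of the other nodes among the points that make up the measure.\<close>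
    define ia where "ia = (\<lambda>n::int. (3 * n, True))"
    define ib where "ib = (\<lambda>n::int. if of_int n \<in> gaps then (3 * n, False) else (3 * n + 2, True))"
    have d3: "3 * n mod 3 = 0" "(3 * n + 2) div 3 = n" "(3 * n + 2) mod 3 = 2" for n :: int by presburger+
    have good: "n \<in> S \<longleftrightarrow> of_int n \<in> gaps" if "n \<in> X" for n
      using that S(2) by (auto simp: X_def Bad_def)
    have ia: "xys (ia n) = first_node S n" if "n \<in> X" for n
      using good[OF that] by (simp add: ia_def xys_def xs_def first_node_def d3)
    have ib: "xys (ib n) = second_node S n" if "n \<in> X" for n
      using good[OF that] by (simp add: ib_def xys_def ys_def xs_def second_node_def d3)
    have inj: "inj_on ia X" "inj_on ib X"
    proof -
      show "inj_on ia X" by (simp add: ia_def inj_on_def)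
      have "fst (ib n) div 3 = n" for n by (simp add: ib_def d3)
      then show "inj_on ib X" by (metis inj_on_def)
    qed
    have near_l2: "(\<Sum>n\<in>X. (cmod (g (p n) - F (p n)))\<^sup>2) \<le> e\<^sup>2"
      if "inj_on \<iota> X" "\<And>n. n \<in> X \<Longrightarrow> xys (\<iota> n) = p n" for \<iota> p
    proof -
      have "(\<Sum>n\<in>X. (cmod (g (xys (\<iota> n)) - F (xys (\<iota> n))))\<^sup>2) \<le> (\<integral>x. (cmod (g x - F x))\<^sup>2 \<partial>MXY)"
        using sum_le_integral_distr[OF L2_diff[OF gL FL, unfolded MXY_def] fin(2) that(1)]
        by (simp only: MXY_def)
      then show ?thesis using F(2) that(2) by (simp cong: sum.cong)
    qed
    have sq: "(\<Sum>n\<in>X. (cmod (of_real (u n)))\<^sup>2) \<le> C" "(\<Sum>n\<in>X. (cmod (of_real (v n)))\<^sup>2) \<le> C"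
      using sum_squares_le_int_decay_total[OF fin(2), of u C1] sum_squares_le_int_decay_total[OF fin(2), of v C1] uv
      by (simp_all add: C_def)
    have e4: "e * (1 + C) / 2 = \<kappa> / 8" 
    proof -
      have "1 + C > 0" using C by simp
      then have "e * (1 + C) = \<kappa> / 4" by (simp add: e_def field_simps)
      then show ?thesis by simp
    qed
    have small: "cmod (\<Sum>n\<in>X. of_real (u n) * (g (first_node S n) - F (first_node S n))) \<le> \<kappa> / 8"
      "cmod (\<Sum>n\<in>X. of_real (v n) * (g (second_node S n) - F (second_node S n))) \<le> \<kappa> / 8"
      using norm_sum_mult_le[OF e near_l2[OF inj(1) ia] sq(1)] norm_sum_mult_le[OF e near_l2[OF inj(2) ib] sq(2)]
      by (simp_all only: e4)
    have S0: "0 \<notin> S" using S(2)[of 0] zero_notin_gaps by auto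
    have int14: "real_of_int n \<noteq> 1/4" "real_of_int n - 1/4 \<noteq> 1/4" "twin n \<noteq> 1/4" "n \<noteq> 0 \<Longrightarrow> real_of_int n + 1/4 \<noteq> 1/4" for n
    proof -
      have "4 * n \<noteq> 1" "4 * n \<noteq> 2" by presburger+
      then have "real_of_int (4 * n) \<noteq> real_of_int 1" "real_of_int (4 * n) \<noteq> real_of_int 2"
        by (simp_all only: of_int_eq_iff not_False_eq_True)
      then show "real_of_int n \<noteq> 1/4" "real_of_int n - 1/4 \<noteq> 1/4" by auto
      show "twin n \<noteq> 1/4"
      proof
        assume "twin n = 1/4"
        then have "0 < real_of_int n" "real_of_int n < 1" using tau_bounds(1,2)[of n] by (auto simp: twin_def)
        then show False by simp
      qed
    qed simp
    have "(\<Sum>n\<in>X. of_real (u n) * g (first_node S n)) = 0"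
      using int14 by (intro sum.neutral) (auto simp: g_def first_node_def)
    moreover have "(\<Sum>n\<in>X. of_real (v n) * g (second_node S n)) = (\<Sum>n\<in>{0}. of_real (v n) * g (second_node S n))"
      using fin(2) int14 zero_notin_gaps
      by (intro sum.mono_neutral_right) (auto simp: X_def Y_def Bad_def g_def second_node_def)
    then have "(\<Sum>n\<in>X. of_real (v n) * g (second_node S n)) = of_real (v 0)"
      using S0 by (simp add: g_def second_node_def)
    moreover have "\<kappa> \<le> \<bar>v 0\<bar>"
    proof -
      have "exp (- 2 * (int_decay_total + 1)) / (2 * pi) * (1/2) \<le> \<bar>kappa S (1/4)\<bar> / (2 * pi) * \<bar>gap_multiplier \<eta> j0 K (1/4)\<bar>"
        using kappa_quarter_ge[OF S] gap_multiplier_ge_half[of "1/4" \<eta> j0 K] eta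
        by (intro mult_mono divide_right_mono) auto
      then show ?thesis using S0 by (simp add: \<kappa>_def v_def second_residue_def second_node_def abs_mult)
    qed
    moreover have "(\<Sum>n\<in>X. of_real (w n) * g (p n)) = (\<Sum>n\<in>X. of_real (w n) * (g (p n) - F (p n))) + (\<Sum>n\<in>X. of_real (w n) * F (p n))"
      for w p by (simp add: sum.distrib[symmetric] right_diff_distrib)
    ultimately have X: "\<kappa> * 3/4 \<le> cmod (\<Sum>n\<in>X. of_real (u n) * F (first_node S n) + of_real (v n) * F (second_node S n))"
    proof -
      assume 0: "(\<Sum>n\<in>X. of_real (u n) * g (first_node S n)) = 0"
        and 1: "(\<Sum>n\<in>X. of_real (v n) * g (second_node S n)) = of_real (v 0)"
        and k: "\<kappa> \<le> \<bar>v 0\<bar>"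
        and split: "\<And>w p. (\<Sum>n\<in>X. of_real (w n) * g (p n)) = (\<Sum>n\<in>X. of_real (w n) * (g (p n) - F (p n))) + (\<Sum>n\<in>X. of_real (w n) * F (p n))"
      define A1 where "A1 = (\<Sum>n\<in>X. of_real (u n) * (g (first_node S n) - F (first_node S n)))"
      define A2 where "A2 = (\<Sum>n\<in>X. of_real (v n) * (g (second_node S n) - F (second_node S n)))"
      define R where "R = (\<Sum>n\<in>X. of_real (u n) * F (first_node S n) + of_real (v n) * F (second_node S n))"
      have "of_real (v 0) = R + (A1 + A2)"
        using split[of u "first_node S"] split[of v "second_node S"] unfolding 0 1 A1_def A2_def R_def sum.distrib
        by (simp add: algebra_simps)
      then have "\<bar>v 0\<bar> = cmod (R + (A1 + A2))" by (metis norm_of_real)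
      also have "\<dots> \<le> cmod R + (cmod A1 + cmod A2)"
        by (intro order_trans[OF norm_triangle_ineq] add_left_mono norm_triangle_ineq)
      finally show ?thesis using k small unfolding A1_def[symmetric] A2_def[symmetric] R_def[symmetric] by linarith
    qed
    have "cmod (\<Sum>n\<in>Bad. of_real (u n) * F (first_node S n) + of_real (v n) * F (second_node S n)) \<le> \<kappa> / 4"
    proof -
      have "cmod (of_real (u n) * F (first_node S n) + of_real (v n) * F (second_node S n))
          \<le> 4 * C1 * CF / real (K + 1) * (1 / (1 + (real_of_int n)\<^sup>2))" if n: "n \<in> Bad" for n
      proof -
        obtain j where j: "of_int n \<in> gap j" using n by (auto simp: Bad_def gaps_def)
        then have "j \<ge> K" using n by (auto simp: Bad_def S_def levels_def not_less)
        then have "real K \<le> real (B j)" using B_ge(2)[of j] by simp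
        then have "real K \<le> \<bar>real_of_int n\<bar>" "\<bar>real_of_int n\<bar> \<ge> 1"
          using j B_ge(1)[of j] by (simp_all add: gap_def)
        then have "real K * 1 \<le> \<bar>real_of_int n\<bar> * \<bar>real_of_int n\<bar>" by (intro mult_mono) auto
        then have Kn: "real (K + 1) \<le> 1 + (real_of_int n)\<^sup>2" by (simp add: power2_eq_square)
        have Fp: "cmod (F p) \<le> 2 * CF / real (K + 1)" if "\<bar>p - of_int n\<bar> \<le> 1/4" for p
        proof -
          have "cmod (F p) \<le> CF * (1 / (1 + p\<^sup>2))" using CF[of p] by simp
          also have "\<dots> \<le> CF * (2 / (1 + (real_of_int n)\<^sup>2))"
            by (intro mult_left_mono near_int_square[OF that] CF0)
          also have "\<dots> \<le> CF * (2 / real (K + 1))"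
            using Kn CF0 by (intro mult_left_mono divide_left_mono) (auto simp: add_pos_nonneg)
          finally show ?thesis by (simp add: mult.commute)
        qed
        have "cmod (of_real (u n) * F (first_node S n) + of_real (v n) * F (second_node S n))
            \<le> \<bar>u n\<bar> * cmod (F (first_node S n)) + \<bar>v n\<bar> * cmod (F (second_node S n))"
          by (rule order_trans[OF norm_triangle_ineq]) (simp add: norm_mult)
        also have "\<dots> \<le> C1 / (1 + (real_of_int n)\<^sup>2) * (2 * CF / real (K + 1)) + C1 / (1 + (real_of_int n)\<^sup>2) * (2 * CF / real (K + 1))"
          using uv C1 by (intro add_mono mult_mono Fp near) auto
        also have "\<dots> = 4 * C1 * CF / real (K + 1) * (1 / (1 + (real_of_int n)\<^sup>2))" by simp
        finally show ?thesis .
      qed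
      then have "cmod (\<Sum>n\<in>Bad. of_real (u n) * F (first_node S n) + of_real (v n) * F (second_node S n))
          \<le> (\<Sum>n\<in>Bad. 4 * C1 * CF / real (K + 1) * (1 / (1 + (real_of_int n)\<^sup>2)))"
        by (rule sum_norm_le)
      also have "\<dots> \<le> 4 * C1 * CF / real (K + 1) * int_decay_total"
        unfolding sum_distrib_left[symmetric] using C1 CF0 by (intro mult_left_mono sum_le_int_decay_total fin) auto
      also have "\<dots> \<le> \<kappa> / 4"
      proof -
        have "16 * C1 * CF * int_decay_total \<le> real K * \<kappa>" using K \<kappa> by (simp add: divide_less_eq)
        also have "\<dots> \<le> real (K + 1) * \<kappa>" using \<kappa> by (intro mult_right_mono) auto
        finally show ?thesis by (simp add: field_simps)
      qed
      finally show ?thesis .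
    qed
    moreover have "(\<Sum>n\<in>Y. f n) = (\<Sum>n\<in>X. f n) + (\<Sum>n\<in>Bad. f n)" for f :: "int \<Rightarrow> complex"
      unfolding X_def by (rule sum.subset_diff) (auto simp: Bad_def fin)
    then have "cmod (\<Sum>n\<in>X. f n) \<le> cmod (\<Sum>n\<in>Y. f n) + cmod (\<Sum>n\<in>Bad. f n)" for f :: "int \<Rightarrow> complex"
      by (metis add_diff_cancel_right' norm_triangle_ineq4)
    note this[of "\<lambda>n. of_real (u n) * F (first_node S n) + of_real (v n) * F (second_node S n)"]
    ultimately show ?thesis using X unfolding Y_def[symmetric] by linarith
  qed
  have "(\<lambda>N. cmod (\<Sum>n\<in>{-int N..int N}. of_real (u n) * F (first_node S n) + of_real (v n) * F (second_node S n))) \<longlonglongrightarrow> 0"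
    using lim by (rule tendsto_norm_zero)
  then have "\<kappa> / 2 \<le> 0" by (rule LIMSEQ_le_const) (use big in auto)
  then show False using \<kappa> by simp
qed

end

section \<open>Choice of the scales\<close>

text \<open>Since \<open>eps\<close> is not assumed monotone, the scales must be so large that it is small from
  \<open>B j\<close> on.\<close>

lemma gap_scales_exist:
  assumes "(eps \<longlongrightarrow> 0) at_top"
  obtains m where "gap_scales m"
    and "\<And>j r. real (2 ^ j * m j) \<le> r \<Longrightarrow> eps r \<le> (1/2) ^ j / real (j + 2)"
proof -
  define few where "few = (\<lambda>j m. real (2 * ((j + 2) * (2 ^ j * m)) + 1) * exp (- real m) \<le> (1/2) ^ j / 64)"
  define small where "small = (\<lambda>j m. \<forall>r. real (2 ^ j * m) \<le> r \<longrightarrow> eps r \<le> (1/2) ^ j / real (j + 2))"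
  have ex: "\<exists>m. 256 \<le> m \<and> few j m \<and> small j m \<and> p < 2 ^ j * m" for j p :: nat
  proof -
    define c where "c = real (2 * ((j + 2) * 2 ^ j))"
    have "((\<lambda>m. (c * real m + 1) * exp (- real m)) \<longlongrightarrow> 0) sequentially" by real_asymp
    then have "eventually (\<lambda>m. (c * real m + 1) * exp (- real m) < (1/2) ^ j / 64) sequentially"
      by (rule order_tendstoD) simp
    then have 1: "eventually (\<lambda>m. few j m) sequentially"
    proof eventually_elim
      case (elim m)
      have "real (2 * ((j + 2) * (2 ^ j * m)) + 1) = c * real m + 1"
        by (simp add: c_def algebra_simps)
      then have "real (2 * ((j + 2) * (2 ^ j * m)) + 1) * exp (- real m) < (1/2) ^ j / 64"
        using elim by (simp only:)
      then show ?case unfolding few_def by (rule less_imp_le)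
    qed
    have "eventually (\<lambda>r. eps r < (1/2) ^ j / real (j + 2)) at_top"
      by (rule order_tendstoD[OF assms]) simp
    then obtain R where R: "\<And>r. R \<le> r \<Longrightarrow> eps r < (1/2) ^ j / real (j + 2)"
      by (auto simp: eventually_at_top_linorder)
    have pow: "m \<le> 2 ^ j * m" for m :: nat by simp
    have "eventually (\<lambda>m. R \<le> real m) sequentially"
      using filterlim_real_sequentially by (auto simp: filterlim_at_top)
    then have 2: "eventually (\<lambda>m. small j m) sequentially"
    proof eventually_elim
      case (elim m)
      have "real m \<le> real (2 ^ j * m)" unfolding of_nat_le_iff by (rule pow)
      show ?case
        unfolding small_def
      proof (intro allI impI)
        fix r assume "real (2 ^ j * m) \<le> r"
        then have "R \<le> r" using elim \<open>real m \<le> real (2 ^ j * m)\<close> by linarith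
        then show "eps r \<le> (1/2) ^ j / real (j + 2)" by (rule less_imp_le[OF R])
      qed
    qed
    have "eventually (\<lambda>m. 256 \<le> m \<and> few j m \<and> small j m \<and> p < m) sequentially"
      using 1 2 eventually_ge_at_top[of 256] eventually_gt_at_top[of p] by eventually_elim simp
    then obtain m where "256 \<le> m \<and> few j m \<and> small j m \<and> p < m"
      by (auto dest!: eventually_happens)
    then show ?thesis using less_le_trans[OF _ pow[of m], of p] by blast
  qed
  have "\<exists>m. \<forall>j. (256 \<le> m j \<and> few j (m j) \<and> small j (m j)) \<and> (j + 2) * (2 ^ j * m j) < 2 ^ Suc j * m (Suc j)"
    by (rule dependent_nat_choice) (use ex in metis)+
  then obtain m where m: "\<And>j. 256 \<le> m j" "\<And>j. few j (m j)" "\<And>j. small j (m j)"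
    "\<And>j. (j + 2) * (2 ^ j * m j) < 2 ^ Suc j * m (Suc j)" by metis
  show ?thesis
  proof (rule that)
    show "gap_scales m" by unfold_locales (use m in \<open>auto simp: few_def\<close>)
    show "eps r \<le> (1/2) ^ j / real (j + 2)" if "real (2 ^ j * m j) \<le> r" for j r
      using m(3)[of j] that unfolding small_def by blast
  qed
qed

lemma (in gap_scales) decay_on_gap:
  assumes "\<And>r. real (B j) \<le> r \<Longrightarrow> eps r \<le> (1/2) ^ j / real (j + 2)" "x \<in> gap j"
  shows "exp (- real (m j)) \<le> exp (- eps \<bar>x\<bar> * \<bar>x\<bar>)"
proof -
  have x: "real (B j) \<le> \<bar>x\<bar>" "\<bar>x\<bar> \<le> real (Q j)" using assms(2) by (auto simp: gap_def)
  have "eps \<bar>x\<bar> * \<bar>x\<bar> \<le> (1/2) ^ j / real (j + 2) * \<bar>x\<bar>"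
    using assms(1)[OF x(1)] by (rule mult_right_mono) simp
  also have "\<dots> \<le> (1/2) ^ j / real (j + 2) * real (Q j)" using x(2) by (intro mult_left_mono) auto
  also have "real (Q j) = real (j + 2) * (2 ^ j * real (m j))"
    unfolding Q_def B_def of_nat_mult of_nat_power of_nat_numeral ..
  also have "(1/2) ^ j / real (j + 2) * (real (j + 2) * (2 ^ j * real (m j))) = (1/2) ^ j * (2 ^ j * real (m j))"
    by (simp del: of_nat_add of_nat_Suc)
  also have "\<dots> = real (m j)" by (simp add: power_divide)
  finally show ?thesis by simp
qed

lemma measure_type_eq:
  assumes "0 \<le> c" "\<And>a. c < a \<Longrightarrow> dense_in_L2 M (fourier_space a)"
    and "\<And>a. 0 < a \<Longrightarrow> a < c \<Longrightarrow> \<not> dense_in_L2 M (fourier_space a)"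
  shows "measure_type M = ereal c"
proof (rule antisym)
  show "ereal c \<le> measure_type M" by (rule measure_type_ge) (use assms(3) in auto)
  show "measure_type M \<le> ereal c"
  proof (rule ccontr)
    assume "\<not> measure_type M \<le> ereal c"
    then obtain a where "ereal c < ereal a" "ereal a < measure_type M"
      using ereal_dense2[of "ereal c" "measure_type M"] by (auto simp: not_le)
    then show False using measure_type_le[of a M] assms(1,2) by auto
  qed
qed

lemma quadratic_growth_density:
  assumes "w \<in> borel_measurable borel" "\<And>x. 0 \<le> w x" "\<And>x. w x \<le> C"
  shows "quadratic_growth (density lborel (\<lambda>x. ennreal (w x)))"
  unfolding quadratic_growth_def
proof
  have "integrable lborel (\<lambda>x. w x * (1 / (1 + x\<^sup>2)))"
  proof (rule Bochner_Integration.integrable_bound[OF integrable_mult_right[OF integrable_quadratic_decay, of C]])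
    show "AE x in lborel. norm (w x * (1 / (1 + x\<^sup>2))) \<le> norm (C * (1 / (1 + x\<^sup>2)))"
      using assms(2,3) by (intro AE_I2) (auto simp: abs_mult intro!: divide_right_mono order_trans[OF _ abs_ge_self])
  qed (use assms(1) in measurable)
  then show "integrable (density lborel (\<lambda>x. ennreal (w x))) (\<lambda>t. 1 / (1 + t\<^sup>2))"
    using assms(1,2) by (subst integrable_density) auto
qed simp

theorem theorem1p6:
  fixes eps :: "real \<Rightarrow> real"
  assumes "eps \<in> borel_measurable (restrict_space borel {0..})"
    and "\<And>r. r \<ge> 0 \<Longrightarrow> eps r > 0"
    and "(eps \<longlongrightarrow> 0) at_top"
  shows "(\<exists>\<phi> :: real \<Rightarrow> real.
            \<phi> \<in> borel_measurable borel \<and> (\<forall>x. \<phi> x \<ge> 0) \<and>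
            poly_growth (density lborel (\<lambda>x. ennreal (\<phi> x))) \<and>
            poly_growth (density lborel (\<lambda>x. ennreal (\<phi> x + exp (- eps \<bar>x\<bar> * \<bar>x\<bar>)))) \<and>
            measure_type (density lborel (\<lambda>x. ennreal (\<phi> x))) = 0 \<and>
            measure_type (density lborel (\<lambda>x. ennreal (\<phi> x + exp (- eps \<bar>x\<bar> * \<bar>x\<bar>)))) = \<infinity>) \<and>
         (\<exists>x y :: int \<Rightarrow> real.
            (\<forall>n. \<bar>y n - x n\<bar> \<le> exp (- eps \<bar>x n\<bar> * \<bar>x n\<bar>)) \<and>
            poly_growth (sum_measure (\<lambda>n. dirac (x n))) \<and>
            poly_growth (sum_measure (\<lambda>n. add_measure (dirac (x n)) (dirac (y n)))) \<and>
            measure_type (sum_measure (\<lambda>n. dirac (x n))) = ereal pi \<and>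
            measure_type (sum_measure (\<lambda>n. add_measure (dirac (x n)) (dirac (y n)))) = ereal (2 * pi))"
proof -
  obtain m where m: "gap_scales m"
    and small: "\<And>j r. real (2 ^ j * m j) \<le> r \<Longrightarrow> eps r \<le> (1/2) ^ j / real (j + 2)"
    by (rule gap_scales_exist[OF assms(3)]) blast
  interpret gap_scales m by (rule m)
  define psi where "psi = (\<lambda>x. exp (- eps \<bar>x\<bar> * \<bar>x\<bar>))"
  have "(\<lambda>x::real. eps \<bar>x\<bar>) \<in> borel_measurable borel"
    by (rule measurable_compose[OF _ assms(1)]) (intro measurable_restrict_space2, auto)
  then have psi_borel: "psi \<in> borel_measurable borel" unfolding psi_def by measurable
  have psi: "psi x > 0" "psi x \<le> 1" for x
    using assms(2)[of "\<bar>x\<bar>"] by (simp_all add: psi_def)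
  have large: "exp (- real (m j)) \<le> psi x" if "x \<in> gap j" for j x
    unfolding psi_def by (rule decay_on_gap[OF _ that]) (use small in \<open>simp add: B_def\<close>)
  have phi1: "phi x \<le> 1" for x
    using phi_le[of x] order_trans[of "phi x" "1 / (1 + x\<^sup>2)" 1] by (simp add: divide_le_eq add_pos_nonneg)
  have part1: "phi \<in> borel_measurable borel \<and> (\<forall>x. phi x \<ge> 0) \<and>
      poly_growth (density lborel (\<lambda>x. ennreal (phi x))) \<and>
      poly_growth (density lborel (\<lambda>x. ennreal (phi x + psi x))) \<and>
      measure_type (density lborel (\<lambda>x. ennreal (phi x))) = 0 \<and>
      measure_type (density lborel (\<lambda>x. ennreal (phi x + psi x))) = \<infinity>"
  proof (intro conjI allI poly_growth_if_quadratic_growth phi_borel phi_nonneg)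
    show "quadratic_growth (density lborel (\<lambda>x. ennreal (phi x)))"
      by (rule quadratic_growth_density[OF phi_borel phi_nonneg phi1])
    show "quadratic_growth (density lborel (\<lambda>x. ennreal (phi x + psi x)))"
    proof (rule quadratic_growth_density)
      show "0 \<le> phi x + psi x" "phi x + psi x \<le> 2" for x
        using phi_nonneg[of x] phi1[of x] psi[of x] by linarith+
    qed (use psi_borel phi_borel in measurable)
    show "measure_type (density lborel (\<lambda>x. ennreal (phi x))) = 0"
      using measure_type_eq[of 0, OF _ dense_phi] by (simp add: zero_ereal_def)
    have "\<infinity> \<le> measure_type (density lborel (\<lambda>x. ennreal (phi x + psi x)))"
      by (intro measure_type_ge not_dense_phi_plus psi_borel psi large)
    then show "measure_type (density lborel (\<lambda>x. ennreal (phi x + psi x))) = \<infinity>" by simp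
  qed
  have MX: "sum_measure (\<lambda>n. dirac (xs n)) = MX"
    by (simp add: sum_measure_dirac MX_def)
  have MXY: "sum_measure (\<lambda>n. add_measure (dirac (xs n)) (dirac (ys n))) = MXY"
    by (simp add: sum_measure_add_dirac MXY_def xys_def)
  have "\<bar>ys n - xs n\<bar> \<le> psi (xs n)" for n
  proof (cases "of_int (n div 3) \<in> gaps")
    case True
    then obtain j where j: "of_int (n div 3) \<in> gap j" by (auto simp: gaps_def)
    show ?thesis using True large[OF j] by (simp add: ys_def xs_def twin_def tau_eq[OF j])
  next
    case False
    then show ?thesis using psi(1)[of "xs n"] by (simp add: ys_def)
  qed
  moreover have "poly_growth MX" "poly_growth MXY"
    by (intro poly_growth_if_quadratic_growth quadratic_growth_MX quadratic_growth_MXY)+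
  moreover have "measure_type MX = ereal pi"
    by (rule measure_type_eq[OF _ dense_MX not_dense_MX]) auto
  moreover have "measure_type MXY = ereal (2 * pi)"
    by (rule measure_type_eq[OF _ dense_MXY not_dense_MXY]) auto
  ultimately have part2: "(\<forall>n. \<bar>ys n - xs n\<bar> \<le> psi (xs n)) \<and>
      poly_growth (sum_measure (\<lambda>n. dirac (xs n))) \<and>
      poly_growth (sum_measure (\<lambda>n. add_measure (dirac (xs n)) (dirac (ys n)))) \<and>
      measure_type (sum_measure (\<lambda>n. dirac (xs n))) = ereal pi \<and>
      measure_type (sum_measure (\<lambda>n. add_measure (dirac (xs n)) (dirac (ys n)))) = ereal (2 * pi)"
    unfolding MX MXY by simp
  show ?thesis
    using part1 part2 unfolding psi_def by blast
qed

end
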